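(* Let $L\supset\mathbb F_q$ be a field and let $f:\underline M\to\underline M'$ be an isogeny between pure Anderson motives over $L$ of the same characteristic. Then 1. there exists an element $a\in A$, $a\neq0$, which annihilates $\operatorname{coker}f$; 2. there exists a dual isogeny $f^\vee:\underline M'\to\underline M$ such that $f\circ f^\vee=a\cdot\operatorname{id}_{\underline M'}$ and $f^\vee\circ f=a\cdot\operatorname{id}_{\underline M}$.
   Context: Notation: $\mathbb F_q$ is a finite field with $q$ elements, $C$ a smooth projective geometrically irreducible curve over $\mathbb F_q$, $\infty\in C(\mathbb F_q)$ a fixed rational point, $A=\Gamma(C\setminus\{\infty\},\mathcal O_C)$. For a field $L\supset\mathbb F_q$ put $C_L=C\times_{\mathbb F_q}\operatorname{Spec}L$, $A_L=A\otimes_{\mathbb F_q}L$; $\sigma$ is the endomorphism of $C_L$ which is the identity on $C$ and the $q$-Frobenius on $L$, and $\sigma^*$ is pullback along $\sigma$; on $A_L$, $\sigma^*(a\otimes b)=a\otimes b^q$, and $\sigma^*M=M\otimes_{A_L,\sigma^*}A_L$. $\mathcal G(k\cdot\infty)=\mathcal G\otimes\mathcal O_{C_L}(k\cdot\infty)$. Pure Anderson motives: fix an $\mathbb F_q$-homomorphism $c^*:A\to L$ and let $J\subset A_L$ be the ideal generated by all $a\otimes1-1\otimes c^*(a)$, $a\in A$. A pure Anderson motive $\underline M=(M,\tau)$ of rank $r$, dimension $d$ (non-negative integers) and characteristic $c^*$ over $L$ is a locally free $A_L$-module $M$ of rank $r$ with an injective $A_L$-homomorphism $\tau:\sigma^*M\to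 M$ such that (1) $\operatorname{coker}\tau$ is an $L$-vector space of dimension $d$ annihilated by $J^d$; (2) $M$ extends to a locally free sheaf $\mathcal M$ of rank $r$ on $C_L$ such that for some positive integers $k,l$ the map $\tau^l:=\tau\circ\sigma^*\tau\circ\dots\circ(\sigma^* )^{l-1}\tau:(\sigma^* )^lM\to M$ induces an isomorphism $(\sigma^* )^l\mathcal M_\infty\to\mathcal M(k\cdot\infty)_\infty$ of stalks at $\infty$. A morphism $(M,\tau)\to(M',\tau')$ is an $A_L$-homomorphism $f:M\to M'$ with $f\circ\tau=\tau'\circ\sigma^*f$. A morphism is an isogeny if it is injective with torsion cokernel (as an $A_L$-module). Elements $a\in A$ act via $a\otimes1\in A_L$. *)

theory Defs
  imports
    "HOL-Algebra.Algebra"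
    "HOL-Algebra.Algebraic_Closure"
    "HOL-Algebra.Free_Abelian_Groups"
    "HOL-Algebra.Ideal_Product"
    "HOL-Algebra.Generated_Rings"
    "HOL-Analysis.Abstract_Topology"
begin

section \<open>Commutative algebra\<close>

text \<open>
  In the module records built below the fields \<open>mult\<close> and \<open>one\<close>, which
  \<^locale>\<open>module\<close> does not constrain, are left undefined.
\<close>

definition mod_hom ::
  "('r, 's) ring_scheme \<Rightarrow> ('r, 'm) module \<Rightarrow> ('r, 'n) module \<Rightarrow> ('m \<Rightarrow> 'n) set" where
  "mod_hom R M N = {h. h \<in> carrier M \<rightarrow> carrier N \<and>
     (\<forall>x\<in>carrier M. \<forall>y\<in>carrier M. h (x \<oplus>\<^bsub>M\<^esub> y) = h x \<oplus>\<^bsub>N\<^esub> h y) \<and>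
     (\<forall>a\<in>carrier R. \<forall>x\<in>carrier M. h (a \<odot>\<^bsub>M\<^esub> x) = a \<odot>\<^bsub>N\<^esub> h x)}"

definition restrict_scalars :: "('r \<Rightarrow> 's) \<Rightarrow> ('s, 'm) module \<Rightarrow> ('r, 'm) module" where
  "restrict_scalars \<phi> M = \<lparr>carrier = carrier M, monoid.mult = undefined, one = undefined,
     ring.zero = \<zero>\<^bsub>M\<^esub>, ring.add = (\<oplus>\<^bsub>M\<^esub>), smult = (\<lambda>a x. \<phi> a \<odot>\<^bsub>M\<^esub> x)\<rparr>"

definition quot_module :: "('r, 'm) module \<Rightarrow> 'm set \<Rightarrow> ('r, 'm set) module" where
  "quot_module M N = \<lparr>carrier = a_rcosets\<^bsub>M\<^esub> N, monoid.mult = undefined, one = undefined,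
     ring.zero = N, ring.add = set_add M,
     smult = (\<lambda>a Q. \<Union>x\<in>Q. N +>\<^bsub>M\<^esub> (a \<odot>\<^bsub>M\<^esub> x))\<rparr>"

definition coker :: "('r, 'm) module \<Rightarrow> ('r, 'n) module \<Rightarrow> ('m \<Rightarrow> 'n) \<Rightarrow> ('r, 'n set) module" where
  "coker M N h = quot_module N (h ` carrier M)"

definition annihilates :: "('r, 'm) module \<Rightarrow> 'r \<Rightarrow> bool" where
  "annihilates M a \<longleftrightarrow> (\<forall>x\<in>carrier M. a \<odot>\<^bsub>M\<^esub> x = \<zero>\<^bsub>M\<^esub>)"

text \<open>Only used over the integral domain \<open>A\<^sub>L\<close>.\<close>

definition torsion_module :: "('r, 's) ring_scheme \<Rightarrow> ('r, 'm) module \<Rightarrow> bool" where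
  "torsion_module R M \<longleftrightarrow>
     (\<forall>x\<in>carrier M. \<exists>a\<in>carrier R. a \<noteq> \<zero>\<^bsub>R\<^esub> \<and> a \<odot>\<^bsub>M\<^esub> x = \<zero>\<^bsub>M\<^esub>)"

definition free_of_rank :: "('r, 's) ring_scheme \<Rightarrow> ('r, 'm) module \<Rightarrow> nat \<Rightarrow> bool" where
  "free_of_rank R M n \<longleftrightarrow> (\<exists>e. e \<in> {..<n} \<rightarrow> carrier M \<and>
     (\<forall>x\<in>carrier M. \<exists>!c. c \<in> {..<n} \<rightarrow>\<^sub>E carrier R \<and> x = (\<Oplus>\<^bsub>M\<^esub>i\<in>{..<n}. c i \<odot>\<^bsub>M\<^esub> e i)))"

text \<open>
  The localisation \<open>M[1/s]\<close> is free of rank \<open>n\<close> over \<open>R[1/s]\<close>. Since \<open>s\<close> becomes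
  invertible, the basis may be taken to consist of images of elements of \<open>M\<close>; generation and
  linear independence are written with denominators cleared.
\<close>

definition localisation_free_of_rank ::
  "('r, 's) ring_scheme \<Rightarrow> ('r, 'm) module \<Rightarrow> 'r \<Rightarrow> nat \<Rightarrow> bool" where
  "localisation_free_of_rank R M s n \<longleftrightarrow> (\<exists>e. e \<in> {..<n} \<rightarrow> carrier M \<and>
     (\<forall>x\<in>carrier M. \<exists>(N::nat) c. c \<in> {..<n} \<rightarrow> carrier R \<and>
        (s [^]\<^bsub>R\<^esub> N) \<odot>\<^bsub>M\<^esub> x = (\<Oplus>\<^bsub>M\<^esub>i\<in>{..<n}. c i \<odot>\<^bsub>M\<^esub> e i)) \<and>
     (\<forall>c. c \<in> {..<n} \<rightarrow> carrier R \<and> (\<Oplus>\<^bsub>M\<^esub>i\<in>{..<n}. c i \<odot>\<^bsub>M\<^esub> e i) = \<zero>\<^bsub>M\<^esub> \<longrightarrow>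
        (\<exists>N::nat. \<forall>i<n. s [^]\<^bsub>R\<^esub> N \<otimes>\<^bsub>R\<^esub> c i = \<zero>\<^bsub>R\<^esub>)))"

definition locally_free_module :: "('r, 's) ring_scheme \<Rightarrow> ('r, 'm) module \<Rightarrow> nat \<Rightarrow> bool" where
  "locally_free_module R M n \<longleftrightarrow> module R M \<and>
     (\<forall>P. primeideal P R \<longrightarrow> (\<exists>s\<in>carrier R - P. localisation_free_of_rank R M s n))"

primrec ideal_power :: "('r, 's) ring_scheme \<Rightarrow> 'r set \<Rightarrow> nat \<Rightarrow> 'r set" where
  "ideal_power R I 0 = carrier R"
| "ideal_power R I (Suc n) = I \<cdot>\<^bsub>R\<^esub> ideal_power R I n"

text \<open>Irreducibility of the topological space \<open>Spec R\<close>, tested on the basic open sets.\<close>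

definition irreducible_spectrum :: "('r, 's) ring_scheme \<Rightarrow> bool" where
  "irreducible_spectrum R \<longleftrightarrow> (\<exists>P. primeideal P R) \<and>
     (\<forall>s\<in>carrier R. \<forall>t\<in>carrier R.
        (\<exists>P. primeideal P R \<and> s \<notin> P) \<and> (\<exists>P. primeideal P R \<and> t \<notin> P) \<longrightarrow>
        (\<exists>P. primeideal P R \<and> s \<notin> P \<and> t \<notin> P))"

subsection \<open>Tensor products of algebras\<close>

text \<open>
  \<open>A \<otimes>\<^sub>k B\<close> for two commutative algebras given by structure maps \<open>\<alpha> : k \<rightarrow> A\<close> and
  \<open>\<beta> : k \<rightarrow> B\<close>: the integral monoid ring of the multiplicative monoid \<open>A \<times> B\<close> modulo the ideal
  generated by the bilinearity relations.
\<close>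

definition prod_monoid_ring ::
  "('a, 's) ring_scheme \<Rightarrow> ('b, 't) ring_scheme \<Rightarrow> ('a \<times> 'b \<Rightarrow>\<^sub>0 int) ring" where
  "prod_monoid_ring A B = \<lparr>carrier = {x. Poly_Mapping.keys x \<subseteq> carrier A \<times> carrier B},
     monoid.mult = (\<lambda>x y. frag_extend (\<lambda>(a, b).
               frag_extend (\<lambda>(a', b'). frag_of (a \<otimes>\<^bsub>A\<^esub> a', b \<otimes>\<^bsub>B\<^esub> b')) y) x),
     one = frag_of (\<one>\<^bsub>A\<^esub>, \<one>\<^bsub>B\<^esub>), ring.zero = 0, ring.add = (+)\<rparr>"

definition tensor_ideal ::
  "('k, 'u) ring_scheme \<Rightarrow> ('k \<Rightarrow> 'a) \<Rightarrow> ('a, 's) ring_scheme \<Rightarrow> ('k \<Rightarrow> 'b) \<Rightarrow> ('b, 't) ring_scheme \<Rightarrow>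
   ('a \<times> 'b \<Rightarrow>\<^sub>0 int) set" where
  "tensor_ideal k \<alpha> A \<beta> B = Idl\<^bsub>prod_monoid_ring A B\<^esub>
    ({frag_of (a \<oplus>\<^bsub>A\<^esub> a', b) - frag_of (a, b) - frag_of (a', b) | a a' b.
        a \<in> carrier A \<and> a' \<in> carrier A \<and> b \<in> carrier B} \<union>
     {frag_of (a, b \<oplus>\<^bsub>B\<^esub> b') - frag_of (a, b) - frag_of (a, b') | a b b'.
        a \<in> carrier A \<and> b \<in> carrier B \<and> b' \<in> carrier B} \<union>
     {frag_of (\<alpha> c \<otimes>\<^bsub>A\<^esub> a, b) - frag_of (a, \<beta> c \<otimes>\<^bsub>B\<^esub> b) | c a b.
        c \<in> carrier k \<and> a \<in> carrier A \<and> b \<in> carrier B})"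

definition tensor_algebra ::
  "('k, 'u) ring_scheme \<Rightarrow> ('k \<Rightarrow> 'a) \<Rightarrow> ('a, 's) ring_scheme \<Rightarrow> ('k \<Rightarrow> 'b) \<Rightarrow> ('b, 't) ring_scheme \<Rightarrow>
   ('a \<times> 'b \<Rightarrow>\<^sub>0 int) set ring" where
  "tensor_algebra k \<alpha> A \<beta> B = prod_monoid_ring A B Quot tensor_ideal k \<alpha> A \<beta> B"

definition pure_tensor ::
  "('k, 'u) ring_scheme \<Rightarrow> ('k \<Rightarrow> 'a) \<Rightarrow> ('a, 's) ring_scheme \<Rightarrow> ('k \<Rightarrow> 'b) \<Rightarrow> ('b, 't) ring_scheme \<Rightarrow>
   'a \<Rightarrow> 'b \<Rightarrow> ('a \<times> 'b \<Rightarrow>\<^sub>0 int) set" where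
  "pure_tensor k \<alpha> A \<beta> B a b = tensor_ideal k \<alpha> A \<beta> B +>\<^bsub>prod_monoid_ring A B\<^esub> frag_of (a, b)"

subsection \<open>Extension of scalars\<close>

text \<open>\<open>M \<otimes>\<^sub>R S\<close> for an \<open>R\<close>-module \<open>M\<close> and a ring homomorphism \<open>\<phi> : R \<rightarrow> S\<close>.\<close>

definition base_change_rel ::
  "('r, 'u) ring_scheme \<Rightarrow> ('r \<Rightarrow> 's) \<Rightarrow> ('s, 't) ring_scheme \<Rightarrow> ('r, 'm) module \<Rightarrow>
   ('m \<times> 's \<Rightarrow>\<^sub>0 int) set" where
  "base_change_rel R \<phi> S M = generate (free_Abelian_group (carrier M \<times> carrier S))
    ({frag_of (x \<oplus>\<^bsub>M\<^esub> x', s) - frag_of (x, s) - frag_of (x', s) | x x' s.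
        x \<in> carrier M \<and> x' \<in> carrier M \<and> s \<in> carrier S} \<union>
     {frag_of (x, s \<oplus>\<^bsub>S\<^esub> s') - frag_of (x, s) - frag_of (x, s') | x s s'.
        x \<in> carrier M \<and> s \<in> carrier S \<and> s' \<in> carrier S} \<union>
     {frag_of (a \<odot>\<^bsub>M\<^esub> x, s) - frag_of (x, \<phi> a \<otimes>\<^bsub>S\<^esub> s) | a x s.
        a \<in> carrier R \<and> x \<in> carrier M \<and> s \<in> carrier S})"

definition base_change_coset ::
  "('r, 'u) ring_scheme \<Rightarrow> ('r \<Rightarrow> 's) \<Rightarrow> ('s, 't) ring_scheme \<Rightarrow> ('r, 'm) module \<Rightarrow>
   ('m \<times> 's \<Rightarrow>\<^sub>0 int) \<Rightarrow> ('m \<times> 's \<Rightarrow>\<^sub>0 int) set" where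
  "base_change_coset R \<phi> S M z =
     base_change_rel R \<phi> S M #>\<^bsub>free_Abelian_group (carrier M \<times> carrier S)\<^esub> z"

definition base_change ::
  "('r, 'u) ring_scheme \<Rightarrow> ('r \<Rightarrow> 's) \<Rightarrow> ('s, 't) ring_scheme \<Rightarrow> ('r, 'm) module \<Rightarrow>
   ('s, ('m \<times> 's \<Rightarrow>\<^sub>0 int) set) module" where
  "base_change R \<phi> S M = \<lparr>
     carrier = rcosets\<^bsub>free_Abelian_group (carrier M \<times> carrier S)\<^esub> base_change_rel R \<phi> S M,
     monoid.mult = undefined, one = undefined, ring.zero = base_change_rel R \<phi> S M,
     ring.add = set_mult (free_Abelian_group (carrier M \<times> carrier S)),
     smult = (\<lambda>s Q. \<Union>z\<in>Q. base_change_coset R \<phi> S M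
                (frag_extend (\<lambda>(x, t). frag_of (x, s \<otimes>\<^bsub>S\<^esub> t)) z))\<rparr>"

definition base_change_pure ::
  "('r, 'u) ring_scheme \<Rightarrow> ('r \<Rightarrow> 's) \<Rightarrow> ('s, 't) ring_scheme \<Rightarrow> ('r, 'm) module \<Rightarrow>
   'm \<Rightarrow> 's \<Rightarrow> ('m \<times> 's \<Rightarrow>\<^sub>0 int) set" where
  "base_change_pure R \<phi> S M x s = base_change_coset R \<phi> S M (frag_of (x, s))"

text \<open>The map \<open>f \<otimes> id : M \<otimes>\<^sub>R S \<rightarrow> M' \<otimes>\<^sub>R S\<close>; only the target \<open>M'\<close> enters the formula.\<close>

definition base_change_map ::
  "('r, 'u) ring_scheme \<Rightarrow> ('r \<Rightarrow> 's) \<Rightarrow> ('s, 't) ring_scheme \<Rightarrow> ('r, 'n) module \<Rightarrow>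
   ('m \<Rightarrow> 'n) \<Rightarrow> ('m \<times> 's \<Rightarrow>\<^sub>0 int) set \<Rightarrow> ('n \<times> 's \<Rightarrow>\<^sub>0 int) set" where
  "base_change_map R \<phi> S M' f Q =
     (\<Union>z\<in>Q. base_change_coset R \<phi> S M' (frag_extend (\<lambda>(x, s). frag_of (f x, s)) z))"

section \<open>Sheaves and schemes\<close>

text \<open>Sheaf axioms for section sets \<open>S U\<close> and restriction maps \<open>\<rho> U V : S U \<rightarrow> S V\<close>.\<close>

definition sheaf_of_sets ::
  "'p topology \<Rightarrow> ('p set \<Rightarrow> 'x set) \<Rightarrow> ('p set \<Rightarrow> 'p set \<Rightarrow> 'x \<Rightarrow> 'x) \<Rightarrow> bool" where
  "sheaf_of_sets T S \<rho> \<longleftrightarrow>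
     (\<forall>U V. openin T U \<and> openin T V \<and> V \<subseteq> U \<longrightarrow> \<rho> U V \<in> S U \<rightarrow> S V) \<and>
     (\<forall>U. openin T U \<longrightarrow> (\<forall>s\<in>S U. \<rho> U U s = s)) \<and>
     (\<forall>U V W. openin T U \<and> openin T V \<and> openin T W \<and> W \<subseteq> V \<and> V \<subseteq> U \<longrightarrow>
        (\<forall>s\<in>S U. \<rho> V W (\<rho> U V s) = \<rho> U W s)) \<and>
     (\<forall>\<U> s. (\<forall>V\<in>\<U>. openin T V \<and> s V \<in> S V) \<and>
        (\<forall>V\<in>\<U>. \<forall>W\<in>\<U>. \<rho> V (V \<inter> W) (s V) = \<rho> W (V \<inter> W) (s W)) \<longrightarrow>
        (\<exists>!t. t \<in> S (\<Union>\<U>) \<and> (\<forall>V\<in>\<U>. \<rho> (\<Union>\<U>) V t = s V)))"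

definition germ ::
  "'p topology \<Rightarrow> ('p set \<Rightarrow> 'x set) \<Rightarrow> ('p set \<Rightarrow> 'p set \<Rightarrow> 'x \<Rightarrow> 'x) \<Rightarrow> 'p \<Rightarrow> 'p set \<Rightarrow> 'x \<Rightarrow>
   ('p set \<times> 'x) set" where
  "germ T S \<rho> x U s = {(V, t). openin T V \<and> x \<in> V \<and> t \<in> S V \<and>
     (\<exists>W. openin T W \<and> x \<in> W \<and> W \<subseteq> U \<inter> V \<and> \<rho> U W s = \<rho> V W t)}"

definition germs ::
  "'p topology \<Rightarrow> ('p set \<Rightarrow> 'x set) \<Rightarrow> ('p set \<Rightarrow> 'p set \<Rightarrow> 'x \<Rightarrow> 'x) \<Rightarrow> 'p \<Rightarrow>
   ('p set \<times> 'x) set set" where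
  "germs T S \<rho> x = {germ T S \<rho> x U s | U s. openin T U \<and> x \<in> U \<and> s \<in> S U}"

text \<open>
  Schemes over a base ring carry a map \<open>str\<close> from the base ring to the global sections.
\<close>

record ('k, 'p, 'a) rspace =
  topo :: "'p topology"
  sec :: "'p set \<Rightarrow> 'a ring"
  res :: "'p set \<Rightarrow> 'p set \<Rightarrow> 'a \<Rightarrow> 'a"
  str :: "'k \<Rightarrow> 'a"

abbreviation pts :: "('k, 'p, 'a) rspace \<Rightarrow> 'p set" where
  "pts S \<equiv> topspace (topo S)"

abbreviation fun_germ :: "('k, 'p, 'a) rspace \<Rightarrow> 'p \<Rightarrow> 'p set \<Rightarrow> 'a \<Rightarrow> ('p set \<times> 'a) set" where
  "fun_germ S \<equiv> germ (topo S) (\<lambda>U. carrier (sec S U)) (res S)"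

definition ringed_space :: "('k, 'p, 'a) rspace \<Rightarrow> bool" where
  "ringed_space S \<longleftrightarrow>
     sheaf_of_sets (topo S) (\<lambda>U. carrier (sec S U)) (res S) \<and>
     (\<forall>U. openin (topo S) U \<longrightarrow> cring (sec S U)) \<and>
     (\<forall>U V. openin (topo S) U \<and> openin (topo S) V \<and> V \<subseteq> U \<longrightarrow>
        res S U V \<in> ring_hom (sec S U) (sec S V))"

definition stalk :: "('k, 'p, 'a) rspace \<Rightarrow> 'p \<Rightarrow> ('p set \<times> 'a) set ring" where
  "stalk S x = \<lparr>carrier = germs (topo S) (\<lambda>U. carrier (sec S U)) (res S) x,
     monoid.mult = (\<lambda>P Q. \<Union>(U, s)\<in>P. \<Union>(V, t)\<in>Q. fun_germ S x (U \<inter> V)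
               (res S U (U \<inter> V) s \<otimes>\<^bsub>sec S (U \<inter> V)\<^esub> res S V (U \<inter> V) t)),
     one = fun_germ S x (pts S) \<one>\<^bsub>sec S (pts S)\<^esub>,
     ring.zero = fun_germ S x (pts S) \<zero>\<^bsub>sec S (pts S)\<^esub>,
     ring.add = (\<lambda>P Q. \<Union>(U, s)\<in>P. \<Union>(V, t)\<in>Q. fun_germ S x (U \<inter> V)
               (res S U (U \<inter> V) s \<oplus>\<^bsub>sec S (U \<inter> V)\<^esub> res S V (U \<inter> V) t))\<rparr>"

text \<open>The non-units of the stalk, which form its maximal ideal when \<open>S\<close> is a scheme.\<close>

definition stalk_max :: "('k, 'p, 'a) rspace \<Rightarrow> 'p \<Rightarrow> ('p set \<times> 'a) set set" where
  "stalk_max S x = carrier (stalk S x) - Units (stalk S x)"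

definition residue_field :: "('k, 'p, 'a) rspace \<Rightarrow> 'p \<Rightarrow> ('p set \<times> 'a) set set ring" where
  "residue_field S x = stalk S x Quot stalk_max S x"

definition residue_class :: "('k, 'p, 'a) rspace \<Rightarrow> 'p \<Rightarrow> ('p set \<times> 'a) set \<Rightarrow> ('p set \<times> 'a) set set" where
  "residue_class S x s = stalk_max S x +>\<^bsub>stalk S x\<^esub> s"

text \<open>The sections over \<open>U\<close> that vanish at \<open>x\<close>, that is, whose germ at \<open>x\<close> is not a unit.\<close>

definition vanishing :: "('k, 'p, 'a) rspace \<Rightarrow> 'p set \<Rightarrow> 'p \<Rightarrow> 'a set" where
  "vanishing S U x = {s \<in> carrier (sec S U).
     \<forall>V. openin (topo S) V \<and> x \<in> V \<and> V \<subseteq> U \<longrightarrow> res S U V s \<notin> Units (sec S V)}"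

definition nonvanishing_locus :: "('k, 'p, 'a) rspace \<Rightarrow> 'p set \<Rightarrow> 'a \<Rightarrow> 'p set" where
  "nonvanishing_locus S U s = {x \<in> U. s \<notin> vanishing S U x}"

text \<open>
  \<open>(U, O|U)\<close> is isomorphic to \<open>Spec R\<close> for \<open>R = O(U)\<close>: the map \<open>x \<mapsto> vanishing S U x\<close> is a bijection
  onto the primes of \<open>R\<close>, the sets \<open>D(s)\<close> form a basis of the topology of \<open>U\<close>, and
  \<open>R \<rightarrow> O(D(s))\<close> is the localisation at \<open>s\<close>. These data on the basis determine the sheaf.
\<close>

definition affine_open :: "('k, 'p, 'a) rspace \<Rightarrow> 'p set \<Rightarrow> bool" where
  "affine_open S U \<longleftrightarrow> openin (topo S) U \<and>
     bij_betw (vanishing S U) U {P. primeideal P (sec S U)} \<and>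
     (\<forall>s\<in>carrier (sec S U). openin (topo S) (nonvanishing_locus S U s)) \<and>
     (\<forall>V. openin (topo S) V \<and> V \<subseteq> U \<longrightarrow>
        (\<forall>x\<in>V. \<exists>s\<in>carrier (sec S U).
           x \<in> nonvanishing_locus S U s \<and> nonvanishing_locus S U s \<subseteq> V)) \<and>
     (\<forall>s\<in>carrier (sec S U). let V = nonvanishing_locus S U s in
        res S U V s \<in> Units (sec S V) \<and>
        (\<forall>t\<in>carrier (sec S V). \<exists>n::nat. \<exists>u\<in>carrier (sec S U).
           res S U V s [^]\<^bsub>sec S V\<^esub> n \<otimes>\<^bsub>sec S V\<^esub> t = res S U V u) \<and>
        (\<forall>u\<in>carrier (sec S U). res S U V u = \<zero>\<^bsub>sec S V\<^esub> \<longrightarrow>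
           (\<exists>n::nat. s [^]\<^bsub>sec S U\<^esub> n \<otimes>\<^bsub>sec S U\<^esub> u = \<zero>\<^bsub>sec S U\<^esub>)))"

definition scheme_over :: "('k, 'u) ring_scheme \<Rightarrow> ('k, 'p, 'a) rspace \<Rightarrow> bool" where
  "scheme_over k S \<longleftrightarrow> ringed_space S \<and>
     (\<forall>x\<in>pts S. \<exists>U. affine_open S U \<and> x \<in> U) \<and>
     str S \<in> ring_hom k (sec S (pts S))"

definition str_on :: "('k, 'p, 'a) rspace \<Rightarrow> 'p set \<Rightarrow> 'k \<Rightarrow> 'a" where
  "str_on S U c = res S (pts S) U (str S c)"

definition str_germ :: "('k, 'p, 'a) rspace \<Rightarrow> 'p \<Rightarrow> 'k \<Rightarrow> ('p set \<times> 'a) set" where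
  "str_germ S x c = fun_germ S x (pts S) (str S c)"

definition preim :: "('k, 'y, 'b) rspace \<Rightarrow> ('y \<Rightarrow> 'p) \<Rightarrow> 'p set \<Rightarrow> 'y set" where
  "preim Y \<phi> U = {y \<in> pts Y. \<phi> y \<in> U}"

text \<open>
  A morphism of locally ringed spaces \<open>Y \<rightarrow> S\<close> with map \<open>\<phi>\<close> on points and comorphism
  \<open>\<phi>s U : O\<^sub>S(U) \<rightarrow> O\<^sub>Y(\<phi>\<inverse> U)\<close>. The base rings of \<open>S\<close> and \<open>Y\<close> are not compared here.
\<close>

definition lrs_morphism ::
  "('l, 'y, 'b) rspace \<Rightarrow> ('k, 'p, 'a) rspace \<Rightarrow> ('y \<Rightarrow> 'p) \<Rightarrow> ('p set \<Rightarrow> 'a \<Rightarrow> 'b) \<Rightarrow> bool" where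
  "lrs_morphism Y S \<phi> \<phi>s \<longleftrightarrow> continuous_map (topo Y) (topo S) \<phi> \<and>
     (\<forall>U. openin (topo S) U \<longrightarrow> \<phi>s U \<in> ring_hom (sec S U) (sec Y (preim Y \<phi> U))) \<and>
     (\<forall>U V. openin (topo S) U \<and> openin (topo S) V \<and> V \<subseteq> U \<longrightarrow>
        (\<forall>s\<in>carrier (sec S U).
           \<phi>s V (res S U V s) = res Y (preim Y \<phi> U) (preim Y \<phi> V) (\<phi>s U s))) \<and>
     (\<forall>U. openin (topo S) U \<longrightarrow> (\<forall>y\<in>preim Y \<phi> U. \<forall>s\<in>carrier (sec S U).
        s \<in> vanishing S U (\<phi> y) \<longrightarrow> \<phi>s U s \<in> vanishing Y (preim Y \<phi> U) y))"

text \<open>The homomorphism \<open>O\<^bsub>S,\<phi> y\<^esub> \<rightarrow> O\<^bsub>Y,y\<^esub>\<close> on stalks.\<close>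

definition stalk_hom ::
  "('l, 'y, 'b) rspace \<Rightarrow> ('y \<Rightarrow> 'p) \<Rightarrow> ('p set \<Rightarrow> 'a \<Rightarrow> 'b) \<Rightarrow> 'y \<Rightarrow>
   ('p set \<times> 'a) set \<Rightarrow> ('y set \<times> 'b) set" where
  "stalk_hom Y \<phi> \<phi>s y P = (\<Union>(U, s)\<in>P. fun_germ Y y (preim Y \<phi> U) (\<phi>s U s))"

text \<open>
  \<open>Y = S \<times> Spec L\<close> for a homomorphism \<open>j : k \<rightarrow> L\<close>, with projection \<open>(\<phi>, \<phi>s)\<close>: over every affine
  open \<open>U\<close> of \<open>S\<close>, \<open>Y\<close> is \<open>Spec (O(U) \<otimes>\<^sub>k L)\<close>. This is how the fibre product is constructed, and
  it determines \<open>Y\<close> up to unique isomorphism.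
\<close>

definition base_change_of ::
  "('k, 'u) ring_scheme \<Rightarrow> ('k, 'p, 'a) rspace \<Rightarrow> ('k \<Rightarrow> 'l) \<Rightarrow> ('l, 't) ring_scheme \<Rightarrow>
   ('l, 'y, 'b) rspace \<Rightarrow> ('y \<Rightarrow> 'p) \<Rightarrow> ('p set \<Rightarrow> 'a \<Rightarrow> 'b) \<Rightarrow> bool" where
  "base_change_of k S j L Y \<phi> \<phi>s \<longleftrightarrow> scheme_over L Y \<and> lrs_morphism Y S \<phi> \<phi>s \<and>
     (\<forall>c\<in>carrier k. \<phi>s (pts S) (str S c) = str Y (j c)) \<and>
     (\<forall>U. affine_open S U \<longrightarrow> affine_open Y (preim Y \<phi> U) \<and>
        (\<exists>h\<in>ring_iso (tensor_algebra k (str_on S U) (sec S U) j L) (sec Y (preim Y \<phi> U)).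
           \<forall>a\<in>carrier (sec S U). \<forall>b\<in>carrier L.
             h (pure_tensor k (str_on S U) (sec S U) j L a b) =
               \<phi>s U a \<otimes>\<^bsub>sec Y (preim Y \<phi> U)\<^esub> str_on Y (preim Y \<phi> U) b))"

subsection \<open>Curves\<close>

definition integral_scheme :: "('k, 'p, 'a) rspace \<Rightarrow> bool" where
  "integral_scheme S \<longleftrightarrow> pts S \<noteq> {} \<and>
     (\<forall>U. openin (topo S) U \<and> U \<noteq> {} \<longrightarrow> domain (sec S U))"

text \<open>
  A closed immersion into projective \<open>n\<close>-space over \<open>k\<close>, written out on the standard charts: \<open>U i\<close>
  is the preimage of the chart \<open>X\<^sub>i \<noteq> 0\<close>, \<open>z i j\<close> the pullback of \<open>X\<^sub>j / X\<^sub>i\<close>, and the last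
  condition says that \<open>k[X\<^sub>0/X\<^sub>i, \<dots>, X\<^sub>n/X\<^sub>i] \<rightarrow> O(U i)\<close> is surjective.
\<close>

definition projective_over :: "('k, 'u) ring_scheme \<Rightarrow> ('k, 'p, 'a) rspace \<Rightarrow> bool" where
  "projective_over k S \<longleftrightarrow> (\<exists>(n::nat) U z.
     (\<forall>i\<le>n. affine_open S (U i)) \<and> pts S = (\<Union>i\<le>n. U i) \<and>
     (\<forall>i\<le>n. \<forall>j\<le>n. z i j \<in> carrier (sec S (U i))) \<and>
     (\<forall>i\<le>n. z i i = \<one>\<^bsub>sec S (U i)\<^esub>) \<and>
     (\<forall>i\<le>n. \<forall>j\<le>n. U i \<inter> U j = nonvanishing_locus S (U i) (z i j)) \<and>
     (\<forall>i\<le>n. \<forall>j\<le>n. \<forall>l\<le>n. let W = U i \<inter> U j in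
        res S (U i) W (z i l) = res S (U i) W (z i j) \<otimes>\<^bsub>sec S W\<^esub> res S (U j) W (z j l)) \<and>
     (\<forall>i\<le>n. carrier (sec S (U i)) =
        generate_ring (sec S (U i)) (str_on S (U i) ` carrier k \<union> z i ` {..n})))"

definition irreducible_closed :: "'p topology \<Rightarrow> 'p set \<Rightarrow> bool" where
  "irreducible_closed T Z \<longleftrightarrow> closedin T Z \<and> Z \<noteq> {} \<and>
     (\<forall>P Q. closedin T P \<and> closedin T Q \<and> Z \<subseteq> P \<union> Q \<longrightarrow> Z \<subseteq> P \<or> Z \<subseteq> Q)"

text \<open>Krull dimension 1.\<close>

definition one_dimensional :: "'p topology \<Rightarrow> bool" where
  "one_dimensional T \<longleftrightarrow>
     (\<exists>Z0 Z1. irreducible_closed T Z0 \<and> irreducible_closed T Z1 \<and> Z0 \<subset> Z1) \<and>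
     \<not> (\<exists>Z0 Z1 Z2. irreducible_closed T Z0 \<and> irreducible_closed T Z1 \<and> irreducible_closed T Z2 \<and>
          Z0 \<subset> Z1 \<and> Z1 \<subset> Z2)"

text \<open>\<open>k\<close>-derivations of the local ring at \<open>x\<close> with values in the residue field \<open>\<kappa>(x)\<close>.\<close>

definition point_derivations ::
  "('k, 'u) ring_scheme \<Rightarrow> ('k, 'p, 'a) rspace \<Rightarrow> 'p \<Rightarrow> (('p set \<times> 'a) set \<Rightarrow> ('p set \<times> 'a) set set) set" where
  "point_derivations k S x = {D. D \<in> carrier (stalk S x) \<rightarrow> carrier (residue_field S x) \<and>
     (\<forall>s\<in>carrier (stalk S x). \<forall>t\<in>carrier (stalk S x).
        D (s \<oplus>\<^bsub>stalk S x\<^esub> t) = D s \<oplus>\<^bsub>residue_field S x\<^esub> D t \<and>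
        D (s \<otimes>\<^bsub>stalk S x\<^esub> t) =
          (residue_class S x s \<otimes>\<^bsub>residue_field S x\<^esub> D t) \<oplus>\<^bsub>residue_field S x\<^esub>
          (residue_class S x t \<otimes>\<^bsub>residue_field S x\<^esub> D s)) \<and>
     (\<forall>c\<in>carrier k. D (str_germ S x c) = \<zero>\<^bsub>residue_field S x\<^esub>)}"

text \<open>
  For a one-dimensional integral scheme of finite type over a field \<open>k\<close>, smoothness means that
  \<open>\<Omega>\<^bsub>S/k\<^esub> \<otimes> \<kappa>(x)\<close> is one-dimensional over \<open>\<kappa>(x)\<close> at every point \<open>x\<close>. The dual of that vector space
  is the space of point derivations, which is therefore required to be one-dimensional.
\<close>

definition smooth_of_dim_1 :: "('k, 'u) ring_scheme \<Rightarrow> ('k, 'p, 'a) rspace \<Rightarrow> bool" where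
  "smooth_of_dim_1 k S \<longleftrightarrow> one_dimensional (topo S) \<and>
     (\<forall>x\<in>pts S. \<exists>D\<in>point_derivations k S x.
        (\<exists>s\<in>carrier (stalk S x). D s \<noteq> \<zero>\<^bsub>residue_field S x\<^esub>) \<and>
        (\<forall>E\<in>point_derivations k S x. \<exists>c\<in>carrier (residue_field S x).
           \<forall>s\<in>carrier (stalk S x). E s = c \<otimes>\<^bsub>residue_field S x\<^esub> D s))"

text \<open>
  For an integral \<open>S\<close>, the base change of \<open>S\<close> to the algebraic closure of \<open>k\<close> is covered by
  the nonempty, pairwise intersecting open sets \<open>Spec (O(U) \<otimes>\<^sub>k k\<^sup>a\<^sup>l\<^sup>g)\<close> for nonempty affine \<open>U\<close>;
  hence it is irreducible iff all of them are.
\<close>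

definition geometrically_irreducible :: "('k, 'u) ring_scheme \<Rightarrow> ('k, 'p, 'a) rspace \<Rightarrow> bool" where
  "geometrically_irreducible k S \<longleftrightarrow>
     (\<forall>U. affine_open S U \<and> U \<noteq> {} \<longrightarrow> irreducible_spectrum
        (tensor_algebra k (str_on S U) (sec S U) (ring.indexed_const k) (field.alg_closure k)))"

definition smooth_projective_curve :: "('k, 'u) ring_scheme \<Rightarrow> ('k, 'p, 'a) rspace \<Rightarrow> bool" where
  "smooth_projective_curve k S \<longleftrightarrow> scheme_over k S \<and> integral_scheme S \<and>
     projective_over k S \<and> smooth_of_dim_1 k S \<and> geometrically_irreducible k S"

definition rational_point :: "('k, 'u) ring_scheme \<Rightarrow> ('k, 'p, 'a) rspace \<Rightarrow> 'p \<Rightarrow> bool" where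
  "rational_point k S x \<longleftrightarrow> x \<in> pts S \<and>
     carrier (residue_field S x) = (\<lambda>c. residue_class S x (str_germ S x c)) ` carrier k"

subsection \<open>Sheaves of modules\<close>

record ('p, 'a, 'm) modsheaf =
  msec :: "'p set \<Rightarrow> ('a, 'm) module"
  mres :: "'p set \<Rightarrow> 'p set \<Rightarrow> 'm \<Rightarrow> 'm"

definition sheaf_of_modules :: "('k, 'p, 'a) rspace \<Rightarrow> ('p, 'a, 'm) modsheaf \<Rightarrow> bool" where
  "sheaf_of_modules S E \<longleftrightarrow>
     sheaf_of_sets (topo S) (\<lambda>U. carrier (msec E U)) (mres E) \<and>
     (\<forall>U. openin (topo S) U \<longrightarrow> module (sec S U) (msec E U)) \<and>
     (\<forall>U V. openin (topo S) U \<and> openin (topo S) V \<and> V \<subseteq> U \<longrightarrow>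
        (\<forall>s\<in>carrier (msec E U). \<forall>t\<in>carrier (msec E U).
           mres E U V (s \<oplus>\<^bsub>msec E U\<^esub> t) = mres E U V s \<oplus>\<^bsub>msec E V\<^esub> mres E U V t) \<and>
        (\<forall>a\<in>carrier (sec S U). \<forall>s\<in>carrier (msec E U).
           mres E U V (a \<odot>\<^bsub>msec E U\<^esub> s) = res S U V a \<odot>\<^bsub>msec E V\<^esub> mres E U V s))"

definition locally_free_sheaf :: "('k, 'p, 'a) rspace \<Rightarrow> ('p, 'a, 'm) modsheaf \<Rightarrow> nat \<Rightarrow> bool" where
  "locally_free_sheaf S E n \<longleftrightarrow> sheaf_of_modules S E \<and>
     (\<forall>x\<in>pts S. \<exists>V e. openin (topo S) V \<and> x \<in> V \<and> e \<in> {..<n} \<rightarrow> carrier (msec E V) \<and>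
        (\<forall>W. openin (topo S) W \<and> W \<subseteq> V \<longrightarrow>
           (\<forall>s\<in>carrier (msec E W). \<exists>!c. c \<in> {..<n} \<rightarrow>\<^sub>E carrier (sec S W) \<and>
              s = (\<Oplus>\<^bsub>msec E W\<^esub>i\<in>{..<n}. c i \<odot>\<^bsub>msec E W\<^esub> mres E V W (e i)))))"

abbreviation mod_germ ::
  "('k, 'p, 'a) rspace \<Rightarrow> ('p, 'a, 'm) modsheaf \<Rightarrow> 'p \<Rightarrow> 'p set \<Rightarrow> 'm \<Rightarrow> ('p set \<times> 'm) set" where
  "mod_germ S E \<equiv> germ (topo S) (\<lambda>U. carrier (msec E U)) (mres E)"

definition mod_stalk ::
  "('k, 'p, 'a) rspace \<Rightarrow> ('p, 'a, 'm) modsheaf \<Rightarrow> 'p \<Rightarrow>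
   (('p set \<times> 'a) set, ('p set \<times> 'm) set) module" where
  "mod_stalk S E x = \<lparr>carrier = germs (topo S) (\<lambda>U. carrier (msec E U)) (mres E) x,
     monoid.mult = undefined, one = undefined,
     ring.zero = mod_germ S E x (pts S) \<zero>\<^bsub>msec E (pts S)\<^esub>,
     ring.add = (\<lambda>P Q. \<Union>(U, s)\<in>P. \<Union>(V, t)\<in>Q. mod_germ S E x (U \<inter> V)
               (mres E U (U \<inter> V) s \<oplus>\<^bsub>msec E (U \<inter> V)\<^esub> mres E V (U \<inter> V) t)),
     smult = (\<lambda>P Q. \<Union>(U, a)\<in>P. \<Union>(V, t)\<in>Q. mod_germ S E x (U \<inter> V)
               (res S U (U \<inter> V) a \<odot>\<^bsub>msec E (U \<inter> V)\<^esub> mres E V (U \<inter> V) t))\<rparr>"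

text \<open>The maps from the stalk at a point to the stalk at a generization \<open>y\<close> of it.\<close>

definition fun_generize ::
  "('k, 'p, 'a) rspace \<Rightarrow> 'p \<Rightarrow> ('p set \<times> 'a) set \<Rightarrow> ('p set \<times> 'a) set" where
  "fun_generize S y P = (\<Union>(U, s)\<in>P. fun_germ S y U s)"

definition mod_generize ::
  "('k, 'p, 'a) rspace \<Rightarrow> ('p, 'a, 'm) modsheaf \<Rightarrow> 'p \<Rightarrow> ('p set \<times> 'm) set \<Rightarrow> ('p set \<times> 'm) set" where
  "mod_generize S E y P = (\<Union>(U, s)\<in>P. mod_germ S E y U s)"

definition generic_point :: "('k, 'p, 'a) rspace \<Rightarrow> 'p" where
  "generic_point S = (THE x. x \<in> pts S \<and> (\<forall>U. openin (topo S) U \<and> U \<noteq> {} \<longrightarrow> x \<in> U))"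

text \<open>
  The stalk at \<open>x\<close> of \<open>E(w\<cdot>x) = E \<otimes> O(w\<cdot>x)\<close>, for \<open>E\<close> locally free and \<open>x\<close> a closed point of an
  integral curve with principal maximal ideal \<open>m\<^sub>x\<close>. Here \<open>O(w\<cdot>x)\<close> is the inverse of the \<open>w\<close>-th power
  of the ideal sheaf of \<open>x\<close>, and the stalk is realised inside the generic stalk of \<open>E\<close>.
\<close>

definition twisted_stalk ::
  "('k, 'p, 'a) rspace \<Rightarrow> ('p, 'a, 'm) modsheaf \<Rightarrow> nat \<Rightarrow> 'p \<Rightarrow> ('p set \<times> 'm) set set" where
  "twisted_stalk S E w x = (let \<eta> = generic_point S in
     {v \<in> carrier (mod_stalk S E \<eta>).
        \<forall>g\<in>ideal_power (stalk S x) (stalk_max S x) w.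
          fun_generize S \<eta> g \<odot>\<^bsub>mod_stalk S E \<eta>\<^esub> v \<in> mod_generize S E \<eta> ` carrier (mod_stalk S E x)})"

section \<open>Pure Anderson motives\<close>

text \<open>
  The fixed geometric data: a field \<open>fld\<close> (\<open>L\<close>) with a finite subfield \<open>fq\<close>, the curve \<open>C\<close> over
  \<open>fq\<close> with the point \<open>\<infinity>\<close>, the base change \<open>C\<^sub>L\<close> with its projection to \<open>C\<close>, and the endomorphism
  \<open>\<sigma>\<close> of \<open>C\<^sub>L\<close>; suffix \<open>_pt\<close> marks maps on points, suffix \<open>_sh\<close> comorphisms.
\<close>

record ('l, 'p, 'a, 'y, 'b) geometry =
  fld :: "'l ring"
  fq :: "'l set"
  curve :: "('l, 'p, 'a) rspace"
  infty :: 'p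
  curveL :: "('l, 'y, 'b) rspace"
  proj_pt :: "'y \<Rightarrow> 'p"
  proj_sh :: "'p set \<Rightarrow> 'a \<Rightarrow> 'b"
  sigma_pt :: "'y \<Rightarrow> 'y"
  sigma_sh :: "'y set \<Rightarrow> 'b \<Rightarrow> 'b"

definition Fq :: "('l, 'p, 'a, 'y, 'b) geometry \<Rightarrow> 'l ring" where
  "Fq G = (fld G)\<lparr>carrier := fq G\<rparr>"

definition frob :: "('l, 'p, 'a, 'y, 'b) geometry \<Rightarrow> 'l \<Rightarrow> 'l" where
  "frob G b = b [^]\<^bsub>fld G\<^esub> card (fq G)"

definition anderson_geometry :: "('l, 'p, 'a, 'y, 'b) geometry \<Rightarrow> bool" where
  "anderson_geometry G \<longleftrightarrow>
     field (fld G) \<and> subfield (fq G) (fld G) \<and> finite (fq G) \<and>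
     smooth_projective_curve (Fq G) (curve G) \<and>
     rational_point (Fq G) (curve G) (infty G) \<and>
     base_change_of (Fq G) (curve G) id (fld G) (curveL G) (proj_pt G) (proj_sh G) \<and>
     lrs_morphism (curveL G) (curveL G) (sigma_pt G) (sigma_sh G) \<and>
     (\<forall>y\<in>pts (curveL G). proj_pt G (sigma_pt G y) = proj_pt G y) \<and>
     (\<forall>U. openin (topo (curve G)) U \<longrightarrow> (\<forall>a\<in>carrier (sec (curve G) U).
        sigma_sh G (preim (curveL G) (proj_pt G) U) (proj_sh G U a) = proj_sh G U a)) \<and>
     (\<forall>b\<in>carrier (fld G).
        sigma_sh G (pts (curveL G)) (str (curveL G) b) = str (curveL G) (frob G b))"

definition affine_part :: "('l, 'p, 'a, 'y, 'b) geometry \<Rightarrow> 'p set" where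
  "affine_part G = pts (curve G) - {infty G}"

definition A_ring :: "('l, 'p, 'a, 'y, 'b) geometry \<Rightarrow> 'a ring" where
  "A_ring G = sec (curve G) (affine_part G)"

definition Fq_to_A :: "('l, 'p, 'a, 'y, 'b) geometry \<Rightarrow> 'l \<Rightarrow> 'a" where
  "Fq_to_A G = str_on (curve G) (affine_part G)"

definition AL :: "('l, 'p, 'a, 'y, 'b) geometry \<Rightarrow> ('a \<times> 'l \<Rightarrow>\<^sub>0 int) set ring" where
  "AL G = tensor_algebra (Fq G) (Fq_to_A G) (A_ring G) id (fld G)"

definition AL_tensor :: "('l, 'p, 'a, 'y, 'b) geometry \<Rightarrow> 'a \<Rightarrow> 'l \<Rightarrow> ('a \<times> 'l \<Rightarrow>\<^sub>0 int) set" where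
  "AL_tensor G = pure_tensor (Fq G) (Fq_to_A G) (A_ring G) id (fld G)"

definition sigma_star ::
  "('l, 'p, 'a, 'y, 'b) geometry \<Rightarrow> ('a \<times> 'l \<Rightarrow>\<^sub>0 int) set \<Rightarrow> ('a \<times> 'l \<Rightarrow>\<^sub>0 int) set" where
  "sigma_star G Q = (\<Union>z\<in>Q. tensor_ideal (Fq G) (Fq_to_A G) (A_ring G) id (fld G)
     +>\<^bsub>prod_monoid_ring (A_ring G) (fld G)\<^esub> frag_extend (\<lambda>(a, b). frag_of (a, frob G b)) z)"

definition characteristic_hom :: "('l, 'p, 'a, 'y, 'b) geometry \<Rightarrow> ('a \<Rightarrow> 'l) \<Rightarrow> bool" where
  "characteristic_hom G c \<longleftrightarrow> c \<in> ring_hom (A_ring G) (fld G) \<and> (\<forall>u\<in>fq G. c (Fq_to_A G u) = u)"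

definition J_ideal ::
  "('l, 'p, 'a, 'y, 'b) geometry \<Rightarrow> ('a \<Rightarrow> 'l) \<Rightarrow> ('a \<times> 'l \<Rightarrow>\<^sub>0 int) set set" where
  "J_ideal G c = Idl\<^bsub>AL G\<^esub> {AL_tensor G a \<one>\<^bsub>fld G\<^esub> \<ominus>\<^bsub>AL G\<^esub> AL_tensor G \<one>\<^bsub>A_ring G\<^esub> (c a) | a.
     a \<in> carrier (A_ring G)}"

text \<open>Types of elements of \<open>A\<^sub>L\<close>, of \<open>A\<^sub>L\<close>-modules and of elements of \<open>\<sigma>\<^sup>*M\<close>.\<close>

type_synonym ('l, 'a) AL_elt = "('a \<times> 'l \<Rightarrow>\<^sub>0 int) set"
type_synonym ('l, 'a, 'm) AL_module = "(('l, 'a) AL_elt, 'm) module"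
type_synonym ('l, 'a, 'm) pullback_elt = "('m \<times> ('l, 'a) AL_elt \<Rightarrow>\<^sub>0 int) set"

definition sigma_pullback ::
  "('l, 'p, 'a, 'y, 'b) geometry \<Rightarrow> ('l, 'a, 'm) AL_module \<Rightarrow>
   ('l, 'a, ('l, 'a, 'm) pullback_elt) AL_module" where
  "sigma_pullback G M = base_change (AL G) (sigma_star G) (AL G) M"

definition sigma_pullback_map ::
  "('l, 'p, 'a, 'y, 'b) geometry \<Rightarrow> ('l, 'a, 'n) AL_module \<Rightarrow> ('m \<Rightarrow> 'n) \<Rightarrow>
   ('l, 'a, 'm) pullback_elt \<Rightarrow> ('l, 'a, 'n) pullback_elt" where
  "sigma_pullback_map G M' = base_change_map (AL G) (sigma_star G) (AL G) M'"

text \<open>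
  The \<open>\<sigma>\<close>-semilinear map \<open>x \<mapsto> \<tau> (x \<otimes> 1)\<close>. Under the identification of \<open>(\<sigma>\<^sup>*)\<^sup>n M\<close> with
  \<open>M \<otimes> A\<^sub>L\<close> along \<open>(\<sigma>\<^sup>*)\<^sup>n\<close>, the map \<open>\<tau>\<^sup>n = \<tau> \<circ> \<sigma>\<^sup>*\<tau> \<circ> \<dots> \<circ> (\<sigma>\<^sup>*)\<^bsup>n-1\<^esup>\<tau>\<close> is the
  linear map that sends \<open>x \<otimes> 1\<close> to the \<open>n\<close>-fold iterate of this semilinear map at \<open>x\<close>.
\<close>

definition tau_semilinear ::
  "('l, 'p, 'a, 'y, 'b) geometry \<Rightarrow> ('l, 'a, 'm) AL_module \<Rightarrow> (('l, 'a, 'm) pullback_elt \<Rightarrow> 'm) \<Rightarrow>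
   'm \<Rightarrow> 'm" where
  "tau_semilinear G M \<tau> x = \<tau> (base_change_pure (AL G) (sigma_star G) (AL G) M x \<one>\<^bsub>AL G\<^esub>)"

definition inftyL :: "('l, 'p, 'a, 'y, 'b) geometry \<Rightarrow> 'y" where
  "inftyL G = (THE y. y \<in> pts (curveL G) \<and> proj_pt G y = infty G)"

definition affine_partL :: "('l, 'p, 'a, 'y, 'b) geometry \<Rightarrow> 'y set" where
  "affine_partL G = preim (curveL G) (proj_pt G) (affine_part G)"

text \<open>
  \<open>E\<close> extends \<open>M\<close>: an isomorphism \<open>\<theta>\<close> of \<open>M\<close> with the sections of \<open>E\<close> over
  \<open>C\<^sub>L - {\<infinity>} = Spec A\<^sub>L\<close>, linear along \<open>a \<otimes> b \<mapsto> a\<cdot>b\<close>.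
\<close>

definition extends_module ::
  "('l, 'p, 'a, 'y, 'b) geometry \<Rightarrow> ('l, 'a, 'm) AL_module \<Rightarrow> ('y, 'b, 'e) modsheaf \<Rightarrow> ('m \<Rightarrow> 'e) \<Rightarrow>
   bool" where
  "extends_module G M E \<theta> \<longleftrightarrow> (let U = affine_partL G; S = curveL G in
     bij_betw \<theta> (carrier M) (carrier (msec E U)) \<and>
     (\<forall>x\<in>carrier M. \<forall>y\<in>carrier M. \<theta> (x \<oplus>\<^bsub>M\<^esub> y) = \<theta> x \<oplus>\<^bsub>msec E U\<^esub> \<theta> y) \<and>
     (\<forall>a\<in>carrier (A_ring G). \<forall>b\<in>carrier (fld G). \<forall>x\<in>carrier M.
        \<theta> (AL_tensor G a b \<odot>\<^bsub>M\<^esub> x) =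
          (proj_sh G (affine_part G) a \<otimes>\<^bsub>sec S U\<^esub> str_on S U b) \<odot>\<^bsub>msec E U\<^esub> \<theta> x))"

text \<open>
  \<open>\<tau>\<^sup>n\<close> induces an isomorphism \<open>(\<sigma>\<^sup>*)\<^sup>n E\<^sub>\<infinity> \<rightarrow> E(w\<cdot>\<infinity>)\<^sub>\<infinity>\<close>. Here \<open>T\<close> is the extension of
  the \<open>n\<close>-fold iterate of \<open>\<tau>\<close> (as a semilinear map) to the generic stalk of \<open>E\<close>, and \<open>\<Phi>\<close> is the
  \<open>O\<^sub>\<infinity>\<close>-linear map \<open>v \<otimes> g \<mapsto> g \<cdot> T v\<close>.
\<close>

definition tau_iso_at_infinity ::
  "('l, 'p, 'a, 'y, 'b) geometry \<Rightarrow> ('l, 'a, 'm) AL_module \<Rightarrow> (('l, 'a, 'm) pullback_elt \<Rightarrow> 'm) \<Rightarrow>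
   ('y, 'b, 'e) modsheaf \<Rightarrow> ('m \<Rightarrow> 'e) \<Rightarrow> nat \<Rightarrow> nat \<Rightarrow> bool" where
  "tau_iso_at_infinity G M \<tau> E \<theta> w n \<longleftrightarrow>
    (let S = curveL G; \<eta> = generic_point S; y = inftyL G;
         O\<^sub>y = stalk S y; E\<^sub>\<eta> = mod_stalk S E \<eta>; E\<^sub>y = mod_stalk S E y;
         \<sigma>\<^sub>\<eta> = stalk_hom S (sigma_pt G) (sigma_sh G) \<eta> ^^ n;
         \<sigma>\<^sub>y = stalk_hom S (sigma_pt G) (sigma_sh G) y ^^ n
     in \<exists>T \<Phi>.
       T \<in> carrier E\<^sub>\<eta> \<rightarrow> carrier E\<^sub>\<eta> \<and>
       (\<forall>u\<in>carrier E\<^sub>\<eta>. \<forall>v\<in>carrier E\<^sub>\<eta>. T (u \<oplus>\<^bsub>E\<^sub>\<eta>\<^esub> v) = T u \<oplus>\<^bsub>E\<^sub>\<eta>\<^esub> T v) \<and>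
       (\<forall>g\<in>carrier (stalk S \<eta>). \<forall>v\<in>carrier E\<^sub>\<eta>. T (g \<odot>\<^bsub>E\<^sub>\<eta>\<^esub> v) = \<sigma>\<^sub>\<eta> g \<odot>\<^bsub>E\<^sub>\<eta>\<^esub> T v) \<and>
       (\<forall>x\<in>carrier M. T (mod_germ S E \<eta> (affine_partL G) (\<theta> x)) =
          mod_germ S E \<eta> (affine_partL G) (\<theta> ((tau_semilinear G M \<tau> ^^ n) x))) \<and>
       \<Phi> \<in> mod_hom O\<^sub>y (base_change O\<^sub>y \<sigma>\<^sub>y O\<^sub>y E\<^sub>y) (restrict_scalars (fun_generize S \<eta>) E\<^sub>\<eta>) \<and>
       (\<forall>v\<in>carrier E\<^sub>y. \<forall>g\<in>carrier O\<^sub>y. \<Phi> (base_change_pure O\<^sub>y \<sigma>\<^sub>y O\<^sub>y E\<^sub>y v g) =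
          fun_generize S \<eta> g \<odot>\<^bsub>E\<^sub>\<eta>\<^esub> T (mod_generize S E \<eta> v)) \<and>
       bij_betw \<Phi> (carrier (base_change O\<^sub>y \<sigma>\<^sub>y O\<^sub>y E\<^sub>y)) (twisted_stalk S E w y))"

text \<open>
  The sections of the sheaf \<open>E\<close> live in the type of \<open>M \<otimes> O\<^sub>\<eta>\<close>, the generic stalk. This is no loss of
  generality: a locally free sheaf on the integral scheme \<open>C\<^sub>L\<close> is isomorphic to a subsheaf of
  the constant sheaf on its generic stalk.
\<close>

definition pure_at_infinity ::
  "('l, 'p, 'a, 'y, 'b) geometry \<Rightarrow> nat \<Rightarrow> ('l, 'a, 'm) AL_module \<Rightarrow>
   (('l, 'a, 'm) pullback_elt \<Rightarrow> 'm) \<Rightarrow> bool" where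
  "pure_at_infinity G r M \<tau> \<longleftrightarrow>
     (\<exists>(E :: ('y, 'b, ('m \<times> ('y set \<times> 'b) set \<Rightarrow>\<^sub>0 int) set) modsheaf) \<theta> w n.
        0 < w \<and> 0 < n \<and> locally_free_sheaf (curveL G) E r \<and>
        extends_module G M E \<theta> \<and> tau_iso_at_infinity G M \<tau> E \<theta> w n)"

definition pure_anderson_motive ::
  "('l, 'p, 'a, 'y, 'b) geometry \<Rightarrow> ('a \<Rightarrow> 'l) \<Rightarrow> nat \<Rightarrow> nat \<Rightarrow> ('l, 'a, 'm) AL_module \<Rightarrow>
   (('l, 'a, 'm) pullback_elt \<Rightarrow> 'm) \<Rightarrow> bool" where
  "pure_anderson_motive G c r d M \<tau> \<longleftrightarrow>
     locally_free_module (AL G) M r \<and>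
     \<tau> \<in> mod_hom (AL G) (sigma_pullback G M) M \<and> inj_on \<tau> (carrier (sigma_pullback G M)) \<and>
     free_of_rank (fld G)
       (restrict_scalars (AL_tensor G \<one>\<^bsub>A_ring G\<^esub>) (coker (sigma_pullback G M) M \<tau>)) d \<and>
     (\<forall>a\<in>ideal_power (AL G) (J_ideal G c) d. annihilates (coker (sigma_pullback G M) M \<tau>) a) \<and>
     pure_at_infinity G r M \<tau>"

definition motive_morphism ::
  "('l, 'p, 'a, 'y, 'b) geometry \<Rightarrow>
   ('l, 'a, 'm) AL_module \<Rightarrow> (('l, 'a, 'm) pullback_elt \<Rightarrow> 'm) \<Rightarrow>
   ('l, 'a, 'n) AL_module \<Rightarrow> (('l, 'a, 'n) pullback_elt \<Rightarrow> 'n) \<Rightarrow> ('m \<Rightarrow> 'n) \<Rightarrow> bool" where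
  "motive_morphism G M \<tau> M' \<tau>' f \<longleftrightarrow> f \<in> mod_hom (AL G) M M' \<and>
     (\<forall>z\<in>carrier (sigma_pullback G M). f (\<tau> z) = \<tau>' (sigma_pullback_map G M' f z))"

definition isogeny ::
  "('l, 'p, 'a, 'y, 'b) geometry \<Rightarrow>
   ('l, 'a, 'm) AL_module \<Rightarrow> (('l, 'a, 'm) pullback_elt \<Rightarrow> 'm) \<Rightarrow>
   ('l, 'a, 'n) AL_module \<Rightarrow> (('l, 'a, 'n) pullback_elt \<Rightarrow> 'n) \<Rightarrow> ('m \<Rightarrow> 'n) \<Rightarrow> bool" where
  "isogeny G M \<tau> M' \<tau>' f \<longleftrightarrow> motive_morphism G M \<tau> M' \<tau>' f \<and>
     inj_on f (carrier M) \<and> torsion_module (AL G) (coker M M' f)"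

definition A_in_AL :: "('l, 'p, 'a, 'y, 'b) geometry \<Rightarrow> 'a \<Rightarrow> ('l, 'a) AL_elt" where
  "A_in_AL G a = AL_tensor G a \<one>\<^bsub>fld G\<^esub>"

end

theory Submission
  imports Defs "HOL-Computational_Algebra.Primes"
begin

text \<open>Let \<open>I \<subseteq> A\<^sub>L\<close> be the annihilator of \<open>K = coker f\<close>. As \<open>K\<close> is torsion and \<open>M'\<close> is locally free of finite
rank over the domain \<open>A\<^sub>L\<close>, some \<open>t \<noteq> 0\<close> lies in \<open>I\<close> (\<open>torsion_quotient_annihilated\<close>). Everything turns on
replacing \<open>t\<close> by an element \<open>a \<otimes> 1\<close> with \<open>a \<in> A\<close>; the dual isogeny is then \<open>x' \<mapsto> f\<^sup>-\<^sup>1(a x')\<close>, which commutes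
with \<open>\<tau>\<close> because \<open>a \<otimes> 1\<close> is fixed by \<open>\<sigma>\<close> (\<open>dual_morphism\<close>).

Such elements come from Galois descent: every nonzero \<open>\<sigma>\<close>-stable \<open>L\<close>-subspace \<open>W\<close> of \<open>A\<^sub>L\<close> contains some
\<open>a \<otimes> 1 \<noteq> 0\<close> (\<open>invariant_contains_rational\<close>). Indeed, let \<open>x \<in> W\<close> be a nonzero sum of as few pure tensors
as possible, with one coefficient scaled to 1. Then \<open>\<sigma> x - x\<close> is shorter, hence 0, so all
coefficients of \<open>x\<close> lie in \<open>\<F>\<^sub>q\<close>.

So one has to see how far \<open>I\<close> is from being \<open>\<sigma>\<close>-stable. Since \<open>f\<close> commutes with \<open>\<tau>\<close> and \<open>\<tau>'\<close>, the elements of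
\<open>\<sigma>(I)\<close> carry the image of \<open>\<tau>'\<close> into \<open>f(M)\<close>, and \<open>J\<^bsup>d'\<^esup> M'\<close> is contained in that image; hence
\<open>\<sigma>(I) J\<^bsup>d'\<^esup> \<subseteq> I\<close> (\<open>sigma_ann\<close>). The power of \<open>J\<close> is removed as follows.

\<^item> If \<open>c\<^sup>*(a\<^sub>0) = 0\<close> for some \<open>a\<^sub>0 \<noteq> 0\<close>, then \<open>g = a\<^sub>0 \<otimes> 1\<close> lies in \<open>J\<close> and is fixed by \<open>\<sigma>\<close>. So the saturation
  \<open>{x. \<exists>n. g\<^sup>n x \<in> I}\<close> is \<open>\<sigma>\<close>-stable, and descent gives \<open>a\<^sub>0\<^sup>n a\<^sub>1 \<otimes> 1 \<in> I\<close>.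

\<^item> Let \<open>c\<^sup>*\<close> be injective. If its image is contained in a finite field, then \<open>A = \<F>\<^sub>q\<close> and \<open>A\<^sub>L = L\<close>, so that
  \<open>I\<close> contains 1.

\<^item> Otherwise a submodule \<open>N\<close> of \<open>M'\<close> that contains \<open>f(M)\<close> and \<open>J M'\<close> must be all of \<open>M'\<close>. If not, \<open>M'/N\<close> has a
  nonzero functional that is linear along the point \<open>\<chi>\<^sub>0 : a \<otimes> b \<mapsto> c\<^sup>*(a) b\<close> of \<open>A\<^sub>L\<close>. Twisting by Frobenius and
  pulling back along the inverse of \<open>\<tau>'\<close> turns a functional at \<open>\<chi>\<^sub>n : a \<otimes> b \<mapsto> c\<^sup>*(a)\<^bsup>q^n\<^esup> b\<close> that
  vanishes on \<open>f(M)\<close> into one at \<open>\<chi>\<^bsub>n+1\<^esub>\<close> (\<open>frobenius_twist_functional\<close>). It stays nonzero because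
  \<open>\<chi>\<^bsub>n+1\<^esub>\<close> does not vanish on \<open>J\<close>. Therefore \<open>\<chi>\<^sub>n(I) = 0\<close> for all \<open>n\<close>. But the elements killed by all but
  finitely many \<open>\<chi>\<^sub>n\<close> form a \<open>\<sigma>\<close>-stable ideal, which now is nonzero, so it contains some
  \<open>a \<otimes> 1\<close> with \<open>c\<^sup>*(a) = 0\<close>, a contradiction. By iteration, a submodule that contains \<open>f(M)\<close> and \<open>J\<^bsup>d'\<^esup> M'\<close> is \<open>M'\<close>.
  For \<open>i \<in> I\<close> this applies to \<open>{x. \<sigma>(i) x \<in> f(M)}\<close>, so \<open>I\<close> itself is \<open>\<sigma>\<close>-stable.

That \<open>A\<^sub>L\<close> is a domain rests on the geometric irreducibility of the curve, which enters in the form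
(\<open>section_ratio\<close>): if \<open>u\<^sup>Q = e\<^bsup>Q-1\<^esup> u\<close> in \<open>A\<close> with \<open>Q\<close> a power of \<open>q\<close> and \<open>e \<noteq> 0\<close>, then \<open>u \<in> \<F>\<^sub>q e\<close>. A shortest
zero divisor of \<open>A\<^sub>L\<close> with a coefficient 1 is compared with its image under a power of \<open>\<sigma>\<close> and with its
\<open>Q\<close>-th power; both comparisons shorten it, and so reduce it to a single pure tensor
(\<open>tensor_domain\<close>).\<close>

section \<open>Prime ideals and Frobenius powers\<close>

text \<open>Krull: an ideal that is maximal among those that contain \<open>I\<close> and miss \<open>S\<close> is prime.\<close>

lemma (in cring) prime_ideal_avoiding:
  assumes I: "ideal I R" and S: "S \<subseteq> carrier R" "\<one> \<in> S" "\<And>x y. x \<in> S \<Longrightarrow> y \<in> S \<Longrightarrow> x \<otimes> y \<in> S"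
    and disj: "I \<inter> S = {}"
  obtains P where "primeideal P R" "I \<subseteq> P" "P \<inter> S = {}"
proof -
  define \<A> where "\<A> = {J. ideal J R \<and> I \<subseteq> J \<and> J \<inter> S = {}}"
  have "\<exists>M\<in>\<A>. \<forall>Y\<in>\<A>. M \<subseteq> Y \<longrightarrow> Y = M"
  proof (rule subset_Zorn_nonempty)
    show "\<A> \<noteq> {}" using I disj unfolding \<A>_def by blast
  next
    fix C assume C: "C \<noteq> {}" "subset.chain \<A> C"
    have ch: "subset.chain {I. ideal I R} C"
      using C(2) unfolding pred_on.chain_def \<A>_def by auto
    have "ideal (\<Union>C) R" using chain_Union_is_ideal[OF ch] C(1) by simp
    moreover have "I \<subseteq> \<Union>C" "\<Union>C \<inter> S = {}" using C unfolding pred_on.chain_def \<A>_def by blast+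
    ultimately show "\<Union>C \<in> \<A>" by (simp add: \<A>_def)
  qed
  then obtain M where MA: "M \<in> \<A>" and mx: "\<forall>Y\<in>\<A>. M \<subseteq> Y \<longrightarrow> Y = M" by (elim bexE)
  have M: "ideal M R" "I \<subseteq> M" "M \<inter> S = {}" using MA unfolding \<A>_def by simp_all
  have max: "Y = M" if "ideal Y R" "M \<subseteq> Y" "Y \<inter> S = {}" for Y
  proof -
    have "Y \<in> \<A>" unfolding \<A>_def using that M(2) by (intro CollectI conjI) (assumption, rule subset_trans, assumption+)
    then show ?thesis using mx that(2) by simp
  qed
  interpret M: ideal M R by fact
  \<comment> \<open>By maximality, adjoining an element outside \<open>M\<close> produces an ideal that meets \<open>S\<close>.\<close>
  have meets: "\<exists>m\<in>M. \<exists>r\<in>carrier R. m \<oplus> r \<otimes> a \<in> S" if a: "a \<in> carrier R" "a \<notin> M" for a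
  proof -
    let ?Z = "M <+>\<^bsub>R\<^esub> PIdl a"
    have id: "ideal ?Z R" using add_ideals[OF M(1) cgenideal_ideal[OF a(1)]] .
    have sub: "M \<subseteq> ?Z"
    proof
      fix m assume "m \<in> M"
      moreover have "\<zero> \<in> PIdl a" using cgenideal_ideal[OF a(1)] by (simp add: additive_subgroup.zero_closed ideal.axioms(1))
      ultimately show "m \<in> ?Z" unfolding set_add_defs using M.Icarr by force
    qed
    have "\<zero> \<oplus> a \<in> ?Z" unfolding set_add_defs using cgenideal_self[OF a(1)] M.zero_closed by force
    then have "?Z \<noteq> M" using a by auto
    then have "?Z \<inter> S \<noteq> {}" using max[OF id sub] by blast
    then show ?thesis unfolding set_add_defs cgenideal_def by auto
  qed
  have "primeideal M R"
  proof (rule primeidealI)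
    show "ideal M R" by fact
    show "cring R" by (rule is_cring)
    show "carrier R \<noteq> M" using M(3) S by blast
  next
    fix a b assume ab: "a \<in> carrier R" "b \<in> carrier R" "a \<otimes> b \<in> M"
    show "a \<in> M \<or> b \<in> M"
    proof (rule ccontr)
      assume "\<not> (a \<in> M \<or> b \<in> M)"
      then obtain m r m' r' where h: "m \<in> M" "r \<in> carrier R" "m \<oplus> r \<otimes> a \<in> S"
        "m' \<in> M" "r' \<in> carrier R" "m' \<oplus> r' \<otimes> b \<in> S"
        using meets ab by metis
      have c: "m \<in> carrier R" "m' \<in> carrier R" using h M.Icarr by auto
      have "(m \<oplus> r \<otimes> a) \<otimes> (m' \<oplus> r' \<otimes> b) = m \<otimes> (m' \<oplus> r' \<otimes> b) \<oplus> ((r \<otimes> a) \<otimes> m' \<oplus> (r \<otimes> r') \<otimes> (a \<otimes> b))"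
        using c h ab by algebra
      moreover have "\<dots> \<in> M"
        using M.I_r_closed[OF h(1)] M.I_l_closed[OF h(4)] M.I_l_closed[OF ab(3)] c h ab
        by (intro M.a_closed) auto
      ultimately show False using S(3)[OF h(3) h(6)] M(3) by auto
    qed
  qed
  then show ?thesis using that M by blast
qed

text \<open>The radical of an ideal is closed under sums. The factor \<open>z\<close> replaces the binomial theorem in the
induction: \<open>z (a + b)\<^bsup>m+n\<^esup>\<close> splits into \<open>(z a) (a + b)\<^bsup>m+n-1\<^esup>\<close> and \<open>(z b) (a + b)\<^bsup>m+n-1\<^esup>\<close>, and \<open>z a\<close> and \<open>z b\<close>
need one factor less.\<close>

lemma (in cring) ideal_pow_add:
  assumes "ideal I R" "a \<in> carrier R" "b \<in> carrier R" "z \<in> carrier R"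
    and "z \<otimes> a [^] (m::nat) \<in> I" "z \<otimes> b [^] (n::nat) \<in> I"
  shows "z \<otimes> (a \<oplus> b) [^] (m + n) \<in> I"
  using assms(4-6)
proof (induction "m + n" arbitrary: m n z rule: less_induct)
  case less
  interpret I: ideal I R by fact
  note c = assms(2,3) less.prems(1)
  show ?case
  proof (cases "m = 0 \<or> n = 0")
    case True
    then have "z \<in> I" using less.prems c by auto
    then show ?thesis using c by (simp add: I.I_r_closed)
  next
    case False
    then obtain m' n' where mn: "m = Suc m'" "n = Suc n'" by (meson not0_implies_Suc)
    have "(z \<otimes> a) \<otimes> a [^] m' \<in> I" using less.prems(2) c unfolding mn
      by (metis m_assoc nat_pow_Suc2 nat_pow_closed)
    moreover have "(z \<otimes> a) \<otimes> b [^] n \<in> I"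
    proof -
      have "(z \<otimes> a) \<otimes> b [^] n = a \<otimes> (z \<otimes> b [^] n)" using c by (simp add: m_ac)
      then show ?thesis using less.prems(3) c by (simp add: I.I_l_closed)
    qed
    ultimately have 1: "(z \<otimes> a) \<otimes> (a \<oplus> b) [^] (m' + n) \<in> I"
      using less.hyps[of m' n "z \<otimes> a"] c mn by auto
    have "(z \<otimes> b) \<otimes> b [^] n' \<in> I" using less.prems(3) c unfolding mn
      by (metis m_assoc nat_pow_Suc2 nat_pow_closed)
    moreover have "(z \<otimes> b) \<otimes> a [^] m \<in> I"
    proof -
      have "(z \<otimes> b) \<otimes> a [^] m = b \<otimes> (z \<otimes> a [^] m)" using c by (simp add: m_ac)
      then show ?thesis using less.prems(2) c by (simp add: I.I_l_closed)
    qed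
    ultimately have 2: "(z \<otimes> b) \<otimes> (a \<oplus> b) [^] (m + n') \<in> I"
      using less.hyps[of m n' "z \<otimes> b"] c mn by auto
    have e: "m' + n = m + n'" using mn by simp
    have "z \<otimes> (a \<oplus> b) [^] (m + n) = (z \<otimes> a) \<otimes> (a \<oplus> b) [^] (m' + n) \<oplus> (z \<otimes> b) \<otimes> (a \<oplus> b) [^] (m + n')"
    proof -
      have s: "m + n = Suc (m + n')" using mn by simp
      have "z \<otimes> (w \<otimes> (a \<oplus> b)) = (z \<otimes> a) \<otimes> w \<oplus> (z \<otimes> b) \<otimes> w" if "w \<in> carrier R" for w
        using c that by algebra
      then show ?thesis unfolding s e nat_pow_Suc using c by simp
    qed
    then show ?thesis using 1 2 by simp
  qed
qed

lemma (in cring) binomial_expansion: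
  assumes x: "x \<in> carrier R" and y: "y \<in> carrier R"
  shows "(x \<oplus> y) [^] (n::nat) = (\<Oplus>k\<in>{..n}. (add_pow R (n choose k) (x [^] k \<otimes> y [^] (n - k))))"
proof (induction n)
  case 0
  then show ?case using x y by simp
next
  case (Suc n)
  note xy = x y
  have "(x \<oplus> y) [^] (Suc n) = (x \<oplus> y) \<otimes> (x \<oplus> y) [^] n" using xy by (simp add: m_comm)
  also have "\<dots> = x \<otimes> (x \<oplus> y) [^] n \<oplus> y \<otimes> (x \<oplus> y) [^] n" using xy by (simp add: l_distr)
  also have "x \<otimes> (x \<oplus> y) [^] n = (\<Oplus>k\<in>{..n}. x \<otimes> ((add_pow R (n choose k) (x [^] k \<otimes> y [^] (n - k)))))"
    unfolding Suc using xy by (subst finsum_rdistr) (auto simp: Pi_def)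
  also have "\<dots> = (\<Oplus>k\<in>{..n}. (add_pow R (n choose k) (x [^] Suc k \<otimes> y [^] (n - k))))"
    using xy by (intro finsum_cong') (auto simp: Pi_def add_pow_rdistr m_ac)
  also have "y \<otimes> (x \<oplus> y) [^] n = (\<Oplus>k\<in>{..n}. y \<otimes> ((add_pow R (n choose k) (x [^] k \<otimes> y [^] (n - k)))))"
    unfolding Suc using xy by (subst finsum_rdistr) (auto simp: Pi_def)
  also have "\<dots> = (\<Oplus>k\<in>{..n}. (add_pow R (n choose k) (x [^] k \<otimes> y [^] (Suc n - k))))"
    using xy by (intro finsum_cong') (auto simp: Pi_def add_pow_rdistr m_ac Suc_diff_le)
  also have "\<dots> = (\<Oplus>k\<in>{..Suc n}. (add_pow R (n choose k) (x [^] k \<otimes> y [^] (Suc n - k))))"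
    using xy by (simp add: Pi_def binomial_eq_0)
  also have "\<dots> = (\<Oplus>k\<in>{..n}. (add_pow R (n choose (Suc k)) (x [^] Suc k \<otimes> y [^] (n - k)))) \<oplus> y [^] Suc n"
    using xy by (subst finsum_Suc2) (auto simp: Pi_def)
  finally have "(x \<oplus> y) [^] (Suc n) = (\<Oplus>k\<in>{..n}. (add_pow R (n choose k) (x [^] Suc k \<otimes> y [^] (n - k)))) \<oplus>
     (\<Oplus>k\<in>{..n}. (add_pow R (n choose (Suc k)) (x [^] Suc k \<otimes> y [^] (n - k)))) \<oplus> y [^] Suc n"
    using xy by (subst a_assoc) auto
  also have "\<dots> = (\<Oplus>k\<in>{..n}. (add_pow R (n choose k) (x [^] Suc k \<otimes> y [^] (n - k))) \<oplus>
     (add_pow R (n choose (Suc k)) (x [^] Suc k \<otimes> y [^] (n - k)))) \<oplus> y [^] Suc n"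
    using xy by (subst finsum_addf) auto
  also have "\<dots> = (\<Oplus>k\<in>{..n}. (add_pow R (Suc n choose Suc k) (x [^] Suc k \<otimes> y [^] (Suc n - Suc k)))) \<oplus> y [^] Suc n"
    using xy by (intro arg_cong2[where f="(\<oplus>)"] finsum_cong') (auto simp: add.nat_pow_mult)
  also have "\<dots> = (\<Oplus>k\<in>{..Suc n}. (add_pow R (Suc n choose k) (x [^] k \<otimes> y [^] (Suc n - k))))"
    using xy by (subst finsum_Suc2) auto
  finally show ?case .
qed

lemma (in cring) add_pow_dvd_zero:
  assumes p: "add_pow R (p) \<one> = \<zero>" and d: "(p::nat) dvd n" and x: "x \<in> carrier R"
  shows "add_pow R (n) x = \<zero>"
proof -
  obtain m where m: "n = p * m" using d by auto
  have "add_pow R (p) x = add_pow R (p) \<one> \<otimes> x" using x by (simp add: add_pow_ldistr)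
  then have "add_pow R (p) x = \<zero>" using p x by simp
  then have "add_pow R (m) (add_pow R (p) x) = \<zero>" by simp
  then show ?thesis unfolding m using add.nat_pow_pow[OF x, of m p] by (simp add: mult.commute)
qed

text \<open>All mixed binomial coefficients are divisible by \<open>p\<close>.\<close>

lemma (in cring) frobenius_add_prime:
  assumes p: "Factorial_Ring.prime (p::nat)" "add_pow R (p) \<one> = \<zero>" and x: "x \<in> carrier R" and y: "y \<in> carrier R"
  shows "(x \<oplus> y) [^] p = x [^] p \<oplus> y [^] p"
proof -
  obtain m where m: "p = Suc m" using prime_gt_0_nat[OF p(1)] gr0_implies_Suc by auto
  have "(x \<oplus> y) [^] p = (\<Oplus>k\<in>{..p}. (add_pow R (p choose k) (x [^] k \<otimes> y [^] (p - k))))"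
    by (rule binomial_expansion[OF x y])
  also have "\<dots> = (\<Oplus>k\<in>{..p}. if k = 0 then y [^] p else if k = p then x [^] p else \<zero>)"
  proof (rule finsum_cong')
    fix k assume k: "k \<in> {..p}"
    have "(add_pow R (p choose k) (x [^] k \<otimes> y [^] (p - k))) = \<zero>" if "k \<noteq> 0" "k \<noteq> p"
    proof -
      have "p dvd (p choose k)" using that k p(1) by (intro dvd_choose_prime) auto
      then show ?thesis using add_pow_dvd_zero[OF p(2)] x y by simp
    qed
    then show "(add_pow R (p choose k) (x [^] k \<otimes> y [^] (p - k))) = (if k = 0 then y [^] p else if k = p then x [^] p else \<zero>)"
      using x y k by auto
  qed (use x y in auto)
  also have "\<dots> = x [^] p \<oplus> ((\<Oplus>k\<in>{..m}. if k = 0 then y [^] p else \<zero>))"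
    unfolding m using x y by (subst finsum_Suc) (auto intro!: arg_cong2[where f="(\<oplus>)"] finsum_cong')
  also have "(\<Oplus>k\<in>{..m}. if k = 0 then y [^] p else \<zero>) = y [^] p"
    using finsum_singleton[of 0 "{..m}" "\<lambda>_. y [^] p"] x y by (simp add: eq_commute)
  finally show ?thesis .
qed

text \<open>The number \<open>q\<close> is a positive power of a prime that is zero in \<open>R\<close>, so that \<open>x \<mapsto> x\<^sup>q\<close> is additive.\<close>

definition frob_exp :: "('a, 'b) ring_scheme \<Rightarrow> nat \<Rightarrow> bool" where
  "frob_exp R q \<longleftrightarrow> (\<exists>p n. Factorial_Ring.prime p \<and> q = p ^ Suc n \<and> add_pow R p \<one>\<^bsub>R\<^esub> = \<zero>\<^bsub>R\<^esub>)"

lemma frob_exp_gt_1: "frob_exp R q \<Longrightarrow> 1 < q"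
  unfolding frob_exp_def by (metis One_nat_def Suc_lessI one_less_power prime_gt_1_nat zero_less_Suc)

lemma frob_exp_pow: "frob_exp R q \<Longrightarrow> frob_exp R (q ^ Suc m)"
  unfolding frob_exp_def
proof (elim exE conjE)
  fix p n assume h: "Factorial_Ring.prime p" "q = p ^ Suc n" "add_pow R p \<one>\<^bsub>R\<^esub> = \<zero>\<^bsub>R\<^esub>"
  have "q ^ Suc m = p ^ (Suc n * Suc m)" using h(2) by (simp only: power_mult)
  also have "Suc n * Suc m = Suc (Suc n * m + n)" by simp
  finally have "q ^ Suc m = p ^ Suc (Suc n * m + n)" .
  then show "\<exists>p n. Factorial_Ring.prime p \<and> q ^ Suc m = p ^ Suc n \<and> add_pow R p \<one>\<^bsub>R\<^esub> = \<zero>\<^bsub>R\<^esub>"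
    using h by blast
qed

lemma (in cring) frob_add:
  assumes q: "frob_exp R q" and x: "x \<in> carrier R" and y: "y \<in> carrier R"
  shows "(x \<oplus> y) [^] q = x [^] q \<oplus> y [^] q"
proof -
  obtain p n where p: "Factorial_Ring.prime p" "q = p ^ Suc n" "add_pow R (p) \<one> = \<zero>" using q unfolding frob_exp_def by auto
  have *: "(x \<oplus> y) [^] (p ^ m) = x [^] (p ^ m) \<oplus> y [^] (p ^ m)" for m
  proof (induction m)
    case 0 then show ?case using x y by simp
  next
    case (Suc m)
    have pw: "z [^] (p ^ Suc m) = (z [^] (p ^ m)) [^] p" if "z \<in> carrier R" for z
      using that by (simp add: nat_pow_pow mult.commute)
    show ?case using x y by (simp only: pw a_closed Suc) (simp add: frobenius_add_prime[OF p(1,3)])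
  qed
  show ?thesis unfolding p(2) by (rule *)
qed

lemma (in cring) frob_minus:
  assumes q: "frob_exp R q" and x: "x \<in> carrier R" and y: "y \<in> carrier R"
  shows "(x \<ominus> y) [^] q = x [^] q \<ominus> y [^] q"
proof -
  have "x [^] q = ((x \<ominus> y) \<oplus> y) [^] q" using x y by (intro arg_cong[where f="\<lambda>z. z [^] q"]) algebra
  also have "\<dots> = (x \<ominus> y) [^] q \<oplus> y [^] q" using x y by (intro frob_add[OF q]) auto
  finally show ?thesis using x y
    by (metis a_minus_def add.inv_closed add.inv_solve_right' minus_closed nat_pow_closed)
qed

lemma (in ring_hom_ring) frob_exp_hom:
  assumes "frob_exp R q" shows "frob_exp S q"
proof -
  have "h (add_pow R p \<one>\<^bsub>R\<^esub>) = add_pow S p \<one>\<^bsub>S\<^esub>" for p :: nat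
    by (induction p) (auto simp: R.add.nat_pow_Suc S.add.nat_pow_Suc)
  then show ?thesis using assms unfolding frob_exp_def by (metis hom_zero)
qed

text \<open>The order \<open>p\<close> of \<open>1\<close> is a prime that kills the additive group, so a Sylow subgroup for another prime
would be trivial.\<close>

lemma (in field) finite_field_frob_exp:
  assumes fin: "finite (carrier R)"
  shows "frob_exp R (card (carrier R))"
proof -
  let ?q = "card (carrier R)" and ?G = "add_monoid R"
  have q0: "0 < ?q" using fin by (metis card_gt_0_iff empty_iff one_closed)
  have G: "group ?G" using a_comm_group comm_group.axioms(2) by blast
  have tors: "add_pow R (?q) x = \<zero>" if "x \<in> carrier R" for x
    using group.pow_order_eq_1[OF G, of x] that fin by (simp add: order_def add_pow_def)
  define p where "p = (LEAST n::nat. 0 < n \<and> add_pow R (n) \<one> = \<zero>)"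
  have p: "0 < p" "add_pow R (p) \<one> = \<zero>" and pmin: "\<And>n. 0 < n \<Longrightarrow> add_pow R (n) \<one> = \<zero> \<Longrightarrow> p \<le> n"
    using LeastI[of "\<lambda>n::nat. 0 < n \<and> add_pow R (n) \<one> = \<zero>" ?q] q0 tors[OF one_closed]
    unfolding p_def by (auto intro: Least_le)
  have "p \<noteq> 1" using p one_not_zero by auto
  have prime: "Factorial_Ring.prime p"
  proof (unfold prime_nat_iff, intro conjI allI impI)
    show "1 < p" using p \<open>p \<noteq> 1\<close> by simp
  next
    fix a assume a: "a dvd p"
    then obtain b where b: "p = a * b" by auto
    have "add_pow R (a) \<one> \<otimes> add_pow R (b) \<one> = add_pow R (b) (add_pow R (a) \<one>)"
      by (simp add: add_pow_rdistr)
    also have "\<dots> = add_pow R (p) \<one>" unfolding b by (rule add.nat_pow_pow) simp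
    finally have "add_pow R (a) \<one> = \<zero> \<or> add_pow R (b) \<one> = \<zero>" using p integral by simp
    moreover have "0 < a" "0 < b" using b p(1) by auto
    ultimately have "p \<le> a \<or> p \<le> b" using pmin by blast
    then show "a = 1 \<or> a = p" using b p(1)
      by (metis \<open>0 < a\<close> \<open>0 < b\<close> a dvd_imp_le dvd_triv_right le_antisym mult_cancel2 nat_mult_1 not_less0)
  qed
  \<comment> \<open>A Sylow subgroup for another prime \<open>l\<close> is killed by \<open>p\<close> and by a power of \<open>l\<close>.\<close>
  have only: "l = p" if l: "Factorial_Ring.prime l" "l dvd ?q" for l
  proof (rule ccontr)
    assume ne: "l \<noteq> p"
    define a where "a = multiplicity l ?q"
    have a1: "0 < a" using l q0 unfolding a_def by (simp add: prime_multiplicity_gt_zero_iff)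
    obtain m where m: "?q = l ^ a * m" unfolding a_def using multiplicity_dvd by blast
    obtain H where H: "subgroup H ?G" "card H = l ^ a"
      using sylow_thm[OF l(1) G, of a m] m fin by (auto simp: order_def)
    have "H = {\<zero>}"
    proof -
      have "h = \<zero>" if h: "h \<in> H" for h
      proof -
        have hc: "h \<in> carrier R" using H(1) h subgroup.subset by fastforce
        interpret H: group "?G\<lparr>carrier := H\<rparr>" using subgroup.subgroup_is_group[OF H(1) G] .
        have "pow (?G\<lparr>carrier := H\<rparr>) h (card H) = \<zero>"
          using H.pow_order_eq_1[of h] h fin H(1) finite_subset[OF subgroup.subset[OF H(1)]]
          by (auto simp: order_def)
        then have 1: "add_pow R (l ^ a) h = \<zero>"
          using monoid.nat_pow_consistent[OF group.is_monoid[OF G], of h "card H" H] H by (simp add: add_pow_def)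
        have 2: "add_pow R (p) h = \<zero>" using add_pow_dvd_zero[OF p(2) _ hc] by simp
        have cop: "coprime (l ^ a) p" using l(1) prime ne by (simp add: primes_coprime coprime_commute)
        obtain u v where uv: "u * l ^ a = v * p + 1"
          using coprime_bezout_strong[OF cop \<open>p \<noteq> 1\<close>] by (metis mult.commute)
        have "add_pow R (u * l ^ a) h = \<zero>" using 1 add.nat_pow_pow[OF hc, of u "l ^ a"] by (simp add: mult.commute)
        moreover have "add_pow R (v * p) h = \<zero>" using 2 add.nat_pow_pow[OF hc, of v p] by (simp add: mult.commute)
        moreover have "add_pow R (v * p + 1) h = add_pow R (v * p) h \<oplus> h" using hc by simp
        ultimately show "h = \<zero>" using uv hc by simp
      qed
      moreover have "\<zero> \<in> H" using subgroup.one_closed[OF H(1)] by simp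
      ultimately show ?thesis by blast
    qed
    then have "l ^ a = 1" using H(2) by simp
    then show False using a1 l(1) by (simp add: prime_nat_iff)
  qed
  have "?q = p ^ multiplicity p ?q"
  proof (rule multiplicity_eq_nat)
    fix r assume r: "Factorial_Ring.prime (r::nat)"
    show "multiplicity r ?q = multiplicity r (p ^ multiplicity p ?q)"
    proof (cases "r = p")
      case True then show ?thesis using prime by simp
    next
      case False
      then have "\<not> r dvd ?q" using only r by blast
      moreover have "multiplicity r (p ^ multiplicity p ?q) = 0" using False r prime
        by (metis multiplicity_distinct_prime_power)
      ultimately show ?thesis by (simp add: not_dvd_imp_multiplicity_0)
    qed
  qed (use q0 p in auto)
  moreover have "multiplicity p ?q \<noteq> 0"
  proof
    assume "multiplicity p ?q = 0"
    then have "?q = 1" using calculation by simp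
    then have "carrier R = {\<zero>}" by (metis card_1_singletonE zero_closed singletonD)
    then show False using one_closed one_not_zero by auto
  qed
  ultimately show ?thesis unfolding frob_exp_def using prime p(2) by (metis not0_implies_Suc)
qed

section \<open>Homogenised polynomials\<close>

text \<open>For a coefficient list \<open>p\<close> of degree \<open>n\<close>, lowest degree first, this is the homogenised value
\<open>e\<^sup>n p(u / e)\<close>. It makes sense without division, so that roots can be split off in rings in which \<open>e\<close>
is not a unit.\<close>

primrec hom_eval :: "('a, 'b) ring_scheme \<Rightarrow> 'a \<Rightarrow> 'a \<Rightarrow> 'a list \<Rightarrow> 'a" where
  "hom_eval R u e [] = \<zero>\<^bsub>R\<^esub>"
| "hom_eval R u e (a # p) = a \<otimes>\<^bsub>R\<^esub> e [^]\<^bsub>R\<^esub> length p \<oplus>\<^bsub>R\<^esub> u \<otimes>\<^bsub>R\<^esub> hom_eval R u e p"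

text \<open>Synthetic division by \<open>X - z\<close>.\<close>

primrec root_quot :: "('a, 'b) ring_scheme \<Rightarrow> 'a \<Rightarrow> 'a list \<Rightarrow> 'a list" where
  "root_quot R z [] = []"
| "root_quot R z (a # p) = (if p = [] then [] else hom_eval R z \<one>\<^bsub>R\<^esub> p # root_quot R z p)"

lemma length_root_quot [simp]: "length (root_quot R z p) = length p - 1"
  by (induction p) auto

context cring
begin

lemma hom_eval_closed [simp]:
  "u \<in> carrier R \<Longrightarrow> e \<in> carrier R \<Longrightarrow> set p \<subseteq> carrier R \<Longrightarrow> hom_eval R u e p \<in> carrier R"
  by (induction p) auto

lemma root_quot_closed:
  "z \<in> carrier R \<Longrightarrow> set p \<subseteq> carrier R \<Longrightarrow> set (root_quot R z p) \<subseteq> carrier R"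
  by (induction p) auto

lemma last_root_quot:
  "z \<in> carrier R \<Longrightarrow> set p \<subseteq> carrier R \<Longrightarrow> 1 < length p \<Longrightarrow> last (root_quot R z p) = last p"
proof (induction p)
  case (Cons a p)
  show ?case
  proof (cases "1 < length p")
    case True
    then have "root_quot R z p \<noteq> []" by (metis length_0_conv length_root_quot not_gr0 zero_less_diff)
    then show ?thesis using Cons True by auto
  next
    case False
    then obtain b where "p = [b]" using Cons.prems(3)
      by (cases p) auto
    then show ?thesis using Cons.prems by simp
  qed
qed simp

lemma hom_eval_root_quot:
  assumes u: "u \<in> carrier R" and e: "e \<in> carrier R" and z: "z \<in> carrier R"
  shows "set p \<subseteq> carrier R \<Longrightarrow> p \<noteq> [] \<Longrightarrow>
    hom_eval R u e p = (u \<ominus> z \<otimes> e) \<otimes> hom_eval R u e (root_quot R z p)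
      \<oplus> hom_eval R z \<one> p \<otimes> e [^] (length p - 1)"
proof (induction p)
  case (Cons a p)
  show ?case
  proof (cases "p = []")
    case True
    then show ?thesis using Cons u e z by simp
  next
    case False
    then obtain m where m: "length p = Suc m" by (cases p) auto
    define w q h s where "w = e [^] m" and "q = hom_eval R u e (root_quot R z p)"
      and "h = hom_eval R z \<one> p" and "s = hom_eval R u e p"
    have c: "w \<in> carrier R" "q \<in> carrier R" "h \<in> carrier R" "s \<in> carrier R" "a \<in> carrier R"
      using Cons.prems u e z root_quot_closed[OF z] unfolding w_def q_def h_def s_def by auto
    have IH: "s = (u \<ominus> z \<otimes> e) \<otimes> q \<oplus> h \<otimes> w"
      using Cons False m unfolding w_def q_def h_def s_def by auto
    have "a \<otimes> (w \<otimes> e) \<oplus> u \<otimes> ((u \<ominus> z \<otimes> e) \<otimes> q \<oplus> h \<otimes> w)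
       = (u \<ominus> z \<otimes> e) \<otimes> (h \<otimes> w \<oplus> u \<otimes> q) \<oplus> (a \<oplus> z \<otimes> h) \<otimes> (w \<otimes> e)"
      using c u e z by algebra
    then show ?thesis using False m c u e z Cons.prems IH
      by (simp add: w_def[symmetric] q_def[symmetric] h_def[symmetric] s_def[symmetric])
  qed
qed simp

lemma hom_eval_replicate:
  assumes u: "u \<in> carrier R" and e: "e \<in> carrier R"
  shows "hom_eval R u e (replicate n \<zero> @ [\<one>]) = u [^] n"
proof (induction n)
  case (Suc n)
  then show ?case using u e by (simp add: m_comm)
qed (use u e in simp)

text \<open>Coefficient list, lowest degree first, of \<open>X\<^sup>Q - X\<close>.\<close>

definition frob_poly :: "nat \<Rightarrow> 'a list" where
  "frob_poly Q = \<zero> # \<ominus> \<one> # replicate (Q - 2) \<zero> @ [\<one>]"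

lemma frob_poly_props:
  assumes "1 < Q"
  shows "set (frob_poly Q) \<subseteq> carrier R" "length (frob_poly Q) = Suc Q" "last (frob_poly Q) = \<one>"
  using assms by (auto simp: frob_poly_def)

lemma hom_eval_frob_poly:
  assumes Q: "1 < Q" and u: "u \<in> carrier R" and e: "e \<in> carrier R"
  shows "hom_eval R u e (frob_poly Q) = u [^] Q \<ominus> e [^] (Q - 1) \<otimes> u"
proof -
  define n where "n = Q - 2"
  have n: "Q = Suc (Suc n)" using Q unfolding n_def by simp
  have e1: "u \<otimes> ((\<ominus> \<one>) \<otimes> a \<oplus> u \<otimes> b) = (b \<otimes> u) \<otimes> u \<ominus> a \<otimes> u"
    if "a \<in> carrier R" "b \<in> carrier R" for a b using that u by (simp add: r_distr l_minus r_minus m_ac a_ac a_minus_def)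
  have "hom_eval R u e (frob_poly Q) = u \<otimes> ((\<ominus> \<one>) \<otimes> e [^] Suc n \<oplus> u \<otimes> u [^] n)"
    unfolding frob_poly_def n hom_eval.simps using u e by (simp add: hom_eval_replicate)
  also have "\<dots> = (u [^] n \<otimes> u) \<otimes> u \<ominus> e [^] Suc n \<otimes> u" using u e by (intro e1) auto
  finally show ?thesis unfolding n by simp
qed

end

lemma (in domain) finite_roots_hom_eval:
  "set p \<subseteq> carrier R \<Longrightarrow> p \<noteq> [] \<Longrightarrow> last p = \<one> \<Longrightarrow>
    finite {x \<in> carrier R. hom_eval R x \<one> p = \<zero>} \<and>
    card {x \<in> carrier R. hom_eval R x \<one> p = \<zero>} \<le> length p - 1"
proof (induction "length p" arbitrary: p rule: less_induct)
  case less
  let ?S = "\<lambda>p. {x \<in> carrier R. hom_eval R x \<one> p = \<zero>}"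
  show ?case
  proof (cases "length p = 1")
    case True
    then have "p = [\<one>]" using less.prems by (cases p) auto
    then have e: "?S p = {}" by auto
    show ?thesis unfolding e by simp
  next
    case False
    then have l: "1 < length p" using less.prems by (cases p) auto
    show ?thesis
    proof (cases "?S p = {}")
      case True show ?thesis unfolding True by simp
    next
      case False
      then obtain z where z: "z \<in> carrier R" "hom_eval R z \<one> p = \<zero>" by auto
      let ?q = "root_quot R z p"
      have q: "set ?q \<subseteq> carrier R" "?q \<noteq> []" "last ?q = \<one>"
        using root_quot_closed[OF z(1)] last_root_quot[OF z(1)] less.prems l
          length_root_quot[of R z p] by (auto simp del: length_root_quot)
      have IH: "finite (?S ?q)" "card (?S ?q) \<le> length p - 2"
        using less.hyps[OF _ q] l by (auto simp: numeral_2_eq_2)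
      have "?S p \<subseteq> insert z (?S ?q)"
      proof
        fix x assume x: "x \<in> ?S p"
        then have "(x \<ominus> z) \<otimes> hom_eval R x \<one> ?q = \<zero>"
          using hom_eval_root_quot[of x \<one> z p] z less.prems q by auto
        then have "x \<ominus> z = \<zero> \<or> hom_eval R x \<one> ?q = \<zero>"
          using x z q by (intro integral) auto
        then show "x \<in> insert z (?S ?q)" using x z by auto
      qed
      then have "finite (?S p)" "card (?S p) \<le> card (insert z (?S ?q))"
        using IH by (auto intro: finite_subset card_mono)
      moreover have "card (insert z (?S ?q)) \<le> Suc (length p - 2)"
        using IH by (simp add: card_insert_if)
      ultimately show ?thesis using l by linarith
    qed
  qed
qed

lemma (in field) finite_field_pow_card:
  assumes fin: "finite (carrier R)" and y: "y \<in> carrier R"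
  shows "y [^] card (carrier R) = y"
proof (cases "y = \<zero>")
  case True
  have "0 < card (carrier R)" using fin y by (metis card_gt_0_iff empty_iff)
  then show ?thesis using True by (simp add: nat_pow_zero)
next
  case False
  have g: "group (Multiplicative_Group.mult_of R)" by (rule field_mult_group)
  have "order (Multiplicative_Group.mult_of R) = card (carrier R) - 1" using order_mult_of fin by (simp add: order_def)
  moreover have "y [^]\<^bsub>Multiplicative_Group.mult_of R\<^esub> (order (Multiplicative_Group.mult_of R)) = \<one>\<^bsub>Multiplicative_Group.mult_of R\<^esub>"
    using group.pow_order_eq_1[OF g] y False by simp
  ultimately have "y [^] (card (carrier R) - 1) = \<one>" by (simp add: Multiplicative_Group.nat_pow_mult_of)
  then have "y [^] Suc (card (carrier R) - 1) = y" using y by simp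
  moreover have "0 < card (carrier R)" using fin y by (metis card_gt_0_iff empty_iff)
  ultimately show ?thesis by simp
qed

text \<open>The \<open>q\<close> elements of \<open>K\<close> are roots of \<open>X\<^sup>q - X\<close>, which cannot have more.\<close>

lemma (in field) fixed_by_frob:
  assumes K: "subfield K R" and fin: "finite K" and x: "x \<in> carrier R" "x [^] card K = x"
  shows "x \<in> K"
proof -
  let ?q = "card K" and ?K = "R\<lparr>carrier := K\<rparr>"
  interpret K: field ?K using subfield_iff(2)[OF K] .
  have q: "1 < ?q" using frob_exp_gt_1[OF K.finite_field_frob_exp] fin by simp
  have sub: "K \<subseteq> carrier R" using subfieldE(3)[OF K] .
  let ?S = "{x \<in> carrier R. hom_eval R x \<one> (frob_poly ?q) = \<zero>}"
  have S: "y \<in> ?S \<longleftrightarrow> y \<in> carrier R \<and> y [^] ?q = y" for y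
    using hom_eval_frob_poly[OF q, of y \<one>] r_right_minus_eq[of "y [^] ?q" y]
    by (cases "y \<in> carrier R") (simp_all del: r_right_minus_eq)
  have fc: "finite ?S \<and> card ?S \<le> ?q"
    using finite_roots_hom_eval[OF frob_poly_props(1)[OF q] _ frob_poly_props(3)[OF q]]
    unfolding frob_poly_props(2)[OF q] by (simp add: frob_poly_def)
  have "K \<subseteq> ?S"
  proof
    fix y assume y: "y \<in> K"
    have "y [^]\<^bsub>?K\<^esub> ?q = y" using K.finite_field_pow_card fin y by simp
    then show "y \<in> ?S" unfolding S using y sub nat_pow_consistent[of y ?q K] by auto
  qed
  then have "K = ?S" using fc by (metis card_seteq)
  then show ?thesis using S x by blast
qed

text \<open>In \<open>poly_ring\<close> the leading coefficient comes first, hence the reversal.\<close>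

lemma (in algebraically_closed) monic_has_root:
  assumes p: "set p \<subseteq> carrier L" "last p = \<one>" "1 < length p"
  obtains z where "z \<in> carrier L" "hom_eval L z \<one> p = \<zero>"
proof -
  have ev: "eval (rev p) z = hom_eval L z \<one> p" if "z \<in> carrier L" "set p \<subseteq> carrier L" for z p
    using that(2)
  proof (induction p)
    case (Cons a p)
    then show ?case using eval_append_aux[of "rev p" a z] that(1) hom_eval_closed[of z \<one> p]
      by (simp add: a_comm m_comm)
  qed simp
  have c: "rev p \<in> carrier (poly_ring L)"
    unfolding univ_poly_carrier[symmetric] polynomial_def
    using p by (cases p rule: rev_cases) auto
  have d: "degree (rev p) > 0" using p by simp
  have "roots (rev p) \<noteq> {#}" using roots_over_carrier[OF c] d unfolding splitted_def by auto
  then obtain a where a: "a \<in># roots (rev p)" by blast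
  then have "is_root (rev p) a" using roots_mem_iff_is_root[OF c] by simp
  then show ?thesis using that ev[OF _ p(1)] unfolding is_root_def by auto
qed

lemma (in ring_hom_ring) hom_hom_eval:
  "u \<in> carrier R \<Longrightarrow> e \<in> carrier R \<Longrightarrow> set p \<subseteq> carrier R \<Longrightarrow> hom_eval R u e p \<in> carrier R \<and>
    h (hom_eval R u e p) = hom_eval S (h u) (h e) (map h p)"
proof (induction p)
  case (Cons a p)
  have "h (e [^] n) = h e [^]\<^bsub>S\<^esub> n" for n :: nat using Cons.prems by (induction n) auto
  then show ?case using Cons by auto
qed simp

lemma (in ring_hom_ring) hom_root_quot:
  "z \<in> carrier R \<Longrightarrow> set p \<subseteq> carrier R \<Longrightarrow> map h (root_quot R z p) = root_quot S (h z) (map h p)"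
  by (induction p) (auto simp: hom_hom_eval)

text \<open>The monic polynomial \<open>p\<close> splits over the algebraically closed field, so its homogenised value at
\<open>(u, e)\<close> is the product of the linear forms \<open>u - z e\<close>. A set with the property of a prime ideal
that contains this product contains a factor.\<close>

lemma (in algebraically_closed) linear_factor_in_prime:
  assumes R: "cring R" and h: "h \<in> ring_hom L R"
    and N: "\<one>\<^bsub>R\<^esub> \<notin> N" "\<And>x y. x \<in> carrier R \<Longrightarrow> y \<in> carrier R \<Longrightarrow> x \<otimes>\<^bsub>R\<^esub> y \<in> N \<Longrightarrow> x \<in> N \<or> y \<in> N"
    and u: "u \<in> carrier R" and e: "e \<in> carrier R"
  shows "set p \<subseteq> carrier L \<Longrightarrow> p \<noteq> [] \<Longrightarrow> last p = \<one> \<Longrightarrow> hom_eval R u e (map h p) \<in> N \<Longrightarrow>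
    \<exists>z\<in>carrier L. u \<ominus>\<^bsub>R\<^esub> h z \<otimes>\<^bsub>R\<^esub> e \<in> N"
proof (induction "length p" arbitrary: p rule: less_induct)
  case less
  interpret R: cring R by fact
  interpret h: ring_hom_ring L R h by (rule ring_hom_ringI2[OF ring_axioms R.ring_axioms h])
  show ?case
  proof (cases "length p = 1")
    case True
    then have "p = [\<one>]" using less.prems by (cases p) auto
    then show ?thesis using less.prems N(1) u e by simp
  next
    case False
    then have l: "1 < length p" using less.prems by (cases p) auto
    obtain z where z: "z \<in> carrier L" "hom_eval L z \<one> p = \<zero>" using monic_has_root less.prems l by blast
    let ?q = "root_quot L z p"
    have q: "set ?q \<subseteq> carrier L" "?q \<noteq> []" "last ?q = \<one>"
      using root_quot_closed[OF z(1)] last_root_quot[OF z(1)] less.prems l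
        length_root_quot[of L z p] by (auto simp del: length_root_quot)
    have mp: "set (map h p) \<subseteq> carrier R" "set (map h ?q) \<subseteq> carrier R" using less.prems q by auto
    have hz: "hom_eval R (h z) \<one>\<^bsub>R\<^esub> (map h p) = \<zero>\<^bsub>R\<^esub>"
      using h.hom_hom_eval[of z \<one> p] z less.prems by auto
    have "hom_eval R u e (map h p) = (u \<ominus>\<^bsub>R\<^esub> h z \<otimes>\<^bsub>R\<^esub> e) \<otimes>\<^bsub>R\<^esub> hom_eval R u e (map h ?q)"
      using R.hom_eval_root_quot[OF u e, of "h z" "map h p"] mp less.prems z hz u e
        h.hom_root_quot[OF z(1), of p] by auto
    then have "u \<ominus>\<^bsub>R\<^esub> h z \<otimes>\<^bsub>R\<^esub> e \<in> N \<or> hom_eval R u e (map h ?q) \<in> N"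
      using N(2) less.prems(4) z u e mp by auto
    then show ?thesis using less.hyps[OF _ q] l z by auto
  qed
qed

section \<open>Linear functionals\<close>

text \<open>A submodule that is maximal among those that contain \<open>W\<close> but not \<open>v\<close> is a hyperplane complementary to
\<open>v\<close>; the functional is the coefficient of \<open>v\<close>.\<close>

lemma separating_functional:
  fixes k :: "('k, 's) ring_scheme" and V :: "('k, 'v) module"
  assumes k: "field k" and V: "module k V" and W: "submodule W k V"
    and v: "v \<in> carrier V" "v \<notin> W"
  obtains \<phi> where "\<phi> \<in> carrier V \<rightarrow> carrier k"
    "\<And>x y. x \<in> carrier V \<Longrightarrow> y \<in> carrier V \<Longrightarrow> \<phi> (x \<oplus>\<^bsub>V\<^esub> y) = \<phi> x \<oplus>\<^bsub>k\<^esub> \<phi> y"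
    "\<And>c x. c \<in> carrier k \<Longrightarrow> x \<in> carrier V \<Longrightarrow> \<phi> (c \<odot>\<^bsub>V\<^esub> x) = c \<otimes>\<^bsub>k\<^esub> \<phi> x"
    "\<phi> v = \<one>\<^bsub>k\<^esub>" "\<And>w. w \<in> W \<Longrightarrow> \<phi> w = \<zero>\<^bsub>k\<^esub>"
proof -
  interpret k: field k by fact
  interpret V: module k V by fact
  define \<A> where "\<A> = {H. submodule H k V \<and> W \<subseteq> H \<and> v \<notin> H}"
  have "\<exists>H\<in>\<A>. \<forall>Y\<in>\<A>. H \<subseteq> Y \<longrightarrow> Y = H"
  proof (rule subset_Zorn_nonempty)
    show "\<A> \<noteq> {}" using W v unfolding \<A>_def by blast
  next
    fix C assume C: "C \<noteq> {}" "subset.chain \<A> C"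
    have mem: "submodule H k V" "W \<subseteq> H" "v \<notin> H" if "H \<in> C" for H
      using C(2) that unfolding pred_on.chain_def \<A>_def by blast+
    have "submodule (\<Union>C) k V"
    proof (rule V.submoduleI)
      show "\<Union>C \<subseteq> carrier V" using mem V.submoduleE(1) by blast
      obtain H where "H \<in> C" using C(1) by blast
      then show "\<zero>\<^bsub>V\<^esub> \<in> \<Union>C" using mem(1) submodule.axioms(1) subgroup.one_closed by fastforce
    next
      fix a assume "a \<in> \<Union>C" then show "\<ominus>\<^bsub>V\<^esub> a \<in> \<Union>C" using mem V.submoduleE(3) by blast
    next
      fix a b assume "a \<in> \<Union>C" "b \<in> \<Union>C"
      then obtain H H' where H: "a \<in> H" "H \<in> C" "b \<in> H'" "H' \<in> C" by blast
      have "H \<subseteq> H' \<or> H' \<subseteq> H" using C(2) H unfolding pred_on.chain_def by blast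
      then show "a \<oplus>\<^bsub>V\<^esub> b \<in> \<Union>C" using H mem(1) V.submoduleE(5) by blast
    next
      fix a x assume "a \<in> carrier k" "x \<in> \<Union>C" then show "a \<odot>\<^bsub>V\<^esub> x \<in> \<Union>C" using mem V.submoduleE(4) by blast
    qed
    then show "\<Union>C \<in> \<A>" unfolding \<A>_def using mem C(1) by blast
  qed
  then obtain H where HA: "H \<in> \<A>" and mx: "\<forall>Y\<in>\<A>. H \<subseteq> Y \<longrightarrow> Y = H" by (elim bexE)
  have H: "submodule H k V" "W \<subseteq> H" "v \<notin> H" using HA unfolding \<A>_def by simp_all
  note HE = V.submoduleE[OF H(1)]
  have Hc: "h \<in> carrier V" if "h \<in> H" for h using HE(1) that by blast
  have mz: "\<ominus>\<^bsub>V\<^esub> \<zero>\<^bsub>V\<^esub> = \<zero>\<^bsub>V\<^esub>"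
    using V.M.minus_equality[of "\<zero>\<^bsub>V\<^esub>" "\<zero>\<^bsub>V\<^esub>"] by simp
  have dec: "\<exists>c\<in>carrier k. x \<ominus>\<^bsub>V\<^esub> c \<odot>\<^bsub>V\<^esub> v \<in> H" if x: "x \<in> carrier V" for x
  proof (cases "x \<in> H")
    case True
    then show ?thesis using x v by (intro bexI[of _ "\<zero>\<^bsub>k\<^esub>"]) (auto simp: a_minus_def mz)
  next
    case False
    let ?Y = "{h \<oplus>\<^bsub>V\<^esub> c \<odot>\<^bsub>V\<^esub> x | h c. h \<in> H \<and> c \<in> carrier k}"
    have Y: "submodule ?Y k V"
    proof (rule V.submoduleI)
      show "?Y \<subseteq> carrier V" using Hc x by auto
      show "\<zero>\<^bsub>V\<^esub> \<in> ?Y" using x submodule.axioms(1)[OF H(1)] subgroup.one_closed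
        by (intro CollectI exI[of _ "\<zero>\<^bsub>V\<^esub>"] exI[of _ "\<zero>\<^bsub>k\<^esub>"]) fastforce
    next
      fix a assume "a \<in> ?Y"
      then obtain h c where a: "a = h \<oplus>\<^bsub>V\<^esub> c \<odot>\<^bsub>V\<^esub> x" "h \<in> H" "c \<in> carrier k" by blast
      have "\<ominus>\<^bsub>V\<^esub> a = \<ominus>\<^bsub>V\<^esub> h \<oplus>\<^bsub>V\<^esub> (\<ominus>\<^bsub>k\<^esub> c) \<odot>\<^bsub>V\<^esub> x"
        using a Hc x by (simp add: V.smult_l_minus V.minus_add)
      then show "\<ominus>\<^bsub>V\<^esub> a \<in> ?Y" using a HE(3) by blast
    next
      fix a b assume "a \<in> ?Y" "b \<in> ?Y"
      then obtain h c h' c' where ab: "a = h \<oplus>\<^bsub>V\<^esub> c \<odot>\<^bsub>V\<^esub> x" "h \<in> H" "c \<in> carrier k"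
        "b = h' \<oplus>\<^bsub>V\<^esub> c' \<odot>\<^bsub>V\<^esub> x" "h' \<in> H" "c' \<in> carrier k" by blast
      have "a \<oplus>\<^bsub>V\<^esub> b = (h \<oplus>\<^bsub>V\<^esub> h') \<oplus>\<^bsub>V\<^esub> (c \<oplus>\<^bsub>k\<^esub> c') \<odot>\<^bsub>V\<^esub> x"
        using ab Hc x by (simp add: V.smult_l_distr V.M.a_ac)
      then show "a \<oplus>\<^bsub>V\<^esub> b \<in> ?Y" using ab HE(5) by blast
    next
      fix d a assume d: "d \<in> carrier k" and "a \<in> ?Y"
      then obtain h c where a: "a = h \<oplus>\<^bsub>V\<^esub> c \<odot>\<^bsub>V\<^esub> x" "h \<in> H" "c \<in> carrier k" by blast
      have "d \<odot>\<^bsub>V\<^esub> a = d \<odot>\<^bsub>V\<^esub> h \<oplus>\<^bsub>V\<^esub> (d \<otimes>\<^bsub>k\<^esub> c) \<odot>\<^bsub>V\<^esub> x"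
        using a d Hc x by (simp add: V.smult_r_distr V.smult_assoc1)
      then show "d \<odot>\<^bsub>V\<^esub> a \<in> ?Y" using a d HE(4) by blast
    qed
    have HY: "H \<subseteq> ?Y"
    proof
      fix h assume h: "h \<in> H"
      then have "h = h \<oplus>\<^bsub>V\<^esub> \<zero>\<^bsub>k\<^esub> \<odot>\<^bsub>V\<^esub> x" using Hc x by simp
      then show "h \<in> ?Y" using h by blast
    qed
    have "x = \<zero>\<^bsub>V\<^esub> \<oplus>\<^bsub>V\<^esub> \<one>\<^bsub>k\<^esub> \<odot>\<^bsub>V\<^esub> x" using x by simp
    moreover have "\<zero>\<^bsub>V\<^esub> \<in> H" using submodule.axioms(1)[OF H(1)] subgroup.one_closed by fastforce
    ultimately have "x \<in> ?Y" by blast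
    then have "?Y \<noteq> H" using False by blast
    then have "v \<in> ?Y" using mx Y HY H(2) unfolding \<A>_def by blast
    then obtain h c where hc: "v = h \<oplus>\<^bsub>V\<^esub> c \<odot>\<^bsub>V\<^esub> x" "h \<in> H" "c \<in> carrier k" by blast
    have c0: "c \<noteq> \<zero>\<^bsub>k\<^esub>" using hc H(3) Hc x by auto
    then have cu: "inv\<^bsub>k\<^esub> c \<in> carrier k" "inv\<^bsub>k\<^esub> c \<otimes>\<^bsub>k\<^esub> c = \<one>\<^bsub>k\<^esub>"
      using hc(3) k.field_Units by auto
    have "inv\<^bsub>k\<^esub> c \<odot>\<^bsub>V\<^esub> v = inv\<^bsub>k\<^esub> c \<odot>\<^bsub>V\<^esub> h \<oplus>\<^bsub>V\<^esub> x"
      using hc cu Hc x by (simp add: V.smult_r_distr V.smult_assoc1[symmetric])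
    then have "x \<ominus>\<^bsub>V\<^esub> inv\<^bsub>k\<^esub> c \<odot>\<^bsub>V\<^esub> v = \<ominus>\<^bsub>V\<^esub> (inv\<^bsub>k\<^esub> c \<odot>\<^bsub>V\<^esub> h)"
      using cu hc Hc x by (simp add: V.M.minus_add a_minus_def V.M.a_ac V.M.r_neg V.M.r_neg1 V.M.r_neg2)
    then have "x \<ominus>\<^bsub>V\<^esub> inv\<^bsub>k\<^esub> c \<odot>\<^bsub>V\<^esub> v \<in> H" using HE(3,4) cu hc by simp
    then show ?thesis using cu by blast
  qed
  have uniq: "c = d" if "c \<in> carrier k" "d \<in> carrier k" "x \<in> carrier V"
    "x \<ominus>\<^bsub>V\<^esub> c \<odot>\<^bsub>V\<^esub> v \<in> H" "x \<ominus>\<^bsub>V\<^esub> d \<odot>\<^bsub>V\<^esub> v \<in> H" for c d x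
  proof (rule ccontr)
    assume "c \<noteq> d"
    then have n: "c \<ominus>\<^bsub>k\<^esub> d \<noteq> \<zero>\<^bsub>k\<^esub>" using that by simp
    then have u: "inv\<^bsub>k\<^esub> (c \<ominus>\<^bsub>k\<^esub> d) \<in> carrier k" "inv\<^bsub>k\<^esub> (c \<ominus>\<^bsub>k\<^esub> d) \<otimes>\<^bsub>k\<^esub> (c \<ominus>\<^bsub>k\<^esub> d) = \<one>\<^bsub>k\<^esub>"
      using that k.field_Units by auto
    have "(x \<ominus>\<^bsub>V\<^esub> d \<odot>\<^bsub>V\<^esub> v) \<oplus>\<^bsub>V\<^esub> (\<ominus>\<^bsub>V\<^esub> (x \<ominus>\<^bsub>V\<^esub> c \<odot>\<^bsub>V\<^esub> v)) \<in> H"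
      using that HE(3,5) by blast
    also have "(x \<ominus>\<^bsub>V\<^esub> d \<odot>\<^bsub>V\<^esub> v) \<oplus>\<^bsub>V\<^esub> (\<ominus>\<^bsub>V\<^esub> (x \<ominus>\<^bsub>V\<^esub> c \<odot>\<^bsub>V\<^esub> v)) = (c \<ominus>\<^bsub>k\<^esub> d) \<odot>\<^bsub>V\<^esub> v"
      using that v by (simp add: a_minus_def V.smult_l_distr V.smult_l_minus V.M.minus_add V.M.minus_minus V.M.a_ac V.M.r_neg V.M.r_neg1 V.M.r_neg2)
    finally have "inv\<^bsub>k\<^esub> (c \<ominus>\<^bsub>k\<^esub> d) \<odot>\<^bsub>V\<^esub> ((c \<ominus>\<^bsub>k\<^esub> d) \<odot>\<^bsub>V\<^esub> v) \<in> H" using HE(4) u by blast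
    then show False using u that v H(3) by (simp add: V.smult_assoc1[symmetric])
  qed
  define \<phi> where "\<phi> x = (SOME c. c \<in> carrier k \<and> x \<ominus>\<^bsub>V\<^esub> c \<odot>\<^bsub>V\<^esub> v \<in> H)" for x
  have \<phi>: "\<phi> x \<in> carrier k" "x \<ominus>\<^bsub>V\<^esub> \<phi> x \<odot>\<^bsub>V\<^esub> v \<in> H" if "x \<in> carrier V" for x
    using someI_ex[of "\<lambda>c. c \<in> carrier k \<and> x \<ominus>\<^bsub>V\<^esub> c \<odot>\<^bsub>V\<^esub> v \<in> H"] dec[OF that]
    unfolding \<phi>_def by blast+
  have eq: "\<phi> x = c" if "x \<in> carrier V" "c \<in> carrier k" "x \<ominus>\<^bsub>V\<^esub> c \<odot>\<^bsub>V\<^esub> v \<in> H" for x c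
    using uniq[OF \<phi>(1) that(2)] \<phi>(2) that by blast
  show ?thesis
  proof (rule that[of \<phi>])
    show "\<phi> \<in> carrier V \<rightarrow> carrier k" using \<phi> by blast
  next
    fix x y assume xy: "x \<in> carrier V" "y \<in> carrier V"
    have "(x \<ominus>\<^bsub>V\<^esub> \<phi> x \<odot>\<^bsub>V\<^esub> v) \<oplus>\<^bsub>V\<^esub> (y \<ominus>\<^bsub>V\<^esub> \<phi> y \<odot>\<^bsub>V\<^esub> v) \<in> H" using \<phi> xy HE(5) by blast
    also have "(x \<ominus>\<^bsub>V\<^esub> \<phi> x \<odot>\<^bsub>V\<^esub> v) \<oplus>\<^bsub>V\<^esub> (y \<ominus>\<^bsub>V\<^esub> \<phi> y \<odot>\<^bsub>V\<^esub> v)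
       = (x \<oplus>\<^bsub>V\<^esub> y) \<ominus>\<^bsub>V\<^esub> (\<phi> x \<oplus>\<^bsub>k\<^esub> \<phi> y) \<odot>\<^bsub>V\<^esub> v"
      using xy v \<phi>(1)[OF xy(1)] \<phi>(1)[OF xy(2)] by (simp add: a_minus_def V.smult_l_distr V.M.minus_add V.M.a_ac)
    finally show "\<phi> (x \<oplus>\<^bsub>V\<^esub> y) = \<phi> x \<oplus>\<^bsub>k\<^esub> \<phi> y" using xy \<phi> by (intro eq) auto
  next
    fix c x assume cx: "c \<in> carrier k" "x \<in> carrier V"
    have "c \<odot>\<^bsub>V\<^esub> (x \<ominus>\<^bsub>V\<^esub> \<phi> x \<odot>\<^bsub>V\<^esub> v) \<in> H" using \<phi> cx HE(4) by blast
    also have "c \<odot>\<^bsub>V\<^esub> (x \<ominus>\<^bsub>V\<^esub> \<phi> x \<odot>\<^bsub>V\<^esub> v) = (c \<odot>\<^bsub>V\<^esub> x) \<ominus>\<^bsub>V\<^esub> (c \<otimes>\<^bsub>k\<^esub> \<phi> x) \<odot>\<^bsub>V\<^esub> v"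
      using cx v \<phi>(1)[OF cx(2)] by (simp add: a_minus_def V.smult_r_distr V.smult_r_minus V.smult_assoc1)
    finally show "\<phi> (c \<odot>\<^bsub>V\<^esub> x) = c \<otimes>\<^bsub>k\<^esub> \<phi> x" using cx \<phi> by (intro eq) auto
  next
    have z: "\<zero>\<^bsub>V\<^esub> \<in> H" using submodule.axioms(1)[OF H(1)] subgroup.one_closed by fastforce
    then show "\<phi> v = \<one>\<^bsub>k\<^esub>" using v by (intro eq) (auto simp: a_minus_def V.M.r_neg)
    fix w assume "w \<in> W"
    then show "\<phi> w = \<zero>\<^bsub>k\<^esub>" using H(2) Hc v by (intro eq) (auto simp: a_minus_def mz)
  qed
qed

section \<open>Tensor products of algebras\<close>

lemma frag_extend_fun_diff:
  "frag_extend (\<lambda>u. f u - g u) x = frag_extend f x - frag_extend g x"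
proof -
  have "Poly_Mapping.keys x \<subseteq> UNIV" by simp
  then show ?thesis by (induction x rule: frag_induction) (auto simp: frag_extend_diff)
qed

locale tensor_product =
  fixes k :: "'k ring" and \<alpha> :: "'k \<Rightarrow> 'a" and A :: "'a ring"
    and \<beta> :: "'k \<Rightarrow> 'b" and B :: "'b ring"
  assumes k: "field k" and A: "cring A" and B: "cring B"
    and \<alpha>: "\<alpha> \<in> ring_hom k A" and \<beta>: "\<beta> \<in> ring_hom k B"
begin

abbreviation P where "P \<equiv> prod_monoid_ring A B"
abbreviation I where "I \<equiv> tensor_ideal k \<alpha> A \<beta> B"
abbreviation T where "T \<equiv> tensor_algebra k \<alpha> A \<beta> B"
abbreviation pt where "pt \<equiv> pure_tensor k \<alpha> A \<beta> B"

sublocale k: field k by (rule k)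
sublocale A: cring A by (rule A)
sublocale B: cring B by (rule B)
sublocale \<alpha>: ring_hom_ring k A \<alpha> by (rule ring_hom_ringI2[OF k.ring_axioms A.ring_axioms \<alpha>])
sublocale \<beta>: ring_hom_ring k B \<beta> by (rule ring_hom_ringI2[OF k.ring_axioms B.ring_axioms \<beta>])

lemma carrier_P: "x \<in> carrier P \<longleftrightarrow> Poly_Mapping.keys x \<subseteq> carrier A \<times> carrier B"
  and zero_P: "\<zero>\<^bsub>P\<^esub> = 0" and add_P: "x \<oplus>\<^bsub>P\<^esub> y = x + y"
  and one_P: "\<one>\<^bsub>P\<^esub> = frag_of (\<one>\<^bsub>A\<^esub>, \<one>\<^bsub>B\<^esub>)"
  and mult_P: "x \<otimes>\<^bsub>P\<^esub> y = frag_extend (\<lambda>(a, b).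
               frag_extend (\<lambda>(a', b'). frag_of (a \<otimes>\<^bsub>A\<^esub> a', b \<otimes>\<^bsub>B\<^esub> b')) y) x"
  by (auto simp: prod_monoid_ring_def)

lemma mult_P_of: "frag_of (a, b) \<otimes>\<^bsub>P\<^esub> frag_of (a', b') = frag_of (a \<otimes>\<^bsub>A\<^esub> a', b \<otimes>\<^bsub>B\<^esub> b')"
  by (simp add: mult_P)

lemma mult_P_diff_left: "(x - y) \<otimes>\<^bsub>P\<^esub> z = x \<otimes>\<^bsub>P\<^esub> z - y \<otimes>\<^bsub>P\<^esub> z"
  by (simp add: mult_P frag_extend_diff)

lemma mult_P_diff_right: "z \<otimes>\<^bsub>P\<^esub> (x - y) = z \<otimes>\<^bsub>P\<^esub> x - z \<otimes>\<^bsub>P\<^esub> y"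
  by (simp add: mult_P frag_extend_diff frag_extend_fun_diff case_prod_unfold)

lemma mult_P_add_left: "(x + y) \<otimes>\<^bsub>P\<^esub> z = x \<otimes>\<^bsub>P\<^esub> z + y \<otimes>\<^bsub>P\<^esub> z"
  by (simp add: mult_P frag_extend_add)

lemma mult_P_0: "0 \<otimes>\<^bsub>P\<^esub> z = 0" "z \<otimes>\<^bsub>P\<^esub> 0 = 0"
  using mult_P_diff_left[of 0 0 z] mult_P_diff_right[of z 0 0] by auto

lemma frag_of_P: "a \<in> carrier A \<Longrightarrow> b \<in> carrier B \<Longrightarrow> frag_of (a, b) \<in> carrier P"
  by (simp add: carrier_P)

lemma diff_P: "x \<in> carrier P \<Longrightarrow> y \<in> carrier P \<Longrightarrow> x - y \<in> carrier P"
  unfolding carrier_P by (meson Un_least keys_diff order.trans)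

text \<open>Differences suffice because the elements of \<open>P\<close> are integral combinations of pairs.\<close>

lemma P_induct [consumes 1, case_names zero one diff]:
  assumes "x \<in> carrier P" "Q 0" "\<And>a b. a \<in> carrier A \<Longrightarrow> b \<in> carrier B \<Longrightarrow> Q (frag_of (a, b))"
    "\<And>x y. x \<in> carrier P \<Longrightarrow> y \<in> carrier P \<Longrightarrow> Q x \<Longrightarrow> Q y \<Longrightarrow> Q (x - y)"
  shows "Q x"
  by (rule free_Abelian_group_induct[of x "carrier A \<times> carrier B" Q])
    (use assms in \<open>auto simp: carrier_P\<close>)

lemma mult_P_closed: "x \<in> carrier P \<Longrightarrow> y \<in> carrier P \<Longrightarrow> x \<otimes>\<^bsub>P\<^esub> y \<in> carrier P"
proof (induction x rule: P_induct)
  case zero then show ?case by (simp add: mult_P_0 carrier_P)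
next
  case (one a b)
  show ?case using one(3)
  proof (induction y rule: P_induct)
    case zero then show ?case by (simp add: mult_P_0 carrier_P)
  next
    case (one a' b') then show ?case using \<open>a \<in> carrier A\<close> \<open>b \<in> carrier B\<close> by (simp add: mult_P_of frag_of_P)
  next
    case (diff x y) then show ?case by (simp add: mult_P_diff_right diff_P)
  qed
next
  case (diff x y) then show ?case by (simp add: mult_P_diff_left diff_P)
qed

lemma mult_P_comm: "x \<in> carrier P \<Longrightarrow> y \<in> carrier P \<Longrightarrow> x \<otimes>\<^bsub>P\<^esub> y = y \<otimes>\<^bsub>P\<^esub> x"
proof (induction x rule: P_induct)
  case zero then show ?case by (simp add: mult_P_0)
next
  case (one a b)
  show ?case using one(3)
  proof (induction y rule: P_induct)
    case zero then show ?case by (simp add: mult_P_0)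
  next
    case (one a' b') then show ?case using \<open>a \<in> carrier A\<close> \<open>b \<in> carrier B\<close>
      by (simp add: mult_P_of A.m_comm B.m_comm)
  next
    case (diff x y) then show ?case by (simp add: mult_P_diff_right mult_P_diff_left)
  qed
next
  case (diff x y) then show ?case by (simp add: mult_P_diff_left mult_P_diff_right)
qed

lemma mult_P_assoc:
  "x \<in> carrier P \<Longrightarrow> y \<in> carrier P \<Longrightarrow> z \<in> carrier P \<Longrightarrow> (x \<otimes>\<^bsub>P\<^esub> y) \<otimes>\<^bsub>P\<^esub> z = x \<otimes>\<^bsub>P\<^esub> (y \<otimes>\<^bsub>P\<^esub> z)"
proof (induction x rule: P_induct)
  case zero then show ?case by (simp add: mult_P_0)
next
  case (one a b)
  show ?case using one(3,4)
  proof (induction y rule: P_induct)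
    case zero then show ?case by (simp add: mult_P_0)
  next
    case (one a' b')
    show ?case using one(3)
    proof (induction z rule: P_induct)
      case zero then show ?case by (simp add: mult_P_0)
    next
      case (one a'' b'') 
      then show ?case using \<open>a \<in> carrier A\<close> \<open>b \<in> carrier B\<close> \<open>a' \<in> carrier A\<close> \<open>b' \<in> carrier B\<close>
        by (simp add: mult_P_of A.m_assoc B.m_assoc)
    next
      case (diff x y) then show ?case by (simp add: mult_P_diff_right)
    qed
  next
    case (diff x y) then show ?case by (simp add: mult_P_diff_right mult_P_diff_left)
  qed
next
  case (diff x y) then show ?case by (simp add: mult_P_diff_left)
qed

lemma mult_P_one: "x \<in> carrier P \<Longrightarrow> \<one>\<^bsub>P\<^esub> \<otimes>\<^bsub>P\<^esub> x = x"
  by (induction x rule: P_induct) (auto simp: one_P mult_P_0 mult_P_of mult_P_diff_right)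

lemma cring_P: "cring P"
proof (rule cringI)
  show "abelian_group P"
  proof (rule abelian_groupI)
    fix x y assume "x \<in> carrier P" "y \<in> carrier P"
    then show "x \<oplus>\<^bsub>P\<^esub> y \<in> carrier P" unfolding add_P carrier_P by (meson Un_least keys_add order.trans)
  next
    fix x assume "x \<in> carrier P"
    then show "\<exists>y\<in>carrier P. y \<oplus>\<^bsub>P\<^esub> x = \<zero>\<^bsub>P\<^esub>"
      by (intro bexI[of _ "- x"]) (auto simp: add_P zero_P carrier_P keys_minus)
  qed (auto simp: add_P zero_P carrier_P add_ac)
  show "comm_monoid P"
  proof (rule comm_monoidI)
    show "\<one>\<^bsub>P\<^esub> \<in> carrier P" by (simp add: one_P frag_of_P)
  qed (auto simp: mult_P_closed mult_P_assoc mult_P_one intro: mult_P_comm)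
  fix x y z show "(x \<oplus>\<^bsub>P\<^esub> y) \<otimes>\<^bsub>P\<^esub> z = x \<otimes>\<^bsub>P\<^esub> z \<oplus>\<^bsub>P\<^esub> y \<otimes>\<^bsub>P\<^esub> z"
    by (simp add: add_P mult_P_add_left)
qed

sublocale P: cring P by (rule cring_P)

lemma minus_P: "x \<in> carrier P \<Longrightarrow> \<ominus>\<^bsub>P\<^esub> x = - x"
  by (rule P.minus_equality) (auto simp: add_P zero_P carrier_P keys_minus)

lemma a_minus_P: "y \<in> carrier P \<Longrightarrow> x \<ominus>\<^bsub>P\<^esub> y = x - y"
  by (simp add: a_minus_def minus_P add_P)

definition rels where "rels =
    {frag_of (a \<oplus>\<^bsub>A\<^esub> a', b) - frag_of (a, b) - frag_of (a', b) | a a' b.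
        a \<in> carrier A \<and> a' \<in> carrier A \<and> b \<in> carrier B} \<union>
     {frag_of (a, b \<oplus>\<^bsub>B\<^esub> b') - frag_of (a, b) - frag_of (a, b') | a b b'.
        a \<in> carrier A \<and> b \<in> carrier B \<and> b' \<in> carrier B} \<union>
     {frag_of (\<alpha> c \<otimes>\<^bsub>A\<^esub> a, b) - frag_of (a, \<beta> c \<otimes>\<^bsub>B\<^esub> b) | c a b.
        c \<in> carrier k \<and> a \<in> carrier A \<and> b \<in> carrier B}"

lemma I_eq: "I = Idl\<^bsub>P\<^esub> rels"
  by (simp add: tensor_ideal_def rels_def)

lemma rels_P: "rels \<subseteq> carrier P"
  unfolding rels_def by (auto intro!: diff_P frag_of_P)

lemma ideal_I: "ideal I P"
  unfolding I_eq by (rule P.genideal_ideal[OF rels_P])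

sublocale I: ideal I P by (rule ideal_I)

lemma rels_I: "x \<in> rels \<Longrightarrow> x \<in> I"
  unfolding I_eq using P.genideal_self[OF rels_P] by blast

lemma T_eq: "T = P Quot I" by (simp add: tensor_algebra_def)

sublocale T: cring T
  unfolding T_eq by (rule I.quotient_is_cring[OF cring_P])

abbreviation cls where "cls x \<equiv> I +>\<^bsub>P\<^esub> x"

lemma cls_hom: "(\<lambda>x. cls x) \<in> ring_hom P T"
  unfolding T_eq by (rule I.rcos_ring_hom)

sublocale cls: ring_hom_ring P T "\<lambda>x. cls x"
  by (rule ring_hom_ringI2[OF P.ring_axioms T.ring_axioms cls_hom])

lemma cls_eq_iff: "x \<in> carrier P \<Longrightarrow> y \<in> carrier P \<Longrightarrow> cls x = cls y \<longleftrightarrow> x - y \<in> I"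
  using P.quotient_eq_iff_same_a_r_cos[OF ideal_I, of x y] by (simp add: a_minus_P)

lemma cls_diff: "x \<in> carrier P \<Longrightarrow> y \<in> carrier P \<Longrightarrow> cls (x - y) = cls x \<ominus>\<^bsub>T\<^esub> cls y"
  using cls.hom_add[of x "\<ominus>\<^bsub>P\<^esub> y"] by (simp add: minus_P[symmetric] a_minus_def add_P a_minus_P[symmetric])

lemma carrier_T: "carrier T = (\<lambda>x. cls x) ` carrier P"
  unfolding T_eq FactRing_def A_RCOSETS_def' by auto

lemma pt_eq: "pt a b = cls (frag_of (a, b))" by (simp add: pure_tensor_def)

lemma pt_closed [simp]: "a \<in> carrier A \<Longrightarrow> b \<in> carrier B \<Longrightarrow> pt a b \<in> carrier T"
  by (simp add: pt_eq frag_of_P)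

lemma pt_mult [simp]:
  assumes "a \<in> carrier A" "b \<in> carrier B" "a' \<in> carrier A" "b' \<in> carrier B"
  shows "pt a b \<otimes>\<^bsub>T\<^esub> pt a' b' = pt (a \<otimes>\<^bsub>A\<^esub> a') (b \<otimes>\<^bsub>B\<^esub> b')"
  using cls.hom_mult[of "frag_of (a, b)" "frag_of (a', b')"] assms
  by (simp add: pt_eq mult_P_of frag_of_P)

lemma pt_one: "pt \<one>\<^bsub>A\<^esub> \<one>\<^bsub>B\<^esub> = \<one>\<^bsub>T\<^esub>"
  using cls.hom_one by (simp add: pt_eq one_P)

lemma cls_rel2: 
  assumes "x - y - z \<in> I" "x \<in> carrier P" "y \<in> carrier P" "z \<in> carrier P"
  shows "cls x = cls y \<oplus>\<^bsub>T\<^esub> cls z"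
proof -
  have "x - (y + z) \<in> I" using assms(1) by (simp add: diff_diff_eq)
  moreover have c: "y + z \<in> carrier P" using P.a_closed[OF assms(3,4)] by (simp add: add_P)
  ultimately have "cls x = cls (y + z)" using cls_eq_iff[OF assms(2) c] by blast
  also have "\<dots> = cls (y \<oplus>\<^bsub>P\<^esub> z)" by (simp add: add_P)
  finally show ?thesis using assms cls.hom_add by simp
qed

lemma pt_add_left:
  assumes "a \<in> carrier A" "a' \<in> carrier A" "b \<in> carrier B"
  shows "pt (a \<oplus>\<^bsub>A\<^esub> a') b = pt a b \<oplus>\<^bsub>T\<^esub> pt a' b"
  unfolding pt_eq by (rule cls_rel2, rule rels_I) (use assms in \<open>auto simp: rels_def intro!: frag_of_P\<close>)

lemma pt_add_right:
  assumes "a \<in> carrier A" "b \<in> carrier B" "b' \<in> carrier B"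
  shows "pt a (b \<oplus>\<^bsub>B\<^esub> b') = pt a b \<oplus>\<^bsub>T\<^esub> pt a b'"
  unfolding pt_eq by (rule cls_rel2, rule rels_I) (use assms in \<open>auto simp: rels_def intro!: frag_of_P\<close>)

lemma pt_balanced:
  assumes "c \<in> carrier k" "a \<in> carrier A" "b \<in> carrier B"
  shows "pt (\<alpha> c \<otimes>\<^bsub>A\<^esub> a) b = pt a (\<beta> c \<otimes>\<^bsub>B\<^esub> b)"
  unfolding pt_eq by (subst cls_eq_iff) (use assms in \<open>auto simp: rels_def intro!: frag_of_P rels_I\<close>)

lemma pt_zero_left [simp]: "b \<in> carrier B \<Longrightarrow> pt \<zero>\<^bsub>A\<^esub> b = \<zero>\<^bsub>T\<^esub>"
  using pt_add_left[of "\<zero>\<^bsub>A\<^esub>" "\<zero>\<^bsub>A\<^esub>" b] by (simp add: T.add.l_cancel_one')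

lemma pt_zero_right [simp]: "a \<in> carrier A \<Longrightarrow> pt a \<zero>\<^bsub>B\<^esub> = \<zero>\<^bsub>T\<^esub>"
  using pt_add_right[of a "\<zero>\<^bsub>B\<^esub>" "\<zero>\<^bsub>B\<^esub>"] by (simp add: T.add.l_cancel_one')

lemma pt_minus_left: "a \<in> carrier A \<Longrightarrow> b \<in> carrier B \<Longrightarrow> \<ominus>\<^bsub>T\<^esub> pt a b = pt (\<ominus>\<^bsub>A\<^esub> a) b"
  using pt_add_left[of "\<ominus>\<^bsub>A\<^esub> a" a b] by (intro T.minus_equality) (auto simp: A.l_neg)

lemma pt_minus_right: "a \<in> carrier A \<Longrightarrow> b \<in> carrier B \<Longrightarrow> \<ominus>\<^bsub>T\<^esub> pt a b = pt a (\<ominus>\<^bsub>B\<^esub> b)"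
  using pt_add_right[of a "\<ominus>\<^bsub>B\<^esub> b" b] by (intro T.minus_equality) (auto simp: B.l_neg)

lemma pt_pow: "a \<in> carrier A \<Longrightarrow> b \<in> carrier B \<Longrightarrow> pt a b [^]\<^bsub>T\<^esub> (n::nat) = pt (a [^]\<^bsub>A\<^esub> n) (b [^]\<^bsub>B\<^esub> n)"
  by (induction n) (auto simp: pt_one)

text \<open>A tensor is handled through a list of pairs that represents it. The number of pairs is what the
minimality arguments below count.\<close>

primrec tsum where
  "tsum [] = \<zero>\<^bsub>T\<^esub>"
| "tsum (u # xs) = pt (fst u) (snd u) \<oplus>\<^bsub>T\<^esub> tsum xs"

definition tlists where "tlists = {xs. set xs \<subseteq> carrier A \<times> carrier B}"

lemma tlists_simps [simp]: "[] \<in> tlists" "u # xs \<in> tlists \<longleftrightarrow> fst u \<in> carrier A \<and> snd u \<in> carrier B \<and> xs \<in> tlists"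
  "xs @ ys \<in> tlists \<longleftrightarrow> xs \<in> tlists \<and> ys \<in> tlists"
  by (cases u, auto simp: tlists_def)+

lemma tsum_closed [simp]: "xs \<in> tlists \<Longrightarrow> tsum xs \<in> carrier T"
  by (induction xs) auto

lemma tsum_append: "xs \<in> tlists \<Longrightarrow> ys \<in> tlists \<Longrightarrow> tsum (xs @ ys) = tsum xs \<oplus>\<^bsub>T\<^esub> tsum ys"
  by (induction xs) (auto simp: T.a_assoc)

lemma tsum_neg:
  "xs \<in> tlists \<Longrightarrow> map (\<lambda>(a, b). (\<ominus>\<^bsub>A\<^esub> a, b)) xs \<in> tlists \<and>
     tsum (map (\<lambda>(a, b). (\<ominus>\<^bsub>A\<^esub> a, b)) xs) = \<ominus>\<^bsub>T\<^esub> tsum xs"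
  by (induction xs) (auto simp: T.minus_add pt_minus_left)

lemma T_tsum:
  assumes "t \<in> carrier T" obtains xs where "xs \<in> tlists" "t = tsum xs"
proof -
  obtain z where z: "z \<in> carrier P" "t = cls z" using assms carrier_T by auto
  have "\<exists>xs\<in>tlists. cls z = tsum xs" using z(1)
  proof (induction z rule: P_induct)
    case zero
    have "cls 0 = \<zero>\<^bsub>T\<^esub>" using cls.hom_zero by (simp add: zero_P)
    then show ?case by (intro bexI[of _ "[]"]) auto
  next
    case (one a b) then show ?case by (intro bexI[of _ "[(a, b)]"]) (auto simp: pt_eq[symmetric])
  next
    case (diff x y)
    then obtain xs ys where h: "xs \<in> tlists" "cls x = tsum xs" "ys \<in> tlists" "cls y = tsum ys" by blast
    show ?case using h diff(1,2) tsum_neg[OF h(3)]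
      by (intro bexI[of _ "xs @ map (\<lambda>(a, b). (\<ominus>\<^bsub>A\<^esub> a, b)) ys"])
        (auto simp: cls_diff tsum_append a_minus_def)
  qed
  then show ?thesis using that z by blast
qed

lemma T_induct [consumes 1, case_names zero pure add]:
  assumes "t \<in> carrier T" "Q \<zero>\<^bsub>T\<^esub>" "\<And>a b. a \<in> carrier A \<Longrightarrow> b \<in> carrier B \<Longrightarrow> Q (pt a b)"
    "\<And>x y. x \<in> carrier T \<Longrightarrow> y \<in> carrier T \<Longrightarrow> Q x \<Longrightarrow> Q y \<Longrightarrow> Q (x \<oplus>\<^bsub>T\<^esub> y)"
  shows "Q t"
proof -
  obtain xs where xs: "xs \<in> tlists" "t = tsum xs" using T_tsum[OF assms(1)] .
  have "Q (tsum xs)" using xs(1) by (induction xs) (use assms in auto)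
  then show ?thesis using xs by simp
qed

text \<open>The elements all of whose multiples are killed by the extension of \<open>\<phi>\<close> to the monoid ring form an
ideal. It contains the generators of \<open>I\<close> because a multiple of a bilinearity relation is one again.\<close>

lemma tensor_lift:
  fixes H :: "('h, 's) ring_scheme"
  assumes H: "abelian_group H"
    and cl: "\<And>a b. a \<in> carrier A \<Longrightarrow> b \<in> carrier B \<Longrightarrow> \<phi> a b \<in> carrier H"
    and al: "\<And>a a' b. a \<in> carrier A \<Longrightarrow> a' \<in> carrier A \<Longrightarrow> b \<in> carrier B \<Longrightarrow>
      \<phi> (a \<oplus>\<^bsub>A\<^esub> a') b = \<phi> a b \<oplus>\<^bsub>H\<^esub> \<phi> a' b"
    and ar: "\<And>a b b'. a \<in> carrier A \<Longrightarrow> b \<in> carrier B \<Longrightarrow> b' \<in> carrier B \<Longrightarrow>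
      \<phi> a (b \<oplus>\<^bsub>B\<^esub> b') = \<phi> a b \<oplus>\<^bsub>H\<^esub> \<phi> a b'"
    and ba: "\<And>c a b. c \<in> carrier k \<Longrightarrow> a \<in> carrier A \<Longrightarrow> b \<in> carrier B \<Longrightarrow>
      \<phi> (\<alpha> c \<otimes>\<^bsub>A\<^esub> a) b = \<phi> a (\<beta> c \<otimes>\<^bsub>B\<^esub> b)"
  obtains \<Phi> where "\<And>x. x \<in> carrier T \<Longrightarrow> \<Phi> x \<in> carrier H"
    "\<And>x y. x \<in> carrier T \<Longrightarrow> y \<in> carrier T \<Longrightarrow> \<Phi> (x \<oplus>\<^bsub>T\<^esub> y) = \<Phi> x \<oplus>\<^bsub>H\<^esub> \<Phi> y"
    "\<And>a b. a \<in> carrier A \<Longrightarrow> b \<in> carrier B \<Longrightarrow> \<Phi> (pt a b) = \<phi> a b"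
proof -
  interpret H: abelian_group H by fact
  have "(\<lambda>(a, b). \<phi> a b) ` (carrier A \<times> carrier B) \<subseteq> carrier (add_monoid H)" using cl by auto
  then obtain h where h0: "h \<in> hom (free_Abelian_group (carrier A \<times> carrier B)) (add_monoid H)"
    and h1: "\<And>x. x \<in> carrier A \<times> carrier B \<Longrightarrow> h (frag_of x) = (\<lambda>(a, b). \<phi> a b) x"
    using comm_group.free_Abelian_group_universal[OF H.a_comm_group] by blast
  have hc: "h x \<in> carrier H" if "x \<in> carrier P" for x
    using h0 that by (auto simp: hom_def carrier_P)
  have hadd: "h (x + y) = h x \<oplus>\<^bsub>H\<^esub> h y" if "x \<in> carrier P" "y \<in> carrier P" for x y
    using h0 that by (auto simp: hom_def carrier_P)
  have h00: "h 0 = \<zero>\<^bsub>H\<^esub>"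
    using hadd[of 0 0] hc[of 0] by (simp add: carrier_P H.add.l_cancel_one')
  have hdiff: "h (x - y) = h x \<ominus>\<^bsub>H\<^esub> h y" if "x \<in> carrier P" "y \<in> carrier P" for x y
  proof -
    have "h x = h (x - y) \<oplus>\<^bsub>H\<^esub> h y" using hadd[OF diff_P[OF that] that(2)] by simp
    then show ?thesis using hc[OF diff_P[OF that]] hc[OF that(1)] hc[OF that(2)]
      by (metis H.add.inv_closed H.add.inv_solve_right' a_minus_def)
  qed
  have H00: "\<zero>\<^bsub>H\<^esub> \<ominus>\<^bsub>H\<^esub> \<zero>\<^bsub>H\<^esub> = \<zero>\<^bsub>H\<^esub>" unfolding a_minus_def by (rule H.r_neg) simp
  have hof: "h (frag_of (a, b)) = \<phi> a b" if "a \<in> carrier A" "b \<in> carrier B" for a b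
    using h1[of "(a, b)"] that by simp
  \<comment> \<open>All multiples are included in the condition so that \<open>N\<close> is an ideal although \<open>h\<close> is only additive.\<close>
  define N where "N = {z \<in> carrier P. \<forall>w\<in>carrier P. h (w \<otimes>\<^bsub>P\<^esub> z) = \<zero>\<^bsub>H\<^esub>}"
  have "ideal N P"
  proof (rule idealI[OF P.ring_axioms])
    show "subgroup N (add_monoid P)"
    proof (rule group.subgroupI[OF P.add.is_group])
      show "N \<subseteq> carrier (add_monoid P)" unfolding N_def by auto
      have "0 \<in> N" unfolding N_def by (auto simp: mult_P_0 h00 carrier_P)
      then show "N \<noteq> {}" by blast
    next
      fix z assume z: "z \<in> N"
      have "h (w \<otimes>\<^bsub>P\<^esub> (0 - z)) = \<zero>\<^bsub>H\<^esub>" if "w \<in> carrier P" for w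
        unfolding mult_P_diff_right using z that
        by (subst hdiff) (auto simp: N_def mult_P_closed mult_P_0 h00 H00 carrier_P[of 0])
      moreover have "0 - z \<in> carrier P" using z by (intro diff_P) (auto simp: N_def carrier_P)
      ultimately have "- z \<in> N" unfolding N_def by auto
      then show "inv\<^bsub>add_monoid P\<^esub> z \<in> N" using z minus_P[of z] by (simp add: N_def a_inv_def)
    next
      fix z z' assume z: "z \<in> N" "z' \<in> N"
      have "z + z' \<in> N" unfolding N_def
      proof (intro CollectI conjI ballI)
        show "z + z' \<in> carrier P" using z P.a_closed[of z z'] by (simp add: N_def add_P)
        fix w assume w: "w \<in> carrier P"
        have "w \<otimes>\<^bsub>P\<^esub> (z + z') = w \<otimes>\<^bsub>P\<^esub> z + w \<otimes>\<^bsub>P\<^esub> z'"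
          using P.r_distr[of z z' w] z w by (simp add: N_def add_P)
        then show "h (w \<otimes>\<^bsub>P\<^esub> (z + z')) = \<zero>\<^bsub>H\<^esub>" using z w by (simp add: hadd N_def)
      qed
      then show "z \<otimes>\<^bsub>add_monoid P\<^esub> z' \<in> N" by (simp add: add_P)
    qed
  next
    fix a x assume ax: "a \<in> N" "x \<in> carrier P"
    have "h (w \<otimes>\<^bsub>P\<^esub> (x \<otimes>\<^bsub>P\<^esub> a)) = \<zero>\<^bsub>H\<^esub>" if "w \<in> carrier P" for w
      using ax that by (simp add: N_def P.m_assoc[symmetric])
    then show "x \<otimes>\<^bsub>P\<^esub> a \<in> N" using ax by (simp add: N_def)
    then show "a \<otimes>\<^bsub>P\<^esub> x \<in> N" using ax by (simp add: N_def P.m_comm)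
  qed
  moreover have "rels \<subseteq> N"
  proof
    fix z assume z: "z \<in> rels"
    have zP: "z \<in> carrier P" using z rels_P by blast
    have "h (w \<otimes>\<^bsub>P\<^esub> z) = \<zero>\<^bsub>H\<^esub>" if "w \<in> carrier P" for w using that
    proof (induction w rule: P_induct)
      case zero then show ?case by (simp add: mult_P_0 h00)
    next
      case (diff x y)
      then show ?case using zP by (simp add: mult_P_diff_left hdiff H00 P.m_closed)
    next
      case (one c d)
      have ba2: "\<phi> (c \<otimes>\<^bsub>A\<^esub> (\<alpha> x \<otimes>\<^bsub>A\<^esub> a)) (d \<otimes>\<^bsub>B\<^esub> b) = \<phi> (c \<otimes>\<^bsub>A\<^esub> a) (d \<otimes>\<^bsub>B\<^esub> (\<beta> x \<otimes>\<^bsub>B\<^esub> b))"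
        if "x \<in> carrier k" "a \<in> carrier A" "b \<in> carrier B" for x a b
        using ba[of x "c \<otimes>\<^bsub>A\<^esub> a" "d \<otimes>\<^bsub>B\<^esub> b"] that one by (simp add: A.m_lcomm B.m_lcomm)
      have n4: "p \<oplus>\<^bsub>H\<^esub> (q \<oplus>\<^bsub>H\<^esub> (\<ominus>\<^bsub>H\<^esub> p \<oplus>\<^bsub>H\<^esub> \<ominus>\<^bsub>H\<^esub> q)) = \<zero>\<^bsub>H\<^esub>" if "p \<in> carrier H" "q \<in> carrier H" for p q
        using H.r_neg[of "p \<oplus>\<^bsub>H\<^esub> q"] that by (simp add: H.minus_add H.a_assoc)
      show ?case using z unfolding rels_def
        by (auto simp: mult_P_diff_right mult_P_of hdiff diff_P frag_of_P one hof A.r_distr B.r_distr al ar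
            cl H.minus_eq H.a_assoc n4 ba2 H.r_neg)
    qed
    then show "z \<in> N" using zP by (simp add: N_def)
  qed
  ultimately have IN: "I \<subseteq> N" unfolding I_eq by (rule P.genideal_minimal)
  have hI: "h z = \<zero>\<^bsub>H\<^esub>" if "z \<in> I" for z
  proof -
    have "z \<in> N" using IN that by blast
    then have z: "z \<in> carrier P" "\<forall>w\<in>carrier P. h (w \<otimes>\<^bsub>P\<^esub> z) = \<zero>\<^bsub>H\<^esub>" unfolding N_def by auto
    show ?thesis using bspec[OF z(2) P.one_closed] by (simp only: P.l_one[OF z(1)])
  qed
  define \<Phi> where "\<Phi> Q = h (SOME z. z \<in> carrier P \<and> Q = cls z)" for Q
  have \<Phi>: "\<Phi> (cls z) = h z" if z: "z \<in> carrier P" for z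
  proof -
    have "\<exists>y. y \<in> carrier P \<and> cls z = cls y" using z by blast
    then obtain y where y: "y \<in> carrier P" "cls z = cls y" "\<Phi> (cls z) = h y"
      unfolding \<Phi>_def by (metis (mono_tags, lifting) someI_ex)
    have "h (z - y) = \<zero>\<^bsub>H\<^esub>" using cls_eq_iff[OF z y(1)] y(2) by (intro hI) simp
    then have "h z \<ominus>\<^bsub>H\<^esub> h y = \<zero>\<^bsub>H\<^esub>" by (simp only: hdiff[OF z y(1)])
    then have "h z = h y" using y(1) hc z H.minus_equality[of "h z" "\<ominus>\<^bsub>H\<^esub> h y"] H.minus_minus[of "h y"]
      by (simp add: a_minus_def)
    then show ?thesis using y(3) by simp
  qed
  show ?thesis
  proof (rule that[of \<Phi>])
    show "\<Phi> x \<in> carrier H" if "x \<in> carrier T" for x using that \<Phi> hc unfolding carrier_T by auto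
    show "\<Phi> (x \<oplus>\<^bsub>T\<^esub> y) = \<Phi> x \<oplus>\<^bsub>H\<^esub> \<Phi> y" if xy: "x \<in> carrier T" "y \<in> carrier T" for x y
    proof -
      obtain z w where zw: "z \<in> carrier P" "x = cls z" "w \<in> carrier P" "y = cls w"
        using xy carrier_T by auto
      have "x \<oplus>\<^bsub>T\<^esub> y = cls (z \<oplus>\<^bsub>P\<^esub> w)" using zw by simp
      then have "\<Phi> (x \<oplus>\<^bsub>T\<^esub> y) = h (z \<oplus>\<^bsub>P\<^esub> w)" using zw \<Phi> P.a_closed by metis
      then show ?thesis using zw \<Phi> by (simp add: add_P hadd)
    qed
    show "\<Phi> (pt a b) = \<phi> a b" if "a \<in> carrier A" "b \<in> carrier B" for a b
      using that by (simp add: pt_eq \<Phi> frag_of_P hof)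
  qed
qed

lemma additive_zero:
  fixes H :: "('h, 's) ring_scheme"
  assumes "abelian_group H" "\<And>x. x \<in> carrier T \<Longrightarrow> \<Phi> x \<in> carrier H"
    "\<And>x y. x \<in> carrier T \<Longrightarrow> y \<in> carrier T \<Longrightarrow> \<Phi> (x \<oplus>\<^bsub>T\<^esub> y) = \<Phi> x \<oplus>\<^bsub>H\<^esub> \<Phi> y"
  shows "\<Phi> \<zero>\<^bsub>T\<^esub> = \<zero>\<^bsub>H\<^esub>"
proof -
  interpret H: abelian_group H by fact
  show ?thesis using assms(3)[of "\<zero>\<^bsub>T\<^esub>" "\<zero>\<^bsub>T\<^esub>"] assms(2)[of "\<zero>\<^bsub>T\<^esub>"] by (simp add: H.add.l_cancel_one')
qed

lemma tensor_lift_hom: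
  fixes H :: "('h, 's) ring_scheme"
  assumes H: "cring H"
    and \<gamma>: "\<gamma> \<in> ring_hom A H" and \<delta>: "\<delta> \<in> ring_hom B H"
    and ba: "\<And>c. c \<in> carrier k \<Longrightarrow> \<gamma> (\<alpha> c) = \<delta> (\<beta> c)"
  obtains \<Phi> where "\<Phi> \<in> ring_hom T H"
    "\<And>a b. a \<in> carrier A \<Longrightarrow> b \<in> carrier B \<Longrightarrow> \<Phi> (pt a b) = \<gamma> a \<otimes>\<^bsub>H\<^esub> \<delta> b"
proof -
  interpret H: cring H by fact
  interpret \<gamma>: ring_hom_ring A H \<gamma> by (rule ring_hom_ringI2[OF A.ring_axioms H.ring_axioms \<gamma>])
  interpret \<delta>: ring_hom_ring B H \<delta> by (rule ring_hom_ringI2[OF B.ring_axioms H.ring_axioms \<delta>])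
  obtain \<Phi> where \<Phi>: "\<And>x. x \<in> carrier T \<Longrightarrow> \<Phi> x \<in> carrier H"
    "\<And>x y. x \<in> carrier T \<Longrightarrow> y \<in> carrier T \<Longrightarrow> \<Phi> (x \<oplus>\<^bsub>T\<^esub> y) = \<Phi> x \<oplus>\<^bsub>H\<^esub> \<Phi> y"
    "\<And>a b. a \<in> carrier A \<Longrightarrow> b \<in> carrier B \<Longrightarrow> \<Phi> (pt a b) = \<gamma> a \<otimes>\<^bsub>H\<^esub> \<delta> b"
    by (rule tensor_lift[OF H.abelian_group_axioms, of "\<lambda>a b. \<gamma> a \<otimes>\<^bsub>H\<^esub> \<delta> b"])
      (auto simp: H.l_distr H.r_distr ba H.m_ac)
  have z: "\<Phi> \<zero>\<^bsub>T\<^esub> = \<zero>\<^bsub>H\<^esub>" using additive_zero[OF H.abelian_group_axioms \<Phi>(1,2)] .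
  have "\<Phi> \<in> ring_hom T H"
  proof (rule ring_hom_memI)
    fix x y assume x: "x \<in> carrier T" and y: "y \<in> carrier T"
    show "\<Phi> (x \<otimes>\<^bsub>T\<^esub> y) = \<Phi> x \<otimes>\<^bsub>H\<^esub> \<Phi> y" using x
    proof (induction x rule: T_induct)
      case zero then show ?case using y by (simp add: z \<Phi>(1))
    next
      case (pure a b)
      show ?case using y
      proof (induction y rule: T_induct)
        case zero then show ?case using pure by (simp add: z \<Phi>(1))
      next
        case (pure a' b') then show ?case using \<open>a \<in> carrier A\<close> \<open>b \<in> carrier B\<close>
          by (simp add: \<Phi>(3) H.m_ac)
      next
        case (add u v) then show ?case using pure by (simp add: T.r_distr \<Phi>(1,2) H.r_distr)
      qed
    next
      case (add u v) then show ?case using y by (simp add: T.l_distr \<Phi>(1,2) H.l_distr)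
    qed
  next
    show "\<Phi> \<one>\<^bsub>T\<^esub> = \<one>\<^bsub>H\<^esub>" using \<Phi>(3)[of "\<one>\<^bsub>A\<^esub>" "\<one>\<^bsub>B\<^esub>"] by (simp add: pt_one)
  qed (use \<Phi> in auto)
  then show ?thesis using that \<Phi>(3) by blast
qed

lemma right_hom: "(\<lambda>b. pt \<one>\<^bsub>A\<^esub> b) \<in> ring_hom B T"
  by (rule ring_hom_memI) (auto simp: pt_add_right pt_one)

lemma left_hom: "(\<lambda>a. pt a \<one>\<^bsub>B\<^esub>) \<in> ring_hom A T"
  by (rule ring_hom_memI) (auto simp: pt_add_left pt_one)

text \<open>The endomorphism \<open>id \<otimes> \<psi>\<close>. The union over representatives is the shape in which \<open>\<sigma>\<^sup>*\<close> is given.\<close>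

definition map_right where
  "map_right \<psi> Q = (\<Union>z\<in>Q. cls (frag_extend (\<lambda>(a, b). frag_of (a, \<psi> b)) z))"

text \<open>The map that the universal property yields agrees with the explicit formula on every
representative of a coset.\<close>

lemma map_right_hom:
  assumes \<psi>: "\<psi> \<in> ring_hom B B" and fixd: "\<And>c. c \<in> carrier k \<Longrightarrow> \<psi> (\<beta> c) = \<beta> c"
  shows "map_right \<psi> \<in> ring_hom T T"
    and "\<And>a b. a \<in> carrier A \<Longrightarrow> b \<in> carrier B \<Longrightarrow> map_right \<psi> (pt a b) = pt a (\<psi> b)"
proof -
  note \<psi>c = ring_hom_memE(1)[OF \<psi>]
  have "(\<lambda>b. pt \<one>\<^bsub>A\<^esub> (\<psi> b)) \<in> ring_hom B T"
    using ring_hom_trans[OF \<psi> right_hom] by (simp add: comp_def)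
  moreover have "pt (\<alpha> c) \<one>\<^bsub>B\<^esub> = pt \<one>\<^bsub>A\<^esub> (\<psi> (\<beta> c))" if "c \<in> carrier k" for c
    using pt_balanced[of c "\<one>\<^bsub>A\<^esub>" "\<one>\<^bsub>B\<^esub>"] that fixd by simp
  ultimately obtain \<Phi> where \<Phi>: "\<Phi> \<in> ring_hom T T"
    "\<And>a b. a \<in> carrier A \<Longrightarrow> b \<in> carrier B \<Longrightarrow> \<Phi> (pt a b) = pt a \<one>\<^bsub>B\<^esub> \<otimes>\<^bsub>T\<^esub> pt \<one>\<^bsub>A\<^esub> (\<psi> b)"
    using tensor_lift_hom[OF T.is_cring left_hom] by blast
  have \<Phi>p: "\<Phi> (pt a b) = pt a (\<psi> b)" if "a \<in> carrier A" "b \<in> carrier B" for a b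
    using \<Phi>(2)[OF that] that \<psi>c by simp
  interpret \<Phi>: ring_hom_ring T T \<Phi> by (rule ring_hom_ringI2[OF T.ring_axioms T.ring_axioms \<Phi>(1)])
  let ?e = "frag_extend (\<lambda>(a, b). frag_of (a, \<psi> b))"
  have e: "?e z \<in> carrier P \<and> cls (?e z) = \<Phi> (cls z)" if "z \<in> carrier P" for z
    using that
  proof (induction z rule: P_induct)
    case zero
    have "cls 0 = \<zero>\<^bsub>T\<^esub>" using cls.hom_zero by (simp add: zero_P)
    then show ?case by (simp add: carrier_P)
  next
    case (one a b) then show ?case using \<psi>c \<Phi>p[of a b] by (simp add: pt_eq frag_of_P)
  next
    case (diff x y)
    then show ?case by (simp add: frag_extend_diff cls_diff diff_P a_minus_def)
  qed
  have eq: "map_right \<psi> (cls z) = \<Phi> (cls z)" if z: "z \<in> carrier P" for z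
  proof -
    have "z' \<in> carrier P \<and> cls z' = cls z" if "z' \<in> cls z" for z'
      using I.a_elemrcos_carrier[OF z that] I.a_repr_independence'[OF that z] by simp
    then have *: "cls (?e z') = \<Phi> (cls z)" if "z' \<in> cls z" for z' using e[of z'] that by metis
    have "map_right \<psi> (cls z) = (\<Union>z'\<in>cls z. \<Phi> (cls z))"
      unfolding map_right_def by (rule SUP_cong[OF refl *])
    moreover have "z \<in> cls z" by (rule I.a_rcos_self[OF z])
    ultimately show ?thesis by blast
  qed
  then have eqT: "map_right \<psi> t = \<Phi> t" if "t \<in> carrier T" for t using that carrier_T by auto
  show "map_right \<psi> \<in> ring_hom T T" using \<Phi>(1) eqT unfolding ring_hom_def by auto
  show "map_right \<psi> (pt a b) = pt a (\<psi> b)" if "a \<in> carrier A" "b \<in> carrier B" for a b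
    using eqT \<Phi>p that by simp
qed

end

section \<open>Tensors of minimal length\<close>

context tensor_product
begin

text \<open>Spans are generated one summand at a time, which matches the way in which summands are absorbed into
lists of pairs.\<close>

inductive_set kspan :: "'a set \<Rightarrow> 'a set" for S where
  zero: "\<zero>\<^bsub>A\<^esub> \<in> kspan S"
| step: "x \<in> kspan S \<Longrightarrow> c \<in> carrier k \<Longrightarrow> s \<in> S \<Longrightarrow> x \<oplus>\<^bsub>A\<^esub> \<alpha> c \<otimes>\<^bsub>A\<^esub> s \<in> kspan S"

lemma kspan_carrier: "x \<in> kspan S \<Longrightarrow> S \<subseteq> carrier A \<Longrightarrow> x \<in> carrier A"
  by (induction rule: kspan.induct) auto

lemma kspan_add:
  assumes "y \<in> kspan S" "x \<in> kspan S" "S \<subseteq> carrier A"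
  shows "x \<oplus>\<^bsub>A\<^esub> y \<in> kspan S"
  using assms(1)
proof (induction rule: kspan.induct)
  case zero then show ?case using assms kspan_carrier by simp
next
  case (step y c s)
  have "x \<oplus>\<^bsub>A\<^esub> (y \<oplus>\<^bsub>A\<^esub> \<alpha> c \<otimes>\<^bsub>A\<^esub> s) = (x \<oplus>\<^bsub>A\<^esub> y) \<oplus>\<^bsub>A\<^esub> \<alpha> c \<otimes>\<^bsub>A\<^esub> s"
    using step assms kspan_carrier[OF step(1)] kspan_carrier[OF assms(2)] by (simp add: A.a_assoc subsetD)
  then show ?case using step kspan.step by simp
qed

lemma kspan_smult:
  assumes "x \<in> kspan S" "c \<in> carrier k" "S \<subseteq> carrier A"
  shows "\<alpha> c \<otimes>\<^bsub>A\<^esub> x \<in> kspan S"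
  using assms(1)
proof (induction rule: kspan.induct)
  case zero then show ?case using assms kspan.zero by simp
next
  case (step x d s)
  have *: "\<alpha> c \<otimes>\<^bsub>A\<^esub> (x \<oplus>\<^bsub>A\<^esub> \<alpha> d \<otimes>\<^bsub>A\<^esub> s) = \<alpha> c \<otimes>\<^bsub>A\<^esub> x \<oplus>\<^bsub>A\<^esub> \<alpha> (c \<otimes>\<^bsub>k\<^esub> d) \<otimes>\<^bsub>A\<^esub> s"
    using step assms kspan_carrier[OF step(1)] by (simp add: A.r_distr A.m_assoc subsetD)
  show ?case unfolding * using step assms by (intro kspan.step) auto
qed

lemma kspan_base: "s \<in> S \<Longrightarrow> S \<subseteq> carrier A \<Longrightarrow> s \<in> kspan S"
  using kspan.step[OF kspan.zero, of "\<one>\<^bsub>k\<^esub>" s S] by (simp add: subsetD)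

definition vecA :: "('k, 'a) module" where
  "vecA = \<lparr>carrier = carrier A, monoid.mult = undefined, one = undefined,
     ring.zero = \<zero>\<^bsub>A\<^esub>, ring.add = (\<oplus>\<^bsub>A\<^esub>), smult = (\<lambda>c x. \<alpha> c \<otimes>\<^bsub>A\<^esub> x)\<rparr>"

lemma module_vecA: "module k vecA"
proof (rule moduleI)
  show "abelian_group vecA"
    by (rule abelian_groupI) (auto simp: vecA_def A.a_assoc intro: A.a_comm A.add.l_inv_ex)
qed (auto simp: vecA_def A.l_distr A.r_distr A.m_assoc k.is_cring)

lemma submodule_kspan:
  assumes S: "S \<subseteq> carrier A" shows "submodule (kspan S) k vecA"
proof -
  interpret V: module k vecA by (rule module_vecA)
  show ?thesis
  proof (rule V.submoduleI)
    show "kspan S \<subseteq> carrier vecA" using kspan_carrier S by (auto simp: vecA_def)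
    show "\<zero>\<^bsub>vecA\<^esub> \<in> kspan S" by (simp add: vecA_def kspan.zero)
    fix x assume x: "x \<in> kspan S"
    then have xc: "x \<in> carrier A" using kspan_carrier S by blast
    have "\<ominus>\<^bsub>vecA\<^esub> x = \<alpha> (\<ominus>\<^bsub>k\<^esub> \<one>\<^bsub>k\<^esub>) \<otimes>\<^bsub>A\<^esub> x"
      by (rule V.minus_equality) (use xc in \<open>auto simp: vecA_def A.l_minus A.l_neg\<close>)
    then show "\<ominus>\<^bsub>vecA\<^esub> x \<in> kspan S" using kspan_smult[OF x _ S, of "\<ominus>\<^bsub>k\<^esub> \<one>\<^bsub>k\<^esub>"] by (simp only:) simp
  qed (use S in \<open>auto simp: vecA_def intro: kspan_add kspan_smult\<close>)
qed

lemma kspan_functional: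
  assumes S: "S \<subseteq> carrier A" and a: "a \<in> carrier A" "a \<notin> kspan S"
  obtains \<phi> where "\<And>x. x \<in> carrier A \<Longrightarrow> \<phi> x \<in> carrier k"
    "\<And>x y. x \<in> carrier A \<Longrightarrow> y \<in> carrier A \<Longrightarrow> \<phi> (x \<oplus>\<^bsub>A\<^esub> y) = \<phi> x \<oplus>\<^bsub>k\<^esub> \<phi> y"
    "\<And>c x. c \<in> carrier k \<Longrightarrow> x \<in> carrier A \<Longrightarrow> \<phi> (\<alpha> c \<otimes>\<^bsub>A\<^esub> x) = c \<otimes>\<^bsub>k\<^esub> \<phi> x"
    "\<phi> a = \<one>\<^bsub>k\<^esub>" "\<And>s. s \<in> S \<Longrightarrow> \<phi> s = \<zero>\<^bsub>k\<^esub>"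
proof -
  obtain \<phi> where \<phi>: "\<phi> \<in> carrier vecA \<rightarrow> carrier k"
    "\<And>x y. x \<in> carrier vecA \<Longrightarrow> y \<in> carrier vecA \<Longrightarrow> \<phi> (x \<oplus>\<^bsub>vecA\<^esub> y) = \<phi> x \<oplus>\<^bsub>k\<^esub> \<phi> y"
    "\<And>c x. c \<in> carrier k \<Longrightarrow> x \<in> carrier vecA \<Longrightarrow> \<phi> (c \<odot>\<^bsub>vecA\<^esub> x) = c \<otimes>\<^bsub>k\<^esub> \<phi> x"
    "\<phi> a = \<one>\<^bsub>k\<^esub>" "\<And>w. w \<in> kspan S \<Longrightarrow> \<phi> w = \<zero>\<^bsub>k\<^esub>"
    by (rule separating_functional[OF k module_vecA submodule_kspan[OF S], of a])
      (use a in \<open>auto simp: vecA_def\<close>)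
  show ?thesis using \<phi> kspan_base[OF _ S] by (intro that[of \<phi>]) (auto simp: vecA_def)
qed

text \<open>If \<open>a\<close> were not in the span, some functional \<open>\<phi>\<close> would be 1 at \<open>a\<close> and 0 at the other left entries.
Then \<open>\<phi> \<otimes> id : T \<rightarrow> B\<close> maps the relation to \<open>b\<close>.\<close>

lemma relation_span:
  assumes xs: "xs \<in> tlists" "xs = ys @ (a, b) # zs" and 0: "tsum xs = \<zero>\<^bsub>T\<^esub>" and b: "b \<noteq> \<zero>\<^bsub>B\<^esub>"
  shows "a \<in> kspan (fst ` set (ys @ zs))"
proof (rule ccontr)
  let ?S = "fst ` set (ys @ zs)"
  assume na: "a \<notin> kspan ?S"
  have c: "ys \<in> tlists" "zs \<in> tlists" "a \<in> carrier A" "b \<in> carrier B" using xs by auto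
  have S: "?S \<subseteq> carrier A" using c unfolding tlists_def by auto
  show False
  proof (rule kspan_functional[OF S c(3) na])
  fix \<phi> assume \<phi>: "\<And>x. x \<in> carrier A \<Longrightarrow> \<phi> x \<in> carrier k"
    "\<And>x y. x \<in> carrier A \<Longrightarrow> y \<in> carrier A \<Longrightarrow> \<phi> (x \<oplus>\<^bsub>A\<^esub> y) = \<phi> x \<oplus>\<^bsub>k\<^esub> \<phi> y"
    "\<And>c x. c \<in> carrier k \<Longrightarrow> x \<in> carrier A \<Longrightarrow> \<phi> (\<alpha> c \<otimes>\<^bsub>A\<^esub> x) = c \<otimes>\<^bsub>k\<^esub> \<phi> x"
    "\<phi> a = \<one>\<^bsub>k\<^esub>" "\<And>s. s \<in> ?S \<Longrightarrow> \<phi> s = \<zero>\<^bsub>k\<^esub>"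
  obtain \<Phi> where \<Phi>: "\<And>x. x \<in> carrier T \<Longrightarrow> \<Phi> x \<in> carrier B"
    "\<And>x y. x \<in> carrier T \<Longrightarrow> y \<in> carrier T \<Longrightarrow> \<Phi> (x \<oplus>\<^bsub>T\<^esub> y) = \<Phi> x \<oplus>\<^bsub>B\<^esub> \<Phi> y"
    "\<And>a b. a \<in> carrier A \<Longrightarrow> b \<in> carrier B \<Longrightarrow> \<Phi> (pt a b) = \<beta> (\<phi> a) \<otimes>\<^bsub>B\<^esub> b"
    by (rule tensor_lift[OF B.abelian_group_axioms, of "\<lambda>a b. \<beta> (\<phi> a) \<otimes>\<^bsub>B\<^esub> b"])
      (auto simp: \<phi> B.l_distr B.r_distr B.m_ac)
  have z: "\<Phi> \<zero>\<^bsub>T\<^esub> = \<zero>\<^bsub>B\<^esub>" by (rule additive_zero[OF B.abelian_group_axioms \<Phi>(1,2)])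
  have van: "\<Phi> (tsum us) = \<zero>\<^bsub>B\<^esub>" if "us \<in> tlists" "fst ` set us \<subseteq> ?S" for us
    using that by (induction us) (auto simp: z \<Phi> \<phi>(5))
  have "\<Phi> (tsum xs) = \<Phi> (tsum ys) \<oplus>\<^bsub>B\<^esub> (\<beta> (\<phi> a) \<otimes>\<^bsub>B\<^esub> b \<oplus>\<^bsub>B\<^esub> \<Phi> (tsum zs))"
    using xs c by (simp add: tsum_append \<Phi>)
  also have "\<dots> = b"
  proof -
    have "\<Phi> (tsum ys) = \<zero>\<^bsub>B\<^esub>" "\<Phi> (tsum zs) = \<zero>\<^bsub>B\<^esub>" using c by (auto intro!: van simp: image_Un)
    then show ?thesis using c \<phi>(4) by simp
  qed
  finally show False using 0 z b by simp
  qed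
qed

lemma pt_one_nonzero:
  assumes a: "a \<in> carrier A" "a \<noteq> \<zero>\<^bsub>A\<^esub>" and nz: "\<one>\<^bsub>B\<^esub> \<noteq> \<zero>\<^bsub>B\<^esub>"
  shows "pt a \<one>\<^bsub>B\<^esub> \<noteq> \<zero>\<^bsub>T\<^esub>"
proof
  assume 0: "pt a \<one>\<^bsub>B\<^esub> = \<zero>\<^bsub>T\<^esub>"
  have "a \<in> kspan (fst ` set ([] @ ([] :: ('a \<times> 'b) list)))"
  proof (rule relation_span[OF _ _ _ nz])
    show "[(a, \<one>\<^bsub>B\<^esub>)] \<in> tlists" unfolding tlists_def using a(1) by simp
    show "[(a, \<one>\<^bsub>B\<^esub>)] = [] @ (a, \<one>\<^bsub>B\<^esub>) # []" by simp
    show "tsum [(a, \<one>\<^bsub>B\<^esub>)] = \<zero>\<^bsub>T\<^esub>" using 0 by simp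
  qed
  then have "a \<in> kspan {}" by simp
  then have "a = \<zero>\<^bsub>A\<^esub>" by (rule kspan.cases) simp_all
  then show False using a(2) by blast
qed

lemma add_term:
  "us \<in> tlists \<Longrightarrow> s \<in> fst ` set us \<Longrightarrow> b \<in> carrier B \<Longrightarrow>
    \<exists>ws\<in>tlists. map fst ws = map fst us \<and> tsum ws = tsum us \<oplus>\<^bsub>T\<^esub> pt s b"
proof (induction us)
  case (Cons u us)
  obtain a c where u: "u = (a, c)" by (cases u)
  show ?case
  proof (cases "s = a")
    case True
    then show ?thesis using Cons.prems u
      by (intro bexI[of _ "(a, c \<oplus>\<^bsub>B\<^esub> b) # us"]) (auto simp: pt_add_right T.a_ac)
  next
    case False
    then obtain ws where ws: "ws \<in> tlists" "map fst ws = map fst us" "tsum ws = tsum us \<oplus>\<^bsub>T\<^esub> pt s b"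
      using Cons u by auto
    have "s \<in> carrier A" using Cons.prems u unfolding tlists_def by auto
    then show ?thesis using Cons.prems u ws
      by (intro bexI[of _ "(a, c) # ws"]) (auto simp: T.a_assoc)
  qed
qed simp

text \<open>A summand whose left entry is a combination of the left entries of \<open>us\<close> only changes the right
entries of \<open>us\<close>.\<close>

lemma absorb_term:
  assumes us: "us \<in> tlists" and a: "a \<in> kspan (fst ` set us)" and b: "b \<in> carrier B"
  shows "\<exists>ws\<in>tlists. map fst ws = map fst us \<and> tsum ws = tsum us \<oplus>\<^bsub>T\<^esub> pt a b"
  using a
proof (induction rule: kspan.induct)
  case zero then show ?case using us b by (intro bexI[of _ us]) auto
next
  case (step x c s)
  have S: "fst ` set us \<subseteq> carrier A" using us unfolding tlists_def by auto
  then have sc: "s \<in> carrier A" "x \<in> carrier A" using step kspan_carrier by auto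
  obtain ws where ws: "ws \<in> tlists" "map fst ws = map fst us" "tsum ws = tsum us \<oplus>\<^bsub>T\<^esub> pt x b"
    using step by blast
  have "fst ` set ws = fst ` set us" using ws(2) by (metis list.set_map)
  then obtain vs where vs: "vs \<in> tlists" "map fst vs = map fst ws"
    "tsum vs = tsum ws \<oplus>\<^bsub>T\<^esub> pt s (\<beta> c \<otimes>\<^bsub>B\<^esub> b)"
    using add_term[OF ws(1), of s "\<beta> c \<otimes>\<^bsub>B\<^esub> b"] step b by auto
  show ?case using vs ws us sc step b
    by (intro bexI[of _ vs]) (auto simp: pt_add_left pt_balanced T.a_assoc)
qed

lemma drop_term:
  assumes xs: "xs \<in> tlists" "xs = ys @ (a, b) # zs" and a: "a \<in> kspan (fst ` set (ys @ zs))"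
  shows "\<exists>ws\<in>tlists. length ws < length xs \<and> tsum ws = tsum xs"
proof -
  have c: "ys \<in> tlists" "zs \<in> tlists" "a \<in> carrier A" "b \<in> carrier B" using xs by auto
  then obtain ws where ws: "ws \<in> tlists" "map fst ws = map fst (ys @ zs)"
    "tsum ws = tsum (ys @ zs) \<oplus>\<^bsub>T\<^esub> pt a b" using absorb_term[of "ys @ zs" a b] a by auto
  have "length ws = length (ys @ zs)" using ws(2) by (metis length_map)
  moreover have "tsum ws = tsum xs" using ws xs c by (simp add: tsum_append T.a_ac)
  ultimately show ?thesis using ws xs by (intro bexI[of _ ws]) auto
qed

definition minrep where
  "minrep xs \<longleftrightarrow> xs \<in> tlists \<and> (\<forall>ys\<in>tlists. tsum ys = tsum xs \<longrightarrow> length xs \<le> length ys)"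

lemma minrep_tlists: "minrep xs \<Longrightarrow> xs \<in> tlists" by (simp add: minrep_def)

lemma minrep_exists:
  assumes "t \<in> carrier T" obtains xs where "minrep xs" "t = tsum xs"
proof -
  obtain us where us: "us \<in> tlists" "t = tsum us" using T_tsum[OF assms] .
  obtain xs where "xs \<in> tlists \<and> t = tsum xs" "\<And>ys. ys \<in> tlists \<and> t = tsum ys \<Longrightarrow> length xs \<le> length ys"
    using ex_has_least_nat[of "\<lambda>xs. xs \<in> tlists \<and> t = tsum xs" us length] us by blast
  then have "minrep xs" "t = tsum xs" unfolding minrep_def by auto
  then show ?thesis by (rule that)
qed

lemma minrep_not_span:
  assumes "minrep xs" "xs = ys @ (a, b) # zs" shows "a \<notin> kspan (fst ` set (ys @ zs))"
proof
  assume "a \<in> kspan (fst ` set (ys @ zs))"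
  then obtain ws where "ws \<in> tlists" "length ws < length xs" "tsum ws = tsum xs"
    using drop_term[OF minrep_tlists[OF assms(1)] assms(2)] by blast
  then show False using assms(1) unfolding minrep_def by (meson not_le)
qed

text \<open>In a shortest representation no left entry is in the span of the others, so by \<open>relation_span\<close>
the left entries are linearly independent over \<open>k\<close>, also with coefficients in \<open>B\<close>.\<close>

lemma minrep_left:
  assumes xs: "minrep xs" and ys: "ys \<in> tlists" "map fst ys = map fst xs" "tsum ys = \<zero>\<^bsub>T\<^esub>"
    and ab: "(a, b) \<in> set ys"
  shows "b = \<zero>\<^bsub>B\<^esub>"
proof (rule ccontr)
  assume b: "b \<noteq> \<zero>\<^bsub>B\<^esub>"
  obtain us vs where uv: "ys = us @ (a, b) # vs" using ab by (meson split_list)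
  have "a \<in> kspan (fst ` set (us @ vs))" by (rule relation_span[OF ys(1) uv ys(3) b])
  moreover obtain us' b' vs' where xe: "xs = us' @ (a, b') # vs'" "map fst us' = map fst us" "map fst vs' = map fst vs"
  proof -
    have e: "map fst xs = map fst us @ a # map fst vs" using ys(2) uv by simp
    let ?n = "length us"
    have "length xs = length ys" using arg_cong[OF ys(2), of length] by simp
    then have n: "?n < length xs" using uv by simp
    have "map fst (take ?n xs) = map fst us" "map fst (drop (Suc ?n) xs) = map fst vs"
      using arg_cong[OF e, of "take ?n"] arg_cong[OF e, of "drop (Suc ?n)"] by (simp_all add: take_map drop_map)
    moreover have "fst (xs ! ?n) = a" using arg_cong[OF e, of "\<lambda>l. l ! ?n"] n by (simp add: nth_append)
    moreover have "xs = take ?n xs @ (fst (xs ! ?n), snd (xs ! ?n)) # drop (Suc ?n) xs"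
      using id_take_nth_drop[OF n] by simp
    ultimately show thesis using that by blast
  qed
  moreover have "fst ` set (us @ vs) = fst ` set (us' @ vs')"
    using xe(2,3) by (metis list.set_map map_append)
  ultimately show False using minrep_not_span[OF xs xe(1)] by simp
qed

text \<open>Exchanging the factors makes statements about left entries available for right entries.\<close>

lemma swap_ex:
  obtains \<Psi> where "\<Psi> \<in> ring_hom T (tensor_algebra k \<beta> B \<alpha> A)"
    "\<And>a b. a \<in> carrier A \<Longrightarrow> b \<in> carrier B \<Longrightarrow> \<Psi> (pt a b) = pure_tensor k \<beta> B \<alpha> A b a"
proof -
  interpret sw: tensor_product k \<beta> B \<alpha> A by unfold_locales (rule \<beta> \<alpha>)+
  have "sw.pt \<one>\<^bsub>B\<^esub> (\<alpha> c) = sw.pt (\<beta> c) \<one>\<^bsub>A\<^esub>" if "c \<in> carrier k" for c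
    using sw.pt_balanced[of c "\<one>\<^bsub>B\<^esub>" "\<one>\<^bsub>A\<^esub>"] that by simp
  then obtain \<Psi> where \<Psi>: "\<Psi> \<in> ring_hom T sw.T"
    "\<And>a b. a \<in> carrier A \<Longrightarrow> b \<in> carrier B \<Longrightarrow> \<Psi> (pt a b) = sw.pt \<one>\<^bsub>B\<^esub> a \<otimes>\<^bsub>sw.T\<^esub> sw.pt b \<one>\<^bsub>A\<^esub>"
    using tensor_lift_hom[OF sw.T.is_cring sw.right_hom sw.left_hom] by blast
  show ?thesis by (rule that[OF \<Psi>(1)]) (simp add: \<Psi>(2))
qed

lemma swap_tsum:
  assumes \<Psi>: "\<Psi> \<in> ring_hom T (tensor_algebra k \<beta> B \<alpha> A)"
    "\<And>a b. a \<in> carrier A \<Longrightarrow> b \<in> carrier B \<Longrightarrow> \<Psi> (pt a b) = pure_tensor k \<beta> B \<alpha> A b a"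
    and xs: "xs \<in> tlists"
  shows "map prod.swap xs \<in> tensor_product.tlists B A \<and>
    \<Psi> (tsum xs) = tensor_product.tsum k \<beta> B \<alpha> A (map prod.swap xs)"
proof -
  interpret sw: tensor_product k \<beta> B \<alpha> A by unfold_locales (rule \<beta> \<alpha>)+
  interpret \<Psi>: ring_hom_ring T sw.T \<Psi>
    by (rule ring_hom_ringI2[OF T.ring_axioms sw.T.ring_axioms \<Psi>(1)])
  show ?thesis using xs by (induction xs) (auto simp: \<Psi>(2))
qed

lemma minrep_right:
  assumes xs: "minrep xs" and ys: "ys \<in> tlists" "map snd ys = map snd xs" "tsum ys = \<zero>\<^bsub>T\<^esub>"
    and ab: "(a, b) \<in> set ys"
  shows "a = \<zero>\<^bsub>A\<^esub>"
proof -
  interpret sw: tensor_product k \<beta> B \<alpha> A by unfold_locales (rule \<beta> \<alpha>)+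
  obtain \<Psi> where \<Psi>: "\<Psi> \<in> ring_hom T sw.T"
    "\<And>a b. a \<in> carrier A \<Longrightarrow> b \<in> carrier B \<Longrightarrow> \<Psi> (pt a b) = sw.pt b a" using swap_ex by blast
  obtain \<Psi>' where \<Psi>': "\<Psi>' \<in> ring_hom sw.T T"
    "\<And>a b. a \<in> carrier B \<Longrightarrow> b \<in> carrier A \<Longrightarrow> \<Psi>' (sw.pt a b) = pt b a" using sw.swap_ex by blast
  interpret \<Psi>: ring_hom_ring T sw.T \<Psi>
    by (rule ring_hom_ringI2[OF T.ring_axioms sw.T.ring_axioms \<Psi>(1)])
  have t: "map prod.swap ys \<in> sw.tlists" "map prod.swap xs \<in> sw.tlists"
    "sw.tsum (map prod.swap ys) = \<zero>\<^bsub>sw.T\<^esub>"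
    using swap_tsum[OF \<Psi> ys(1)] swap_tsum[OF \<Psi> minrep_tlists[OF xs]] ys(3) \<Psi>.hom_zero by simp_all
  have "sw.minrep (map prod.swap xs)" unfolding sw.minrep_def
  proof (intro conjI ballI impI)
    fix ws assume ws: "ws \<in> sw.tlists" "sw.tsum ws = sw.tsum (map prod.swap xs)"
    have "map prod.swap ws \<in> tlists" "tsum (map prod.swap ws) = tsum xs"
      using sw.swap_tsum[OF \<Psi>' ws(1)] sw.swap_tsum[OF \<Psi>' t(2)] ws(2) by (auto simp: comp_def)
    then show "length (map prod.swap xs) \<le> length ws" using xs unfolding minrep_def by force
  qed (rule t)
  moreover have "map fst (map prod.swap ys) = map fst (map prod.swap xs)" using ys(2) by (simp add: comp_def)
  ultimately show ?thesis using sw.minrep_left[OF _ t(1) _ t(3), of "map prod.swap xs" b a] ab by force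
qed

lemma tsum_scale:
  "v \<in> carrier A \<Longrightarrow> w \<in> carrier B \<Longrightarrow> xs \<in> tlists \<Longrightarrow>
    map (\<lambda>(a, b). (v \<otimes>\<^bsub>A\<^esub> a, w \<otimes>\<^bsub>B\<^esub> b)) xs \<in> tlists \<and>
    tsum (map (\<lambda>(a, b). (v \<otimes>\<^bsub>A\<^esub> a, w \<otimes>\<^bsub>B\<^esub> b)) xs) = pt v w \<otimes>\<^bsub>T\<^esub> tsum xs"
  by (induction xs) (auto simp: T.r_distr)

lemma tsum_diff_right:
  assumes "\<And>a b. a \<in> carrier A \<Longrightarrow> b \<in> carrier B \<Longrightarrow> g a b \<in> carrier B \<and> h a b \<in> carrier B"
  shows "xs \<in> tlists \<Longrightarrow> map (\<lambda>(a, b). (a, g a b \<ominus>\<^bsub>B\<^esub> h a b)) xs \<in> tlists \<and>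
    map (\<lambda>(a, b). (a, g a b)) xs \<in> tlists \<and> map (\<lambda>(a, b). (a, h a b)) xs \<in> tlists \<and>
    tsum (map (\<lambda>(a, b). (a, g a b \<ominus>\<^bsub>B\<^esub> h a b)) xs) =
      tsum (map (\<lambda>(a, b). (a, g a b)) xs) \<ominus>\<^bsub>T\<^esub> tsum (map (\<lambda>(a, b). (a, h a b)) xs)"
proof (induction xs)
  case (Cons u xs)
  obtain a b where u: "u = (a, b)" by (cases u)
  have ab: "a \<in> carrier A" "b \<in> carrier B" using Cons.prems u by auto
  have gh: "g a b \<in> carrier B" "h a b \<in> carrier B" using assms ab by auto
  have "pt a (g a b \<ominus>\<^bsub>B\<^esub> h a b) = pt a (g a b) \<ominus>\<^bsub>T\<^esub> pt a (h a b)"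
    using ab gh by (simp add: a_minus_def pt_add_right pt_minus_right)
  then show ?case using Cons ab gh u
    by (auto simp: a_minus_def T.minus_add T.a_ac)
qed (simp add: a_minus_def T.r_neg)

lemma tsum_diff_left:
  assumes "\<And>a b. a \<in> carrier A \<Longrightarrow> b \<in> carrier B \<Longrightarrow> g a b \<in> carrier A \<and> h a b \<in> carrier A"
  shows "xs \<in> tlists \<Longrightarrow> map (\<lambda>(a, b). (g a b \<ominus>\<^bsub>A\<^esub> h a b, b)) xs \<in> tlists \<and>
    map (\<lambda>(a, b). (g a b, b)) xs \<in> tlists \<and> map (\<lambda>(a, b). (h a b, b)) xs \<in> tlists \<and>
    tsum (map (\<lambda>(a, b). (g a b \<ominus>\<^bsub>A\<^esub> h a b, b)) xs) =
      tsum (map (\<lambda>(a, b). (g a b, b)) xs) \<ominus>\<^bsub>T\<^esub> tsum (map (\<lambda>(a, b). (h a b, b)) xs)"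
proof (induction xs)
  case (Cons u xs)
  obtain a b where u: "u = (a, b)" by (cases u)
  have ab: "a \<in> carrier A" "b \<in> carrier B" using Cons.prems u by auto
  have gh: "g a b \<in> carrier A" "h a b \<in> carrier A" using assms ab by auto
  have "pt (g a b \<ominus>\<^bsub>A\<^esub> h a b) b = pt (g a b) b \<ominus>\<^bsub>T\<^esub> pt (h a b) b"
    using ab gh by (simp add: a_minus_def pt_add_left pt_minus_left)
  then show ?case using Cons ab gh u
    by (auto simp: a_minus_def T.minus_add T.a_ac)
qed (simp add: a_minus_def T.r_neg)

text \<open>Additivity of the Frobenius power.\<close>

lemma tsum_pow:
  assumes Q: "frob_exp T Q"
  shows "xs \<in> tlists \<Longrightarrow> map (\<lambda>(a, b). (a [^]\<^bsub>A\<^esub> Q, b [^]\<^bsub>B\<^esub> Q)) xs \<in> tlists \<and>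
    tsum xs [^]\<^bsub>T\<^esub> Q = tsum (map (\<lambda>(a, b). (a [^]\<^bsub>A\<^esub> Q, b [^]\<^bsub>B\<^esub> Q)) xs)"
proof (induction xs)
  case Nil
  have "0 < Q" using frob_exp_gt_1[OF Q] by simp
  then show ?case by (simp add: T.nat_pow_zero)
next
  case (Cons u xs)
  obtain a b where u: "u = (a, b)" by (cases u)
  show ?case using Cons u by (auto simp: T.frob_add[OF Q] pt_pow)
qed

end

section \<open>The Frobenius endomorphism of a tensor product\<close>

lemma (in ring_hom_ring) hom_pow_nat: "x \<in> carrier R \<Longrightarrow> h (x [^]\<^bsub>R\<^esub> (n::nat)) = h x [^]\<^bsub>S\<^esub> n"
  by (induction n) auto

lemma (in domain) pow_eq_zero: "x \<in> carrier R \<Longrightarrow> x [^] (n::nat) = \<zero> \<Longrightarrow> x = \<zero>"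
  by (induction n) (auto simp: integral_iff)

lemma (in domain) frob_inj:
  assumes q: "frob_exp R q" and "x \<in> carrier R" "y \<in> carrier R" "x [^] q = y [^] q"
  shows "x = y"
proof -
  have "(x \<ominus> y) [^] q = \<zero>" using frob_minus[OF q assms(2,3)] assms by simp
  then have "x \<ominus> y = \<zero>" using pow_eq_zero assms by simp
  then show ?thesis using assms by simp
qed

text \<open>For motives, \<open>k\<close> is \<open>\<F>\<^sub>q\<close>, \<open>A\<close> the coordinate ring of the affine curve and \<open>B\<close> the field \<open>L\<close>. To exploit geometric
irreducibility, \<open>B\<close> will be an algebraic closure of \<open>k\<close>.\<close>

locale frobenius_tensor = tensor_product k \<alpha> A \<beta> B
  for k :: "'k ring" and \<alpha> :: "'k \<Rightarrow> 'a" and A :: "'a ring"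
    and \<beta> :: "'k \<Rightarrow> 'b" and B :: "'b ring" +
  assumes fin_k: "finite (carrier k)" and field_B: "field B" and domain_A: "domain A"
begin

abbreviation q where "q \<equiv> card (carrier k)"
abbreviation \<sigma> where "\<sigma> \<equiv> map_right (\<lambda>b. b [^]\<^bsub>B\<^esub> q)"

sublocale B: field B by (rule field_B)
sublocale A: domain A by (rule domain_A)

lemma frob_k: "frob_exp k q" using k.finite_field_frob_exp fin_k .
lemma frob_A: "frob_exp A q" using \<alpha>.frob_exp_hom[OF frob_k] .
lemma frob_B: "frob_exp B q" using \<beta>.frob_exp_hom[OF frob_k] .
lemma frob_T: "frob_exp T q"
proof -
  interpret l: ring_hom_ring A T "\<lambda>a. pt a \<one>\<^bsub>B\<^esub>"
    by (rule ring_hom_ringI2[OF A.ring_axioms T.ring_axioms left_hom])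
  show ?thesis by (rule l.frob_exp_hom[OF frob_A])
qed

lemma q_gt_1: "1 < q" using frob_exp_gt_1[OF frob_k] .

lemma frobB_hom: "(\<lambda>b. b [^]\<^bsub>B\<^esub> q) \<in> ring_hom B B"
  by (rule ring_hom_memI) (auto simp: B.frob_add[OF frob_B] B.nat_pow_distrib)

lemma k_pow: "c \<in> carrier k \<Longrightarrow> c [^]\<^bsub>k\<^esub> q = c"
  by (rule k.finite_field_pow_card[OF fin_k])

lemma frobB_fixes: "c \<in> carrier k \<Longrightarrow> \<beta> c [^]\<^bsub>B\<^esub> q = \<beta> c"
  using \<beta>.hom_pow_nat[of c q] k_pow by simp

lemma sigma_hom: "\<sigma> \<in> ring_hom T T"
  by (rule map_right_hom(1)[OF frobB_hom frobB_fixes])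

lemma sigma_pt: "a \<in> carrier A \<Longrightarrow> b \<in> carrier B \<Longrightarrow> \<sigma> (pt a b) = pt a (b [^]\<^bsub>B\<^esub> q)"
  by (rule map_right_hom(2)[OF frobB_hom frobB_fixes])

sublocale \<sigma>: ring_hom_ring T T \<sigma>
  by (rule ring_hom_ringI2[OF T.ring_axioms T.ring_axioms sigma_hom])

lemma sigma_pow_hom: "(\<sigma> ^^ n) \<in> ring_hom T T"
proof (induction n)
  case 0 then show ?case by (simp add: ring_hom_def)
next
  case (Suc n) then show ?case using ring_hom_trans[OF Suc sigma_hom] unfolding funpow.simps by blast
qed

lemma sigma_pow_ring_hom: "ring_hom_ring T T (\<sigma> ^^ n)"
  by (rule ring_hom_ringI2[OF T.ring_axioms T.ring_axioms sigma_pow_hom])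

lemma sigma_pow_closed: "t \<in> carrier T \<Longrightarrow> (\<sigma> ^^ n) t \<in> carrier T"
  using ring_hom_memE(1)[OF sigma_pow_hom] .

lemma sigma_pow_pt: "a \<in> carrier A \<Longrightarrow> b \<in> carrier B \<Longrightarrow> (\<sigma> ^^ n) (pt a b) = pt a (b [^]\<^bsub>B\<^esub> (q ^ n))"
  by (induction n) (auto simp: sigma_pt B.nat_pow_pow mult.commute)

lemma sigma_pow_tsum:
  assumes "xs \<in> tlists"
  shows "map (\<lambda>(a, b). (a, b [^]\<^bsub>B\<^esub> (q ^ n))) xs \<in> tlists \<and>
    (\<sigma> ^^ n) (tsum xs) = tsum (map (\<lambda>(a, b). (a, b [^]\<^bsub>B\<^esub> (q ^ n))) xs)"
proof -
  interpret s: ring_hom_ring T T "\<sigma> ^^ n" by (rule sigma_pow_ring_hom)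
  show ?thesis using assms by (induction xs) (auto simp: sigma_pow_pt)
qed

lemma fixed_B:
  assumes "b \<in> carrier B" "b [^]\<^bsub>B\<^esub> q = b" obtains c where "c \<in> carrier k" "b = \<beta> c"
proof -
  have inj: "inj_on \<beta> (carrier k)" by (rule non_trivial_field_hom_is_inj[OF \<beta> k field_B])
  have sf: "subfield (\<beta> ` carrier k) B"
    by (rule \<beta>.img_is_subfield(2)[OF k.carrier_is_subfield]) simp
  have "b \<in> \<beta> ` carrier k"
    by (rule B.fixed_by_frob[OF sf]) (use fin_k assms inj in \<open>auto simp: card_image\<close>)
  then show ?thesis using that by blast
qed

lemma tlists_mem: "xs \<in> tlists \<Longrightarrow> (a, b) \<in> set xs \<Longrightarrow> a \<in> carrier A \<and> b \<in> carrier B"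
  unfolding tlists_def by blast

lemma minrep_snd_nonzero:
  assumes "minrep ((a, b) # us)" shows "b \<noteq> \<zero>\<^bsub>B\<^esub>"
proof
  assume b: "b = \<zero>\<^bsub>B\<^esub>"
  have c: "us \<in> tlists" "a \<in> carrier A" using minrep_tlists[OF assms] by auto
  then have "tsum us = tsum ((a, b) # us)" using b by simp
  then show False using assms c unfolding minrep_def by force
qed

text \<open>Coefficients in \<open>k\<close> are their own \<open>q\<close>-th powers.\<close>

lemma frob_kspan:
  assumes S: "S \<subseteq> carrier A"
  shows "y \<in> kspan ((\<lambda>a. a [^]\<^bsub>A\<^esub> q) ` S) \<Longrightarrow> \<exists>x\<in>kspan S. y = x [^]\<^bsub>A\<^esub> q"
proof (induction rule: kspan.induct)
  case zero
  show ?case using q_gt_1 kspan.zero[of S] by (intro bexI[of _ "\<zero>\<^bsub>A\<^esub>"]) (auto simp: A.nat_pow_zero)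
next
  case (step y c s)
  then obtain x a where x: "x \<in> kspan S" "y = x [^]\<^bsub>A\<^esub> q" and a: "a \<in> S" "s = a [^]\<^bsub>A\<^esub> q" by blast
  have cr: "x \<in> carrier A" "a \<in> carrier A" using x a S kspan_carrier by auto
  have "\<alpha> c = \<alpha> c [^]\<^bsub>A\<^esub> q" using \<alpha>.hom_pow_nat[of c q] k_pow step by simp
  then have "y \<oplus>\<^bsub>A\<^esub> \<alpha> c \<otimes>\<^bsub>A\<^esub> s = (x \<oplus>\<^bsub>A\<^esub> \<alpha> c \<otimes>\<^bsub>A\<^esub> a) [^]\<^bsub>A\<^esub> q"
    using x a cr step by (simp add: A.frob_add[OF frob_A] A.nat_pow_distrib)
  moreover have "x \<oplus>\<^bsub>A\<^esub> \<alpha> c \<otimes>\<^bsub>A\<^esub> a \<in> kspan S" using kspan.step[OF x(1) _ a(1)] step by blast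
  ultimately show ?case by blast
qed

text \<open>If \<open>t\<^sup>2 = 0\<close>, then \<open>t\<^sup>q = 0\<close>, so the \<open>q\<close>-th power of the first left entry of a shortest representation is
in the span of the \<open>q\<close>-th powers of the others. As \<open>A\<close> is a domain of characteristic \<open>p\<close>, the same holds
without the powers, against minimality.\<close>

lemma T_reduced:
  assumes t: "t \<in> carrier T" and 0: "t \<otimes>\<^bsub>T\<^esub> t = \<zero>\<^bsub>T\<^esub>"
  shows "t = \<zero>\<^bsub>T\<^esub>"
proof -
  obtain xs where xs: "minrep xs" "t = tsum xs" by (rule minrep_exists[OF t])
  show ?thesis
  proof (cases xs)
    case Nil then show ?thesis using xs by simp
  next
    case (Cons u us)
    obtain a b where u: "u = (a, b)" by (cases u)
    have c: "us \<in> tlists" "a \<in> carrier A" "b \<in> carrier B" using minrep_tlists[OF xs(1)] Cons u by auto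
    have "b \<noteq> \<zero>\<^bsub>B\<^esub>" using minrep_snd_nonzero xs Cons u by blast
    then have bq: "b [^]\<^bsub>B\<^esub> q \<noteq> \<zero>\<^bsub>B\<^esub>" using B.pow_eq_zero c by blast
    define r where "r = q - 2"
    have r: "q = r + 2" using q_gt_1 by (simp add: r_def)
    have "t [^]\<^bsub>T\<^esub> q = t [^]\<^bsub>T\<^esub> r \<otimes>\<^bsub>T\<^esub> t [^]\<^bsub>T\<^esub> (2::nat)"
      by (subst r) (rule T.nat_pow_mult[OF t, symmetric])
    also have "t [^]\<^bsub>T\<^esub> (2::nat) = \<zero>\<^bsub>T\<^esub>" using t 0 by (simp add: numeral_2_eq_2)
    finally have tq: "t [^]\<^bsub>T\<^esub> q = \<zero>\<^bsub>T\<^esub>" using t by simp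
    let ?f = "\<lambda>(a, b). (a [^]\<^bsub>A\<^esub> q, b [^]\<^bsub>B\<^esub> q)"
    have ys: "map ?f xs \<in> tlists" "tsum (map ?f xs) = \<zero>\<^bsub>T\<^esub>"
      using tsum_pow[OF frob_T minrep_tlists[OF xs(1)]] tq xs(2) by simp_all
    have "a [^]\<^bsub>A\<^esub> q \<in> kspan (fst ` set ([] @ map ?f us))"
      by (rule relation_span[OF ys(1) _ ys(2) bq]) (simp add: Cons u)
    also have "fst ` set ([] @ map ?f us) = (\<lambda>a. a [^]\<^bsub>A\<^esub> q) ` (fst ` set us)" by force
    finally have aq: "a [^]\<^bsub>A\<^esub> q \<in> kspan ((\<lambda>a. a [^]\<^bsub>A\<^esub> q) ` (fst ` set us))" .
    have S: "fst ` set us \<subseteq> carrier A" using c(1) unfolding tlists_def by auto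
    obtain x where x: "x \<in> kspan (fst ` set us)" "a [^]\<^bsub>A\<^esub> q = x [^]\<^bsub>A\<^esub> q"
      using frob_kspan[OF S aq] by blast
    have "a = x" using A.frob_inj[OF frob_A c(2) kspan_carrier[OF x(1) S] x(2)] .
    then show ?thesis using minrep_not_span[OF xs(1), of "[]" a b us] x(1) Cons u by simp
  qed
qed

text \<open>The map \<open>\<sigma>\<close> keeps the left entries, which are independent in a shortest representation.\<close>

lemma sigma_inj:
  assumes t: "t \<in> carrier T" and 0: "\<sigma> t = \<zero>\<^bsub>T\<^esub>"
  shows "t = \<zero>\<^bsub>T\<^esub>"
proof -
  obtain xs where xs: "minrep xs" "t = tsum xs" by (rule minrep_exists[OF t])
  show ?thesis
  proof (cases xs)
    case Nil then show ?thesis using xs by simp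
  next
    case (Cons u us)
    obtain a b where u: "u = (a, b)" by (cases u)
    have c: "b \<in> carrier B" using minrep_tlists[OF xs(1)] Cons u by auto
    have ys: "map (\<lambda>(a, b). (a, b [^]\<^bsub>B\<^esub> q)) xs \<in> tlists"
      "tsum (map (\<lambda>(a, b). (a, b [^]\<^bsub>B\<^esub> q)) xs) = \<zero>\<^bsub>T\<^esub>"
      using sigma_pow_tsum[OF minrep_tlists[OF xs(1)], of 1] 0 xs(2) by simp_all
    have "b [^]\<^bsub>B\<^esub> q = \<zero>\<^bsub>B\<^esub>"
      by (rule minrep_left[OF xs(1) ys(1) _ ys(2), of a]) (auto simp: Cons u)
    then have "b = \<zero>\<^bsub>B\<^esub>" using B.pow_eq_zero c by blast
    then show ?thesis using minrep_snd_nonzero xs Cons u by blast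
  qed
qed

lemma sigma_pow_inj:
  "t \<in> carrier T \<Longrightarrow> (\<sigma> ^^ n) t = \<zero>\<^bsub>T\<^esub> \<Longrightarrow> t = \<zero>\<^bsub>T\<^esub>"
  by (induction n) (auto dest: sigma_inj[OF sigma_pow_closed])

text \<open>Let \<open>s\<^sub>j = \<sigma>\<^sup>j y\<close> and suppose that \<open>y s\<^sub>j = 0\<close> for all \<open>j > 0\<close>. Consider tensors \<open>z\<close> with \<open>z s\<^sub>j = s\<^sub>j\<^sup>2\<close> for
one \<open>j\<close> and \<open>z s\<^sub>i = 0\<close> for all \<open>i > j\<close>; for \<open>j = 0\<close> one of them is \<open>y\<close>. The tensor \<open>\<sigma> z - w z\<close>, for \<open>w \<in> B\<close>,
has this property with \<open>j + 1\<close>, and for a suitable \<open>w\<close> it is shorter than \<open>z\<close>. So \<open>z = 0\<close> is reached, and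
then \<open>s\<^sub>j\<^sup>2 = 0\<close>. Since \<open>T\<close> is reduced and \<open>\<sigma>\<close> injective, this forces \<open>y = 0\<close>.\<close>

lemma not_orthogonal:
  assumes y: "y \<in> carrier T" "y \<noteq> \<zero>\<^bsub>T\<^esub>"
  obtains m where "y \<otimes>\<^bsub>T\<^esub> (\<sigma> ^^ Suc m) y \<noteq> \<zero>\<^bsub>T\<^esub>"
proof (rule ccontr)
  assume "\<not> thesis"
  then have orth: "y \<otimes>\<^bsub>T\<^esub> (\<sigma> ^^ Suc m) y = \<zero>\<^bsub>T\<^esub>" for m using that by blast
  define s where "s j = (\<sigma> ^^ j) y" for j
  have sc: "s j \<in> carrier T" for j unfolding s_def using y sigma_pow_closed by blast
  have sS: "s (Suc j) = \<sigma> (s j)" for j by (simp add: s_def)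
  have False if "xs \<in> tlists" "tsum xs \<otimes>\<^bsub>T\<^esub> s j = s j \<otimes>\<^bsub>T\<^esub> s j"
    "\<And>i. j < i \<Longrightarrow> tsum xs \<otimes>\<^bsub>T\<^esub> s i = \<zero>\<^bsub>T\<^esub>" for xs j
    using that
  proof (induction "length xs" arbitrary: xs j rule: less_induct)
    case less
    show ?case
    proof (cases xs)
      case Nil
      then have "s j \<otimes>\<^bsub>T\<^esub> s j = \<zero>\<^bsub>T\<^esub>" using less.prems(2) sc by simp
      then have "s j = \<zero>\<^bsub>T\<^esub>" using T_reduced sc by blast
      then show False using sigma_pow_inj y unfolding s_def by blast
    next
      case (Cons u us)
      obtain a b where u: "u = (a, b)" by (cases u)
      have c: "a \<in> carrier A" "b \<in> carrier B" "us \<in> tlists" using less.prems(1) Cons u by auto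
      let ?z = "tsum xs" and ?w = "b [^]\<^bsub>B\<^esub> (q - 1)"
      let ?xs' = "map (\<lambda>(a', b'). (a', b' [^]\<^bsub>B\<^esub> q \<ominus>\<^bsub>B\<^esub> ?w \<otimes>\<^bsub>B\<^esub> b'))"
      \<comment> \<open>The scalar \<open>b\<^bsup>q-1\<^esup>\<close> makes the first summands of \<open>\<sigma> z\<close> and \<open>w z\<close> agree.\<close>
      let ?z' = "\<sigma> ?z \<ominus>\<^bsub>T\<^esub> pt \<one>\<^bsub>A\<^esub> ?w \<otimes>\<^bsub>T\<^esub> ?z"
      have zc: "?z \<in> carrier T" using less.prems(1) by simp
      have wc: "?w \<in> carrier B" using c by simp
      have ztail: "?z' = tsum (?xs' us)" and ust: "?xs' us \<in> tlists"
      proof -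
        have 1: "?xs' xs \<in> tlists" "tsum (?xs' xs) =
            tsum (map (\<lambda>(a, b'). (a, b' [^]\<^bsub>B\<^esub> q)) xs) \<ominus>\<^bsub>T\<^esub> tsum (map (\<lambda>(a, b'). (a, ?w \<otimes>\<^bsub>B\<^esub> b')) xs)"
          using tsum_diff_right[of "\<lambda>a b'. b' [^]\<^bsub>B\<^esub> q" "\<lambda>a b'. ?w \<otimes>\<^bsub>B\<^esub> b'" xs] less.prems(1) c by auto
        have 2: "tsum (map (\<lambda>(a, b'). (a, b' [^]\<^bsub>B\<^esub> q)) xs) = \<sigma> ?z"
          using sigma_pow_tsum[OF less.prems(1), of 1] by simp
        have e0: "map (\<lambda>(a, b'). (\<one>\<^bsub>A\<^esub> \<otimes>\<^bsub>A\<^esub> a, ?w \<otimes>\<^bsub>B\<^esub> b')) xs = map (\<lambda>(a, b'). (a, ?w \<otimes>\<^bsub>B\<^esub> b')) xs"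
          using less.prems(1) unfolding tlists_def by (intro map_cong) auto
        have 3: "tsum (map (\<lambda>(a, b'). (a, ?w \<otimes>\<^bsub>B\<^esub> b')) xs) = pt \<one>\<^bsub>A\<^esub> ?w \<otimes>\<^bsub>T\<^esub> ?z"
          using conjunct2[OF tsum_scale[OF A.one_closed wc less.prems(1)]] unfolding e0 .
        have "b [^]\<^bsub>B\<^esub> q = ?w \<otimes>\<^bsub>B\<^esub> b"
          using c q_gt_1 B.nat_pow_Suc[of b "q - 1"] by simp
        then have h: "?xs' xs = (a, \<zero>\<^bsub>B\<^esub>) # ?xs' us" using c by (simp add: Cons u)
        show ust: "?xs' us \<in> tlists" using 1(1) unfolding h by simp
        have "tsum (?xs' xs) = tsum (?xs' us)" unfolding h using c ust by simp
        then show "?z' = tsum (?xs' us)" using 1 2 3 by simp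
      qed
      have scl: "\<sigma> ?z \<in> carrier T" "pt \<one>\<^bsub>A\<^esub> ?w \<otimes>\<^bsub>T\<^esub> ?z \<in> carrier T" using zc wc by auto
      have "?z' \<otimes>\<^bsub>T\<^esub> s i = \<sigma> ?z \<otimes>\<^bsub>T\<^esub> s i \<ominus>\<^bsub>T\<^esub> pt \<one>\<^bsub>A\<^esub> ?w \<otimes>\<^bsub>T\<^esub> (?z \<otimes>\<^bsub>T\<^esub> s i)" for i
        using zc wc scl sc by (simp add: a_minus_def T.l_distr T.l_minus T.m_assoc)
      then have e: "?z' \<otimes>\<^bsub>T\<^esub> s i = \<sigma> ?z \<otimes>\<^bsub>T\<^esub> s i" if "j < i" for i
        using less.prems(3)[OF that] zc wc scl sc by (simp add: a_minus_def)
      have "tsum (?xs' us) \<otimes>\<^bsub>T\<^esub> s (Suc j) = \<sigma> (?z \<otimes>\<^bsub>T\<^esub> s j)"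
        using e[of "Suc j"] zc sc unfolding ztail[symmetric] sS by simp
      then have A1: "tsum (?xs' us) \<otimes>\<^bsub>T\<^esub> s (Suc j) = s (Suc j) \<otimes>\<^bsub>T\<^esub> s (Suc j)"
        unfolding less.prems(2) sS using sc by simp
      have A2: "tsum (?xs' us) \<otimes>\<^bsub>T\<^esub> s i = \<zero>\<^bsub>T\<^esub>" if i: "Suc j < i" for i
      proof -
        obtain i' where i': "i = Suc i'" "j < i'" using i by (cases i) auto
        have "tsum (?xs' us) \<otimes>\<^bsub>T\<^esub> s i = \<sigma> (?z \<otimes>\<^bsub>T\<^esub> s i')"
          using e[of i] zc sc i unfolding ztail[symmetric] i'(1) sS by simp
        then show ?thesis using less.prems(3)[OF i'(2)] by simp
      qed
      show False by (rule less.hyps[OF _ ust A1 A2]) (simp add: Cons)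
    qed
  qed
  moreover obtain xs where xs: "minrep xs" "y = tsum xs" by (rule minrep_exists[OF y(1)])
  moreover have "y \<otimes>\<^bsub>T\<^esub> s i = \<zero>\<^bsub>T\<^esub>" if "0 < i" for i
    using orth[of "i - 1"] that by (simp add: s_def)
  moreover have "s 0 = y" by (simp add: s_def)
  ultimately show False using minrep_tlists[OF xs(1)] by metis
qed

lemma unit_scale:
  assumes "b \<in> carrier B" "b \<noteq> \<zero>\<^bsub>B\<^esub>" "t \<in> carrier T" "pt \<one>\<^bsub>A\<^esub> (inv\<^bsub>B\<^esub> b) \<otimes>\<^bsub>T\<^esub> t = \<zero>\<^bsub>T\<^esub>"
  shows "t = \<zero>\<^bsub>T\<^esub>"
proof -
  have b: "inv\<^bsub>B\<^esub> b \<in> carrier B" "b \<otimes>\<^bsub>B\<^esub> inv\<^bsub>B\<^esub> b = \<one>\<^bsub>B\<^esub>" using assms B.field_Units by auto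
  have "pt \<one>\<^bsub>A\<^esub> b \<otimes>\<^bsub>T\<^esub> (pt \<one>\<^bsub>A\<^esub> (inv\<^bsub>B\<^esub> b) \<otimes>\<^bsub>T\<^esub> t) = t"
    using assms(1,3) b by (simp add: T.m_assoc[symmetric] pt_one)
  then show ?thesis using assms by simp
qed

lemma normalise_head:
  assumes xs: "minrep ((a, b) # us)"
  obtains us' where "(a, \<one>\<^bsub>B\<^esub>) # us' \<in> tlists" "length us' = length us"
    "tsum ((a, \<one>\<^bsub>B\<^esub>) # us') = pt \<one>\<^bsub>A\<^esub> (inv\<^bsub>B\<^esub> b) \<otimes>\<^bsub>T\<^esub> tsum ((a, b) # us)"
proof -
  have c: "a \<in> carrier A" "b \<in> carrier B" using minrep_tlists[OF xs] by auto
  have b: "inv\<^bsub>B\<^esub> b \<in> carrier B" "inv\<^bsub>B\<^esub> b \<otimes>\<^bsub>B\<^esub> b = \<one>\<^bsub>B\<^esub>"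
    using minrep_snd_nonzero[OF xs] c B.field_Units by auto
  show ?thesis
    using that[of "map (\<lambda>(a', b'). (\<one>\<^bsub>A\<^esub> \<otimes>\<^bsub>A\<^esub> a', inv\<^bsub>B\<^esub> b \<otimes>\<^bsub>B\<^esub> b')) us"]
      tsum_scale[OF A.one_closed b(1) minrep_tlists[OF xs]] b c by simp
qed

text \<open>Galois descent. A shortest nonzero tensor in \<open>W\<close> with a coefficient \<open>1\<close> is fixed by \<open>\<sigma>\<close>, because
the coefficient \<open>1\<close> cancels in \<open>\<sigma> x - x\<close>. By independence of the left entries all coefficients are then
fixed by Frobenius, so they come from \<open>k\<close> and can be moved to the left.\<close>

lemma invariant_contains_rational:
  assumes W: "W \<subseteq> carrier T" "\<And>x y. x \<in> W \<Longrightarrow> y \<in> W \<Longrightarrow> x \<ominus>\<^bsub>T\<^esub> y \<in> W"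
    "\<And>b x. b \<in> carrier B \<Longrightarrow> x \<in> W \<Longrightarrow> pt \<one>\<^bsub>A\<^esub> b \<otimes>\<^bsub>T\<^esub> x \<in> W" "\<And>x. x \<in> W \<Longrightarrow> \<sigma> x \<in> W"
    and t: "t \<in> W" "t \<noteq> \<zero>\<^bsub>T\<^esub>"
  obtains a where "a \<in> carrier A" "a \<noteq> \<zero>\<^bsub>A\<^esub>" "pt a \<one>\<^bsub>B\<^esub> \<in> W"
proof -
  define Q where "Q xs \<longleftrightarrow> xs \<in> tlists \<and> tsum xs \<in> W \<and> tsum xs \<noteq> \<zero>\<^bsub>T\<^esub>" for xs
  have tT: "t \<in> carrier T" using t W(1) by blast
  obtain xs0 where "xs0 \<in> tlists" "t = tsum xs0" by (rule T_tsum[OF tT])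
  then have "Q xs0" using t unfolding Q_def by simp
  then obtain xs where Qxs: "Q xs" and mn: "\<And>ys. Q ys \<Longrightarrow> length xs \<le> length ys"
    using ex_has_least_nat[of Q xs0 length] by blast
  have mrep: "minrep ys" if "Q ys" "length ys = length xs" for ys
    unfolding minrep_def
  proof (intro conjI ballI impI)
    show "ys \<in> tlists" using that by (simp add: Q_def)
    fix zs assume "zs \<in> tlists" "tsum zs = tsum ys"
    then have "Q zs" using that(1) by (simp add: Q_def)
    then show "length ys \<le> length zs" using mn that(2) by simp
  qed
  have mx: "minrep xs" using mrep Qxs by blast
  note xs = Qxs[unfolded Q_def]
  obtain a b us where x: "xs = (a, b) # us" using xs by (cases xs) auto
  obtain us' where us': "(a, \<one>\<^bsub>B\<^esub>) # us' \<in> tlists" "length us' = length us"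
    "tsum ((a, \<one>\<^bsub>B\<^esub>) # us') = pt \<one>\<^bsub>A\<^esub> (inv\<^bsub>B\<^esub> b) \<otimes>\<^bsub>T\<^esub> tsum xs"
    using normalise_head mx x by blast
  have c: "a \<in> carrier A" "b \<in> carrier B" "b \<noteq> \<zero>\<^bsub>B\<^esub>" using xs x minrep_snd_nonzero mx by auto
  have ib: "inv\<^bsub>B\<^esub> b \<in> carrier B" using c B.field_Units by auto
  let ?ys = "(a, \<one>\<^bsub>B\<^esub>) # us'"
  have tyW: "tsum ?ys \<in> W" unfolding us'(3) by (rule W(3)[OF ib]) (use xs in blast)
  have "tsum ?ys \<noteq> \<zero>\<^bsub>T\<^esub>" unfolding us'(3) using unit_scale[OF c(2,3), of "tsum xs"] xs tsum_closed by blast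
  then have Py: "Q ?ys" using us'(1) tyW unfolding Q_def by blast
  have my: "minrep ?ys" by (rule mrep[OF Py]) (simp add: us'(2) x)
  let ?f = "map (\<lambda>(a, b). (a, b [^]\<^bsub>B\<^esub> q \<ominus>\<^bsub>B\<^esub> b))"
  have d: "?f ?ys \<in> tlists" "tsum (?f ?ys) = tsum (map (\<lambda>(a, b). (a, b [^]\<^bsub>B\<^esub> q)) ?ys) \<ominus>\<^bsub>T\<^esub> tsum (map (\<lambda>(a, b). (a, b)) ?ys)"
    using tsum_diff_right[of "\<lambda>a b. b [^]\<^bsub>B\<^esub> q" "\<lambda>a b. b" ?ys] us'(1) by auto
  have d2: "tsum (?f ?ys) = \<sigma> (tsum ?ys) \<ominus>\<^bsub>T\<^esub> tsum ?ys"
    using d(2) sigma_pow_tsum[OF us'(1), of 1] by simp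
  have hd: "?f ?ys = (a, \<zero>\<^bsub>B\<^esub>) # ?f us'" by simp
  have ft: "?f us' \<in> tlists" using d(1) unfolding hd by simp
  have e0: "tsum (?f us') = tsum (?f ?ys)" unfolding hd using ft c by simp
  then have "tsum (?f us') = \<sigma> (tsum ?ys) \<ominus>\<^bsub>T\<^esub> tsum ?ys" unfolding d2 .
  then have "tsum (?f us') \<in> W" by (simp only:) (rule W(2)[OF W(4)[OF tyW] tyW])
  have "tsum (?f us') = \<zero>\<^bsub>T\<^esub>"
  proof (rule ccontr)
    assume "tsum (?f us') \<noteq> \<zero>\<^bsub>T\<^esub>"
    then have "Q (?f us')" using ft \<open>tsum (?f us') \<in> W\<close> unfolding Q_def by blast
    then have "length xs \<le> length (?f us')" by (rule mn)
    then show False using us'(2) x by simp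
  qed
  then have z: "tsum (?f ?ys) = \<zero>\<^bsub>T\<^esub>" by (rule trans[OF e0[symmetric]])
  have fixd: "\<exists>c\<in>carrier k. b' = \<beta> c" if ab: "(a', b') \<in> set ?ys" for a' b'
  proof -
    have bc: "b' \<in> carrier B" using tlists_mem[OF us'(1) ab] by simp
    have "(a', b' [^]\<^bsub>B\<^esub> q \<ominus>\<^bsub>B\<^esub> b') \<in> set (?f ?ys)" using ab by force
    then have "b' [^]\<^bsub>B\<^esub> q \<ominus>\<^bsub>B\<^esub> b' = \<zero>\<^bsub>B\<^esub>"
      by (rule minrep_left[OF my d(1) _ z, rotated]) (simp add: comp_def case_prod_unfold)
    then have "b' [^]\<^bsub>B\<^esub> q = b'" using bc by simp
    then show ?thesis using fixed_B[OF bc] by blast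
  qed
  have "\<exists>e\<in>carrier A. tsum zs = pt e \<one>\<^bsub>B\<^esub>"
    if "zs \<in> tlists" "\<And>a' b'. (a', b') \<in> set zs \<Longrightarrow> \<exists>c\<in>carrier k. b' = \<beta> c" for zs
    using that
  proof (induction zs)
    case Nil then show ?case by (intro bexI[of _ "\<zero>\<^bsub>A\<^esub>"]) auto
  next
    case (Cons u zs)
    obtain a' b' where u: "u = (a', b')" by (cases u)
    obtain c where c: "c \<in> carrier k" "b' = \<beta> c" using Cons.prems(2)[of a' b'] u by auto
    obtain e where e: "e \<in> carrier A" "tsum zs = pt e \<one>\<^bsub>B\<^esub>" using Cons by (auto simp: u)
    have ac: "a' \<in> carrier A" using Cons.prems(1) u by simp
    have "pt a' b' = pt (\<alpha> c \<otimes>\<^bsub>A\<^esub> a') \<one>\<^bsub>B\<^esub>" using pt_balanced[of c a' "\<one>\<^bsub>B\<^esub>"] c ac by simp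
    then show ?case using e ac c u
      by (intro bexI[of _ "\<alpha> c \<otimes>\<^bsub>A\<^esub> a' \<oplus>\<^bsub>A\<^esub> e"]) (auto simp: pt_add_left)
  qed
  then obtain e where e: "e \<in> carrier A" "tsum ?ys = pt e \<one>\<^bsub>B\<^esub>" using us'(1) fixd by blast
  have "e \<noteq> \<zero>\<^bsub>A\<^esub>" using \<open>tsum ?ys \<noteq> \<zero>\<^bsub>T\<^esub>\<close> unfolding e(2) using pt_zero_left[OF B.one_closed] by metis
  then show ?thesis using that[OF e(1)] tyW unfolding e(2) by blast
qed

text \<open>Suppose that \<open>t y = 0\<close> with \<open>t, y \<noteq> 0\<close>, where \<open>t = a \<otimes> 1 + \<dots>\<close> is as short as possible among all such \<open>t\<close>,
and choose \<open>n > 0\<close> with \<open>y \<sigma>\<^sup>n y \<noteq> 0\<close>. Put \<open>Q = q\<^sup>n\<close>. The tensor \<open>\<sigma>\<^sup>n t - t\<close> is shorter and kills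
\<open>y \<sigma>\<^sup>n y\<close>, so it vanishes: the coefficients \<open>b\<close> of \<open>t\<close> satisfy \<open>b\<^sup>Q = b\<close>. Hence \<open>t\<^sup>Q\<close> arises from \<open>t\<close> by raising the
left entries to the power \<open>Q\<close>, and \<open>(a\<^bsup>Q-1\<^esup> \<otimes> 1) t - t\<^sup>Q\<close> is shorter and kills \<open>y\<close>. So it vanishes as well:
every left entry \<open>a'\<close> satisfies \<open>a'\<^sup>Q = a\<^bsup>Q-1\<^esup> a'\<close>, and by assumption is a multiple of \<open>a\<close>. Thus
\<open>t = a \<otimes> 1\<close>, which is not a zero divisor because \<open>A\<close> is a domain.\<close>

theorem tensor_domain:
  assumes rat: "\<And>m u e. u \<in> carrier A \<Longrightarrow> e \<in> carrier A \<Longrightarrow> e \<noteq> \<zero>\<^bsub>A\<^esub> \<Longrightarrow>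
      u [^]\<^bsub>A\<^esub> (q ^ Suc m) = e [^]\<^bsub>A\<^esub> (q ^ Suc m - 1) \<otimes>\<^bsub>A\<^esub> u \<Longrightarrow> \<exists>c\<in>carrier k. u = \<alpha> c \<otimes>\<^bsub>A\<^esub> e"
  shows "domain T"
proof (rule domainI[OF T.is_cring])
  show "\<one>\<^bsub>T\<^esub> \<noteq> \<zero>\<^bsub>T\<^esub>"
    using pt_one_nonzero[OF A.one_closed A.one_not_zero B.one_not_zero] unfolding pt_one .
next
  fix t0 y0 assume t0: "t0 \<in> carrier T" and y0: "y0 \<in> carrier T" and ty: "t0 \<otimes>\<^bsub>T\<^esub> y0 = \<zero>\<^bsub>T\<^esub>"
  show "t0 = \<zero>\<^bsub>T\<^esub> \<or> y0 = \<zero>\<^bsub>T\<^esub>"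
  proof (rule ccontr)
    assume n0: "\<not> (t0 = \<zero>\<^bsub>T\<^esub> \<or> y0 = \<zero>\<^bsub>T\<^esub>)"
    define Q where "Q xs \<longleftrightarrow> xs \<in> tlists \<and> tsum xs \<noteq> \<zero>\<^bsub>T\<^esub> \<and>
      (\<exists>y\<in>carrier T. y \<noteq> \<zero>\<^bsub>T\<^esub> \<and> tsum xs \<otimes>\<^bsub>T\<^esub> y = \<zero>\<^bsub>T\<^esub>)" for xs
    obtain xs0 where "xs0 \<in> tlists" "t0 = tsum xs0" by (rule T_tsum[OF t0])
    then have "Q xs0" using y0 ty n0 unfolding Q_def by blast
    then obtain xs where Qxs: "Q xs" and mn: "\<And>ys. Q ys \<Longrightarrow> length xs \<le> length ys"
      using ex_has_least_nat[of Q xs0 length] by blast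
    note xs = Qxs[unfolded Q_def]
    have mrep: "minrep ys" if "Q ys" "length ys = length xs" for ys
      unfolding minrep_def
    proof (intro conjI ballI impI)
      show "ys \<in> tlists" using that by (simp add: Q_def)
      fix zs assume "zs \<in> tlists" "tsum zs = tsum ys"
      then have "Q zs" using that(1) by (simp add: Q_def)
      then show "length ys \<le> length zs" using mn that(2) by simp
    qed
    have small: "tsum ys = \<zero>\<^bsub>T\<^esub>" if "ys \<in> tlists" "length ys < length xs" "y \<in> carrier T" "y \<noteq> \<zero>\<^bsub>T\<^esub>"
      "tsum ys \<otimes>\<^bsub>T\<^esub> y = \<zero>\<^bsub>T\<^esub>" for ys y
    proof (rule ccontr)
      assume "tsum ys \<noteq> \<zero>\<^bsub>T\<^esub>"
      then have "Q ys" using that unfolding Q_def by blast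
      then have "length xs \<le> length ys" by (rule mn)
      then show False using that(2) by simp
    qed
    have mx: "minrep xs" using mrep Qxs by blast
    obtain y where y: "y \<in> carrier T" "y \<noteq> \<zero>\<^bsub>T\<^esub>" "tsum xs \<otimes>\<^bsub>T\<^esub> y = \<zero>\<^bsub>T\<^esub>" using xs by blast
    obtain a b us0 where x: "xs = (a, b) # us0" using xs by (cases xs) auto
    obtain us where us: "(a, \<one>\<^bsub>B\<^esub>) # us \<in> tlists" "length us = length us0"
      "tsum ((a, \<one>\<^bsub>B\<^esub>) # us) = pt \<one>\<^bsub>A\<^esub> (inv\<^bsub>B\<^esub> b) \<otimes>\<^bsub>T\<^esub> tsum xs"
      using normalise_head mx x by blast
    have c: "a \<in> carrier A" "b \<in> carrier B" "b \<noteq> \<zero>\<^bsub>B\<^esub>" using xs x minrep_snd_nonzero mx by auto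
    have ib: "inv\<^bsub>B\<^esub> b \<in> carrier B" using c B.field_Units by auto
    let ?ys = "(a, \<one>\<^bsub>B\<^esub>) # us"
    let ?t = "tsum ?ys"
    have tc: "?t \<in> carrier T" and ust: "us \<in> tlists" using us(1) tsum_closed by auto
    have txy: "?t \<otimes>\<^bsub>T\<^esub> y = \<zero>\<^bsub>T\<^esub>"
      unfolding us(3) using y ib xs by (subst T.m_assoc) auto
    have tn: "?t \<noteq> \<zero>\<^bsub>T\<^esub>" unfolding us(3) using unit_scale[OF c(2,3) tsum_closed] xs by blast
    have len: "length us < length xs" "length ?ys = length xs" using us(2) x by auto
    have "Q ?ys" unfolding Q_def by (intro conjI us(1) tn bexI[of _ y] y txy)
    then have my: "minrep ?ys" using mrep len(2) by blast
    have an: "a \<noteq> \<zero>\<^bsub>A\<^esub>"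
    proof
      assume "a = \<zero>\<^bsub>A\<^esub>"
      then have "?t = tsum us" using ust by simp
      then have "length ?ys \<le> length us" using my ust unfolding minrep_def by metis
      then show False by simp
    qed
    obtain m where m0: "y \<otimes>\<^bsub>T\<^esub> (\<sigma> ^^ Suc m) y \<noteq> \<zero>\<^bsub>T\<^esub>" by (rule not_orthogonal[OF y(1,2)])
    define n where "n = Suc m"
    note m = m0[folded n_def]
    let ?Q = "q ^ n" and ?s = "\<sigma> ^^ n"
    have fQT: "frob_exp T ?Q" unfolding n_def by (rule frob_exp_pow[OF frob_T])
    interpret s: ring_hom_ring T T ?s by (rule sigma_pow_ring_hom)
    have syc: "?s y \<in> carrier T" by (rule s.hom_closed[OF y(1)])
    \<comment> \<open>The tensor \<open>\<sigma>\<^sup>n t - t\<close> has the coefficients \<open>b\<^sup>Q - b\<close>, the first of which is \<open>1 - 1\<close>.\<close>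
    let ?f = "map (\<lambda>(a, b). (a, b [^]\<^bsub>B\<^esub> ?Q \<ominus>\<^bsub>B\<^esub> b))"
    have d: "?f ?ys \<in> tlists" "tsum (?f ?ys) = tsum (map (\<lambda>(a, b). (a, b [^]\<^bsub>B\<^esub> ?Q)) ?ys) \<ominus>\<^bsub>T\<^esub> tsum (map (\<lambda>(a, b). (a, b)) ?ys)"
      using tsum_diff_right[of "\<lambda>a b. b [^]\<^bsub>B\<^esub> ?Q" "\<lambda>a b. b" ?ys] us(1) by auto
    have d2: "tsum (?f ?ys) = ?s ?t \<ominus>\<^bsub>T\<^esub> ?t"
      using d(2) sigma_pow_tsum[OF us(1), of n] by simp
    have hd: "?f ?ys = (a, \<zero>\<^bsub>B\<^esub>) # ?f us" by simp
    have ft: "?f us \<in> tlists" using d(1) unfolding hd by simp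
    have e1: "tsum (?f us) = tsum (?f ?ys)" unfolding hd using ft c by simp
    have stc: "?s ?t \<in> carrier T" using tc by (rule s.hom_closed)
    have "?s ?t \<otimes>\<^bsub>T\<^esub> ?s y = \<zero>\<^bsub>T\<^esub>" using s.hom_mult[OF tc y(1)] txy s.hom_zero by simp
    then have "(?s ?t \<ominus>\<^bsub>T\<^esub> ?t) \<otimes>\<^bsub>T\<^esub> (y \<otimes>\<^bsub>T\<^esub> ?s y) = \<zero>\<^bsub>T\<^esub>"
    proof -
      have "(?s ?t \<ominus>\<^bsub>T\<^esub> ?t) \<otimes>\<^bsub>T\<^esub> (y \<otimes>\<^bsub>T\<^esub> ?s y) =
        y \<otimes>\<^bsub>T\<^esub> (?s ?t \<otimes>\<^bsub>T\<^esub> ?s y) \<ominus>\<^bsub>T\<^esub> (?t \<otimes>\<^bsub>T\<^esub> y) \<otimes>\<^bsub>T\<^esub> ?s y"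
      proof -
        have "(p \<ominus>\<^bsub>T\<^esub> r) \<otimes>\<^bsub>T\<^esub> (v \<otimes>\<^bsub>T\<^esub> w) = v \<otimes>\<^bsub>T\<^esub> (p \<otimes>\<^bsub>T\<^esub> w) \<ominus>\<^bsub>T\<^esub> (r \<otimes>\<^bsub>T\<^esub> v) \<otimes>\<^bsub>T\<^esub> w"
          if "p \<in> carrier T" "r \<in> carrier T" "v \<in> carrier T" "w \<in> carrier T" for p r v w
          using that by (simp add: a_minus_def T.l_distr T.r_distr T.l_minus T.r_minus T.m_ac)
        then show ?thesis using stc tc y(1) syc by blast
      qed
      then show ?thesis using \<open>?s ?t \<otimes>\<^bsub>T\<^esub> ?s y = \<zero>\<^bsub>T\<^esub>\<close> txy y(1) syc by (simp only: T.r_null T.l_null T.r_right_minus_eq T.zero_closed)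
    qed
    then have "tsum (?f us) = \<zero>\<^bsub>T\<^esub>"
      using small[OF ft, of "y \<otimes>\<^bsub>T\<^esub> ?s y"] len(1) m y(1) syc unfolding e1 d2 by simp
    then have z: "tsum (?f ?ys) = \<zero>\<^bsub>T\<^esub>" by (rule trans[OF e1[symmetric]])
    have fixd: "b' [^]\<^bsub>B\<^esub> ?Q = b'" if ab: "(a', b') \<in> set ?ys" for a' b'
    proof -
      have bc: "b' \<in> carrier B" using tlists_mem[OF us(1) ab] by simp
      have "(a', b' [^]\<^bsub>B\<^esub> ?Q \<ominus>\<^bsub>B\<^esub> b') \<in> set (?f ?ys)" using ab by force
      then have "b' [^]\<^bsub>B\<^esub> ?Q \<ominus>\<^bsub>B\<^esub> b' = \<zero>\<^bsub>B\<^esub>"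
        by (rule minrep_left[OF my d(1) _ z, rotated]) (simp add: comp_def case_prod_unfold)
      then show ?thesis using bc by simp
    qed
    \<comment> \<open>The left entry of the first summand of \<open>(a\<^bsup>Q-1\<^esup> \<otimes> 1) t - t\<^sup>Q\<close> is \<open>a\<^bsup>Q-1\<^esup> a - a\<^sup>Q = 0\<close>.\<close>
    let ?w = "a [^]\<^bsub>A\<^esub> (?Q - 1)"
    let ?g = "map (\<lambda>(a', b). (?w \<otimes>\<^bsub>A\<^esub> a' \<ominus>\<^bsub>A\<^esub> a' [^]\<^bsub>A\<^esub> ?Q, b))"
    have wc: "?w \<in> carrier A" using c by simp
    have g: "?g ?ys \<in> tlists" "tsum (?g ?ys) = tsum (map (\<lambda>(a', b). (?w \<otimes>\<^bsub>A\<^esub> a', b)) ?ys) \<ominus>\<^bsub>T\<^esub>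
        tsum (map (\<lambda>(a', b). (a' [^]\<^bsub>A\<^esub> ?Q, b)) ?ys)"
      using tsum_diff_left[of "\<lambda>a' b. ?w \<otimes>\<^bsub>A\<^esub> a'" "\<lambda>a' b. a' [^]\<^bsub>A\<^esub> ?Q" ?ys] us(1) wc by auto
    have "map (\<lambda>(a', b). (?w \<otimes>\<^bsub>A\<^esub> a', \<one>\<^bsub>B\<^esub> \<otimes>\<^bsub>B\<^esub> b)) ?ys = map (\<lambda>(a', b). (?w \<otimes>\<^bsub>A\<^esub> a', b)) ?ys"
      using us(1) unfolding tlists_def by (intro map_cong) auto
    then have g1: "tsum (map (\<lambda>(a', b). (?w \<otimes>\<^bsub>A\<^esub> a', b)) ?ys) = pt ?w \<one>\<^bsub>B\<^esub> \<otimes>\<^bsub>T\<^esub> ?t"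
      using tsum_scale[OF wc B.one_closed us(1)] by metis
    have "map (\<lambda>(a', b). (a' [^]\<^bsub>A\<^esub> ?Q, b [^]\<^bsub>B\<^esub> ?Q)) ?ys = map (\<lambda>(a', b). (a' [^]\<^bsub>A\<^esub> ?Q, b)) ?ys"
      using fixd by (intro map_cong) auto
    then have g2: "tsum (map (\<lambda>(a', b). (a' [^]\<^bsub>A\<^esub> ?Q, b)) ?ys) = ?t [^]\<^bsub>T\<^esub> ?Q"
      using tsum_pow[OF fQT us(1)] by metis
    have Q1: "1 < ?Q" using frob_exp_gt_1[OF fQT] .
    have QS: "Suc (?Q - 1) = ?Q" using Q1 by simp
    have "?w \<otimes>\<^bsub>A\<^esub> a = a [^]\<^bsub>A\<^esub> ?Q"
      using A.nat_pow_Suc[of a "?Q - 1"] unfolding QS by (rule sym)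
    then have ghd: "?g ?ys = (\<zero>\<^bsub>A\<^esub>, \<one>\<^bsub>B\<^esub>) # ?g us" using c by simp
    have gt: "?g us \<in> tlists" using g(1) unfolding ghd by simp
    have e2: "tsum (?g us) = tsum (?g ?ys)" unfolding ghd using gt by simp
    have "?t [^]\<^bsub>T\<^esub> ?Q = ?t [^]\<^bsub>T\<^esub> (?Q - 1) \<otimes>\<^bsub>T\<^esub> ?t"
      using T.nat_pow_Suc[of ?t "?Q - 1"] unfolding QS .
    then have "tsum (?g ?ys) = (pt ?w \<one>\<^bsub>B\<^esub> \<ominus>\<^bsub>T\<^esub> ?t [^]\<^bsub>T\<^esub> (?Q - 1)) \<otimes>\<^bsub>T\<^esub> ?t"
      unfolding g(2) g1 g2 using wc tc by (simp add: a_minus_def T.l_distr T.l_minus)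
    then have "tsum (?g us) \<otimes>\<^bsub>T\<^esub> y = \<zero>\<^bsub>T\<^esub>"
      unfolding e2 using wc tc y(1) txy by (simp only: T.m_assoc T.r_null T.minus_closed pt_closed B.one_closed T.nat_pow_closed)
    then have "tsum (?g us) = \<zero>\<^bsub>T\<^esub>" using small[OF gt] len(1) y by simp
    then have z2: "tsum (?g ?ys) = \<zero>\<^bsub>T\<^esub>" by (rule trans[OF e2[symmetric]])
    have propo: "\<exists>c\<in>carrier k. a' = \<alpha> c \<otimes>\<^bsub>A\<^esub> a" if ab: "(a', b') \<in> set ?ys" for a' b'
    proof -
      have ac: "a' \<in> carrier A" using tlists_mem[OF us(1) ab] by simp
      have "(?w \<otimes>\<^bsub>A\<^esub> a' \<ominus>\<^bsub>A\<^esub> a' [^]\<^bsub>A\<^esub> ?Q, b') \<in> set (?g ?ys)" using ab by force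
      then have "?w \<otimes>\<^bsub>A\<^esub> a' \<ominus>\<^bsub>A\<^esub> a' [^]\<^bsub>A\<^esub> ?Q = \<zero>\<^bsub>A\<^esub>"
        by (rule minrep_right[OF my g(1) _ z2, rotated]) (simp add: comp_def case_prod_unfold)
      then have "?w \<otimes>\<^bsub>A\<^esub> a' = a' [^]\<^bsub>A\<^esub> ?Q" using ac wc A.r_right_minus_eq by simp
      then show ?thesis using rat[OF ac c(1) an, of m] unfolding n_def by simp
    qed
    have "us = []"
    proof (cases us)
      case (Cons v vs)
      obtain a1 b1 where v: "v = (a1, b1)" by (cases v)
      obtain d where dd: "d \<in> carrier k" "a1 = \<alpha> d \<otimes>\<^bsub>A\<^esub> a" using propo[of a1 b1] Cons v by auto
      have cc: "b1 \<in> carrier B" "vs \<in> tlists" using ust Cons v by auto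
      \<comment> \<open>A second summand that is a multiple of the first one could be merged into it.\<close>
      let ?zs = "(a, \<one>\<^bsub>B\<^esub> \<oplus>\<^bsub>B\<^esub> \<beta> d \<otimes>\<^bsub>B\<^esub> b1) # vs"
      have "?zs \<in> tlists" "tsum ?zs = ?t" using Cons v dd cc c
        by (auto simp: pt_add_right pt_balanced T.a_assoc)
      then have "length ?ys \<le> length ?zs" using my unfolding minrep_def by blast
      then show ?thesis using Cons by simp
    qed
    then have te: "?t = pt a \<one>\<^bsub>B\<^esub>" using c by simp
    obtain ws where ws: "minrep ws" "y = tsum ws" by (rule minrep_exists[OF y(1)])
    let ?h = "map (\<lambda>(a', b'). (a \<otimes>\<^bsub>A\<^esub> a', \<one>\<^bsub>B\<^esub> \<otimes>\<^bsub>B\<^esub> b'))"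
    have h: "?h ws \<in> tlists" "tsum (?h ws) = \<zero>\<^bsub>T\<^esub>"
      using tsum_scale[OF c(1) B.one_closed minrep_tlists[OF ws(1)]] txy ws(2) te by auto
    obtain a1 b1 ws' where w1: "ws = (a1, b1) # ws'" using y ws by (cases ws) auto
    have cw: "a1 \<in> carrier A" "ws' \<in> tlists" "b1 \<in> carrier B" using minrep_tlists[OF ws(1)] w1 by auto
    have "map snd (?h ws) = map snd ws"
      using minrep_tlists[OF ws(1)] unfolding tlists_def by (auto simp: comp_def case_prod_unfold)
    then have "a \<otimes>\<^bsub>A\<^esub> a1 = \<zero>\<^bsub>A\<^esub>"
      by (intro minrep_right[OF ws(1) h(1) _ h(2), of _ "\<one>\<^bsub>B\<^esub> \<otimes>\<^bsub>B\<^esub> b1"]) (auto simp: w1)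
    then have "a1 = \<zero>\<^bsub>A\<^esub>" using an c cw by (simp add: A.integral_iff)
    then have "tsum ws' = tsum ws" using w1 cw by simp
    then have "length ws \<le> length ws'" using ws(1) cw unfolding minrep_def by simp
    then show False using w1 by simp
  qed
qed

end

section \<open>Fractions that are algebraic over the finite field\<close>

context frobenius_tensor
begin

lemma kspan_singleton: "x \<in> kspan {s} \<Longrightarrow> s \<in> carrier A \<Longrightarrow> \<exists>c\<in>carrier k. x = \<alpha> c \<otimes>\<^bsub>A\<^esub> s"
proof (induction rule: kspan.induct)
  case zero then show ?case by (intro bexI[of _ "\<zero>\<^bsub>k\<^esub>"]) auto
next
  case (step x c s')
  then obtain d where d: "d \<in> carrier k" "x = \<alpha> d \<otimes>\<^bsub>A\<^esub> s" by blast
  then show ?case using step by (intro bexI[of _ "d \<oplus>\<^bsub>k\<^esub> c"]) (auto simp: A.l_distr)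
qed

lemma k_pow_pow: "c \<in> carrier k \<Longrightarrow> c [^]\<^bsub>k\<^esub> (q ^ n) = c"
proof (induction n)
  case (Suc n)
  have "c [^]\<^bsub>k\<^esub> (q ^ Suc n) = (c [^]\<^bsub>k\<^esub> (q ^ n)) [^]\<^bsub>k\<^esub> q" using Suc.prems by (simp add: k.nat_pow_pow mult.commute)
  then show ?case using Suc k_pow by simp
qed simp

text \<open>Irreducibility of the spectrum says that the nilradical \<open>N\<close> of
\<open>T\<close> is prime. The form \<open>X\<^sup>Q - X\<close> splits over the algebraically closed field \<open>B\<close>, so some \<open>u \<otimes> 1 - e \<otimes> z\<close> is in \<open>N\<close>, hence is nilpotent.
A further Frobenius power \<open>R\<close> makes it zero, so that \<open>u\<^sup>R\<close> is a \<open>k\<close>-multiple of \<open>e\<^sup>R\<close>. As elements of \<open>k\<close> are their own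
\<open>R\<close>-th powers and \<open>R\<close>-th roots in \<open>A\<close> are unique, \<open>u\<close> is a \<open>k\<close>-multiple of \<open>e\<close>.\<close>

lemma homogeneous_ratio:
  assumes ac: "algebraically_closed B" and irr: "irreducible_spectrum T"
    and u: "u \<in> carrier A" and e: "e \<in> carrier A"
    and eq: "u [^]\<^bsub>A\<^esub> (q ^ Suc m) = e [^]\<^bsub>A\<^esub> (q ^ Suc m - 1) \<otimes>\<^bsub>A\<^esub> u"
  shows "\<exists>c\<in>carrier k. u = \<alpha> c \<otimes>\<^bsub>A\<^esub> e"
proof -
  define N where "N = {x \<in> carrier T. \<forall>P. primeideal P T \<longrightarrow> x \<in> P}"
  have N1: "\<one>\<^bsub>T\<^esub> \<notin> N"
  proof
    assume "\<one>\<^bsub>T\<^esub> \<in> N"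
    obtain P where P: "primeideal P T" using irr unfolding irreducible_spectrum_def by blast
    interpret P: primeideal P T by fact
    have "\<one>\<^bsub>T\<^esub> \<in> P" using \<open>\<one>\<^bsub>T\<^esub> \<in> N\<close> P unfolding N_def by blast
    then show False using P.one_imp_carrier P.I_notcarr by blast
  qed
  have N2: "x \<in> N \<or> y \<in> N" if xy: "x \<in> carrier T" "y \<in> carrier T" "x \<otimes>\<^bsub>T\<^esub> y \<in> N" for x y
  proof (rule ccontr)
    assume "\<not> (x \<in> N \<or> y \<in> N)"
    then have "(\<exists>P. primeideal P T \<and> x \<notin> P) \<and> (\<exists>P. primeideal P T \<and> y \<notin> P)" using xy unfolding N_def by blast
    then obtain P where P: "primeideal P T" "x \<notin> P" "y \<notin> P" using irr xy unfolding irreducible_spectrum_def by blast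
    have "x \<otimes>\<^bsub>T\<^esub> y \<in> P" using xy P unfolding N_def by blast
    then show False using primeideal.I_prime[OF P(1) xy(1,2)] P by blast
  qed
  let ?h = "\<lambda>b. pt \<one>\<^bsub>A\<^esub> b" and ?Q = "q ^ Suc m"
  interpret h: ring_hom_ring B T ?h by (rule ring_hom_ringI2[OF B.ring_axioms T.ring_axioms right_hom])
  have Q1: "1 < ?Q" using frob_exp_gt_1[OF frob_exp_pow[OF frob_T]] .
  have mapf: "map ?h (B.frob_poly ?Q) = T.frob_poly ?Q"
    unfolding B.frob_poly_def T.frob_poly_def using h.hom_one h.hom_zero h.hom_a_inv[OF B.one_closed]
    by (simp only: list.map map_append map_replicate)
  have ue: "pt u \<one>\<^bsub>B\<^esub> \<in> carrier T" "pt e \<one>\<^bsub>B\<^esub> \<in> carrier T" using u e by auto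
  have N0: "\<zero>\<^bsub>T\<^esub> \<in> N"
    unfolding N_def by (intro CollectI conjI allI impI T.zero_closed) (rule additive_subgroup.zero_closed[OF ideal.axioms(1)[OF primeideal.axioms(1)]])
  have h0: "hom_eval T (pt u \<one>\<^bsub>B\<^esub>) (pt e \<one>\<^bsub>B\<^esub>) (map ?h (B.frob_poly ?Q)) = \<zero>\<^bsub>T\<^esub>"
    unfolding mapf T.hom_eval_frob_poly[OF Q1 ue] using u e eq
    by (simp only: pt_pow B.one_closed pt_mult A.nat_pow_closed B.nat_pow_one B.l_one T.r_right_minus_eq pt_closed A.m_closed)
  have z: "hom_eval T (pt u \<one>\<^bsub>B\<^esub>) (pt e \<one>\<^bsub>B\<^esub>) (map ?h (B.frob_poly ?Q)) \<in> N"
    unfolding h0 by (rule N0)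
  have ne: "B.frob_poly ?Q \<noteq> []" by (simp add: B.frob_poly_def)
  obtain z where z: "z \<in> carrier B" "pt u \<one>\<^bsub>B\<^esub> \<ominus>\<^bsub>T\<^esub> pt \<one>\<^bsub>A\<^esub> z \<otimes>\<^bsub>T\<^esub> pt e \<one>\<^bsub>B\<^esub> \<in> N"
    using bexE[OF algebraically_closed.linear_factor_in_prime[OF ac T.is_cring right_hom N1 N2 ue
        B.frob_poly_props(1)[OF Q1] ne B.frob_poly_props(3)[OF Q1] z]] by metis
  let ?w = "pt u \<one>\<^bsub>B\<^esub> \<ominus>\<^bsub>T\<^esub> pt e z"
  have w: "?w \<in> carrier T" "?w \<in> N" using z u e by simp_all
  have "\<exists>n::nat. ?w [^]\<^bsub>T\<^esub> n = \<zero>\<^bsub>T\<^esub>"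
  proof (rule ccontr)
    assume nn: "\<not> (\<exists>n::nat. ?w [^]\<^bsub>T\<^esub> n = \<zero>\<^bsub>T\<^esub>)"
    let ?S = "range (\<lambda>n::nat. ?w [^]\<^bsub>T\<^esub> n)"
    have S1: "?S \<subseteq> carrier T" using T.nat_pow_closed[OF w(1)] by blast
    have S2: "\<one>\<^bsub>T\<^esub> \<in> ?S" using T.nat_pow_0[of ?w] by (metis rangeI)
    have S3: "x \<otimes>\<^bsub>T\<^esub> y \<in> ?S" if xy: "x \<in> ?S" "y \<in> ?S" for x y
    proof -
      obtain i :: nat where i: "x = ?w [^]\<^bsub>T\<^esub> i" using xy(1) by (rule rangeE)
      obtain j :: nat where j: "y = ?w [^]\<^bsub>T\<^esub> j" using xy(2) by (rule rangeE)
      have "x \<otimes>\<^bsub>T\<^esub> y = ?w [^]\<^bsub>T\<^esub> (i + j)" unfolding i j by (rule T.nat_pow_mult[OF w(1)])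
      then show ?thesis by (rule image_eqI[OF _ UNIV_I])
    qed
    have S4: "{\<zero>\<^bsub>T\<^esub>} \<inter> ?S = {}" 
    proof (rule ccontr)
      assume "{\<zero>\<^bsub>T\<^esub>} \<inter> ?S \<noteq> {}"
      then have "\<zero>\<^bsub>T\<^esub> \<in> ?S" by blast
      then obtain n :: nat where "\<zero>\<^bsub>T\<^esub> = ?w [^]\<^bsub>T\<^esub> n" by (elim rangeE)
      then show False using nn by (metis (no_types))
    qed
    obtain P where P: "primeideal P T" "P \<inter> ?S = {}"
      by (rule T.prime_ideal_avoiding[OF T.zeroideal S1 S2 S3 S4])
    have "?w \<in> P" using w P(1) unfolding N_def by blast
    moreover have "?w [^]\<^bsub>T\<^esub> (1::nat) = ?w" using w(1) by simp
    moreover have "?w [^]\<^bsub>T\<^esub> (1::nat) \<in> ?S" by (rule rangeI)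
    ultimately show False using P(2) by auto
  qed
  then obtain n :: nat where n: "?w [^]\<^bsub>T\<^esub> n = \<zero>\<^bsub>T\<^esub>" by blast
  \<comment> \<open>A power of \<open>q\<close> that exceeds the exponent of nilpotency.\<close>
  let ?R = "q ^ Suc n"
  have fR: "frob_exp T ?R" by (rule frob_exp_pow[OF frob_T])
  have fRA: "frob_exp A ?R" by (rule frob_exp_pow[OF frob_A])
  have "n < ?R" using q_gt_1 power_gt_expt[of q "Suc n"] by simp
  then have nR: "?R = (?R - n) + n" by simp
  have "?w [^]\<^bsub>T\<^esub> ?R = ?w [^]\<^bsub>T\<^esub> (?R - n) \<otimes>\<^bsub>T\<^esub> ?w [^]\<^bsub>T\<^esub> n"
    by (subst nR) (rule T.nat_pow_mult[OF w(1), symmetric])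
  then have wR: "?w [^]\<^bsub>T\<^esub> ?R = \<zero>\<^bsub>T\<^esub>" unfolding n using T.r_null T.nat_pow_closed[OF w(1)] by metis
  let ?u = "u [^]\<^bsub>A\<^esub> ?R" and ?e = "e [^]\<^bsub>A\<^esub> ?R" and ?z = "z [^]\<^bsub>B\<^esub> ?R"
  have cl: "?u \<in> carrier A" "?e \<in> carrier A" "?z \<in> carrier B" using u e z by auto
  have d: "pt ?u \<one>\<^bsub>B\<^esub> \<ominus>\<^bsub>T\<^esub> pt ?e ?z = \<zero>\<^bsub>T\<^esub>"
    using T.frob_minus[OF fR, of "pt u \<one>\<^bsub>B\<^esub>" "pt e z"] wR u e z(1)
    by (simp only: pt_pow pt_closed B.one_closed B.nat_pow_one)
  have "\<ominus>\<^bsub>A\<^esub> ?e \<in> carrier A" using cl by simp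
  then have xs: "[(?u, \<one>\<^bsub>B\<^esub>), (\<ominus>\<^bsub>A\<^esub> ?e, ?z)] \<in> tlists" using cl by simp
  have ts: "tsum [(?u, \<one>\<^bsub>B\<^esub>), (\<ominus>\<^bsub>A\<^esub> ?e, ?z)] = \<zero>\<^bsub>T\<^esub>"
  proof -
    have "tsum [(?u, \<one>\<^bsub>B\<^esub>), (\<ominus>\<^bsub>A\<^esub> ?e, ?z)] = pt ?u \<one>\<^bsub>B\<^esub> \<oplus>\<^bsub>T\<^esub> (pt (\<ominus>\<^bsub>A\<^esub> ?e) ?z \<oplus>\<^bsub>T\<^esub> \<zero>\<^bsub>T\<^esub>)" by simp
    also have "\<dots> = pt ?u \<one>\<^bsub>B\<^esub> \<ominus>\<^bsub>T\<^esub> pt ?e ?z"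
      using cl pt_minus_left[OF cl(2,3)] T.r_zero[OF pt_closed[OF \<open>\<ominus>\<^bsub>A\<^esub> ?e \<in> carrier A\<close> cl(3)]]
      unfolding a_minus_def by (simp only:)
    finally show ?thesis using d by (rule trans)
  qed
  have "?u \<in> kspan (fst ` set ([] @ [(\<ominus>\<^bsub>A\<^esub> ?e, ?z)]))"
    by (rule relation_span[OF xs _ ts, of _ _ "\<one>\<^bsub>B\<^esub>"]) simp_all
  then have "?u \<in> kspan {\<ominus>\<^bsub>A\<^esub> ?e}" by simp
  then obtain c where c: "c \<in> carrier k" "?u = \<alpha> c \<otimes>\<^bsub>A\<^esub> \<ominus>\<^bsub>A\<^esub> ?e" using kspan_singleton cl by (metis A.a_inv_closed)
  let ?d = "\<ominus>\<^bsub>k\<^esub> c"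
  have dk: "?d \<in> carrier k" using c by simp
  have "?u = \<alpha> ?d \<otimes>\<^bsub>A\<^esub> ?e" using c cl by (simp add: A.r_minus A.l_minus del: nat_pow_Suc power_Suc)
  also have "\<alpha> ?d = \<alpha> ?d [^]\<^bsub>A\<^esub> ?R" using \<alpha>.hom_pow_nat[OF dk, of ?R] k_pow_pow[OF dk, of "Suc n"] by metis
  also have "\<alpha> ?d [^]\<^bsub>A\<^esub> ?R \<otimes>\<^bsub>A\<^esub> ?e = (\<alpha> ?d \<otimes>\<^bsub>A\<^esub> e) [^]\<^bsub>A\<^esub> ?R"
    using A.nat_pow_distrib[OF \<alpha>.hom_closed[OF dk] e] by (rule sym)
  finally have "u = \<alpha> ?d \<otimes>\<^bsub>A\<^esub> e"
    using A.frob_inj[OF fRA u] A.m_closed[OF \<alpha>.hom_closed[OF dk] e] by blast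
  then show ?thesis using dk by blast
qed

end

section \<open>Integral schemes\<close>

locale integral_sch =
  fixes k :: "'k ring" and S :: "('k, 'p, 'a) rspace"
  assumes sch: "scheme_over k S" and int: "integral_scheme S" and k_field: "field k"
begin

abbreviation T where "T \<equiv> topo S"

lemma rs: "ringed_space S" using sch unfolding scheme_over_def by blast

lemma sheaf: "sheaf_of_sets T (\<lambda>U. carrier (sec S U)) (res S)" using rs unfolding ringed_space_def by blast

lemma res_hom: "openin T U \<Longrightarrow> openin T V \<Longrightarrow> V \<subseteq> U \<Longrightarrow> res S U V \<in> ring_hom (sec S U) (sec S V)"
  using rs[unfolded ringed_space_def, THEN conjunct2, THEN conjunct2] by blast

lemma cring_sec: "openin T U \<Longrightarrow> cring (sec S U)"
  using rs[unfolded ringed_space_def, THEN conjunct2, THEN conjunct1] by blast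

lemma domain_sec: "openin T U \<Longrightarrow> U \<noteq> {} \<Longrightarrow> domain (sec S U)"
  using int unfolding integral_scheme_def by blast

lemma res_ring_hom: "openin T U \<Longrightarrow> openin T V \<Longrightarrow> V \<subseteq> U \<Longrightarrow> ring_hom_ring (sec S U) (sec S V) (res S U V)"
  by (rule ring_hom_ringI2) (auto intro: res_hom cring_sec cring.axioms(1))

lemma res_closed: "openin T U \<Longrightarrow> openin T V \<Longrightarrow> V \<subseteq> U \<Longrightarrow> s \<in> carrier (sec S U) \<Longrightarrow> res S U V s \<in> carrier (sec S V)"
  using ring_hom_memE(1)[OF res_hom] by blast

lemma res_comp: "openin T U \<Longrightarrow> openin T V \<Longrightarrow> openin T W \<Longrightarrow> W \<subseteq> V \<Longrightarrow> V \<subseteq> U \<Longrightarrow> s \<in> carrier (sec S U) \<Longrightarrow>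
    res S V W (res S U V s) = res S U W s"
  using sheaf[unfolded sheaf_of_sets_def, THEN conjunct2, THEN conjunct2, THEN conjunct1] by blast

lemma res_self: "openin T U \<Longrightarrow> s \<in> carrier (sec S U) \<Longrightarrow> res S U U s = s"
  using sheaf[unfolded sheaf_of_sets_def, THEN conjunct2, THEN conjunct1] by blast

lemma glue:
  assumes "\<And>V. V \<in> \<U> \<Longrightarrow> openin T V \<and> s V \<in> carrier (sec S V)"
    "\<And>V W. V \<in> \<U> \<Longrightarrow> W \<in> \<U> \<Longrightarrow> res S V (V \<inter> W) (s V) = res S W (V \<inter> W) (s W)"
  shows "\<exists>!t. t \<in> carrier (sec S (\<Union>\<U>)) \<and> (\<forall>V\<in>\<U>. res S (\<Union>\<U>) V t = s V)"
  by (rule sheaf[unfolded sheaf_of_sets_def, THEN conjunct2, THEN conjunct2, THEN conjunct2, rule_format, of \<U> s])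
    (use assms in blast)

lemma locality:
  assumes U: "\<And>V. V \<in> \<U> \<Longrightarrow> openin T V" and s: "s \<in> carrier (sec S (\<Union>\<U>))" and t: "t \<in> carrier (sec S (\<Union>\<U>))"
    and eq: "\<And>V. V \<in> \<U> \<Longrightarrow> res S (\<Union>\<U>) V s = res S (\<Union>\<U>) V t"
  shows "s = t"
proof -
  have o: "openin T (\<Union>\<U>)" using U by blast
  have "\<exists>!r. r \<in> carrier (sec S (\<Union>\<U>)) \<and> (\<forall>V\<in>\<U>. res S (\<Union>\<U>) V r = res S (\<Union>\<U>) V s)"
  proof (rule glue)
    fix V assume V: "V \<in> \<U>"
    then have "V \<subseteq> \<Union>\<U>" by blast
    then show "openin T V \<and> res S (\<Union>\<U>) V s \<in> carrier (sec S V)" using res_closed[OF o U[OF V]] U[OF V] s by blast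
  next
    fix V W assume VW: "V \<in> \<U>" "W \<in> \<U>"
    have "openin T (V \<inter> W)" using U VW by blast
    moreover have "V \<subseteq> \<Union>\<U>" "W \<subseteq> \<Union>\<U>" using VW by blast+
    ultimately show "res S V (V \<inter> W) (res S (\<Union>\<U>) V s) = res S W (V \<inter> W) (res S (\<Union>\<U>) W s)"
      using res_comp[OF o U[OF VW(1)], of "V \<inter> W" s] res_comp[OF o U[OF VW(2)], of "V \<inter> W" s] s by simp
  qed
  then show ?thesis by (rule ex1E) (use s t eq in metis)
qed

text \<open>On a disjoint union one could glue \<open>(1, 0)\<close> and \<open>(0, 1)\<close>, and these would be zero divisors.\<close>

lemma opens_meet:
  assumes U: "openin T U" "U \<noteq> {}" and V: "openin T V" "V \<noteq> {}"
  shows "U \<inter> V \<noteq> {}"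
proof
  assume UV: "U \<inter> V = {}"
  interpret U: domain "sec S U" by (rule domain_sec[OF U])
  interpret V: domain "sec S V" by (rule domain_sec[OF V])
  have UnV: "U \<noteq> V" using UV U by blast
  have o: "openin T (U \<union> V)" using U V by blast
  interpret UV: domain "sec S (U \<union> V)" by (rule domain_sec[OF o]) (use U in blast)
  have e: "\<Union>{U, V} = U \<union> V" by blast
  have oe: "openin T {}" by simp
  have empty: "a = b" if "a \<in> carrier (sec S {})" "b \<in> carrier (sec S {})" for a b
    by (rule locality[of "{}"]) (use that in auto)
  have gl: "\<exists>t\<in>carrier (sec S (U \<union> V)). res S (U \<union> V) U t = a \<and> res S (U \<union> V) V t = b"
    if a: "a \<in> carrier (sec S U)" and b: "b \<in> carrier (sec S V)" for a b
  proof -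
    let ?s = "\<lambda>W. if W = U then a else b"
    have "\<exists>!t. t \<in> carrier (sec S (\<Union>{U, V})) \<and> (\<forall>W\<in>{U, V}. res S (\<Union>{U, V}) W t = ?s W)"
    proof (rule glue)
      fix W assume "W \<in> {U, V}" then show "openin T W \<and> ?s W \<in> carrier (sec S W)" using U V a b by auto
    next
      fix W W' assume W: "W \<in> {U, V}" "W' \<in> {U, V}"
      show "res S W (W \<inter> W') (?s W) = res S W' (W \<inter> W') (?s W')"
      proof (cases "W = W'")
        case True then show ?thesis by simp
      next
        case False
        then have i: "W \<inter> W' = {}" using W UV by auto
        have "?s W \<in> carrier (sec S W)" "?s W' \<in> carrier (sec S W')" "openin T W" "openin T W'" using W U V a b by auto
        then show ?thesis unfolding i using empty res_closed[OF _ oe] by blast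
      qed
    qed
    then show ?thesis unfolding e using UnV by auto
  qed
  obtain t where t: "t \<in> carrier (sec S (U \<union> V))" "res S (U \<union> V) U t = \<one>\<^bsub>sec S U\<^esub>" "res S (U \<union> V) V t = \<zero>\<^bsub>sec S V\<^esub>"
    using gl[of "\<one>\<^bsub>sec S U\<^esub>" "\<zero>\<^bsub>sec S V\<^esub>"] by auto
  obtain r where r: "r \<in> carrier (sec S (U \<union> V))" "res S (U \<union> V) U r = \<zero>\<^bsub>sec S U\<^esub>" "res S (U \<union> V) V r = \<one>\<^bsub>sec S V\<^esub>"
    using gl[of "\<zero>\<^bsub>sec S U\<^esub>" "\<one>\<^bsub>sec S V\<^esub>"] by auto
  interpret rU: ring_hom_ring "sec S (U \<union> V)" "sec S U" "res S (U \<union> V) U" by (rule res_ring_hom) (use o U in auto)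
  interpret rV: ring_hom_ring "sec S (U \<union> V)" "sec S V" "res S (U \<union> V) V" by (rule res_ring_hom) (use o V in auto)
  have "t \<otimes>\<^bsub>sec S (U \<union> V)\<^esub> r = \<zero>\<^bsub>sec S (U \<union> V)\<^esub>"
  proof (rule locality[of "{U, V}", unfolded e])
    fix W assume "W \<in> {U, V}"
    then show "res S (U \<union> V) W (t \<otimes>\<^bsub>sec S (U \<union> V)\<^esub> r) = res S (U \<union> V) W \<zero>\<^bsub>sec S (U \<union> V)\<^esub>"
      using t r by auto
  qed (use U V t r in auto)
  then have "t = \<zero>\<^bsub>sec S (U \<union> V)\<^esub> \<or> r = \<zero>\<^bsub>sec S (U \<union> V)\<^esub>" using UV.integral t r by blast
  then show False using t r rU.hom_zero rV.hom_zero U.one_not_zero V.one_not_zero by auto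
qed

text \<open>The parts of \<open>affine_open\<close> in the form in which they are applied.\<close>

lemma affine_facts:
  assumes "affine_open S W"
  shows "openin T W" "inj_on (vanishing S W) W"
    "\<And>x. x \<in> W \<Longrightarrow> primeideal (vanishing S W x) (sec S W)"
    "\<And>s. s \<in> carrier (sec S W) \<Longrightarrow> openin T (nonvanishing_locus S W s)"
    "\<And>V x. openin T V \<Longrightarrow> V \<subseteq> W \<Longrightarrow> x \<in> V \<Longrightarrow>
      \<exists>s\<in>carrier (sec S W). x \<in> nonvanishing_locus S W s \<and> nonvanishing_locus S W s \<subseteq> V"
    "\<And>s. s \<in> carrier (sec S W) \<Longrightarrow> res S W (nonvanishing_locus S W s) s \<in> Units (sec S (nonvanishing_locus S W s))"
    "\<And>s t. s \<in> carrier (sec S W) \<Longrightarrow> t \<in> carrier (sec S (nonvanishing_locus S W s)) \<Longrightarrow>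
      \<exists>n::nat. \<exists>u\<in>carrier (sec S W). res S W (nonvanishing_locus S W s) s [^]\<^bsub>sec S (nonvanishing_locus S W s)\<^esub> n
        \<otimes>\<^bsub>sec S (nonvanishing_locus S W s)\<^esub> t = res S W (nonvanishing_locus S W s) u"
    "\<And>s u. s \<in> carrier (sec S W) \<Longrightarrow> u \<in> carrier (sec S W) \<Longrightarrow>
      res S W (nonvanishing_locus S W s) u = \<zero>\<^bsub>sec S (nonvanishing_locus S W s)\<^esub> \<Longrightarrow>
      \<exists>n::nat. s [^]\<^bsub>sec S W\<^esub> n \<otimes>\<^bsub>sec S W\<^esub> u = \<zero>\<^bsub>sec S W\<^esub>"
proof -
  note a = assms[unfolded affine_open_def Let_def]
  note a1 = a[THEN conjunct1] and b1 = a[THEN conjunct2, THEN conjunct1]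
    and c1 = a[THEN conjunct2, THEN conjunct2, THEN conjunct1]
    and d1 = a[THEN conjunct2, THEN conjunct2, THEN conjunct2, THEN conjunct1]
    and e1 = a[THEN conjunct2, THEN conjunct2, THEN conjunct2, THEN conjunct2]
  show "openin T W" by (rule a1)
  show "inj_on (vanishing S W) W" using b1 by (rule bij_betw_imp_inj_on)
  show "primeideal (vanishing S W x) (sec S W)" if "x \<in> W" for x
    using bij_betwE[OF b1] that by blast
  show "openin T (nonvanishing_locus S W s)" if "s \<in> carrier (sec S W)" for s using c1 that by blast
  show "\<exists>s\<in>carrier (sec S W). x \<in> nonvanishing_locus S W s \<and> nonvanishing_locus S W s \<subseteq> V"
    if "openin T V" "V \<subseteq> W" "x \<in> V" for V x using d1 that by blast
  fix s assume s: "s \<in> carrier (sec S W)"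
  note e2 = bspec[OF e1 s]
  show "res S W (nonvanishing_locus S W s) s \<in> Units (sec S (nonvanishing_locus S W s))"
    by (rule e2[THEN conjunct1])
  show "\<exists>n::nat. \<exists>u\<in>carrier (sec S W). res S W (nonvanishing_locus S W s) s [^]\<^bsub>sec S (nonvanishing_locus S W s)\<^esub> n
        \<otimes>\<^bsub>sec S (nonvanishing_locus S W s)\<^esub> t = res S W (nonvanishing_locus S W s) u"
    if "t \<in> carrier (sec S (nonvanishing_locus S W s))" for t
    by (rule bspec[OF e2[THEN conjunct2, THEN conjunct1] that])
  show "\<exists>n::nat. s [^]\<^bsub>sec S W\<^esub> n \<otimes>\<^bsub>sec S W\<^esub> u = \<zero>\<^bsub>sec S W\<^esub>"
    if "u \<in> carrier (sec S W)" "res S W (nonvanishing_locus S W s) u = \<zero>\<^bsub>sec S (nonvanishing_locus S W s)\<^esub>" for u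
    using e2[THEN conjunct2, THEN conjunct2] that by blast
qed

lemma nonvan_sub: "nonvanishing_locus S W s \<subseteq> W" unfolding nonvanishing_locus_def by blast

lemma affine_nbhd: "x \<in> pts S \<Longrightarrow> \<exists>W. affine_open S W \<and> x \<in> W" using sch unfolding scheme_over_def by blast

lemma nonzero_on_locus:
  assumes W: "affine_open S W" and g: "g \<in> carrier (sec S W)" and y: "y \<in> nonvanishing_locus S W g"
  shows "g \<noteq> \<zero>\<^bsub>sec S W\<^esub>"
proof
  let ?D = "nonvanishing_locus S W g"
  assume g0: "g = \<zero>\<^bsub>sec S W\<^esub>"
  have oW: "openin T W" and oD: "openin T ?D" using affine_facts(1,4)[OF W] g by blast+
  interpret D: domain "sec S ?D" using domain_sec[OF oD] y by blast
  interpret r: ring_hom_ring "sec S W" "sec S ?D" "res S W ?D" by (rule res_ring_hom[OF oW oD nonvan_sub])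
  have "res S W ?D g \<in> Units (sec S ?D)" by (rule affine_facts(6)[OF W g])
  moreover have "res S W ?D g = \<zero>\<^bsub>sec S ?D\<^esub>" using g0 r.hom_zero by metis
  ultimately have "\<zero>\<^bsub>sec S ?D\<^esub> \<in> Units (sec S ?D)" by simp
  then show False using D.Units_r_inv D.Units_inv_closed D.l_null D.one_not_zero by metis
qed

text \<open>Around every point of an open set lies a principal open set of an affine chart, on which
sections have denominators.\<close>

lemma chart:
  assumes U: "openin T U" and x: "x \<in> U"
  obtains W g where "affine_open S W" "g \<in> carrier (sec S W)" "x \<in> nonvanishing_locus S W g"
    "nonvanishing_locus S W g \<subseteq> U"
proof -
  have "x \<in> pts S" using U x openin_subset by blast
  then obtain W where W: "affine_open S W" "x \<in> W" using affine_nbhd by blast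
  have "openin T (U \<inter> W)" using U affine_facts(1)[OF W(1)] by blast
  then obtain g where "g \<in> carrier (sec S W)" "x \<in> nonvanishing_locus S W g" "nonvanishing_locus S W g \<subseteq> U \<inter> W"
    using affine_facts(5)[OF W(1), of "U \<inter> W" x] W x by blast
  then show ?thesis using that W by blast
qed

text \<open>On a principal open set \<open>D(g)\<close> of a chart inside \<open>U\<close>, some multiple \<open>g\<^sup>n s\<close> extends to a section \<open>t\<close>
of the chart. It vanishes on a smaller principal open set inside \<open>V\<close>, which exists because nonempty open
sets meet. So a power of some nonzero \<open>g'\<close> kills \<open>t\<close>, and \<open>t = 0\<close> in a domain.\<close>

lemma res_zero_imp:
  assumes U: "openin T U" and V: "openin T V" "V \<subseteq> U" "V \<noteq> {}" and s: "s \<in> carrier (sec S U)"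
    and z: "res S U V s = \<zero>\<^bsub>sec S V\<^esub>"
  shows "s = \<zero>\<^bsub>sec S U\<^esub>"
proof -
  define \<D> where "\<D> = {D. openin T D \<and> D \<subseteq> U \<and> res S U D s = \<zero>\<^bsub>sec S D\<^esub>}"
  have cov: "\<exists>D\<in>\<D>. x \<in> D" if x: "x \<in> U" for x
  proof -
    obtain W g where W: "affine_open S W" and g: "g \<in> carrier (sec S W)"
      and xD: "x \<in> nonvanishing_locus S W g" and DU: "nonvanishing_locus S W g \<subseteq> U" by (rule chart[OF U x])
    let ?D = "nonvanishing_locus S W g"
    note af = affine_facts[OF W]
    have oD: "openin T ?D" using af(4)[OF g] .
    have "?D \<inter> V \<noteq> {}" using opens_meet[OF oD _ V(1,3)] xD by blast
    then obtain y where y: "y \<in> ?D \<inter> V" by blast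
    have "openin T (?D \<inter> V)" "?D \<inter> V \<subseteq> W" using oD V nonvan_sub by blast+
    then obtain g' where g': "g' \<in> carrier (sec S W)" "y \<in> nonvanishing_locus S W g'" "nonvanishing_locus S W g' \<subseteq> ?D \<inter> V"
      using af(5) y by blast
    let ?D' = "nonvanishing_locus S W g'"
    have oD': "openin T ?D'" using af(4)[OF g'(1)] .
    have D'D: "?D' \<subseteq> ?D" "?D' \<subseteq> V" using g'(3) by auto
    interpret W: domain "sec S W" using domain_sec[OF af(1)] g'(2) nonvan_sub by blast
    interpret D: cring "sec S ?D" by (rule cring_sec[OF oD])
    interpret D': cring "sec S ?D'" by (rule cring_sec[OF oD'])
    interpret WD: ring_hom_ring "sec S W" "sec S ?D" "res S W ?D" by (rule res_ring_hom[OF af(1) oD nonvan_sub])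
    interpret DD': ring_hom_ring "sec S ?D" "sec S ?D'" "res S ?D ?D'" by (rule res_ring_hom[OF oD oD' D'D(1)])
    interpret VD': ring_hom_ring "sec S V" "sec S ?D'" "res S V ?D'" by (rule res_ring_hom[OF V(1) oD' D'D(2)])
    let ?s = "res S U ?D s" and ?G = "res S W ?D g"
    have sc: "?s \<in> carrier (sec S ?D)" by (rule res_closed[OF U oD DU s])
    obtain n :: nat and t where t: "t \<in> carrier (sec S W)" "?G [^]\<^bsub>sec S ?D\<^esub> n \<otimes>\<^bsub>sec S ?D\<^esub> ?s = res S W ?D t"
      using af(7)[OF g sc] by blast
    have Gc: "?G \<in> carrier (sec S ?D)" using g by simp
    have "res S ?D ?D' ?s = res S V ?D' (res S U V s)"
      using res_comp[OF U oD oD' D'D(1) DU s] res_comp[OF U V(1) oD' D'D(2) V(2) s] by simp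
    then have s0: "res S ?D ?D' ?s = \<zero>\<^bsub>sec S ?D'\<^esub>" unfolding z by simp
    have "res S W ?D' t = res S ?D ?D' (res S W ?D t)"
      using res_comp[OF af(1) oD oD' D'D(1) nonvan_sub t(1)] by simp
    also have "\<dots> = res S ?D ?D' (?G [^]\<^bsub>sec S ?D\<^esub> n) \<otimes>\<^bsub>sec S ?D'\<^esub> res S ?D ?D' ?s"
      unfolding t(2)[symmetric] using Gc sc by simp
    also have "\<dots> = \<zero>\<^bsub>sec S ?D'\<^esub>" unfolding s0 using Gc by simp
    finally obtain n' :: nat where "g' [^]\<^bsub>sec S W\<^esub> n' \<otimes>\<^bsub>sec S W\<^esub> t = \<zero>\<^bsub>sec S W\<^esub>"
      using af(8)[OF g'(1) t(1)] by blast
    moreover have "g' [^]\<^bsub>sec S W\<^esub> n' \<noteq> \<zero>\<^bsub>sec S W\<^esub>"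
      using W.pow_eq_zero[OF g'(1)] nonzero_on_locus[OF W g'(1,2)] by blast
    ultimately have "t = \<zero>\<^bsub>sec S W\<^esub>" using W.integral t(1) g'(1) by (metis W.nat_pow_closed)
    then have "?G [^]\<^bsub>sec S ?D\<^esub> n \<otimes>\<^bsub>sec S ?D\<^esub> ?s = \<zero>\<^bsub>sec S ?D\<^esub>" using t(2) by simp
    moreover have "?G [^]\<^bsub>sec S ?D\<^esub> n \<in> Units (sec S ?D)" using af(6)[OF g] by (rule D.Units_pow_closed)
    ultimately have "?s = \<zero>\<^bsub>sec S ?D\<^esub>" using sc D.Units_l_cancel[of "?G [^]\<^bsub>sec S ?D\<^esub> n" ?s "\<zero>\<^bsub>sec S ?D\<^esub>"] Gc by simp
    then have "?D \<in> \<D>" unfolding \<D>_def using oD DU by blast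
    then show ?thesis using xD by blast
  qed
  have e: "\<Union>\<D> = U" using cov unfolding \<D>_def by blast
  interpret U: cring "sec S U" by (rule cring_sec[OF U])
  show ?thesis
  proof (rule locality[of \<D>, unfolded e])
    fix D assume D: "D \<in> \<D>"
    then have oD: "openin T D" "D \<subseteq> U" unfolding \<D>_def by blast+
    interpret r: ring_hom_ring "sec S U" "sec S D" "res S U D" by (rule res_ring_hom[OF U oD])
    show "res S U D s = res S U D \<zero>\<^bsub>sec S U\<^esub>" using D unfolding \<D>_def by simp
  qed (use s \<D>_def in auto)
qed

lemma str_hom: "str S \<in> ring_hom k (sec S (pts S))" using sch unfolding scheme_over_def by blast

lemma str_on_hom: "openin T U \<Longrightarrow> str_on S U \<in> ring_hom k (sec S U)"
proof -
  assume U: "openin T U"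
  have "res S (pts S) U \<circ> str S \<in> ring_hom k (sec S U)"
    by (rule ring_hom_trans[OF str_hom res_hom[OF openin_topspace U openin_subset[OF U]]])
  moreover have "res S (pts S) U \<circ> str S = str_on S U" by (rule ext) (simp add: str_on_def)
  ultimately show ?thesis by simp
qed

lemma res_str_on: "openin T U \<Longrightarrow> openin T V \<Longrightarrow> V \<subseteq> U \<Longrightarrow> c \<in> carrier k \<Longrightarrow> res S U V (str_on S U c) = str_on S V c"
  unfolding str_on_def by (rule res_comp[OF openin_topspace]) (auto intro: ring_hom_memE(1)[OF str_hom] dest: openin_subset)

subsection \<open>Stalks\<close>

lemma germ_self:
  "openin T U \<Longrightarrow> x \<in> U \<Longrightarrow> s \<in> carrier (sec S U) \<Longrightarrow> (U, s) \<in> fun_germ S x U s"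
  unfolding germ_def by blast

lemma germ_memE:
  assumes "(V, t) \<in> fun_germ S x U s"
  obtains W where "openin T V" "x \<in> V" "t \<in> carrier (sec S V)" "openin T W" "x \<in> W" "W \<subseteq> U" "W \<subseteq> V"
    "res S U W s = res S V W t"
  using assms unfolding germ_def by auto

lemma germ_eq_sub:
  assumes U: "openin T U" "s \<in> carrier (sec S U)" and V: "openin T V" "t \<in> carrier (sec S V)"
    and W: "openin T W" "x \<in> W" "W \<subseteq> U" "W \<subseteq> V" and eq: "res S U W s = res S V W t"
  shows "fun_germ S x U s \<subseteq> fun_germ S x V t"
proof
  fix p assume p: "p \<in> fun_germ S x U s"
  obtain Z r where pe: "p = (Z, r)" by (cases p)
  obtain W' where Z: "openin T Z" "x \<in> Z" "r \<in> carrier (sec S Z)"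
    and W': "openin T W'" "x \<in> W'" "W' \<subseteq> U" "W' \<subseteq> Z" "res S U W' s = res S Z W' r"
    by (rule germ_memE[OF p[unfolded pe]])
  let ?N = "W \<inter> W'"
  have N: "openin T ?N" "x \<in> ?N" "?N \<subseteq> W" "?N \<subseteq> W'" "?N \<subseteq> V \<inter> Z" using W W' by auto
  have "res S V ?N t = res S W ?N (res S V W t)" using res_comp[OF V(1) W(1) N(1) N(3) W(4) V(2)] by simp
  also have "\<dots> = res S U ?N s" unfolding eq[symmetric] by (rule res_comp[OF U(1) W(1) N(1) N(3) W(3) U(2)])
  also have "\<dots> = res S W' ?N (res S U W' s)" using res_comp[OF U(1) W'(1) N(1) N(4) W'(3) U(2)] by simp
  also have "\<dots> = res S Z ?N r" unfolding W'(5) by (rule res_comp[OF Z(1) W'(1) N(1) N(4) W'(4) Z(3)])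
  finally show "p \<in> fun_germ S x V t" unfolding germ_def pe using Z N by blast
qed

lemma germ_eqI:
  assumes "openin T U" "s \<in> carrier (sec S U)" "openin T V" "t \<in> carrier (sec S V)"
    "openin T W" "x \<in> W" "W \<subseteq> U" "W \<subseteq> V" "res S U W s = res S V W t"
  shows "fun_germ S x U s = fun_germ S x V t"
  by (rule equalityI; rule germ_eq_sub[where W=W]) (use assms in auto)

text \<open>A sectionwise operation that is compatible with restriction may be computed on arbitrary
representatives of germs; the unions in \<open>stalk\<close> therefore have a single value.\<close>

lemma germ_op:
  assumes f: "\<And>W a b. openin T W \<Longrightarrow> a \<in> carrier (sec S W) \<Longrightarrow> b \<in> carrier (sec S W) \<Longrightarrow> f W a b \<in> carrier (sec S W)"
    and fr: "\<And>W W' a b. openin T W \<Longrightarrow> openin T W' \<Longrightarrow> W' \<subseteq> W \<Longrightarrow> a \<in> carrier (sec S W) \<Longrightarrow> b \<in> carrier (sec S W) \<Longrightarrow>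
      res S W W' (f W a b) = f W' (res S W W' a) (res S W W' b)"
    and U: "openin T U" "x \<in> U" "s \<in> carrier (sec S U)" and V: "openin T V" "x \<in> V" "t \<in> carrier (sec S V)"
  shows "(\<Union>(U, s)\<in>fun_germ S x U s. \<Union>(V, t)\<in>fun_germ S x V t.
      fun_germ S x (U \<inter> V) (f (U \<inter> V) (res S U (U \<inter> V) s) (res S V (U \<inter> V) t))) =
    fun_germ S x (U \<inter> V) (f (U \<inter> V) (res S U (U \<inter> V) s) (res S V (U \<inter> V) t))" (is "?L = ?R")
proof -
  have fc: "f (U \<inter> V) (res S U (U \<inter> V) s) (res S V (U \<inter> V) t) \<in> carrier (sec S (U \<inter> V))"
    if "openin T U" "s \<in> carrier (sec S U)" "openin T V" "t \<in> carrier (sec S V)" for U V s t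
    using that by (intro f openin_Int res_closed[of U] res_closed[of V]) auto
  have fw: "res S (U \<inter> V) W (f (U \<inter> V) (res S U (U \<inter> V) s) (res S V (U \<inter> V) t)) = f W (res S U W s) (res S V W t)"
    if h: "openin T U" "s \<in> carrier (sec S U)" "openin T V" "t \<in> carrier (sec S V)" "openin T W" "W \<subseteq> U" "W \<subseteq> V" for U V W s t
  proof -
    have o: "openin T (U \<inter> V)" "W \<subseteq> U \<inter> V" "U \<inter> V \<subseteq> U" "U \<inter> V \<subseteq> V" using h by auto
    show ?thesis
      using fr[OF o(1) h(5) o(2) res_closed[OF h(1) o(1,3) h(2)] res_closed[OF h(3) o(1,4) h(4)]]
        res_comp[OF h(1) o(1) h(5) o(2,3) h(2)] res_comp[OF h(3) o(1) h(5) o(2,4) h(4)] by simp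
  qed
  have all: "fun_germ S x (U' \<inter> V') (f (U' \<inter> V') (res S U' (U' \<inter> V') s') (res S V' (U' \<inter> V') t')) = ?R"
    if p: "(U', s') \<in> fun_germ S x U s" "(V', t') \<in> fun_germ S x V t" for U' s' V' t'
  proof -
    obtain W1 where U': "openin T U'" "x \<in> U'" "s' \<in> carrier (sec S U')"
      and W1: "openin T W1" "x \<in> W1" "W1 \<subseteq> U" "W1 \<subseteq> U'" "res S U W1 s = res S U' W1 s'"
      by (rule germ_memE[OF p(1)])
    obtain W2 where V': "openin T V'" "x \<in> V'" "t' \<in> carrier (sec S V')"
      and W2: "openin T W2" "x \<in> W2" "W2 \<subseteq> V" "W2 \<subseteq> V'" "res S V W2 t = res S V' W2 t'"
      by (rule germ_memE[OF p(2)])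
    let ?W = "W1 \<inter> W2"
    have W: "openin T ?W" "x \<in> ?W" "?W \<subseteq> W1" "?W \<subseteq> W2" "?W \<subseteq> U \<inter> V" "?W \<subseteq> U' \<inter> V'" using W1 W2 by auto
    have e1: "res S U' ?W s' = res S U ?W s"
      using res_comp[OF U'(1) W1(1) W(1,3) W1(4) U'(3)] res_comp[OF U(1) W1(1) W(1,3) W1(3) U(3)] W1(5) by simp
    have e2: "res S V' ?W t' = res S V ?W t"
      using res_comp[OF V'(1) W2(1) W(1,4) W2(4) V'(3)] res_comp[OF V(1) W2(1) W(1,4) W2(3) V(3)] W2(5) by simp
    show ?thesis
    proof (rule germ_eqI[where W="?W"])
      show "res S (U' \<inter> V') ?W (f (U' \<inter> V') (res S U' (U' \<inter> V') s') (res S V' (U' \<inter> V') t')) =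
        res S (U \<inter> V) ?W (f (U \<inter> V) (res S U (U \<inter> V) s) (res S V (U \<inter> V) t))"
        using fw[OF U'(1,3) V'(1,3) W(1)] fw[OF U(1,3) V(1,3) W(1)] W(5,6) e1 e2 by simp
    qed (use U U' V V' W fc in auto)
  qed
  show ?thesis
  proof (rule equalityI; rule subsetI)
    fix p assume "p \<in> ?L"
    then obtain U' s' V' t' where "(U', s') \<in> fun_germ S x U s" "(V', t') \<in> fun_germ S x V t"
      "p \<in> fun_germ S x (U' \<inter> V') (f (U' \<inter> V') (res S U' (U' \<inter> V') s') (res S V' (U' \<inter> V') t'))" by blast
    then show "p \<in> ?R" using all by blast
  next
    fix p assume "p \<in> ?R"
    then show "p \<in> ?L" using germ_self[OF U] germ_self[OF V] by blast
  qed
qed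

lemma stalk_mult:
  assumes "openin T U" "x \<in> U" "s \<in> carrier (sec S U)" "openin T V" "x \<in> V" "t \<in> carrier (sec S V)"
  shows "fun_germ S x U s \<otimes>\<^bsub>stalk S x\<^esub> fun_germ S x V t =
    fun_germ S x (U \<inter> V) (res S U (U \<inter> V) s \<otimes>\<^bsub>sec S (U \<inter> V)\<^esub> res S V (U \<inter> V) t)"
proof -
  have "fun_germ S x U s \<otimes>\<^bsub>stalk S x\<^esub> fun_germ S x V t = (\<Union>(U, s)\<in>fun_germ S x U s. \<Union>(V, t)\<in>fun_germ S x V t.
      fun_germ S x (U \<inter> V) (res S U (U \<inter> V) s \<otimes>\<^bsub>sec S (U \<inter> V)\<^esub> res S V (U \<inter> V) t))"
    by (simp add: stalk_def)
  also have "\<dots> = fun_germ S x (U \<inter> V) (res S U (U \<inter> V) s \<otimes>\<^bsub>sec S (U \<inter> V)\<^esub> res S V (U \<inter> V) t)"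
  proof (rule germ_op[OF _ _ assms, of "\<lambda>W a b. a \<otimes>\<^bsub>sec S W\<^esub> b"])
    fix W a b assume "openin T W" "a \<in> carrier (sec S W)" "b \<in> carrier (sec S W)"
    then show "a \<otimes>\<^bsub>sec S W\<^esub> b \<in> carrier (sec S W)" using cring_sec cring.cring_simprules(5) by metis
  next
    fix W W' a b assume "openin T W" "openin T W'" "W' \<subseteq> W" "a \<in> carrier (sec S W)" "b \<in> carrier (sec S W)"
    then show "res S W W' (a \<otimes>\<^bsub>sec S W\<^esub> b) = res S W W' a \<otimes>\<^bsub>sec S W'\<^esub> res S W W' b"
      by (intro ring_hom_memE(2)[OF res_hom]) auto
  qed
  finally show ?thesis .
qed

lemma stalk_add:
  assumes "openin T U" "x \<in> U" "s \<in> carrier (sec S U)" "openin T V" "x \<in> V" "t \<in> carrier (sec S V)"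
  shows "fun_germ S x U s \<oplus>\<^bsub>stalk S x\<^esub> fun_germ S x V t =
    fun_germ S x (U \<inter> V) (res S U (U \<inter> V) s \<oplus>\<^bsub>sec S (U \<inter> V)\<^esub> res S V (U \<inter> V) t)"
proof -
  have "fun_germ S x U s \<oplus>\<^bsub>stalk S x\<^esub> fun_germ S x V t = (\<Union>(U, s)\<in>fun_germ S x U s. \<Union>(V, t)\<in>fun_germ S x V t.
      fun_germ S x (U \<inter> V) (res S U (U \<inter> V) s \<oplus>\<^bsub>sec S (U \<inter> V)\<^esub> res S V (U \<inter> V) t))"
    by (simp add: stalk_def)
  also have "\<dots> = fun_germ S x (U \<inter> V) (res S U (U \<inter> V) s \<oplus>\<^bsub>sec S (U \<inter> V)\<^esub> res S V (U \<inter> V) t)"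
  proof (rule germ_op[OF _ _ assms, of "\<lambda>W a b. a \<oplus>\<^bsub>sec S W\<^esub> b"])
    fix W a b assume "openin T W" "a \<in> carrier (sec S W)" "b \<in> carrier (sec S W)"
    then show "a \<oplus>\<^bsub>sec S W\<^esub> b \<in> carrier (sec S W)" using cring_sec cring.cring_simprules(1) by metis
  next
    fix W W' a b assume "openin T W" "openin T W'" "W' \<subseteq> W" "a \<in> carrier (sec S W)" "b \<in> carrier (sec S W)"
    then show "res S W W' (a \<oplus>\<^bsub>sec S W\<^esub> b) = res S W W' a \<oplus>\<^bsub>sec S W'\<^esub> res S W W' b"
      by (intro ring_hom_memE(3)[OF res_hom]) auto
  qed
  finally show ?thesis .
qed

lemma germ_in_stalk: "openin T U \<Longrightarrow> x \<in> U \<Longrightarrow> s \<in> carrier (sec S U) \<Longrightarrow> fun_germ S x U s \<in> carrier (stalk S x)"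
  unfolding stalk_def germs_def by auto

lemma germ_of_unit:
  assumes U: "openin T U" "t \<in> carrier (sec S U)" and N: "openin T N" "x \<in> N" "N \<subseteq> U"
    and u: "res S U N t \<in> Units (sec S N)"
  shows "fun_germ S x U t \<in> Units (stalk S x)"
proof -
  interpret N: cring "sec S N" by (rule cring_sec[OF N(1)])
  let ?t = "res S U N t" and ?i = "inv\<^bsub>sec S N\<^esub> (res S U N t)"
  have tc: "?t \<in> carrier (sec S N)" and ic: "?i \<in> carrier (sec S N)" using u by auto
  have xp: "x \<in> pts S" using N openin_subset by blast
  have g: "fun_germ S x U t = fun_germ S x N ?t"
    by (rule germ_eqI[OF U N(1) tc N(1,2,3)]) (use res_self[OF N(1) tc] in auto)
  interpret P: cring "sec S (pts S)" by (rule cring_sec[OF openin_topspace])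
  interpret r: ring_hom_ring "sec S (pts S)" "sec S N" "res S (pts S) N"
    by (rule res_ring_hom[OF openin_topspace N(1) openin_subset[OF N(1)]])
  have one: "\<one>\<^bsub>stalk S x\<^esub> = fun_germ S x N \<one>\<^bsub>sec S N\<^esub>"
  proof -
    have "fun_germ S x (pts S) \<one>\<^bsub>sec S (pts S)\<^esub> = fun_germ S x N \<one>\<^bsub>sec S N\<^esub>"
      by (rule germ_eqI[OF openin_topspace P.one_closed N(1) N.one_closed N(1,2) openin_subset[OF N(1)] subset_refl])
        (use res_self[OF N(1) N.one_closed] in simp)
    then show ?thesis by (simp add: stalk_def)
  qed
  have m1: "fun_germ S x N ?i \<otimes>\<^bsub>stalk S x\<^esub> fun_germ S x N ?t = \<one>\<^bsub>stalk S x\<^esub>"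
    unfolding one stalk_mult[OF N(1,2) ic N(1,2) tc] using u res_self[OF N(1) tc] res_self[OF N(1) ic] by simp
  have m2: "fun_germ S x N ?t \<otimes>\<^bsub>stalk S x\<^esub> fun_germ S x N ?i = \<one>\<^bsub>stalk S x\<^esub>"
    unfolding one stalk_mult[OF N(1,2) tc N(1,2) ic] using u res_self[OF N(1) tc] res_self[OF N(1) ic] by simp
  show ?thesis unfolding g Units_def
    using m1 m2 germ_in_stalk[OF N(1,2) tc] germ_in_stalk[OF N(1,2) ic] by blast
qed

text \<open>The residue class of the germ of \<open>s\<close> is that of a constant. The work is to pass from the germ of
\<open>s - c\<close> being a non-unit to \<open>s - c\<close> not being invertible near \<open>x\<close>.\<close>

lemma rational_value:
  assumes rp: "rational_point k S x" and W: "openin T W" "x \<in> W" and s: "s \<in> carrier (sec S W)"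
  shows "\<exists>c\<in>carrier k. s \<ominus>\<^bsub>sec S W\<^esub> str_on S W c \<in> vanishing S W x"
proof -
  let ?M = "stalk_max S x" and ?R = "stalk S x"
  have xp: "x \<in> pts S" using rp unfolding rational_point_def by blast
  let ?g = "fun_germ S x W s"
  interpret P: domain "sec S (pts S)" by (rule domain_sec[OF openin_topspace]) (use xp in blast)
  interpret Wc: cring "sec S W" by (rule cring_sec[OF W(1)])
  have gR: "?g \<in> carrier ?R" by (rule germ_in_stalk[OF W s])
  have "residue_class S x ?g \<in> carrier (residue_field S x)"
    unfolding residue_class_def residue_field_def FactRing_def A_RCOSETS_def' using gR by auto
  then obtain c where c: "c \<in> carrier k" "residue_class S x ?g = residue_class S x (str_germ S x c)"
    using rp unfolding rational_point_def by auto
  have strc: "str S c \<in> carrier (sec S (pts S))" using c(1) ring_hom_memE(1)[OF str_hom] by blast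
  let ?z = "\<zero>\<^bsub>sec S (pts S)\<^esub>"
  have zero: "\<zero>\<^bsub>?R\<^esub> = fun_germ S x (pts S) ?z" by (simp add: stalk_def)
  have zM: "\<zero>\<^bsub>?R\<^esub> \<in> ?M"
  proof -
    have "\<zero>\<^bsub>?R\<^esub> \<notin> Units ?R"
    proof
      assume "\<zero>\<^bsub>?R\<^esub> \<in> Units ?R"
      then obtain b where b: "b \<in> carrier ?R" "b \<otimes>\<^bsub>?R\<^esub> \<zero>\<^bsub>?R\<^esub> = \<one>\<^bsub>?R\<^esub>" unfolding Units_def by blast
      then obtain U r where r: "openin T U" "x \<in> U" "r \<in> carrier (sec S U)" "b = fun_germ S x U r"
        unfolding stalk_def germs_def by auto
      have UP: "U \<inter> pts S = U" using openin_subset[OF r(1)] by blast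
      interpret U: domain "sec S U" by (rule domain_sec[OF r(1)]) (use r in blast)
      interpret pU: ring_hom_ring "sec S (pts S)" "sec S U" "res S (pts S) U"
        by (rule res_ring_hom[OF openin_topspace r(1) openin_subset[OF r(1)]])
      have "fun_germ S x U \<zero>\<^bsub>sec S U\<^esub> = fun_germ S x (pts S) \<one>\<^bsub>sec S (pts S)\<^esub>"
        using b(2) stalk_mult[OF r(1,2,3) openin_topspace xp P.zero_closed] res_self[OF r(1,3)] r(3)
        unfolding zero r(4) UP by (simp add: stalk_def)
      then have "(U, \<zero>\<^bsub>sec S U\<^esub>) \<in> fun_germ S x (pts S) \<one>\<^bsub>sec S (pts S)\<^esub>"
        using germ_self[OF r(1,2) U.zero_closed] by simp
      then obtain N where N: "openin T N" "x \<in> N" "N \<subseteq> U" "res S (pts S) N \<one>\<^bsub>sec S (pts S)\<^esub> = res S U N \<zero>\<^bsub>sec S U\<^esub>"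
        by (rule germ_memE)
      interpret N: domain "sec S N" by (rule domain_sec[OF N(1)]) (use N in blast)
      interpret pN: ring_hom_ring "sec S (pts S)" "sec S N" "res S (pts S) N"
        by (rule res_ring_hom[OF openin_topspace N(1) openin_subset[OF N(1)]])
      interpret UN: ring_hom_ring "sec S U" "sec S N" "res S U N" by (rule res_ring_hom[OF r(1) N(1,3)])
      show False using N(4) pN.hom_one UN.hom_zero N.one_not_zero by simp
    qed
    moreover have "\<zero>\<^bsub>?R\<^esub> \<in> carrier ?R" unfolding zero by (rule germ_in_stalk[OF openin_topspace xp P.zero_closed])
    ultimately show ?thesis unfolding stalk_max_def by blast
  qed
  have WP: "pts S \<inter> W = W" using openin_subset[OF W(1)] by blast
  interpret pW: ring_hom_ring "sec S (pts S)" "sec S W" "res S (pts S) W"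
    by (rule res_ring_hom[OF openin_topspace W(1) openin_subset[OF W(1)]])
  have "\<zero>\<^bsub>?R\<^esub> \<oplus>\<^bsub>?R\<^esub> ?g = ?g"
    unfolding zero stalk_add[OF openin_topspace xp P.zero_closed W s] WP using res_self[OF W(1) s] s by simp
  then have "?g \<in> residue_class S x ?g" unfolding residue_class_def a_r_coset_def' using zM by force
  then have "?g \<in> residue_class S x (str_germ S x c)" unfolding c(2) .
  then obtain h where h: "h \<in> ?M" "?g = h \<oplus>\<^bsub>?R\<^esub> str_germ S x c" unfolding residue_class_def a_r_coset_def' by blast
  then obtain U t where t: "openin T U" "x \<in> U" "t \<in> carrier (sec S U)" "h = fun_germ S x U t"
    unfolding stalk_max_def stalk_def germs_def by auto
  have UP: "U \<inter> pts S = U" using openin_subset[OF t(1)] by blast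
  interpret Uc: cring "sec S U" by (rule cring_sec[OF t(1)])
  have so: "str_on S V c \<in> carrier (sec S V)" if "openin T V" for V using ring_hom_memE(1)[OF str_on_hom[OF that] c(1)] .
  have ge: "?g = fun_germ S x U (t \<oplus>\<^bsub>sec S U\<^esub> str_on S U c)"
    using h(2) stalk_add[OF t(1,2,3) openin_topspace xp strc] res_self[OF t(1,3)]
    unfolding t(4) str_germ_def UP str_on_def by simp
  have "(U, t \<oplus>\<^bsub>sec S U\<^esub> str_on S U c) \<in> ?g"
    unfolding ge by (rule germ_self[OF t(1,2)]) (use t so in simp)
  then obtain N where N: "openin T N" "x \<in> N" "N \<subseteq> W" "N \<subseteq> U"
    "res S W N s = res S U N (t \<oplus>\<^bsub>sec S U\<^esub> str_on S U c)" by (rule germ_memE)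
  interpret N: cring "sec S N" by (rule cring_sec[OF N(1)])
  interpret WN: ring_hom_ring "sec S W" "sec S N" "res S W N" by (rule res_ring_hom[OF W(1) N(1,3)])
  interpret UN: ring_hom_ring "sec S U" "sec S N" "res S U N" by (rule res_ring_hom[OF t(1) N(1,4)])
  let ?d = "s \<ominus>\<^bsub>sec S W\<^esub> str_on S W c"
  have dc: "?d \<in> carrier (sec S W)" using s so[OF W(1)] by simp
  have "res S W N ?d = res S W N s \<ominus>\<^bsub>sec S N\<^esub> str_on S N c"
    using s so[OF W(1)] res_str_on[OF W(1) N(1,3) c(1)] by (simp add: a_minus_def)
  also have "\<dots> = (res S U N t \<oplus>\<^bsub>sec S N\<^esub> str_on S N c) \<ominus>\<^bsub>sec S N\<^esub> str_on S N c"
    unfolding N(5) using t(3) so[OF t(1)] res_str_on[OF t(1) N(1,4) c(1)] by simp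
  also have "\<dots> = res S U N t"
    using t(3) so[OF N(1)] by (simp add: a_minus_def N.a_assoc N.r_neg)
  finally have dN: "res S W N ?d = res S U N t" .
  have "?d \<in> vanishing S W x" unfolding vanishing_def
  proof (intro CollectI conjI allI impI dc)
    fix V assume V: "openin T V \<and> x \<in> V \<and> V \<subseteq> W"
    show "res S W V ?d \<notin> Units (sec S V)"
    proof
      assume un: "res S W V ?d \<in> Units (sec S V)"
      let ?Z = "V \<inter> N"
      have Z: "openin T ?Z" "x \<in> ?Z" "?Z \<subseteq> V" "?Z \<subseteq> N" "?Z \<subseteq> U" using V N by auto
      interpret V: cring "sec S V" by (rule cring_sec) (use V in blast)
      interpret Z: cring "sec S ?Z" by (rule cring_sec[OF Z(1)])
      interpret VZ: ring_hom_ring "sec S V" "sec S ?Z" "res S V ?Z" by (rule res_ring_hom) (use V Z in auto)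
      have i: "inv\<^bsub>sec S V\<^esub> (res S W V ?d) \<in> carrier (sec S V)" "res S W V ?d \<in> carrier (sec S V)"
        "inv\<^bsub>sec S V\<^esub> (res S W V ?d) \<otimes>\<^bsub>sec S V\<^esub> res S W V ?d = \<one>\<^bsub>sec S V\<^esub>" using un by auto
      have "res S V ?Z (inv\<^bsub>sec S V\<^esub> (res S W V ?d)) \<otimes>\<^bsub>sec S ?Z\<^esub> res S V ?Z (res S W V ?d) = \<one>\<^bsub>sec S ?Z\<^esub>"
        using VZ.hom_mult[OF i(1,2)] i(3) VZ.hom_one by simp
      then have "res S V ?Z (res S W V ?d) \<in> Units (sec S ?Z)"
        using VZ.hom_closed[OF i(1)] VZ.hom_closed[OF i(2)] Z.m_comm unfolding Units_def by force
      moreover have "res S V ?Z (res S W V ?d) = res S U ?Z t"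
        using res_comp[OF W(1) _ Z(1) Z(3) _ dc, of ] V res_comp[OF W(1) N(1) Z(1) Z(4) N(3) dc]
          res_comp[OF t(1) N(1) Z(1) Z(4) N(4) t(3)] dN by simp
      ultimately have "h \<in> Units ?R" unfolding t(4) using germ_of_unit[OF t(1,3) Z(1,2,5)] by simp
      then show False using h(1) unfolding stalk_max_def by blast
    qed
  qed
  then show ?thesis using c(1) by blast
qed

text \<open>In an affine chart the prime ideal of \<open>x\<close> has residue field \<open>k\<close>, so it is maximal: a
function that vanishes at \<open>y\<close> but not at \<open>x\<close> differs from a nonzero constant by a function that vanishes
at \<open>x\<close>. Hence some function vanishes at \<open>x\<close> but not at \<open>y\<close>.\<close>

lemma rational_point_closed:
  assumes rp: "rational_point k S x"
  shows "openin T (pts S - {x})"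
proof (subst openin_subopen, rule ballI)
  fix y assume y: "y \<in> pts S - {x}"
  obtain W where W: "affine_open S W" "y \<in> W" using affine_nbhd y by blast
  note af = affine_facts[OF W(1)]
  show "\<exists>V. openin T V \<and> y \<in> V \<and> V \<subseteq> pts S - {x}"
  proof (cases "x \<in> W")
    case False
    then show ?thesis using W(2) af(1) openin_subset[OF af(1)] by blast
  next
    case True
    let ?P = "vanishing S W x" and ?P' = "vanishing S W y"
    interpret P: primeideal ?P "sec S W" by (rule af(3)[OF True])
    interpret P': primeideal ?P' "sec S W" by (rule af(3)[OF W(2)])
    have ne: "?P \<noteq> ?P'" using af(2) True W(2) y by (auto dest: inj_onD)
    have "\<not> ?P \<subseteq> ?P'"
    proof
      assume sub: "?P \<subseteq> ?P'"
      then obtain s where s: "s \<in> ?P'" "s \<notin> ?P" using ne by blast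
      have sc: "s \<in> carrier (sec S W)" using s(1) P'.Icarr by blast
      obtain c where c: "c \<in> carrier k" "s \<ominus>\<^bsub>sec S W\<^esub> str_on S W c \<in> ?P" using rational_value[OF rp af(1) True sc] by blast
      interpret k: field k by (rule k_field)
      interpret st: ring_hom_ring k "sec S W" "str_on S W"
        by (rule ring_hom_ringI2[OF k.ring_axioms P.ring_axioms str_on_hom[OF af(1)]])
      have cc: "str_on S W c \<in> carrier (sec S W)" using c(1) by simp
      have c0: "c \<noteq> \<zero>\<^bsub>k\<^esub>"
      proof
        assume "c = \<zero>\<^bsub>k\<^esub>"
        then have "s \<ominus>\<^bsub>sec S W\<^esub> str_on S W c = s" using sc P.minus_zero by (simp add: a_minus_def)
        then show False using c(2) s(2) by simp
      qed
      have "s \<ominus>\<^bsub>sec S W\<^esub> str_on S W c \<in> ?P'" using c(2) sub by blast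
      then have "s \<oplus>\<^bsub>sec S W\<^esub> (\<ominus>\<^bsub>sec S W\<^esub> (s \<ominus>\<^bsub>sec S W\<^esub> str_on S W c)) \<in> ?P'" using s(1) by simp
      moreover have "s \<oplus>\<^bsub>sec S W\<^esub> (\<ominus>\<^bsub>sec S W\<^esub> (s \<ominus>\<^bsub>sec S W\<^esub> str_on S W c)) = str_on S W c"
        using sc cc by (simp add: a_minus_def P.minus_add P.r_neg2)
      ultimately have "str_on S W c \<in> ?P'" by simp
      then have "str_on S W (inv\<^bsub>k\<^esub> c) \<otimes>\<^bsub>sec S W\<^esub> str_on S W c \<in> ?P'"
        using c(1) c0 k.field_Units by (intro P'.I_l_closed) auto
      moreover have "str_on S W (inv\<^bsub>k\<^esub> c) \<otimes>\<^bsub>sec S W\<^esub> str_on S W c = \<one>\<^bsub>sec S W\<^esub>"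
        using c(1) c0 k.field_Units st.hom_mult[of "inv\<^bsub>k\<^esub> c" c] by auto
      ultimately show False using P'.one_imp_carrier P'.I_notcarr by simp
    qed
    then obtain g where g: "g \<in> ?P" "g \<notin> ?P'" by blast
    have gc: "g \<in> carrier (sec S W)" using g(1) P.Icarr by blast
    have "y \<in> nonvanishing_locus S W g" "x \<notin> nonvanishing_locus S W g"
      using g W(2) unfolding nonvanishing_locus_def by auto
    then show ?thesis using af(4)[OF gc] openin_subset[OF af(4)[OF gc]] by blast
  qed
qed

text \<open>With \<open>e = 1\<close> this says that functions fixed by a power of Frobenius are constant. Multiplying
\<open>u\<close> and \<open>e\<close> by the same power of a denominator preserves the equation and moves it to an affine chart,
where \<open>homogeneous_ratio\<close> applies. Restriction to a nonempty open set is injective, so the conclusion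
can be moved back.\<close>

lemma section_ratio:
  assumes fin: "finite (carrier k)" and gi: "geometrically_irreducible k S"
    and U: "openin T U" "U \<noteq> {}" and u: "u \<in> carrier (sec S U)" and e: "e \<in> carrier (sec S U)" "e \<noteq> \<zero>\<^bsub>sec S U\<^esub>"
    and eq: "u [^]\<^bsub>sec S U\<^esub> (card (carrier k) ^ Suc m) = e [^]\<^bsub>sec S U\<^esub> (card (carrier k) ^ Suc m - 1) \<otimes>\<^bsub>sec S U\<^esub> u"
  shows "\<exists>c\<in>carrier k. u = str_on S U c \<otimes>\<^bsub>sec S U\<^esub> e"
proof -
  obtain x where x: "x \<in> U" using U by blast
  obtain W g where W: "affine_open S W" and g: "g \<in> carrier (sec S W)"
    and xD: "x \<in> nonvanishing_locus S W g" and DU: "nonvanishing_locus S W g \<subseteq> U" by (rule chart[OF U(1) x])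
  let ?D = "nonvanishing_locus S W g"
  note af = affine_facts[OF W]
  have oD: "openin T ?D" using af(4)[OF g] .
  have Dne: "?D \<noteq> {}" and Wne: "W \<noteq> {}" using xD nonvan_sub by blast+
  interpret k: field k by (rule k_field)
  interpret U: domain "sec S U" by (rule domain_sec[OF U])
  interpret W: domain "sec S W" by (rule domain_sec[OF af(1) Wne])
  interpret D: domain "sec S ?D" by (rule domain_sec[OF oD Dne])
  interpret WD: ring_hom_ring "sec S W" "sec S ?D" "res S W ?D" by (rule res_ring_hom[OF af(1) oD nonvan_sub])
  interpret UD: ring_hom_ring "sec S U" "sec S ?D" "res S U ?D" by (rule res_ring_hom[OF U(1) oD DU])
  let ?G = "res S W ?D g" and ?u = "res S U ?D u" and ?e = "res S U ?D e"
  have c: "?G \<in> carrier (sec S ?D)" "?u \<in> carrier (sec S ?D)" "?e \<in> carrier (sec S ?D)" using g u e by auto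
  obtain i :: nat and tu where tu: "tu \<in> carrier (sec S W)" "?G [^]\<^bsub>sec S ?D\<^esub> i \<otimes>\<^bsub>sec S ?D\<^esub> ?u = res S W ?D tu"
    using af(7)[OF g c(2)] by blast
  obtain j :: nat and te where te: "te \<in> carrier (sec S W)" "?G [^]\<^bsub>sec S ?D\<^esub> j \<otimes>\<^bsub>sec S ?D\<^esub> ?e = res S W ?D te"
    using af(7)[OF g c(3)] by blast
  let ?Q = "card (carrier k) ^ Suc m"
  \<comment> \<open>The exponents \<open>i\<close> and \<open>j\<close> of the two denominators are balanced, so that \<open>u\<close> and \<open>e\<close> are scaled by the same unit \<open>g\<^bsup>i+j\<^esup>\<close>.\<close>
  define h where "h = ?G [^]\<^bsub>sec S ?D\<^esub> (i + j)"
  define u' where "u' = g [^]\<^bsub>sec S W\<^esub> j \<otimes>\<^bsub>sec S W\<^esub> tu"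
  define e' where "e' = g [^]\<^bsub>sec S W\<^esub> i \<otimes>\<^bsub>sec S W\<^esub> te"
  have cW: "u' \<in> carrier (sec S W)" "e' \<in> carrier (sec S W)" using g tu te by (auto simp: u'_def e'_def)
  have hU: "h \<in> Units (sec S ?D)" unfolding h_def using af(6)[OF g] by (rule D.Units_pow_closed)
  have hc: "h \<in> carrier (sec S ?D)" using hU by blast
  have ru: "res S W ?D u' = h \<otimes>\<^bsub>sec S ?D\<^esub> ?u"
    unfolding u'_def h_def using g tu c
    by (simp add: WD.hom_pow_nat tu(2)[symmetric] D.nat_pow_mult[symmetric] D.m_ac)
  have re: "res S W ?D e' = h \<otimes>\<^bsub>sec S ?D\<^esub> ?e"
    unfolding e'_def h_def using g te c
    by (simp add: WD.hom_pow_nat te(2)[symmetric] D.nat_pow_mult[symmetric] D.m_ac)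
  have fk: "frob_exp k (card (carrier k))" by (rule k.finite_field_frob_exp[OF fin])
  have Q1: "1 < ?Q" by (rule frob_exp_gt_1[OF frob_exp_pow[OF fk]])
  have QS: "Suc (?Q - 1) = ?Q" using Q1 by simp
  have eqD: "?u [^]\<^bsub>sec S ?D\<^esub> ?Q = ?e [^]\<^bsub>sec S ?D\<^esub> (?Q - 1) \<otimes>\<^bsub>sec S ?D\<^esub> ?u"
    using arg_cong[OF eq, of "res S U ?D"] UD.hom_pow_nat[OF u] UD.hom_pow_nat[OF e(1)]
      UD.hom_mult[OF U.nat_pow_closed[OF e(1)] u] by metis
  define Q where "Q = ?Q - 1"
  have "(h \<otimes>\<^bsub>sec S ?D\<^esub> ?u) [^]\<^bsub>sec S ?D\<^esub> Suc Q = (h \<otimes>\<^bsub>sec S ?D\<^esub> ?e) [^]\<^bsub>sec S ?D\<^esub> Q \<otimes>\<^bsub>sec S ?D\<^esub> (h \<otimes>\<^bsub>sec S ?D\<^esub> ?u)"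
  proof -
    have "(h \<otimes>\<^bsub>sec S ?D\<^esub> ?u) [^]\<^bsub>sec S ?D\<^esub> Suc Q = h [^]\<^bsub>sec S ?D\<^esub> Suc Q \<otimes>\<^bsub>sec S ?D\<^esub> ?u [^]\<^bsub>sec S ?D\<^esub> Suc Q"
      by (rule D.nat_pow_distrib[OF hc c(2)])
    also have "?u [^]\<^bsub>sec S ?D\<^esub> Suc Q = ?e [^]\<^bsub>sec S ?D\<^esub> Q \<otimes>\<^bsub>sec S ?D\<^esub> ?u"
      unfolding Q_def QS by (rule eqD)
    finally show ?thesis using hc c D.nat_pow_distrib[OF hc c(3), of Q] by (simp add: D.m_ac)
  qed
  then have "res S W ?D (u' [^]\<^bsub>sec S W\<^esub> Suc Q) = res S W ?D (e' [^]\<^bsub>sec S W\<^esub> Q \<otimes>\<^bsub>sec S W\<^esub> u')"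
    using WD.hom_pow_nat[OF cW(1), of "Suc Q"] WD.hom_pow_nat[OF cW(2), of Q]
      WD.hom_mult[OF W.nat_pow_closed[OF cW(2)] cW(1), of Q] ru re by metis
  then have z: "res S W ?D (u' [^]\<^bsub>sec S W\<^esub> Suc Q \<ominus>\<^bsub>sec S W\<^esub> e' [^]\<^bsub>sec S W\<^esub> Q \<otimes>\<^bsub>sec S W\<^esub> u') = \<zero>\<^bsub>sec S ?D\<^esub>"
    using cW by (simp add: a_minus_def D.r_neg del: W.nat_pow_Suc)
  have eqW: "u' [^]\<^bsub>sec S W\<^esub> Suc Q = e' [^]\<^bsub>sec S W\<^esub> Q \<otimes>\<^bsub>sec S W\<^esub> u'"
    using res_zero_imp[OF af(1) oD nonvan_sub Dne _ z] cW by (simp del: W.nat_pow_Suc)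
  interpret K: algebraic_closure "field.alg_closure k" "ring.indexed_const k ` carrier k" by (rule k.alg_closureE(1))
  interpret t: frobenius_tensor k "str_on S W" "sec S W" "ring.indexed_const k" "field.alg_closure k"
  proof
    show "str_on S W \<in> ring_hom k (sec S W)" by (rule str_on_hom[OF af(1)])
    show "ring.indexed_const k \<in> ring_hom k (field.alg_closure k)" by (rule k.alg_closureE(2))
    show "finite (carrier k)" by (rule fin)
  qed
  have irr: "irreducible_spectrum t.T" using gi W Wne unfolding geometrically_irreducible_def by blast
  obtain d where d: "d \<in> carrier k" "u' = str_on S W d \<otimes>\<^bsub>sec S W\<^esub> e'"
    using t.homogeneous_ratio[OF K.algebraically_closed_axioms irr cW, of m] eqW unfolding Q_def QS by blast
  have dc: "str_on S V d \<in> carrier (sec S V)" if "openin T V" for V using ring_hom_memE(1)[OF str_on_hom[OF that] d(1)] .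
  have "h \<otimes>\<^bsub>sec S ?D\<^esub> ?u = h \<otimes>\<^bsub>sec S ?D\<^esub> (str_on S ?D d \<otimes>\<^bsub>sec S ?D\<^esub> ?e)"
    using ru re d(2) WD.hom_mult[OF dc[OF af(1)] cW(2)] res_str_on[OF af(1) oD nonvan_sub d(1)] hc c dc[OF oD]
    by (simp add: D.m_lcomm)
  then have "?u = str_on S ?D d \<otimes>\<^bsub>sec S ?D\<^esub> ?e" using D.Units_l_cancel[OF hU] c dc[OF oD] by simp
  then have "res S U ?D (u \<ominus>\<^bsub>sec S U\<^esub> str_on S U d \<otimes>\<^bsub>sec S U\<^esub> e) = \<zero>\<^bsub>sec S ?D\<^esub>"
    using u e dc[OF U(1)] dc[OF oD] c res_str_on[OF U(1) oD DU d(1)] by (simp add: a_minus_def D.r_neg)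
  then have "u \<ominus>\<^bsub>sec S U\<^esub> str_on S U d \<otimes>\<^bsub>sec S U\<^esub> e = \<zero>\<^bsub>sec S U\<^esub>"
    using res_zero_imp[OF U(1) oD DU Dne] u e dc[OF U(1)] by simp
  then show ?thesis using d(1) u e dc[OF U(1)] by auto
qed

end

section \<open>Quotient modules\<close>

lemma coset_facts:
  fixes M :: "('r, 'm) module"
  assumes M: "module R M" and N: "submodule N R M"
  shows "x \<in> carrier M \<Longrightarrow> (N +>\<^bsub>M\<^esub> x = N) = (x \<in> N)"
    and "x \<in> carrier M \<Longrightarrow> a \<in> carrier R \<Longrightarrow> a \<odot>\<^bsub>quot_module M N\<^esub> (N +>\<^bsub>M\<^esub> x) = N +>\<^bsub>M\<^esub> (a \<odot>\<^bsub>M\<^esub> x)"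
    and "carrier (quot_module M N) = (\<lambda>x. N +>\<^bsub>M\<^esub> x) ` carrier M"
    and "\<zero>\<^bsub>quot_module M N\<^esub> = N"
proof -
  interpret module R M by (rule M)
  interpret N: abelian_subgroup N M
    by (rule abelian_subgroupI3[OF additive_subgroup.intro[OF submodule.axioms(1)[OF N]] abelian_group_axioms])
  show 1: "(N +>\<^bsub>M\<^esub> x = N) = (x \<in> N)" if "x \<in> carrier M" for x
    using N.a_rcos_self[OF that] N.a_rcos_const[of x] by auto
  show "a \<odot>\<^bsub>quot_module M N\<^esub> (N +>\<^bsub>M\<^esub> x) = N +>\<^bsub>M\<^esub> (a \<odot>\<^bsub>M\<^esub> x)" if x: "x \<in> carrier M" and a: "a \<in> carrier R"
  proof -
    have "N +>\<^bsub>M\<^esub> (a \<odot>\<^bsub>M\<^esub> y) = N +>\<^bsub>M\<^esub> (a \<odot>\<^bsub>M\<^esub> x)" if y: "y \<in> N +>\<^bsub>M\<^esub> x" for y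
    proof -
      obtain n where n: "n \<in> N" "y = n \<oplus>\<^bsub>M\<^esub> x" using y unfolding a_r_coset_def' by blast
      have nc: "n \<in> carrier M" using n(1) N.a_subset by blast
      have "a \<odot>\<^bsub>M\<^esub> y = a \<odot>\<^bsub>M\<^esub> n \<oplus>\<^bsub>M\<^esub> a \<odot>\<^bsub>M\<^esub> x" unfolding n(2) using a nc x by (rule smult_r_distr)
      moreover have "a \<odot>\<^bsub>M\<^esub> n \<in> N" using submodule.smult_closed[OF N a n(1)] .
      ultimately have "a \<odot>\<^bsub>M\<^esub> y \<in> N +>\<^bsub>M\<^esub> (a \<odot>\<^bsub>M\<^esub> x)" unfolding a_r_coset_def' by blast
      then show ?thesis using N.a_repr_independence' a x smult_closed by metis
    qed
    then have "(\<Union>y\<in>N +>\<^bsub>M\<^esub> x. N +>\<^bsub>M\<^esub> (a \<odot>\<^bsub>M\<^esub> y)) = N +>\<^bsub>M\<^esub> (a \<odot>\<^bsub>M\<^esub> x)"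
      using N.a_rcos_self[OF x] by blast
    then show ?thesis by (simp add: quot_module_def)
  qed
  show "carrier (quot_module M N) = (\<lambda>x. N +>\<^bsub>M\<^esub> x) ` carrier M"
    unfolding quot_module_def A_RCOSETS_def' by auto
  show "\<zero>\<^bsub>quot_module M N\<^esub> = N" by (simp add: quot_module_def)
qed

lemma mod_homD:
  assumes "f \<in> mod_hom R M M'"
  shows "x \<in> carrier M \<Longrightarrow> f x \<in> carrier M'"
    "x \<in> carrier M \<Longrightarrow> y \<in> carrier M \<Longrightarrow> f (x \<oplus>\<^bsub>M\<^esub> y) = f x \<oplus>\<^bsub>M'\<^esub> f y"
    "a \<in> carrier R \<Longrightarrow> x \<in> carrier M \<Longrightarrow> f (a \<odot>\<^bsub>M\<^esub> x) = a \<odot>\<^bsub>M'\<^esub> f x"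
  using assms unfolding mod_hom_def by auto

lemma mod_hom_zero:
  assumes M: "abelian_group M" and M': "abelian_group M'" and f: "f \<in> mod_hom R M M'"
  shows "f \<zero>\<^bsub>M\<^esub> = \<zero>\<^bsub>M'\<^esub>"
proof -
  interpret M: abelian_group M by fact
  interpret M': abelian_group M' by fact
  show ?thesis using mod_homD(2)[OF f, of "\<zero>\<^bsub>M\<^esub>" "\<zero>\<^bsub>M\<^esub>"] mod_homD(1)[OF f, of "\<zero>\<^bsub>M\<^esub>"]
    by (simp add: M'.add.l_cancel_one')
qed

text \<open>The source is an abelian group with an action rather than a module, since this is all that will be
known of scalar extensions.\<close>

lemma image_submodule:
  assumes M: "abelian_group M" and sm: "\<And>a x. a \<in> carrier R \<Longrightarrow> x \<in> carrier M \<Longrightarrow> a \<odot>\<^bsub>M\<^esub> x \<in> carrier M"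
    and M': "module R M'" and f: "f \<in> mod_hom R M M'"
  shows "submodule (f ` carrier M) R M'"
proof -
  interpret M: abelian_group M by fact
  interpret M': module R M' by fact
  note fD = mod_homD[OF f]
  have z: "f \<zero>\<^bsub>M\<^esub> = \<zero>\<^bsub>M'\<^esub>" by (rule mod_hom_zero[OF M M'.abelian_group_axioms f])
  show ?thesis
  proof (rule M'.submoduleI)
    show "f ` carrier M \<subseteq> carrier M'" using fD(1) by blast
    show "\<zero>\<^bsub>M'\<^esub> \<in> f ` carrier M" using z M.zero_closed by (metis imageI)
    show "\<ominus>\<^bsub>M'\<^esub> y \<in> f ` carrier M" if y: "y \<in> f ` carrier M" for y
    proof -
      obtain x where x: "x \<in> carrier M" "y = f x" using y by blast
      have "f (\<ominus>\<^bsub>M\<^esub> x) \<oplus>\<^bsub>M'\<^esub> f x = \<zero>\<^bsub>M'\<^esub>" using fD(2)[of "\<ominus>\<^bsub>M\<^esub> x" x] x z by (simp add: M.l_neg)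
      then have "\<ominus>\<^bsub>M'\<^esub> y = f (\<ominus>\<^bsub>M\<^esub> x)" unfolding x(2) using x fD(1) by (intro M'.minus_equality) auto
      then show ?thesis using x by blast
    qed
    show "y \<oplus>\<^bsub>M'\<^esub> y' \<in> f ` carrier M" if y: "y \<in> f ` carrier M" "y' \<in> f ` carrier M" for y y'
    proof -
      obtain x x' where x: "x \<in> carrier M" "y = f x" "x' \<in> carrier M" "y' = f x'" using y by blast
      then have "y \<oplus>\<^bsub>M'\<^esub> y' = f (x \<oplus>\<^bsub>M\<^esub> x')" using fD(2) by simp
      then show ?thesis using x M.a_closed by blast
    qed
    show "a \<odot>\<^bsub>M'\<^esub> y \<in> f ` carrier M" if a: "a \<in> carrier R" and y: "y \<in> f ` carrier M" for a y
    proof -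
      obtain x where x: "x \<in> carrier M" "y = f x" using y by blast
      have "a \<odot>\<^bsub>M'\<^esub> y = f (a \<odot>\<^bsub>M\<^esub> x)" using fD(3)[OF a x(1)] x by simp
      then show ?thesis using sm[OF a x(1)] by blast
    qed
  qed
qed

lemma annihilates_coker_iff:
  assumes "module R M'" "submodule (f ` carrier M) R M'" "a \<in> carrier R"
  shows "annihilates (coker M M' f) a \<longleftrightarrow> (\<forall>x\<in>carrier M'. a \<odot>\<^bsub>M'\<^esub> x \<in> f ` carrier M)"
proof -
  interpret M': module R M' by fact
  note c = coset_facts[OF assms(1,2)]
  show ?thesis unfolding annihilates_def coker_def c(3,4) using c(1,2) assms(3) by auto
qed

lemma torsion_coker_iff:
  assumes "module R M'" "submodule (f ` carrier M) R M'"
  shows "torsion_module R (coker M M' f) \<longleftrightarrow>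
    (\<forall>x\<in>carrier M'. \<exists>a\<in>carrier R. a \<noteq> \<zero>\<^bsub>R\<^esub> \<and> a \<odot>\<^bsub>M'\<^esub> x \<in> f ` carrier M)"
proof -
  interpret M': module R M' by fact
  note c = coset_facts[OF assms(1,2)]
  show ?thesis unfolding torsion_module_def coker_def c(3,4) using c(1,2) by auto
qed

section \<open>Extension of scalars\<close>

locale scalar_extension =
  fixes R :: "'r ring" and \<phi> :: "'r \<Rightarrow> 's" and S :: "'s ring" and M :: "('r, 'm) module"
  assumes S: "cring S" and \<phi>: "\<phi> \<in> ring_hom R S" and M: "module R M"
begin

abbreviation F where "F \<equiv> free_Abelian_group (carrier M \<times> carrier S)"
abbreviation Rel where "Rel \<equiv> base_change_rel R \<phi> S M"
abbreviation BC where "BC \<equiv> base_change R \<phi> S M"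
abbreviation cls where "cls \<equiv> base_change_coset R \<phi> S M"
abbreviation pure where "pure \<equiv> base_change_pure R \<phi> S M"

sublocale S: cring S by (rule S)
sublocale M: module R M by (rule M)
sublocale \<phi>: ring_hom_ring R S \<phi> by (rule ring_hom_ringI2[OF M.ring_axioms S.ring_axioms \<phi>])
sublocale F: comm_group F by (rule abelian_free_Abelian_group)

definition gens where "gens =
    {frag_of (x \<oplus>\<^bsub>M\<^esub> x', s) - frag_of (x, s) - frag_of (x', s) | x x' s.
        x \<in> carrier M \<and> x' \<in> carrier M \<and> s \<in> carrier S} \<union>
     {frag_of (x, s \<oplus>\<^bsub>S\<^esub> s') - frag_of (x, s) - frag_of (x, s') | x s s'.
        x \<in> carrier M \<and> s \<in> carrier S \<and> s' \<in> carrier S} \<union>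
     {frag_of (a \<odot>\<^bsub>M\<^esub> x, s) - frag_of (x, \<phi> a \<otimes>\<^bsub>S\<^esub> s) | a x s.
        a \<in> carrier R \<and> x \<in> carrier M \<and> s \<in> carrier S}"

lemma gens_intros:
  "x \<in> carrier M \<Longrightarrow> x' \<in> carrier M \<Longrightarrow> s \<in> carrier S \<Longrightarrow>
    frag_of (x \<oplus>\<^bsub>M\<^esub> x', s) - frag_of (x, s) - frag_of (x', s) \<in> gens"
  "x \<in> carrier M \<Longrightarrow> s \<in> carrier S \<Longrightarrow> s' \<in> carrier S \<Longrightarrow>
    frag_of (x, s \<oplus>\<^bsub>S\<^esub> s') - frag_of (x, s) - frag_of (x, s') \<in> gens"
  "a \<in> carrier R \<Longrightarrow> x \<in> carrier M \<Longrightarrow> s \<in> carrier S \<Longrightarrow>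
    frag_of (a \<odot>\<^bsub>M\<^esub> x, s) - frag_of (x, \<phi> a \<otimes>\<^bsub>S\<^esub> s) \<in> gens"
  unfolding gens_def by blast+

lemma gens_cases [consumes 1, case_names left right scalar]:
  assumes "r \<in> gens"
  obtains x x' s where "x \<in> carrier M" "x' \<in> carrier M" "s \<in> carrier S"
      "r = frag_of (x \<oplus>\<^bsub>M\<^esub> x', s) - frag_of (x, s) - frag_of (x', s)"
    | x s s' where "x \<in> carrier M" "s \<in> carrier S" "s' \<in> carrier S"
      "r = frag_of (x, s \<oplus>\<^bsub>S\<^esub> s') - frag_of (x, s) - frag_of (x, s')"
    | a x s where "a \<in> carrier R" "x \<in> carrier M" "s \<in> carrier S"
      "r = frag_of (a \<odot>\<^bsub>M\<^esub> x, s) - frag_of (x, \<phi> a \<otimes>\<^bsub>S\<^esub> s)"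
  using assms(1) unfolding gens_def
  by (elim UnE CollectE exE conjE) (rule that(1) that(2) that(3); assumption)+

lemma Rel_eq: "Rel = generate F gens" by (simp add: base_change_rel_def gens_def)

lemma F_diff: "x \<in> carrier F \<Longrightarrow> y \<in> carrier F \<Longrightarrow> x - y \<in> carrier F"
  unfolding carrier_free_Abelian_group_iff by (meson Un_least keys_diff order.trans)

lemma F_of: "x \<in> carrier M \<Longrightarrow> s \<in> carrier S \<Longrightarrow> frag_of (x, s) \<in> carrier F" by simp

lemma gens_F: "gens \<subseteq> carrier F"
  unfolding gens_def by (auto simp del: carrier_free_Abelian_group_iff intro!: F_diff F_of)

lemma sub_Rel: "subgroup Rel F" unfolding Rel_eq by (rule F.generate_is_subgroup[OF gens_F])

lemma gens_Rel: "x \<in> gens \<Longrightarrow> x \<in> Rel" unfolding Rel_eq by (rule generate.incl)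

sublocale N: normal Rel F by (rule F.subgroup_imp_normal[OF sub_Rel])

lemma cls_def': "cls z = Rel #>\<^bsub>F\<^esub> z" by (simp add: base_change_coset_def)

lemma BC_carrier: "carrier BC = cls ` carrier F"
  unfolding base_change_def RCOSETS_def by (auto simp: cls_def')

lemma BC_zero: "\<zero>\<^bsub>BC\<^esub> = Rel" by (simp add: base_change_def)

lemma cls_add: "x \<in> carrier F \<Longrightarrow> y \<in> carrier F \<Longrightarrow> cls x \<oplus>\<^bsub>BC\<^esub> cls y = cls (x + y)"
  using N.rcos_sum[of x y] by (simp add: base_change_def cls_def')

lemma cls_eq_iff: "x \<in> carrier F \<Longrightarrow> y \<in> carrier F \<Longrightarrow> cls x = cls y \<longleftrightarrow> x - y \<in> Rel"
proof -
  assume xy: "x \<in> carrier F" "y \<in> carrier F"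
  have "cls x = cls y \<longleftrightarrow> x \<in> cls y"
    unfolding cls_def' using F.repr_independence[OF _ xy(2) sub_Rel, of x] F.rcos_self[OF xy(1) sub_Rel] by auto
  also have "\<dots> \<longleftrightarrow> x - y \<in> Rel"
  proof
    assume "x \<in> cls y"
    then obtain r where "r \<in> Rel" "x = r + y" unfolding cls_def' r_coset_def by auto
    then show "x - y \<in> Rel" by simp
  next
    assume "x - y \<in> Rel"
    then show "x \<in> cls y" unfolding cls_def' r_coset_def by (auto intro!: bexI[of _ "x - y"])
  qed
  finally show ?thesis .
qed

lemma cls_0: "cls 0 = \<zero>\<^bsub>BC\<^esub>"
  unfolding BC_zero cls_def' using F.coset_join2[OF F.one_closed sub_Rel] subgroup.one_closed[OF sub_Rel] by simp

lemma group_BC: "abelian_group BC"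
proof (rule abelian_groupI)
  have F0: "(0 :: 'm \<times> 's \<Rightarrow>\<^sub>0 int) \<in> carrier F" by simp
  note Fadd = F.m_closed[unfolded mult_free_Abelian_group]
  show "x \<oplus>\<^bsub>BC\<^esub> y \<in> carrier BC" if xy: "x \<in> carrier BC" "y \<in> carrier BC" for x y
  proof -
    obtain z w where zw: "z \<in> carrier F" "x = cls z" "w \<in> carrier F" "y = cls w" using xy unfolding BC_carrier by blast
    show ?thesis unfolding zw(2,4) cls_add[OF zw(1,3)] BC_carrier by (rule imageI[OF Fadd[OF zw(1,3)]])
  qed
  show "\<zero>\<^bsub>BC\<^esub> \<in> carrier BC" unfolding BC_carrier cls_0[symmetric] using F0 by (rule imageI)
  show "(x \<oplus>\<^bsub>BC\<^esub> y) \<oplus>\<^bsub>BC\<^esub> z = x \<oplus>\<^bsub>BC\<^esub> (y \<oplus>\<^bsub>BC\<^esub> z)"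
    if "x \<in> carrier BC" "y \<in> carrier BC" "z \<in> carrier BC" for x y z
    using that unfolding BC_carrier by (elim imageE) (simp only: cls_add Fadd add.assoc)
  show "x \<oplus>\<^bsub>BC\<^esub> y = y \<oplus>\<^bsub>BC\<^esub> x" if "x \<in> carrier BC" "y \<in> carrier BC" for x y
    using that unfolding BC_carrier by (elim imageE) (simp only: cls_add Fadd add.commute)
  show "\<zero>\<^bsub>BC\<^esub> \<oplus>\<^bsub>BC\<^esub> x = x" if "x \<in> carrier BC" for x
    using that F0 unfolding BC_carrier cls_0[symmetric] by (elim imageE) (simp only: cls_add add_0)
  show "\<exists>y\<in>carrier BC. y \<oplus>\<^bsub>BC\<^esub> x = \<zero>\<^bsub>BC\<^esub>" if x: "x \<in> carrier BC" for x
  proof -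
    obtain z where z: "z \<in> carrier F" "x = cls z" using x unfolding BC_carrier by blast
    have "0 - z \<in> carrier F" using F_diff[OF F0 z(1)] .
    then have "cls (0 - z) \<in> carrier BC" "cls (0 - z) \<oplus>\<^bsub>BC\<^esub> x = \<zero>\<^bsub>BC\<^esub>"
      unfolding BC_carrier z(2) cls_add[OF \<open>0 - z \<in> carrier F\<close> z(1)] cls_0[symmetric] by auto
    then show ?thesis by blast
  qed
qed

sublocale BC: abelian_group BC by (rule group_BC)

lemma pure_eq: "pure x s = cls (frag_of (x, s))" by (simp add: base_change_pure_def)

lemma pure_closed [simp]: "x \<in> carrier M \<Longrightarrow> s \<in> carrier S \<Longrightarrow> pure x s \<in> carrier BC"
  unfolding pure_eq BC_carrier by (rule imageI[OF F_of])

lemma cls_rel2: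
  assumes "x - y - z \<in> gens" "x \<in> carrier F" "y \<in> carrier F" "z \<in> carrier F"
  shows "cls x = cls y \<oplus>\<^bsub>BC\<^esub> cls z"
proof -
  have "x - (y + z) \<in> Rel" using gens_Rel[OF assms(1)] by (simp add: diff_diff_eq)
  then show ?thesis
    using cls_eq_iff[OF assms(2) F.m_closed[OF assms(3,4)]] cls_add[OF assms(3,4)] by simp
qed

lemma pure_add_left:
  assumes "x \<in> carrier M" "x' \<in> carrier M" "s \<in> carrier S"
  shows "pure (x \<oplus>\<^bsub>M\<^esub> x') s = pure x s \<oplus>\<^bsub>BC\<^esub> pure x' s"
  unfolding pure_eq by (rule cls_rel2) (use assms in \<open>auto simp: gens_def\<close>)

lemma pure_balanced:
  assumes "a \<in> carrier R" "x \<in> carrier M" "s \<in> carrier S"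
  shows "pure (a \<odot>\<^bsub>M\<^esub> x) s = pure x (\<phi> a \<otimes>\<^bsub>S\<^esub> s)"
  unfolding pure_eq using assms
  by (subst cls_eq_iff) (auto simp: gens_def intro!: gens_Rel)

lemma pure_zero: "s \<in> carrier S \<Longrightarrow> pure \<zero>\<^bsub>M\<^esub> s = \<zero>\<^bsub>BC\<^esub>"
  using pure_add_left[of "\<zero>\<^bsub>M\<^esub>" "\<zero>\<^bsub>M\<^esub>" s] by (simp add: BC.add.l_cancel_one')

lemma pure_minus: "x \<in> carrier M \<Longrightarrow> s \<in> carrier S \<Longrightarrow> \<ominus>\<^bsub>BC\<^esub> pure x s = pure (\<ominus>\<^bsub>M\<^esub> x) s"
  using pure_add_left[of "\<ominus>\<^bsub>M\<^esub> x" x s] pure_zero[of s] by (intro BC.minus_equality) (auto simp: M.l_neg)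

text \<open>Negatives of pure tensors are pure, so sums suffice.\<close>

lemma BC_induct [consumes 1, case_names zero pure add]:
  assumes z: "z \<in> carrier BC" and P0: "P \<zero>\<^bsub>BC\<^esub>"
    and Pp: "\<And>x s. x \<in> carrier M \<Longrightarrow> s \<in> carrier S \<Longrightarrow> P (pure x s)"
    and Pa: "\<And>x y. x \<in> carrier BC \<Longrightarrow> y \<in> carrier BC \<Longrightarrow> P x \<Longrightarrow> P y \<Longrightarrow> P (x \<oplus>\<^bsub>BC\<^esub> y)"
  shows "P z"
proof -
  obtain w where w: "w \<in> carrier F" "z = cls w" using z unfolding BC_carrier by blast
  have "P (cls w) \<and> P (cls (0 - w))"
  proof (rule free_Abelian_group_induct[of w "carrier M \<times> carrier S"])
    show "Poly_Mapping.keys w \<subseteq> carrier M \<times> carrier S" using w(1) by simp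
    show "P (cls 0) \<and> P (cls (0 - 0))" using P0 by (simp add: cls_0)
  next
    fix x y :: "'m \<times> 's \<Rightarrow>\<^sub>0 int"
    assume k: "Poly_Mapping.keys x \<subseteq> carrier M \<times> carrier S" "Poly_Mapping.keys y \<subseteq> carrier M \<times> carrier S"
      and P: "P (cls x) \<and> P (cls (0 - x))" "P (cls y) \<and> P (cls (0 - y))"
    have c: "x \<in> carrier F" "y \<in> carrier F" "0 - x \<in> carrier F" "0 - y \<in> carrier F" using k by auto
    have "cls (x - y) = cls x \<oplus>\<^bsub>BC\<^esub> cls (0 - y)" "cls (0 - (x - y)) = cls y \<oplus>\<^bsub>BC\<^esub> cls (0 - x)"
      using cls_add[OF c(1,4)] cls_add[OF c(2,3)] by simp_all
    then show "P (cls (x - y)) \<and> P (cls (0 - (x - y)))" using P Pa c BC_carrier by auto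
  next
    fix a assume a: "a \<in> carrier M \<times> carrier S"
    obtain x s where xs: "a = (x, s)" "x \<in> carrier M" "s \<in> carrier S" using a by blast
    have f0: "0 - frag_of (x, s) \<in> carrier F" using xs by simp
    have "cls (0 - frag_of (x, s)) \<oplus>\<^bsub>BC\<^esub> pure x s = \<zero>\<^bsub>BC\<^esub>"
      unfolding pure_eq cls_add[OF f0 F_of[OF xs(2,3)]] cls_0[symmetric] by simp
    moreover have "cls (0 - frag_of (x, s)) \<in> carrier BC" unfolding BC_carrier using f0 by (rule imageI)
    ultimately have "cls (0 - frag_of (x, s)) = \<ominus>\<^bsub>BC\<^esub> pure x s" using xs BC.minus_equality by force
    then have "cls (0 - frag_of (x, s)) = pure (\<ominus>\<^bsub>M\<^esub> x) s" using pure_minus xs by simp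
    then show "P (cls (frag_of a)) \<and> P (cls (0 - frag_of a))" using Pp xs by (simp add: pure_eq)
  qed
  then show ?thesis using w(2) by simp
qed

text \<open>The operations on scalar extensions are given as unions over all representatives of a coset; these
unions collapse as soon as relations are mapped to relations.\<close>

lemma union_rep:
  assumes sub: "subgroup Rel' F'" and F': "F' = free_Abelian_group T"
    and g: "\<And>x s. x \<in> carrier M \<Longrightarrow> s \<in> carrier S \<Longrightarrow> g (x, s) \<in> carrier F'"
    and gg: "\<And>r. r \<in> gens \<Longrightarrow> frag_extend g r \<in> Rel'" and z: "z \<in> carrier F"
  shows "frag_extend g z \<in> carrier F'" "(\<Union>w\<in>cls z. Rel' #>\<^bsub>F'\<^esub> frag_extend g w) = Rel' #>\<^bsub>F'\<^esub> frag_extend g z"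
proof -
  let ?e = "frag_extend g"
  interpret F': comm_group F' unfolding F' by (rule abelian_free_Abelian_group)
  have F'd: "x - y \<in> carrier F'" if "x \<in> carrier F'" "y \<in> carrier F'" for x y
    using that unfolding F' carrier_free_Abelian_group_iff by (meson Un_least keys_diff order.trans)
  have ec: "?e w \<in> carrier F'" if "w \<in> carrier F" for w
  proof (rule free_Abelian_group_induct[of w "carrier M \<times> carrier S"])
    show "Poly_Mapping.keys w \<subseteq> carrier M \<times> carrier S" using that by simp
    show "?e 0 \<in> carrier F'" unfolding F' by simp
    show "?e (x - y) \<in> carrier F'" if "?e x \<in> carrier F'" "?e y \<in> carrier F'" for x y
      unfolding frag_extend_diff using that by (rule F'd)
    show "?e (frag_of a) \<in> carrier F'" if "a \<in> carrier M \<times> carrier S" for a using that g by auto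
  qed
  show "?e z \<in> carrier F'" using ec[OF z] .
  let ?K = "{w \<in> carrier F. ?e w \<in> Rel'}"
  have m': "x \<otimes>\<^bsub>F'\<^esub> y = x + y" "\<one>\<^bsub>F'\<^esub> = 0" for x y unfolding F' by simp_all
  have i': "inv\<^bsub>F'\<^esub> x = - x" if "x \<in> carrier F'" for x using that unfolding F' by simp
  have "subgroup ?K F"
  proof (rule F.subgroupI)
    show "?K \<subseteq> carrier F" by blast
    have "0 \<in> ?K" using subgroup.one_closed[OF sub] m' by simp
    then show "?K \<noteq> {}" by blast
    show "inv\<^bsub>F\<^esub> w \<in> ?K" if "w \<in> ?K" for w
    proof -
      have w: "w \<in> carrier F" "?e w \<in> Rel'" using that by blast+
      have "?e (- w) = - ?e w" by (rule frag_extend_minus)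
      then have "?e (- w) \<in> Rel'" using subgroup.m_inv_closed[OF sub w(2)] i'[OF ec[OF w(1)]] by simp
      moreover have "inv\<^bsub>F\<^esub> w = - w" using w(1) by simp
      ultimately show ?thesis using F.inv_closed[OF w(1)] by simp
    qed
    show "w \<otimes>\<^bsub>F\<^esub> w' \<in> ?K" if "w \<in> ?K" "w' \<in> ?K" for w w'
    proof -
      have w: "w \<in> carrier F" "?e w \<in> Rel'" "w' \<in> carrier F" "?e w' \<in> Rel'" using that by blast+
      have "?e (w + w') \<in> Rel'" using subgroup.m_closed[OF sub w(2,4)] by (simp add: frag_extend_add m')
      then show ?thesis using F.m_closed[OF w(1,3)] by simp
    qed
  qed
  then have RK: "Rel \<subseteq> ?K" unfolding Rel_eq
    by (rule F.generate_subgroup_incl[rotated]) (use gens_F gg in blast)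
  have eq: "Rel' #>\<^bsub>F'\<^esub> ?e w = Rel' #>\<^bsub>F'\<^esub> ?e z" if w: "w \<in> cls z" for w
  proof -
    obtain r where r: "r \<in> Rel" "w = r + z" using w unfolding cls_def' r_coset_def by auto
    have er: "?e r \<in> Rel'" using RK r(1) by blast
    have "?e w \<in> Rel' #>\<^bsub>F'\<^esub> ?e z" unfolding r(2) frag_extend_add r_coset_def using er m' by auto
    then show ?thesis using F'.repr_independence[OF _ ec[OF z] sub] by simp
  qed
  have "z \<in> cls z" unfolding cls_def' by (rule F.rcos_self[OF z sub_Rel])
  then show "(\<Union>w\<in>cls z. Rel' #>\<^bsub>F'\<^esub> ?e w) = Rel' #>\<^bsub>F'\<^esub> ?e z" using eq by blast
qed

lemma smult_cls:
  assumes s: "s \<in> carrier S" and z: "z \<in> carrier F"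
  shows "frag_extend (\<lambda>(x, t). frag_of (x, s \<otimes>\<^bsub>S\<^esub> t)) z \<in> carrier F"
    "s \<odot>\<^bsub>BC\<^esub> cls z = cls (frag_extend (\<lambda>(x, t). frag_of (x, s \<otimes>\<^bsub>S\<^esub> t)) z)"
proof -
  have gg: "frag_extend (\<lambda>(x, t). frag_of (x, s \<otimes>\<^bsub>S\<^esub> t)) r \<in> Rel" if r: "r \<in> gens" for r
  proof (rule gens_Rel)
    show "frag_extend (\<lambda>(x, t). frag_of (x, s \<otimes>\<^bsub>S\<^esub> t)) r \<in> gens"
      using r
    proof (cases rule: gens_cases)
      case (left x x' t)
      then show ?thesis using gens_intros(1)[of x x' "s \<otimes>\<^bsub>S\<^esub> t"] s by (simp add: frag_extend_diff)
    next
      case (right x t t')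
      then show ?thesis using gens_intros(2)[of x "s \<otimes>\<^bsub>S\<^esub> t" "s \<otimes>\<^bsub>S\<^esub> t'"] s by (simp add: frag_extend_diff S.r_distr)
    next
      case (scalar a x t)
      then show ?thesis using gens_intros(3)[of a x "s \<otimes>\<^bsub>S\<^esub> t"] s by (simp add: frag_extend_diff S.m_lcomm)
    qed
  qed
  note u = union_rep[OF sub_Rel refl _ gg z]
  show "frag_extend (\<lambda>(x, t). frag_of (x, s \<otimes>\<^bsub>S\<^esub> t)) z \<in> carrier F" by (rule u(1)) (use s in auto)
  have "(\<Union>w\<in>cls z. cls (frag_extend (\<lambda>(x, t). frag_of (x, s \<otimes>\<^bsub>S\<^esub> t)) w)) = cls (frag_extend (\<lambda>(x, t). frag_of (x, s \<otimes>\<^bsub>S\<^esub> t)) z)"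
    unfolding cls_def'[of "frag_extend _ _"] by (rule u(2)) (use s in auto)
  then show "s \<odot>\<^bsub>BC\<^esub> cls z = cls (frag_extend (\<lambda>(x, t). frag_of (x, s \<otimes>\<^bsub>S\<^esub> t)) z)" by (simp add: base_change_def)
qed

lemma smult_closed: "s \<in> carrier S \<Longrightarrow> P \<in> carrier BC \<Longrightarrow> s \<odot>\<^bsub>BC\<^esub> P \<in> carrier BC"
  unfolding BC_carrier by (elim imageE) (simp only: smult_cls imageI)

lemma smult_pure: "s \<in> carrier S \<Longrightarrow> x \<in> carrier M \<Longrightarrow> t \<in> carrier S \<Longrightarrow> s \<odot>\<^bsub>BC\<^esub> pure x t = pure x (s \<otimes>\<^bsub>S\<^esub> t)"
  using smult_cls(2)[OF _ F_of] by (simp add: pure_eq)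

lemma smult_add:
  assumes s: "s \<in> carrier S" and x: "x \<in> carrier BC" and y: "y \<in> carrier BC"
  shows "s \<odot>\<^bsub>BC\<^esub> (x \<oplus>\<^bsub>BC\<^esub> y) = s \<odot>\<^bsub>BC\<^esub> x \<oplus>\<^bsub>BC\<^esub> s \<odot>\<^bsub>BC\<^esub> y"
proof -
  obtain z w where zw: "z \<in> carrier F" "x = cls z" "w \<in> carrier F" "y = cls w" using x y unfolding BC_carrier by blast
  have zw': "z + w \<in> carrier F" using F.m_closed[OF zw(1,3)] by simp
  show ?thesis unfolding zw(2,4) cls_add[OF zw(1,3)] smult_cls(2)[OF s zw(1)] smult_cls(2)[OF s zw(3)]
      smult_cls(2)[OF s zw'] cls_add[OF smult_cls(1)[OF s zw(1)] smult_cls(1)[OF s zw(3)]] frag_extend_add ..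
qed

text \<open>The universal property of \<open>M \<otimes>\<^sub>R S\<close>.\<close>

lemma extension_lift:
  fixes H :: "('h, 'z) ring_scheme"
  assumes H: "abelian_group H"
    and cl: "\<And>x s. x \<in> carrier M \<Longrightarrow> s \<in> carrier S \<Longrightarrow> \<psi> x s \<in> carrier H"
    and al: "\<And>x x' s. x \<in> carrier M \<Longrightarrow> x' \<in> carrier M \<Longrightarrow> s \<in> carrier S \<Longrightarrow>
      \<psi> (x \<oplus>\<^bsub>M\<^esub> x') s = \<psi> x s \<oplus>\<^bsub>H\<^esub> \<psi> x' s"
    and ar: "\<And>x s s'. x \<in> carrier M \<Longrightarrow> s \<in> carrier S \<Longrightarrow> s' \<in> carrier S \<Longrightarrow>
      \<psi> x (s \<oplus>\<^bsub>S\<^esub> s') = \<psi> x s \<oplus>\<^bsub>H\<^esub> \<psi> x s'"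
    and ba: "\<And>a x s. a \<in> carrier R \<Longrightarrow> x \<in> carrier M \<Longrightarrow> s \<in> carrier S \<Longrightarrow>
      \<psi> (a \<odot>\<^bsub>M\<^esub> x) s = \<psi> x (\<phi> a \<otimes>\<^bsub>S\<^esub> s)"
  obtains \<Psi> where "\<And>P. P \<in> carrier BC \<Longrightarrow> \<Psi> P \<in> carrier H"
    "\<And>P Q. P \<in> carrier BC \<Longrightarrow> Q \<in> carrier BC \<Longrightarrow> \<Psi> (P \<oplus>\<^bsub>BC\<^esub> Q) = \<Psi> P \<oplus>\<^bsub>H\<^esub> \<Psi> Q"
    "\<And>x s. x \<in> carrier M \<Longrightarrow> s \<in> carrier S \<Longrightarrow> \<Psi> (pure x s) = \<psi> x s"
proof -
  interpret H: abelian_group H by fact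
  have "(\<lambda>(x, s). \<psi> x s) ` (carrier M \<times> carrier S) \<subseteq> carrier (add_monoid H)" using cl by auto
  then obtain h where h0: "h \<in> hom F (add_monoid H)"
    and h1: "\<And>u. u \<in> carrier M \<times> carrier S \<Longrightarrow> h (frag_of u) = (\<lambda>(x, s). \<psi> x s) u"
    using comm_group.free_Abelian_group_universal[OF H.a_comm_group] by blast
  interpret h: group_hom F "add_monoid H" h
    using h0 H.a_comm_group by (simp add: group_hom_def group_hom_axioms_def comm_group_def)
  have hadd: "h (x + y) = h x \<oplus>\<^bsub>H\<^esub> h y" if "x \<in> carrier F" "y \<in> carrier F" for x y
    using h.hom_mult[OF that] by simp
  have hc: "h x \<in> carrier H" if "x \<in> carrier F" for x using h.hom_closed[OF that] by simp
  have hof: "h (frag_of (x, s)) = \<psi> x s" if "x \<in> carrier M" "s \<in> carrier S" for x s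
    using h1[of "(x, s)"] that by simp
  have h3: "h (x - y - z) = \<zero>\<^bsub>H\<^esub>" if "x \<in> carrier F" "y \<in> carrier F" "z \<in> carrier F" "h x = h y \<oplus>\<^bsub>H\<^esub> h z" for x y z
  proof -
    have d: "x - y - z \<in> carrier F" using that F_diff by blast
    have yz: "y + z \<in> carrier F" using F.m_closed[OF that(2,3)] by simp
    have "h x = h (x - y - z) \<oplus>\<^bsub>H\<^esub> (h y \<oplus>\<^bsub>H\<^esub> h z)" using hadd[OF d yz] hadd[OF that(2,3)] by simp
    then show ?thesis using that(4) hc[OF d] hc[OF that(2)] hc[OF that(3)] by (simp add: H.add.r_cancel_one')
  qed
  have h2: "h (x - y) = \<zero>\<^bsub>H\<^esub>" if "x \<in> carrier F" "y \<in> carrier F" "h x = h y" for x y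
    using h3[OF that(1,2) F.one_closed] that hc h.hom_one by simp
  let ?K = "kernel F (add_monoid H) h"
  have "gens \<subseteq> ?K"
  proof
    fix r assume r: "r \<in> gens"
    have "h r = \<zero>\<^bsub>H\<^esub>" using r
    proof (cases rule: gens_cases)
      case (left x x' t) then show ?thesis unfolding left(4) by (intro h3) (auto simp: hof al)
    next
      case (right x t t') then show ?thesis unfolding right(4) by (intro h3) (auto simp: hof ar)
    next
      case (scalar a x t) then show ?thesis unfolding scalar(4) by (intro h2) (auto simp: hof ba)
    qed
    moreover have "r \<in> carrier F" using gens_F r by (rule subsetD)
    ultimately show "r \<in> ?K" unfolding kernel_def by simp
  qed
  then have RK: "Rel \<subseteq> ?K" unfolding Rel_eq by (rule F.generate_subgroup_incl[OF _ h.subgroup_kernel])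
  define \<Psi> where "\<Psi> P = h (SOME z. z \<in> carrier F \<and> P = cls z)" for P
  have \<Psi>: "\<Psi> (cls z) = h z" if z: "z \<in> carrier F" for z
  proof -
    have "\<exists>y. y \<in> carrier F \<and> cls z = cls y" using z by blast
    then obtain y where y: "y \<in> carrier F" "cls z = cls y" "\<Psi> (cls z) = h y"
      unfolding \<Psi>_def by (metis (mono_tags, lifting) someI_ex)
    have "z - y \<in> ?K" using cls_eq_iff[OF z y(1)] y(2) RK by blast
    then have k: "h (z - y) = \<zero>\<^bsub>H\<^esub>" unfolding kernel_def by simp
    have "h z = h (z - y) \<oplus>\<^bsub>H\<^esub> h y" using hadd[OF F_diff[OF z y(1)] y(1)] by simp
    then show ?thesis using k y hc[OF y(1)] by simp
  qed
  show ?thesis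
  proof (rule that[of \<Psi>])
    show "\<Psi> P \<in> carrier H" if "P \<in> carrier BC" for P using that \<Psi> hc unfolding BC_carrier by auto
    show "\<Psi> (P \<oplus>\<^bsub>BC\<^esub> Q) = \<Psi> P \<oplus>\<^bsub>H\<^esub> \<Psi> Q" if PQ: "P \<in> carrier BC" "Q \<in> carrier BC" for P Q
    proof -
      obtain z w where zw: "z \<in> carrier F" "P = cls z" "w \<in> carrier F" "Q = cls w" using PQ unfolding BC_carrier by blast
      have "z + w \<in> carrier F" using F.m_closed[OF zw(1,3)] by simp
      then show ?thesis using zw \<Psi> hadd cls_add by simp
    qed
    show "\<Psi> (pure x s) = \<psi> x s" if "x \<in> carrier M" "s \<in> carrier S" for x s
      using \<Psi>[OF F_of[OF that]] hof[OF that] by (simp add: pure_eq)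
  qed
qed

lemma extension_map:
  assumes M': "module R M'" and f: "f \<in> mod_hom R M M'"
  shows "\<And>P. P \<in> carrier BC \<Longrightarrow> base_change_map R \<phi> S M' f P \<in> carrier (base_change R \<phi> S M')"
    "\<And>P Q. P \<in> carrier BC \<Longrightarrow> Q \<in> carrier BC \<Longrightarrow> base_change_map R \<phi> S M' f (P \<oplus>\<^bsub>BC\<^esub> Q) =
      base_change_map R \<phi> S M' f P \<oplus>\<^bsub>base_change R \<phi> S M'\<^esub> base_change_map R \<phi> S M' f Q"
    "\<And>x s. x \<in> carrier M \<Longrightarrow> s \<in> carrier S \<Longrightarrow>
      base_change_map R \<phi> S M' f (pure x s) = base_change_pure R \<phi> S M' (f x) s"
proof -
  interpret X: scalar_extension R \<phi> S M' by (rule scalar_extension.intro[OF S \<phi> M'])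
  note fD = mod_homD[OF f]
  let ?g = "\<lambda>(x, s). frag_of (f x, s)" and ?m = "base_change_map R \<phi> S M' f"
  have gg: "frag_extend ?g r \<in> X.Rel" if r: "r \<in> gens" for r
  proof (rule X.gens_Rel)
    show "frag_extend ?g r \<in> X.gens"
      using r
    proof (cases rule: gens_cases)
      case (left x x' t)
      then show ?thesis using X.gens_intros(1)[of "f x" "f x'" t] fD(1) by (simp add: frag_extend_diff fD(2))
    next
      case (right x t t')
      then show ?thesis using X.gens_intros(2)[of "f x" t t'] fD(1) by (simp add: frag_extend_diff)
    next
      case (scalar a x t)
      then show ?thesis using X.gens_intros(3)[of a "f x" t] fD(1) by (simp add: frag_extend_diff fD(3))
    qed
  qed
  have u: "frag_extend ?g z \<in> carrier X.F" "?m (cls z) = X.cls (frag_extend ?g z)" if z: "z \<in> carrier F" for z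
  proof -
    note u = union_rep[OF X.sub_Rel refl _ gg z]
    show "frag_extend ?g z \<in> carrier X.F" by (rule u(1)) (use fD(1) in auto)
    show "?m (cls z) = X.cls (frag_extend ?g z)"
      unfolding base_change_map_def X.cls_def' by (rule u(2)) (use fD(1) in auto)
  qed
  show "?m P \<in> carrier X.BC" if P: "P \<in> carrier BC" for P
    using P unfolding BC_carrier X.BC_carrier by (elim imageE) (simp only: u imageI)
  show "?m (P \<oplus>\<^bsub>BC\<^esub> Q) = ?m P \<oplus>\<^bsub>X.BC\<^esub> ?m Q" if PQ: "P \<in> carrier BC" "Q \<in> carrier BC" for P Q
  proof -
    obtain z w where zw: "z \<in> carrier F" "P = cls z" "w \<in> carrier F" "Q = cls w" using PQ unfolding BC_carrier by blast
    have "z + w \<in> carrier F" using F.m_closed[OF zw(1,3)] by simp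
    then show ?thesis unfolding zw(2,4) cls_add[OF zw(1,3)] using u zw X.cls_add by (simp add: frag_extend_add)
  qed
  show "?m (pure x s) = X.pure (f x) s" if "x \<in> carrier M" "s \<in> carrier S" for x s
    using u(2)[OF F_of[OF that]] by (simp add: pure_eq X.pure_eq)
qed

end

section \<open>Locally free modules over a domain\<close>

lemma (in cring) idealI_cring:
  assumes "I \<subseteq> carrier R" "\<zero> \<in> I" "\<And>x y. x \<in> I \<Longrightarrow> y \<in> I \<Longrightarrow> x \<oplus> y \<in> I"
    "\<And>r x. r \<in> carrier R \<Longrightarrow> x \<in> I \<Longrightarrow> r \<otimes> x \<in> I"
  shows "ideal I R"
proof (rule idealI)
  show "ring R" by (rule ring_axioms)
  show "subgroup I (add_monoid R)"
  proof (rule add.subgroupI)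
    show "I \<subseteq> carrier R" "I \<noteq> {}" using assms by auto
    show "\<ominus> x \<in> I" if "x \<in> I" for x
      using assms(4)[of "\<ominus> \<one>" x] that assms(1) by (auto simp: l_minus)
    show "x \<oplus> y \<in> I" if "x \<in> I" "y \<in> I" for x y using assms(3) that by blast
  qed
  show "a \<in> I \<Longrightarrow> x \<in> carrier R \<Longrightarrow> x \<otimes> a \<in> I" for a x using assms(4) by blast
  show "a \<in> I \<Longrightarrow> x \<in> carrier R \<Longrightarrow> a \<otimes> x \<in> I" for a x using assms(4)[of x a] assms(1) m_comm by auto
qed

lemma (in cring) prime_pow:
  assumes "primeideal P R" "s \<in> carrier R" "s [^] (n::nat) \<in> P"
  shows "s \<in> P"
proof -
  interpret P: primeideal P R by fact
  show ?thesis using assms(3)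
  proof (induction n)
    case 0
    then have "carrier R = P" by (metis P.one_imp_carrier nat_pow_0)
    then show ?case using P.I_notcarr by simp
  next
    case (Suc n)
    then show ?case using P.I_prime[of "s [^] n" s] assms(2) by auto
  qed
qed

text \<open>An ideal that is contained in no prime ideal is the unit ideal; this is how local statements
become global.\<close>

lemma (in cring) ideal_avoiding_primes:
  assumes "ideal I R" "\<And>P. primeideal P R \<Longrightarrow> I \<subseteq> P \<Longrightarrow> False"
  shows "\<one> \<in> I"
proof (rule ccontr)
  assume n: "\<one> \<notin> I"
  obtain P where "primeideal P R" "I \<subseteq> P" "P \<inter> {\<one>} = {}"
    by (rule prime_ideal_avoiding[OF assms(1), of "{\<one>}"]) (use n in auto)
  then show False using assms(2) by blast
qed

lemma (in module) transporter_ideal: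
  assumes N: "submodule N R M" and x: "x \<in> carrier M"
  shows "ideal {r \<in> carrier R. r \<odot>\<^bsub>M\<^esub> x \<in> N} R"
proof (rule R.idealI_cring)
  show "{r \<in> carrier R. r \<odot>\<^bsub>M\<^esub> x \<in> N} \<subseteq> carrier R" by blast
  have "\<zero>\<^bsub>M\<^esub> \<in> N" using subgroup.one_closed[OF submodule.axioms(1)[OF N]] by simp
  then show "\<zero> \<in> {r \<in> carrier R. r \<odot>\<^bsub>M\<^esub> x \<in> N}" using x by simp
  show "r \<oplus> s \<in> {r \<in> carrier R. r \<odot>\<^bsub>M\<^esub> x \<in> N}"
    if "r \<in> {r \<in> carrier R. r \<odot>\<^bsub>M\<^esub> x \<in> N}" "s \<in> {r \<in> carrier R. r \<odot>\<^bsub>M\<^esub> x \<in> N}" for r s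
    using that x submoduleE(5)[OF N] by (simp add: smult_l_distr)
  show "r \<otimes> s \<in> {r \<in> carrier R. r \<odot>\<^bsub>M\<^esub> x \<in> N}"
    if "r \<in> carrier R" "s \<in> {r \<in> carrier R. r \<odot>\<^bsub>M\<^esub> x \<in> N}" for r s
    using that x submoduleE(4)[OF N] by (simp add: smult_assoc1)
qed

lemma (in module) zero_submodule: "submodule {\<zero>\<^bsub>M\<^esub>} R M"
  by (rule submoduleI) simp_all

text \<open>The annihilator of \<open>x\<close> lies in no prime ideal \<open>P\<close>: over a localisation that is free, \<open>a x = 0\<close>
forces the coordinates of \<open>x\<close> to vanish, so that a power of some \<open>s \<notin> P\<close> kills \<open>x\<close>.\<close>

lemma locally_free_torsion_free:
  fixes R :: "'r ring" (structure)
  assumes R: "domain R" and lf: "locally_free_module R M n"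
    and a: "a \<in> carrier R" "a \<noteq> \<zero>\<^bsub>R\<^esub>" and x: "x \<in> carrier M" "a \<odot>\<^bsub>M\<^esub> x = \<zero>\<^bsub>M\<^esub>"
  shows "x = \<zero>\<^bsub>M\<^esub>"
proof -
  interpret domain R by fact
  interpret M: module R M using lf unfolding locally_free_module_def by blast
  let ?N = "{s \<in> carrier R. s \<odot>\<^bsub>M\<^esub> x \<in> {\<zero>\<^bsub>M\<^esub>}}"
  have I: "ideal ?N R" by (rule M.transporter_ideal[OF M.zero_submodule x(1)])
  have "\<one>\<^bsub>R\<^esub> \<in> ?N"
  proof (rule ideal_avoiding_primes[OF I])
    fix P assume P: "primeideal P R" "?N \<subseteq> P"
    obtain s where s: "s \<in> carrier R" "s \<notin> P" "localisation_free_of_rank R M s n"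
      using lf P(1) unfolding locally_free_module_def by blast
    obtain e where e: "e \<in> {..<n} \<rightarrow> carrier M"
      and span: "\<forall>x\<in>carrier M. \<exists>(N::nat) c. c \<in> {..<n} \<rightarrow> carrier R \<and>
        (s [^] N) \<odot>\<^bsub>M\<^esub> x = (\<Oplus>\<^bsub>M\<^esub>i\<in>{..<n}. c i \<odot>\<^bsub>M\<^esub> e i)"
      and ind: "\<forall>c. c \<in> {..<n} \<rightarrow> carrier R \<and> (\<Oplus>\<^bsub>M\<^esub>i\<in>{..<n}. c i \<odot>\<^bsub>M\<^esub> e i) = \<zero>\<^bsub>M\<^esub> \<longrightarrow>
        (\<exists>N::nat. \<forall>i<n. s [^] N \<otimes> c i = \<zero>)"
      using s(3) unfolding localisation_free_of_rank_def by blast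
    obtain N :: nat and c where c: "c \<in> {..<n} \<rightarrow> carrier R"
      "(s [^] N) \<odot>\<^bsub>M\<^esub> x = (\<Oplus>\<^bsub>M\<^esub>i\<in>{..<n}. c i \<odot>\<^bsub>M\<^esub> e i)" using bspec[OF span x(1)] by blast
    have cc: "c i \<in> carrier R" "e i \<in> carrier M" if "i < n" for i using c(1) e that by auto
    have "(\<Oplus>\<^bsub>M\<^esub>i\<in>{..<n}. (a \<otimes> c i) \<odot>\<^bsub>M\<^esub> e i) = (\<Oplus>\<^bsub>M\<^esub>i\<in>{..<n}. a \<odot>\<^bsub>M\<^esub> (c i \<odot>\<^bsub>M\<^esub> e i))"
      by (rule M.finsum_cong') (use cc a in \<open>auto simp: M.smult_assoc1\<close>)
    also have "\<dots> = a \<odot>\<^bsub>M\<^esub> (s [^] N \<odot>\<^bsub>M\<^esub> x)" unfolding c(2)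
      by (rule M.finsum_smult_ldistr[symmetric]) (use cc a in auto)
    also have "\<dots> = s [^] N \<odot>\<^bsub>M\<^esub> (a \<odot>\<^bsub>M\<^esub> x)"
      using a(1) s(1) x(1) by (simp add: M.smult_assoc1[symmetric] m_comm)
    also have "\<dots> = \<zero>\<^bsub>M\<^esub>" using x(2) s(1) by simp
    finally obtain K :: nat where K: "\<forall>i<n. s [^] K \<otimes> (a \<otimes> c i) = \<zero>"
      using ind[rule_format, of "\<lambda>i. a \<otimes> c i"] cc a(1) by auto
    have s0: "s \<noteq> \<zero>" using s(2) P(1) by (metis additive_subgroup.zero_closed ideal_def primeideal_def)
    then have sK: "s [^] K \<noteq> \<zero>" using s(1) pow_eq_zero by blast
    have c0: "c i = \<zero>" if "i < n" for i
      using K[rule_format, OF that] sK a cc(1)[OF that] s(1) integral_iff by auto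
    have "(\<Oplus>\<^bsub>M\<^esub>i\<in>{..<n}. c i \<odot>\<^bsub>M\<^esub> e i) = (\<Oplus>\<^bsub>M\<^esub>i\<in>{..<n}. \<zero>\<^bsub>M\<^esub>)"
      by (rule M.finsum_cong') (use cc c0 in auto)
    then have "s [^] N \<in> ?N" using c(2) s(1) by simp
    then show False using prime_pow[OF P(1) s(1), of N] P(2) s(2) by blast
  qed
  then show ?thesis using x(1) by simp
qed

text \<open>Let \<open>Y\<close> be the ideal of all \<open>s\<close> such that \<open>M/N\<close>, localised at \<open>s\<close>, is killed by a nonzero element.
If \<open>M\<close> is free over the localisation at \<open>s\<close>, then \<open>s \<in> Y\<close>: multiply elements that kill the
finitely many basis vectors. So \<open>Y\<close> lies in no prime ideal and contains \<open>1\<close>.\<close>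

lemma torsion_quotient_annihilated:
  fixes R :: "'r ring" (structure)
  assumes R: "domain R" and lf: "locally_free_module R M n" and N: "submodule N R M"
    and tor: "\<And>x. x \<in> carrier M \<Longrightarrow> \<exists>a\<in>carrier R. a \<noteq> \<zero>\<^bsub>R\<^esub> \<and> a \<odot>\<^bsub>M\<^esub> x \<in> N"
  obtains t where "t \<in> carrier R" "t \<noteq> \<zero>\<^bsub>R\<^esub>" "\<And>x. x \<in> carrier M \<Longrightarrow> t \<odot>\<^bsub>M\<^esub> x \<in> N"
proof -
  interpret domain R by fact
  interpret M: module R M using lf unfolding locally_free_module_def by blast
  define I where "I x = {r \<in> carrier R. r \<odot>\<^bsub>M\<^esub> x \<in> N}" for x
  have I: "ideal (I x) R" if "x \<in> carrier M" for x unfolding I_def by (rule M.transporter_ideal[OF N that])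
  have Il: "r \<otimes> s \<in> I x" if "x \<in> carrier M" "r \<in> carrier R" "s \<in> I x" for r s x
    using ideal.I_l_closed[OF I[OF that(1)] that(3,2)] .
  \<comment> \<open>The exponent may depend on \<open>x\<close>, but \<open>t\<close> may not; this is what makes \<open>1 \<in> Y\<close> useful.\<close>
  define Y where "Y = {s \<in> carrier R. \<exists>t\<in>carrier R. t \<noteq> \<zero> \<and> (\<forall>x\<in>carrier M. \<exists>n::nat. t \<otimes> s [^] n \<in> I x)}"
  have "ideal Y R"
  proof (rule idealI_cring)
    show "Y \<subseteq> carrier R" unfolding Y_def by blast
    have "\<one> \<otimes> \<zero> [^] (1::nat) \<in> I x" if "x \<in> carrier M" for x
      using additive_subgroup.zero_closed[OF ideal.axioms(1)[OF I[OF that]]] by simp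
    then show "\<zero> \<in> Y" unfolding Y_def using one_not_zero by blast
    show "s \<oplus> s' \<in> Y" if s: "s \<in> Y" and s': "s' \<in> Y" for s s'
    proof -
      obtain t where t: "s \<in> carrier R" "t \<in> carrier R" "t \<noteq> \<zero>" "\<forall>x\<in>carrier M. \<exists>n::nat. t \<otimes> s [^] n \<in> I x"
        using s unfolding Y_def by blast
      obtain t' where t': "s' \<in> carrier R" "t' \<in> carrier R" "t' \<noteq> \<zero>" "\<forall>x\<in>carrier M. \<exists>n::nat. t' \<otimes> s' [^] n \<in> I x"
        using s' unfolding Y_def by blast
      have "\<exists>n::nat. (t \<otimes> t') \<otimes> (s \<oplus> s') [^] n \<in> I x" if x: "x \<in> carrier M" for x
      proof -
        obtain m n :: nat where mn: "t \<otimes> s [^] m \<in> I x" "t' \<otimes> s' [^] n \<in> I x" using t(4) t'(4) x by blast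
        have "(t \<otimes> t') \<otimes> s [^] m \<in> I x" "(t \<otimes> t') \<otimes> s' [^] n \<in> I x"
          using Il[OF x t'(2) mn(1)] Il[OF x t(2) mn(2)] t(1,2) t'(1,2) by (simp_all add: m_assoc m_lcomm)
        then show ?thesis using ideal_pow_add[OF I[OF x] t(1) t'(1)] t(2) t'(2) by blast
      qed
      moreover have "t \<otimes> t' \<noteq> \<zero>" "t \<otimes> t' \<in> carrier R" "s \<oplus> s' \<in> carrier R" using t t' integral_iff by auto
      ultimately show ?thesis unfolding Y_def by blast
    qed
    show "r \<otimes> s \<in> Y" if r: "r \<in> carrier R" and s: "s \<in> Y" for r s
    proof -
      obtain t where t: "s \<in> carrier R" "t \<in> carrier R" "t \<noteq> \<zero>" "\<forall>x\<in>carrier M. \<exists>n::nat. t \<otimes> s [^] n \<in> I x"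
        using s unfolding Y_def by blast
      have "\<exists>n::nat. t \<otimes> (r \<otimes> s) [^] n \<in> I x" if x: "x \<in> carrier M" for x
      proof -
        obtain n :: nat where n: "t \<otimes> s [^] n \<in> I x" using t(4) x by blast
        have "r [^] n \<otimes> (t \<otimes> s [^] n) \<in> I x" by (rule Il[OF x _ n]) (use r in simp)
        moreover have "r [^] n \<otimes> (t \<otimes> s [^] n) = t \<otimes> (r \<otimes> s) [^] n"
          using r t(1,2) by (simp add: nat_pow_distrib m_lcomm)
        ultimately show ?thesis by metis
      qed
      then show ?thesis unfolding Y_def using t r by blast
    qed
  qed
  moreover have False if P: "primeideal P R" "Y \<subseteq> P" for P
  proof -
    obtain s where s: "s \<in> carrier R" "s \<notin> P" "localisation_free_of_rank R M s n"
      using lf P(1) unfolding locally_free_module_def by blast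
    obtain e where e: "e \<in> {..<n} \<rightarrow> carrier M"
      and span: "\<forall>x\<in>carrier M. \<exists>(N::nat) c. c \<in> {..<n} \<rightarrow> carrier R \<and>
        (s [^] N) \<odot>\<^bsub>M\<^esub> x = (\<Oplus>\<^bsub>M\<^esub>i\<in>{..<n}. c i \<odot>\<^bsub>M\<^esub> e i)"
      using s(3) unfolding localisation_free_of_rank_def by blast
    have eC: "e i \<in> carrier M" if "i < n" for i using e that by auto
    have "\<forall>i\<in>{..<n}. \<exists>a. a \<in> carrier R \<and> a \<noteq> \<zero> \<and> a \<odot>\<^bsub>M\<^esub> e i \<in> N" using tor eC by blast
    then obtain a where a: "\<forall>i\<in>{..<n}. a i \<in> carrier R \<and> a i \<noteq> \<zero> \<and> a i \<odot>\<^bsub>M\<^esub> e i \<in> N" by metis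
    \<comment> \<open>A common multiple of elements that move the first \<open>m\<close> basis vectors into \<open>N\<close>.\<close>
    have "m \<le> n \<Longrightarrow> \<exists>t\<in>carrier R. t \<noteq> \<zero> \<and> (\<forall>i<m. t \<odot>\<^bsub>M\<^esub> e i \<in> N)" for m
    proof (induction m)
      case 0 show ?case using one_not_zero by blast
    next
      case (Suc m)
      then obtain t where t: "t \<in> carrier R" "t \<noteq> \<zero>" "\<forall>i<m. t \<odot>\<^bsub>M\<^esub> e i \<in> N" by auto
      have am: "a m \<in> carrier R" "a m \<noteq> \<zero>" "a m \<odot>\<^bsub>M\<^esub> e m \<in> N" using a Suc.prems by auto
      have "(a m \<otimes> t) \<odot>\<^bsub>M\<^esub> e i \<in> N" if i: "i < Suc m" for i
      proof (cases "i = m")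
        case True
        have "(a m \<otimes> t) \<odot>\<^bsub>M\<^esub> e i = t \<odot>\<^bsub>M\<^esub> (a m \<odot>\<^bsub>M\<^esub> e i)"
          using am(1) t(1) eC[of i] i Suc.prems by (simp add: M.smult_assoc1[symmetric] m_comm)
        then show ?thesis using True am M.submoduleE(4)[OF N] t(1) by simp
      next
        case False
        then have "(a m \<otimes> t) \<odot>\<^bsub>M\<^esub> e i = a m \<odot>\<^bsub>M\<^esub> (t \<odot>\<^bsub>M\<^esub> e i)"
          using am(1) t(1) eC[of i] i Suc.prems by (simp add: M.smult_assoc1)
        then show ?thesis using False i t(3) am M.submoduleE(4)[OF N] by simp
      qed
      then show ?case using am t integral_iff m_closed by metis
    qed
    then obtain t where t: "t \<in> carrier R" "t \<noteq> \<zero>" "\<forall>i<n. t \<odot>\<^bsub>M\<^esub> e i \<in> N" by blast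
    have "\<exists>m::nat. t \<otimes> s [^] m \<in> I x" if x: "x \<in> carrier M" for x
    proof -
      obtain m :: nat and c where c: "c \<in> {..<n} \<rightarrow> carrier R"
        "(s [^] m) \<odot>\<^bsub>M\<^esub> x = (\<Oplus>\<^bsub>M\<^esub>i\<in>{..<n}. c i \<odot>\<^bsub>M\<^esub> e i)" using bspec[OF span x] by blast
      have cc: "c i \<in> carrier R" if "i < n" for i using c(1) that by auto
      have N0: "\<zero>\<^bsub>M\<^esub> \<in> N" using additive_subgroup.zero_closed[OF ideal.axioms(1)[OF I[OF x]]] x by (simp add: I_def)
      have fin: "(\<Oplus>\<^bsub>M\<^esub>i\<in>D. g i) \<in> N" if "finite D" "g \<in> D \<rightarrow> N" for D :: "nat set" and g
        using that
      proof (induction D rule: finite_induct)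
        case empty then show ?case using N0 by simp
      next
        case (insert y D)
        then show ?case using M.submoduleE(5)[OF N] M.submoduleE(1)[OF N]
          by (subst M.finsum_insert) auto
      qed
      have "t \<odot>\<^bsub>M\<^esub> (c i \<odot>\<^bsub>M\<^esub> e i) \<in> N" if "i < n" for i
      proof -
        have "t \<odot>\<^bsub>M\<^esub> (c i \<odot>\<^bsub>M\<^esub> e i) = c i \<odot>\<^bsub>M\<^esub> (t \<odot>\<^bsub>M\<^esub> e i)"
          using cc[OF that] eC[OF that] t(1) by (simp add: M.smult_assoc1[symmetric] m_comm)
        then show ?thesis using M.submoduleE(4)[OF N cc[OF that]] t(3) that by simp
      qed
      then have "(\<Oplus>\<^bsub>M\<^esub>i\<in>{..<n}. t \<odot>\<^bsub>M\<^esub> (c i \<odot>\<^bsub>M\<^esub> e i)) \<in> N" by (intro fin) auto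
      moreover have "(\<Oplus>\<^bsub>M\<^esub>i\<in>{..<n}. t \<odot>\<^bsub>M\<^esub> (c i \<odot>\<^bsub>M\<^esub> e i)) = t \<odot>\<^bsub>M\<^esub> (s [^] m \<odot>\<^bsub>M\<^esub> x)" unfolding c(2)
        by (rule M.finsum_smult_ldistr[symmetric]) (use cc eC t in auto)
      ultimately have "t \<otimes> s [^] m \<in> I x" unfolding I_def using t(1) s(1) x by (simp add: M.smult_assoc1)
      then show ?thesis by blast
    qed
    then have "s \<in> Y" unfolding Y_def using s(1) t by blast
    then show False using P(2) s(2) by blast
  qed
  ultimately have "\<one> \<in> Y" by (rule ideal_avoiding_primes)
  then obtain t where t: "t \<in> carrier R" "t \<noteq> \<zero>" "\<forall>x\<in>carrier M. \<exists>n::nat. t \<otimes> \<one> [^] n \<in> I x"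
    unfolding Y_def by blast
  then have "t \<odot>\<^bsub>M\<^esub> x \<in> N" if "x \<in> carrier M" for x using that unfolding I_def by auto
  then show ?thesis using that t by blast
qed

lemma (in cring) ideal_power_ideal: "ideal J R \<Longrightarrow> ideal (ideal_power R J n) R"
  by (induction n) (auto simp: oneideal intro: ideal_prod_is_ideal)

lemma (in cring) pow_in_ideal_power:
  assumes "ideal J R" "g \<in> J" shows "g [^] (n::nat) \<in> ideal_power R J n"
proof (induction n)
  case (Suc n)
  have "g \<in> carrier R" by (rule ideal.Icarr[OF assms])
  then have "g [^] Suc n = g \<otimes> g [^] n" by (rule nat_pow_Suc2)
  then show ?case using ideal_prod.prod[OF assms(2) Suc.IH, of R] by (simp only: ideal_power.simps)
next
  case 0
  show ?case by simp
qed

section \<open>The cokernel of a morphism of Frobenius modules\<close>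

text \<open>A morphism of pairs \<open>(M, \<tau>)\<close> over an arbitrary ring \<open>T\<close> with an endomorphism \<open>\<sigma>\<close> and an ideal \<open>J\<close> that takes
the part of the ideal of the characteristic.\<close>

locale frobenius_module_morphism =
  fixes T :: "'t ring" and \<sigma> :: "'t \<Rightarrow> 't" and J :: "'t set"
    and M :: "('t, 'm) module" and \<tau> :: "('m \<times> 't \<Rightarrow>\<^sub>0 int) set \<Rightarrow> 'm" and d :: nat
    and M' :: "('t, 'n) module" and \<tau>' :: "('n \<times> 't \<Rightarrow>\<^sub>0 int) set \<Rightarrow> 'n" and d' :: nat
    and f :: "'m \<Rightarrow> 'n"
  assumes T: "cring T" and \<sigma>: "\<sigma> \<in> ring_hom T T" and J: "ideal J T"
    and M: "module T M" and M': "module T M'"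
    and \<tau>: "\<tau> \<in> mod_hom T (base_change T \<sigma> T M) M"
    and \<tau>': "\<tau>' \<in> mod_hom T (base_change T \<sigma> T M') M'"
    and inj_\<tau>': "inj_on \<tau>' (carrier (base_change T \<sigma> T M'))"
    and coker_\<tau>: "\<And>g x. g \<in> ideal_power T J d \<Longrightarrow> x \<in> carrier M \<Longrightarrow>
      g \<odot>\<^bsub>M\<^esub> x \<in> \<tau> ` carrier (base_change T \<sigma> T M)"
    and coker_\<tau>': "\<And>g x. g \<in> ideal_power T J d' \<Longrightarrow> x \<in> carrier M' \<Longrightarrow>
      g \<odot>\<^bsub>M'\<^esub> x \<in> \<tau>' ` carrier (base_change T \<sigma> T M')"
    and f: "f \<in> mod_hom T M M'"
    and commutes: "\<And>z. z \<in> carrier (base_change T \<sigma> T M) \<Longrightarrow> f (\<tau> z) = \<tau>' (base_change_map T \<sigma> T M' f z)"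
begin

sublocale T: cring T by (rule T)
sublocale E: scalar_extension T \<sigma> T M by (rule scalar_extension.intro[OF T \<sigma> M])
sublocale E': scalar_extension T \<sigma> T M' by (rule scalar_extension.intro[OF T \<sigma> M'])

abbreviation img where "img \<equiv> f ` carrier M"

lemmas fD = mod_homD[OF f]
lemmas tD = mod_homD[OF \<tau>]
lemmas tD' = mod_homD[OF \<tau>']

lemma img_sub: "submodule img T M'"
  by (rule image_submodule[OF E.M.abelian_group_axioms E.M.smult_closed M' f])

lemma img_zero: "\<zero>\<^bsub>M'\<^esub> \<in> img" using subgroup.one_closed[OF submodule.axioms(1)[OF img_sub]] by simp

lemmas imgE = E'.M.submoduleE[OF img_sub]

lemma tau_zero': "\<tau>' \<zero>\<^bsub>E'.BC\<^esub> = \<zero>\<^bsub>M'\<^esub>"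
  by (rule mod_hom_zero[OF E'.group_BC E'.M.abelian_group_axioms \<tau>'])

text \<open>The element is \<open>f(\<tau>(m \<otimes> s))\<close>.\<close>

lemma tau_image_pure: "m \<in> carrier M \<Longrightarrow> s \<in> carrier T \<Longrightarrow> \<tau>' (E'.pure (f m) s) \<in> img"
  using commutes[OF E.pure_closed] E.extension_map(3)[OF M' f] tD(1)[OF E.pure_closed] by (metis imageI)

definition ann where "ann = {i \<in> carrier T. \<forall>x\<in>carrier M'. i \<odot>\<^bsub>M'\<^esub> x \<in> img}"

lemma annD: "i \<in> ann \<Longrightarrow> i \<in> carrier T" "i \<in> ann \<Longrightarrow> x \<in> carrier M' \<Longrightarrow> i \<odot>\<^bsub>M'\<^esub> x \<in> img"
  unfolding ann_def by simp_all

lemma ann_ideal: "ideal ann T"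
proof (rule T.idealI_cring)
  show "ann \<subseteq> carrier T" using annD(1) by (rule subsetI)
  show "\<zero>\<^bsub>T\<^esub> \<in> ann" unfolding ann_def using img_zero by simp
  show "x \<oplus>\<^bsub>T\<^esub> y \<in> ann" if "x \<in> ann" "y \<in> ann" for x y
    using annD[OF that(1)] annD[OF that(2)] unfolding ann_def by (simp add: E'.M.smult_l_distr imgE(5))
  show "r \<otimes>\<^bsub>T\<^esub> x \<in> ann" if "r \<in> carrier T" "x \<in> ann" for r x
    using that(1) annD[OF that(2)] unfolding ann_def by (simp add: E'.M.smult_assoc1 imgE(4))
qed

text \<open>On pure tensors, \<open>\<sigma>(i) \<tau>'(x \<otimes> s) = \<tau>'(i x \<otimes> s)\<close>, and \<open>i x\<close> is in the image of \<open>f\<close>.\<close>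

lemma sigma_ann_tau:
  assumes i: "i \<in> ann" and z: "z \<in> carrier E'.BC"
  shows "\<sigma> i \<odot>\<^bsub>M'\<^esub> \<tau>' z \<in> img"
  using z
proof (induction z rule: E'.BC_induct)
  case zero
  show ?case unfolding tau_zero' using annD(1)[OF i] img_zero by simp
next
  case (pure x s)
  have s: "\<sigma> i \<in> carrier T" using annD(1)[OF i] by simp
  obtain m where m: "m \<in> carrier M" "i \<odot>\<^bsub>M'\<^esub> x = f m" using annD(2)[OF i pure(1)] by blast
  have "\<sigma> i \<odot>\<^bsub>M'\<^esub> \<tau>' (E'.pure x s) = \<tau>' (\<sigma> i \<odot>\<^bsub>E'.BC\<^esub> E'.pure x s)"
    by (rule tD'(3)[symmetric, OF s E'.pure_closed[OF pure]])
  also have "\<dots> = \<tau>' (E'.pure (f m) s)"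
    unfolding E'.smult_pure[OF s pure] E'.pure_balanced[OF annD(1)[OF i] pure, symmetric] m(2) ..
  finally show ?case using tau_image_pure[OF m(1) pure(2)] by simp
next
  case (add x y)
  have s: "\<sigma> i \<in> carrier T" using annD(1)[OF i] by simp
  have "\<sigma> i \<odot>\<^bsub>M'\<^esub> \<tau>' (x \<oplus>\<^bsub>E'.BC\<^esub> y) = \<sigma> i \<odot>\<^bsub>M'\<^esub> \<tau>' x \<oplus>\<^bsub>M'\<^esub> \<sigma> i \<odot>\<^bsub>M'\<^esub> \<tau>' y"
    unfolding tD'(2)[OF add(1,2)] by (rule E'.M.smult_r_distr[OF s tD'(1)[OF add(1)] tD'(1)[OF add(2)]])
  then show ?case using imgE(5)[OF add(3,4)] by simp
qed

lemma sigma_ann: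
  assumes i: "i \<in> ann" and g: "g \<in> ideal_power T J d'"
  shows "\<sigma> i \<otimes>\<^bsub>T\<^esub> g \<in> ann"
proof -
  have gc: "g \<in> carrier T" by (rule ideal.Icarr[OF T.ideal_power_ideal[OF J] g])
  have s: "\<sigma> i \<in> carrier T" using annD(1)[OF i] by simp
  have "(\<sigma> i \<otimes>\<^bsub>T\<^esub> g) \<odot>\<^bsub>M'\<^esub> x \<in> img" if x: "x \<in> carrier M'" for x
  proof -
    obtain z where z: "z \<in> carrier E'.BC" "g \<odot>\<^bsub>M'\<^esub> x = \<tau>' z" using coker_\<tau>'[OF g x] by blast
    show ?thesis unfolding E'.M.smult_assoc1[OF s gc x] z(2) by (rule sigma_ann_tau[OF i z(1)])
  qed
  then show ?thesis unfolding ann_def using s gc by simp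
qed

text \<open>A property of Nakayama type passes from \<open>J\<close> to its powers: the elements that \<open>J\<^sup>n\<close> moves into \<open>N\<close> form
a submodule that contains \<open>J M'\<close>, so they are all of \<open>M'\<close>.\<close>

lemma absorbs_ideal_power:
  assumes H: "\<And>N. submodule N T M' \<Longrightarrow> img \<subseteq> N \<Longrightarrow> (\<And>j x. j \<in> J \<Longrightarrow> x \<in> carrier M' \<Longrightarrow> j \<odot>\<^bsub>M'\<^esub> x \<in> N) \<Longrightarrow>
      N = carrier M'"
  shows "submodule N T M' \<Longrightarrow> img \<subseteq> N \<Longrightarrow> (\<And>g x. g \<in> ideal_power T J n \<Longrightarrow> x \<in> carrier M' \<Longrightarrow> g \<odot>\<^bsub>M'\<^esub> x \<in> N) \<Longrightarrow>
      N = carrier M'"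
proof (induction n)
  case 0
  have "x \<in> N" if "x \<in> carrier M'" for x using 0(3)[of "\<one>\<^bsub>T\<^esub>" x] that by simp
  then show ?case using E'.M.submoduleE(1)[OF 0(1)] by blast
next
  case (Suc n)
  note NE = E'.M.submoduleE[OF Suc.prems(1)]
  have N0: "\<zero>\<^bsub>M'\<^esub> \<in> N" using subgroup.one_closed[OF submodule.axioms(1)[OF Suc.prems(1)]] by simp
  note Pc = ideal.Icarr[OF T.ideal_power_ideal[OF J]]
  let ?N = "{x \<in> carrier M'. \<forall>g\<in>ideal_power T J n. g \<odot>\<^bsub>M'\<^esub> x \<in> N}"
  have "?N = carrier M'"
  proof (rule H)
    show "submodule ?N T M'"
    proof (rule E'.M.submoduleI)
      show "?N \<subseteq> carrier M'" by blast
      show "\<zero>\<^bsub>M'\<^esub> \<in> ?N" using N0 Pc by simp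
      show "\<ominus>\<^bsub>M'\<^esub> x \<in> ?N" if "x \<in> ?N" for x using that Pc NE(3) by (simp add: E'.M.smult_r_minus)
      show "x \<oplus>\<^bsub>M'\<^esub> y \<in> ?N" if "x \<in> ?N" "y \<in> ?N" for x y using that Pc NE(5) by (simp add: E'.M.smult_r_distr)
      show "a \<odot>\<^bsub>M'\<^esub> x \<in> ?N" if a: "a \<in> carrier T" and x: "x \<in> ?N" for a x
      proof -
        have "g \<odot>\<^bsub>M'\<^esub> (a \<odot>\<^bsub>M'\<^esub> x) = a \<odot>\<^bsub>M'\<^esub> (g \<odot>\<^bsub>M'\<^esub> x)" if "g \<in> ideal_power T J n" for g
          using Pc[OF that] a x by (simp add: E'.M.smult_assoc1[symmetric] T.m_comm)
        then show ?thesis using x a NE(4) by simp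
      qed
    qed
    show "img \<subseteq> ?N"
    proof
      fix y assume y: "y \<in> img"
      show "y \<in> ?N" using imgE(1) Suc.prems(2) imgE(4)[OF Pc y] y by blast
    qed
    show "j \<odot>\<^bsub>M'\<^esub> x \<in> ?N" if j: "j \<in> J" and x: "x \<in> carrier M'" for j x
    proof -
      have jc: "j \<in> carrier T" by (rule ideal.Icarr[OF J j])
      have "g \<odot>\<^bsub>M'\<^esub> (j \<odot>\<^bsub>M'\<^esub> x) \<in> N" if g: "g \<in> ideal_power T J n" for g
      proof -
        have "j \<otimes>\<^bsub>T\<^esub> g \<in> ideal_power T J (Suc n)" unfolding ideal_power.simps by (rule ideal_prod.prod[OF j g])
        moreover have "g \<odot>\<^bsub>M'\<^esub> (j \<odot>\<^bsub>M'\<^esub> x) = (j \<otimes>\<^bsub>T\<^esub> g) \<odot>\<^bsub>M'\<^esub> x"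
          using Pc[OF g] jc x by (simp add: E'.M.smult_assoc1[symmetric] T.m_comm)
        ultimately show ?thesis using Suc.prems(3)[OF _ x] by simp
      qed
      then show ?thesis using jc x by simp
    qed
  qed
  then have "\<And>g x. g \<in> ideal_power T J n \<Longrightarrow> x \<in> carrier M' \<Longrightarrow> g \<odot>\<^bsub>M'\<^esub> x \<in> N" by blast
  then show ?case by (rule Suc.IH[OF Suc.prems(1,2)])
qed

text \<open>The elements that \<open>\<sigma>(i)\<close> moves into the image of \<open>f\<close> contain this image and \<open>J\<^bsup>d'\<^esup> M'\<close>.\<close>

lemma ann_stable:
  assumes H: "\<And>N. submodule N T M' \<Longrightarrow> img \<subseteq> N \<Longrightarrow> (\<And>j x. j \<in> J \<Longrightarrow> x \<in> carrier M' \<Longrightarrow> j \<odot>\<^bsub>M'\<^esub> x \<in> N) \<Longrightarrow>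
      N = carrier M'"
    and i: "i \<in> ann"
  shows "\<sigma> i \<in> ann"
proof -
  have s: "\<sigma> i \<in> carrier T" using annD(1)[OF i] by simp
  let ?N = "{x \<in> carrier M'. \<sigma> i \<odot>\<^bsub>M'\<^esub> x \<in> img}"
  have "?N = carrier M'"
  proof (rule absorbs_ideal_power[OF H, where n = d'])
    show "submodule ?N T M'"
    proof (rule E'.M.submoduleI)
      show "?N \<subseteq> carrier M'" by blast
      show "\<zero>\<^bsub>M'\<^esub> \<in> ?N" using img_zero s by simp
      show "\<ominus>\<^bsub>M'\<^esub> x \<in> ?N" if "x \<in> ?N" for x using that s imgE(3) by (simp add: E'.M.smult_r_minus)
      show "x \<oplus>\<^bsub>M'\<^esub> y \<in> ?N" if "x \<in> ?N" "y \<in> ?N" for x y using that s imgE(5) by (simp add: E'.M.smult_r_distr)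
      show "a \<odot>\<^bsub>M'\<^esub> x \<in> ?N" if a: "a \<in> carrier T" and x: "x \<in> ?N" for a x
      proof -
        have "\<sigma> i \<odot>\<^bsub>M'\<^esub> (a \<odot>\<^bsub>M'\<^esub> x) = a \<odot>\<^bsub>M'\<^esub> (\<sigma> i \<odot>\<^bsub>M'\<^esub> x)"
          using s a x by (simp add: E'.M.smult_assoc1[symmetric] T.m_comm)
        then show ?thesis using x a imgE(4) by simp
      qed
    qed
    show "img \<subseteq> ?N" using imgE(1) imgE(4)[OF s] by blast
    show "g \<odot>\<^bsub>M'\<^esub> x \<in> ?N" if g: "g \<in> ideal_power T J d'" and x: "x \<in> carrier M'" for g x
    proof -
      have gc: "g \<in> carrier T" by (rule ideal.Icarr[OF T.ideal_power_ideal[OF J] g])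
      show ?thesis using annD(2)[OF sigma_ann[OF i g] x] gc x s by (simp add: E'.M.smult_assoc1)
    qed
  qed auto
  then show ?thesis unfolding ann_def using s by blast
qed

text \<open>Nonzero maps \<open>M' \<rightarrow> B\<close> that are linear along \<open>\<chi>\<close> and vanish on the image of \<open>f\<close>. In other words, \<open>\<chi>\<close> is a
point at which the fibre of the cokernel is not zero.\<close>

definition semifunctional :: "('b, 'c) ring_scheme \<Rightarrow> ('t \<Rightarrow> 'b) \<Rightarrow> ('n \<Rightarrow> 'b) \<Rightarrow> bool" where
  "semifunctional B \<chi> l \<longleftrightarrow> (\<forall>x\<in>carrier M'. l x \<in> carrier B) \<and>
    (\<forall>x\<in>carrier M'. \<forall>y\<in>carrier M'. l (x \<oplus>\<^bsub>M'\<^esub> y) = l x \<oplus>\<^bsub>B\<^esub> l y) \<and>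
    (\<forall>t\<in>carrier T. \<forall>x\<in>carrier M'. l (t \<odot>\<^bsub>M'\<^esub> x) = \<chi> t \<otimes>\<^bsub>B\<^esub> l x) \<and>
    (\<exists>x\<in>carrier M'. l x \<noteq> \<zero>\<^bsub>B\<^esub>) \<and> (\<forall>y\<in>img. l y = \<zero>\<^bsub>B\<^esub>)"

text \<open>The functional \<open>l\<close> induces \<open>l\<^sup>\<sigma>(x \<otimes> s) = \<chi>'(s) l(x)\<^sup>q\<close> on \<open>\<sigma>\<^sup>*M'\<close>. For \<open>j \<in> J\<^bsup>d'\<^esup>\<close> the map
\<open>y \<mapsto> l\<^sup>\<sigma>(\<tau>'\<^sup>-\<^sup>1(j y))\<close> is defined on \<open>M'\<close>. Its value at \<open>\<tau>'(x \<otimes> 1)\<close> is \<open>\<chi>'(j) l(x)\<^sup>q\<close>, so it is nonzero. It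
vanishes on the image of \<open>f\<close>, because a multiple of \<open>f(m)\<close> by an element of \<open>J\<^sup>d\<close> outside the kernel of \<open>\<chi>'\<close>
has the form \<open>f(\<tau> z) = \<tau>'((\<sigma>\<^sup>*f) z)\<close>, and \<open>l\<^sup>\<sigma>\<close> vanishes at \<open>(\<sigma>\<^sup>*f) z\<close>.\<close>

lemma frobenius_twist_functional:
  fixes B :: "'b ring"
  assumes B: "field B" and q: "frob_exp B q" and \<chi>: "\<chi> \<in> ring_hom T B" and \<chi>': "\<chi>' \<in> ring_hom T B"
    and \<chi>\<sigma>: "\<And>t. t \<in> carrier T \<Longrightarrow> \<chi>' (\<sigma> t) = \<chi> t [^]\<^bsub>B\<^esub> q"
    and g: "g \<in> J" "\<chi>' g \<noteq> \<zero>\<^bsub>B\<^esub>" and l: "semifunctional B \<chi> l"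
  obtains l' where "semifunctional B \<chi>' l'"
proof -
  interpret B: field B by fact
  interpret \<chi>: ring_hom_ring T B \<chi> by (rule ring_hom_ringI2[OF T.ring_axioms B.ring_axioms \<chi>])
  interpret \<chi>': ring_hom_ring T B \<chi>' by (rule ring_hom_ringI2[OF T.ring_axioms B.ring_axioms \<chi>'])
  have lc: "l x \<in> carrier B" if "x \<in> carrier M'" for x using l that unfolding semifunctional_def by blast
  have la: "l (x \<oplus>\<^bsub>M'\<^esub> y) = l x \<oplus>\<^bsub>B\<^esub> l y" if "x \<in> carrier M'" "y \<in> carrier M'" for x y
    using l that unfolding semifunctional_def by blast
  have ls: "l (t \<odot>\<^bsub>M'\<^esub> x) = \<chi> t \<otimes>\<^bsub>B\<^esub> l x" if "t \<in> carrier T" "x \<in> carrier M'" for t x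
    using l that unfolding semifunctional_def by blast
  have li: "l y = \<zero>\<^bsub>B\<^esub>" if "y \<in> img" for y using l that unfolding semifunctional_def by blast
  obtain x0 where x0: "x0 \<in> carrier M'" "l x0 \<noteq> \<zero>\<^bsub>B\<^esub>" using l unfolding semifunctional_def by blast
  \<comment> \<open>Powers of a single element of \<open>J\<close> lie in both powers of \<open>J\<close> and avoid the kernel of \<open>\<chi>'\<close>.\<close>
  define j where "j = g [^]\<^bsub>T\<^esub> d'"
  define j2 where "j2 = g [^]\<^bsub>T\<^esub> d"
  have gc: "g \<in> carrier T" by (rule ideal.Icarr[OF J g(1)])
  have j: "j \<in> carrier T" "j \<in> ideal_power T J d'" "\<chi>' j \<noteq> \<zero>\<^bsub>B\<^esub>"
    unfolding j_def using gc T.pow_in_ideal_power[OF J g(1)] \<chi>'.hom_pow_nat[OF gc] B.pow_eq_zero[of "\<chi>' g" d'] g(2) by auto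
  have j2: "j2 \<in> carrier T" "j2 \<in> ideal_power T J d" "\<chi>' j2 \<noteq> \<zero>\<^bsub>B\<^esub>"
    unfolding j2_def using gc T.pow_in_ideal_power[OF J g(1)] \<chi>'.hom_pow_nat[OF gc] B.pow_eq_zero[of "\<chi>' g" d] g(2) by auto
  obtain ls' where c: "\<And>z. z \<in> carrier E'.BC \<Longrightarrow> ls' z \<in> carrier B"
    and a: "\<And>z w. z \<in> carrier E'.BC \<Longrightarrow> w \<in> carrier E'.BC \<Longrightarrow> ls' (z \<oplus>\<^bsub>E'.BC\<^esub> w) = ls' z \<oplus>\<^bsub>B\<^esub> ls' w"
    and p: "\<And>x s. x \<in> carrier M' \<Longrightarrow> s \<in> carrier T \<Longrightarrow> ls' (E'.pure x s) = \<chi>' s \<otimes>\<^bsub>B\<^esub> l x [^]\<^bsub>B\<^esub> q"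
  proof (rule E'.extension_lift[OF B.abelian_group_axioms, of "\<lambda>x s. \<chi>' s \<otimes>\<^bsub>B\<^esub> l x [^]\<^bsub>B\<^esub> q"])
    show "\<chi>' s \<otimes>\<^bsub>B\<^esub> l x [^]\<^bsub>B\<^esub> q \<in> carrier B" if "x \<in> carrier M'" "s \<in> carrier T" for x s
      using that lc by simp
    show "\<chi>' s \<otimes>\<^bsub>B\<^esub> l (x \<oplus>\<^bsub>M'\<^esub> x') [^]\<^bsub>B\<^esub> q = \<chi>' s \<otimes>\<^bsub>B\<^esub> l x [^]\<^bsub>B\<^esub> q \<oplus>\<^bsub>B\<^esub> \<chi>' s \<otimes>\<^bsub>B\<^esub> l x' [^]\<^bsub>B\<^esub> q"
      if "x \<in> carrier M'" "x' \<in> carrier M'" "s \<in> carrier T" for x x' s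
      using that lc by (simp add: la B.frob_add[OF q] B.r_distr)
    show "\<chi>' (s \<oplus>\<^bsub>T\<^esub> s') \<otimes>\<^bsub>B\<^esub> l x [^]\<^bsub>B\<^esub> q = \<chi>' s \<otimes>\<^bsub>B\<^esub> l x [^]\<^bsub>B\<^esub> q \<oplus>\<^bsub>B\<^esub> \<chi>' s' \<otimes>\<^bsub>B\<^esub> l x [^]\<^bsub>B\<^esub> q"
      if "x \<in> carrier M'" "s \<in> carrier T" "s' \<in> carrier T" for x s s'
      using that lc by (simp add: B.l_distr)
    show "\<chi>' s \<otimes>\<^bsub>B\<^esub> l (t \<odot>\<^bsub>M'\<^esub> x) [^]\<^bsub>B\<^esub> q = \<chi>' (\<sigma> t \<otimes>\<^bsub>T\<^esub> s) \<otimes>\<^bsub>B\<^esub> l x [^]\<^bsub>B\<^esub> q"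
      if "t \<in> carrier T" "x \<in> carrier M'" "s \<in> carrier T" for t x s
      using that lc by (simp add: ls \<chi>\<sigma> B.nat_pow_distrib B.m_assoc B.m_lcomm)
    fix \<Psi>
    assume "\<And>z. z \<in> carrier E'.BC \<Longrightarrow> \<Psi> z \<in> carrier B"
      "\<And>z w. z \<in> carrier E'.BC \<Longrightarrow> w \<in> carrier E'.BC \<Longrightarrow> \<Psi> (z \<oplus>\<^bsub>E'.BC\<^esub> w) = \<Psi> z \<oplus>\<^bsub>B\<^esub> \<Psi> w"
      "\<And>x s. x \<in> carrier M' \<Longrightarrow> s \<in> carrier T \<Longrightarrow> \<Psi> (E'.pure x s) = \<chi>' s \<otimes>\<^bsub>B\<^esub> l x [^]\<^bsub>B\<^esub> q"
    then show thesis by (rule that)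
  qed
  have z0: "ls' \<zero>\<^bsub>E'.BC\<^esub> = \<zero>\<^bsub>B\<^esub>"
    using a[OF E'.BC.zero_closed E'.BC.zero_closed] c[OF E'.BC.zero_closed] by (simp add: B.add.l_cancel_one')
  have s: "ls' (t \<odot>\<^bsub>E'.BC\<^esub> z) = \<chi>' t \<otimes>\<^bsub>B\<^esub> ls' z" if t: "t \<in> carrier T" and z: "z \<in> carrier E'.BC" for t z
  proof -
    have sa: "t \<odot>\<^bsub>E'.BC\<^esub> (x \<oplus>\<^bsub>E'.BC\<^esub> y) = t \<odot>\<^bsub>E'.BC\<^esub> x \<oplus>\<^bsub>E'.BC\<^esub> t \<odot>\<^bsub>E'.BC\<^esub> y"
      if "x \<in> carrier E'.BC" "y \<in> carrier E'.BC" for x y using E'.smult_add[OF t that] .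
    show ?thesis using z
    proof (induction z rule: E'.BC_induct)
      case zero
      have "t \<odot>\<^bsub>E'.BC\<^esub> \<zero>\<^bsub>E'.BC\<^esub> = \<zero>\<^bsub>E'.BC\<^esub>"
        using E'.smult_pure[OF t E'.M.zero_closed T.one_closed] E'.pure_zero t by simp
      then show ?case using z0 t by simp
    next
      case (pure x u)
      show ?case unfolding E'.smult_pure[OF t pure] using t pure p lc by (simp add: B.m_assoc)
    next
      case (add x y)
      show ?case unfolding sa[OF add(1,2)] a[OF add(1,2)] a[OF E'.smult_closed[OF t add(1)] E'.smult_closed[OF t add(2)]] add(3,4)
        by (rule B.r_distr[symmetric, OF c[OF add(1)] c[OF add(2)]]) (use t in simp)
    qed
  qed
  define r where "r = inv_into (carrier E'.BC) \<tau>'"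
  have r: "r (\<tau>' z) = z" if "z \<in> carrier E'.BC" for z unfolding r_def by (rule inv_into_f_f[OF inj_\<tau>' that])
  have jx: "\<exists>z. z \<in> carrier E'.BC \<and> j \<odot>\<^bsub>M'\<^esub> x = \<tau>' z" if "x \<in> carrier M'" for x
    using coker_\<tau>'[OF j(2) that] by blast
  define l' where "l' x = ls' (r (j \<odot>\<^bsub>M'\<^esub> x))" for x
  have l'z: "l' x = ls' z" if "z \<in> carrier E'.BC" "j \<odot>\<^bsub>M'\<^esub> x = \<tau>' z" for x z
    unfolding l'_def that(2) r[OF that(1)] ..
  have l's: "l' (t \<odot>\<^bsub>M'\<^esub> x) = \<chi>' t \<otimes>\<^bsub>B\<^esub> l' x" if t: "t \<in> carrier T" and x: "x \<in> carrier M'" for t x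
  proof -
    obtain z where z: "z \<in> carrier E'.BC" "j \<odot>\<^bsub>M'\<^esub> x = \<tau>' z" using jx[OF x] by blast
    have "j \<odot>\<^bsub>M'\<^esub> (t \<odot>\<^bsub>M'\<^esub> x) = t \<odot>\<^bsub>M'\<^esub> (j \<odot>\<^bsub>M'\<^esub> x)"
      using t x j(1) by (simp add: E'.M.smult_assoc1[symmetric] T.m_comm)
    also have "\<dots> = \<tau>' (t \<odot>\<^bsub>E'.BC\<^esub> z)" unfolding z(2) by (rule tD'(3)[symmetric, OF t z(1)])
    finally have "l' (t \<odot>\<^bsub>M'\<^esub> x) = ls' (t \<odot>\<^bsub>E'.BC\<^esub> z)" by (rule l'z[OF E'.smult_closed[OF t z(1)]])
    then show ?thesis unfolding s[OF t z(1)] l'z[OF z] .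
  qed
  have l'tau: "l' (\<tau>' z) = \<chi>' j \<otimes>\<^bsub>B\<^esub> ls' z" if z: "z \<in> carrier E'.BC" for z
  proof -
    have "l' (\<tau>' z) = ls' (j \<odot>\<^bsub>E'.BC\<^esub> z)"
      by (rule l'z[OF E'.smult_closed[OF j(1) z] tD'(3)[symmetric, OF j(1) z]])
    then show ?thesis unfolding s[OF j(1) z] .
  qed
  have l'c: "l' x \<in> carrier B" if x: "x \<in> carrier M'" for x
    using jx[OF x] l'z c by metis
  have "semifunctional B \<chi>' l'" unfolding semifunctional_def
  proof (intro conjI ballI)
    show "l' x \<in> carrier B" if "x \<in> carrier M'" for x by (rule l'c[OF that])
    show "l' (x \<oplus>\<^bsub>M'\<^esub> y) = l' x \<oplus>\<^bsub>B\<^esub> l' y" if xy: "x \<in> carrier M'" "y \<in> carrier M'" for x y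
    proof -
      obtain z w where z: "z \<in> carrier E'.BC" "j \<odot>\<^bsub>M'\<^esub> x = \<tau>' z" and w: "w \<in> carrier E'.BC" "j \<odot>\<^bsub>M'\<^esub> y = \<tau>' w"
        using jx[OF xy(1)] jx[OF xy(2)] by blast
      have "j \<odot>\<^bsub>M'\<^esub> (x \<oplus>\<^bsub>M'\<^esub> y) = \<tau>' (z \<oplus>\<^bsub>E'.BC\<^esub> w)"
        unfolding E'.M.smult_r_distr[OF j(1) xy] z(2) w(2) tD'(2)[OF z(1) w(1)] ..
      then show ?thesis using l'z[OF E'.BC.a_closed[OF z(1) w(1)]] l'z[OF z] l'z[OF w] a[OF z(1) w(1)] by simp
    qed
    show "l' (t \<odot>\<^bsub>M'\<^esub> x) = \<chi>' t \<otimes>\<^bsub>B\<^esub> l' x" if "t \<in> carrier T" "x \<in> carrier M'" for t x by (rule l's[OF that])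
    show "\<exists>x\<in>carrier M'. l' x \<noteq> \<zero>\<^bsub>B\<^esub>"
    proof
      have z: "E'.pure x0 \<one>\<^bsub>T\<^esub> \<in> carrier E'.BC" by (rule E'.pure_closed[OF x0(1) T.one_closed])
      \<comment> \<open>The new functional is nonzero at \<open>\<tau>'(x\<^sub>0 \<otimes> 1)\<close>.\<close>
      show "\<tau>' (E'.pure x0 \<one>\<^bsub>T\<^esub>) \<in> carrier M'" by (rule tD'(1)[OF z])
      have "l x0 [^]\<^bsub>B\<^esub> q \<noteq> \<zero>\<^bsub>B\<^esub>" using B.pow_eq_zero[OF lc[OF x0(1)]] x0(2) by blast
      then show "l' (\<tau>' (E'.pure x0 \<one>\<^bsub>T\<^esub>)) \<noteq> \<zero>\<^bsub>B\<^esub>"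
        unfolding l'tau[OF z] p[OF x0(1) T.one_closed] using j(1,3) lc[OF x0(1)] B.integral_iff by simp
    qed
    show "l' y = \<zero>\<^bsub>B\<^esub>" if y: "y \<in> img" for y
    proof -
      obtain m where m: "m \<in> carrier M" "y = f m" using y by blast
      obtain z where z: "z \<in> carrier E.BC" "j2 \<odot>\<^bsub>M\<^esub> m = \<tau> z" using coker_\<tau>[OF j2(2) m(1)] by blast
      let ?F = "base_change_map T \<sigma> T M' f"
      have yM: "y \<in> carrier M'" using fD(1) m by blast
      have Fz: "?F z \<in> carrier E'.BC" by (rule E.extension_map(1)[OF M' f z(1)])
      have "j2 \<odot>\<^bsub>M'\<^esub> y = \<tau>' (?F z)"
        unfolding m(2) fD(3)[symmetric, OF j2(1) m(1)] z(2) by (rule commutes[OF z(1)])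
      then have e: "\<chi>' j2 \<otimes>\<^bsub>B\<^esub> l' y = \<chi>' j \<otimes>\<^bsub>B\<^esub> ls' (?F z)" using l's[OF j2(1) yM] l'tau[OF Fz] by simp
      have "ls' (?F z) = \<zero>\<^bsub>B\<^esub>" using z(1)
      proof (induction z rule: E.BC_induct)
        case zero
        have "?F \<zero>\<^bsub>E.BC\<^esub> = ?F (E.pure \<zero>\<^bsub>M\<^esub> \<one>\<^bsub>T\<^esub>)" using E.pure_zero by simp
        also have "\<dots> = E'.pure \<zero>\<^bsub>M'\<^esub> \<one>\<^bsub>T\<^esub>"
          unfolding E.extension_map(3)[OF M' f E.M.zero_closed T.one_closed]
            mod_hom_zero[OF E.M.abelian_group_axioms E'.M.abelian_group_axioms f] ..
        also have "\<dots> = \<zero>\<^bsub>E'.BC\<^esub>" by (rule E'.pure_zero) simp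
        finally show ?case using z0 by simp
      next
        case (pure x u)
        have "l (f x) = \<zero>\<^bsub>B\<^esub>" using li pure(1) by blast
        then show ?case unfolding E.extension_map(3)[OF M' f pure] p[OF fD(1)[OF pure(1)] pure(2)]
          using frob_exp_gt_1[OF q] pure(2) by (simp add: B.nat_pow_zero)
      next
        case (add x y)
        show ?case unfolding E.extension_map(2)[OF M' f add(1,2)]
            a[OF E.extension_map(1)[OF M' f add(1)] E.extension_map(1)[OF M' f add(2)]] add(3,4) by simp
      qed
      then show ?thesis using e j(1) j2(1,3) l'c[OF yM] B.integral_iff by simp
    qed
  qed
  then show ?thesis by (rule that)
qed

lemma functional_kills_ann:
  fixes B :: "'b ring"
  assumes B: "field B" and \<chi>: "\<chi> \<in> ring_hom T B" and l: "semifunctional B \<chi> l" and i: "i \<in> ann"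
  shows "\<chi> i = \<zero>\<^bsub>B\<^esub>"
proof -
  interpret B: field B by fact
  obtain x where x: "x \<in> carrier M'" "l x \<noteq> \<zero>\<^bsub>B\<^esub>" using l unfolding semifunctional_def by blast
  have lx: "l x \<in> carrier B" "l (i \<odot>\<^bsub>M'\<^esub> x) = \<chi> i \<otimes>\<^bsub>B\<^esub> l x" "l (i \<odot>\<^bsub>M'\<^esub> x) = \<zero>\<^bsub>B\<^esub>"
    using l x(1) annD[OF i] unfolding semifunctional_def by blast+
  have c: "\<chi> i \<in> carrier B" using \<chi> annD(1)[OF i] by (rule ring_hom_closed)
  have "\<chi> i \<otimes>\<^bsub>B\<^esub> l x = \<zero>\<^bsub>B\<^esub>" using lx(2,3) by (rule trans[OF sym])
  then show ?thesis using B.integral[OF _ c lx(1)] x(2) by blast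
qed

end

section \<open>The annihilator of the cokernel contains a rational element\<close>

text \<open>The integrality of \<open>A \<otimes> B\<close> and the description of the elements of \<open>A\<close> that are fixed by a Frobenius power are
what the geometry of the curve contributes.\<close>

locale characteristic_tensor = frobenius_tensor k \<alpha> A \<beta> B
  for k :: "'k ring" and \<alpha> :: "'k \<Rightarrow> 'a" and A :: "'a ring"
    and \<beta> :: "'k \<Rightarrow> 'b" and B :: "'b ring" +
  fixes c :: "'a \<Rightarrow> 'b"
  assumes T_domain: "domain T"
    and fixed_rational: "\<And>u m. u \<in> carrier A \<Longrightarrow> u [^]\<^bsub>A\<^esub> (q ^ Suc m) = u \<Longrightarrow> \<exists>z\<in>carrier k. u = \<alpha> z"
    and c_hom: "c \<in> ring_hom A B" and c_structure: "\<And>z. z \<in> carrier k \<Longrightarrow> c (\<alpha> z) = \<beta> z"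
begin

sublocale T: domain T by (rule T_domain)
sublocale c: ring_hom_ring A B c by (rule ring_hom_ringI2[OF A.ring_axioms B.ring_axioms c_hom])

definition J where "J = Idl\<^bsub>T\<^esub> {pt a \<one>\<^bsub>B\<^esub> \<ominus>\<^bsub>T\<^esub> pt \<one>\<^bsub>A\<^esub> (c a) | a. a \<in> carrier A}"

lemma J_gens: "{pt a \<one>\<^bsub>B\<^esub> \<ominus>\<^bsub>T\<^esub> pt \<one>\<^bsub>A\<^esub> (c a) | a. a \<in> carrier A} \<subseteq> carrier T"
proof
  fix x assume "x \<in> {pt a \<one>\<^bsub>B\<^esub> \<ominus>\<^bsub>T\<^esub> pt \<one>\<^bsub>A\<^esub> (c a) | a. a \<in> carrier A}"
  then obtain a where a: "a \<in> carrier A" "x = pt a \<one>\<^bsub>B\<^esub> \<ominus>\<^bsub>T\<^esub> pt \<one>\<^bsub>A\<^esub> (c a)" by (elim CollectE exE conjE) (rule that)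
  show "x \<in> carrier T" unfolding a(2) by (rule T.minus_closed) (simp_all add: a(1))
qed

lemma J_ideal: "ideal J T" unfolding J_def by (rule T.genideal_ideal[OF J_gens])

lemma J_gen: "a \<in> carrier A \<Longrightarrow> pt a \<one>\<^bsub>B\<^esub> \<ominus>\<^bsub>T\<^esub> pt \<one>\<^bsub>A\<^esub> (c a) \<in> J"
  unfolding J_def by (rule subsetD[OF T.genideal_self[OF J_gens]]) (rule CollectI, rule exI, rule conjI, rule refl)

text \<open>The points \<open>a \<otimes> b \<mapsto> c(a)\<^bsup>q^n\<^esup> b\<close>; composition with \<open>\<sigma>\<close> lowers the index and applies Frobenius to the value.\<close>

lemma evaluations:
  obtains \<chi> where "\<And>n. \<chi> n \<in> ring_hom T B"
    "\<And>n a b. a \<in> carrier A \<Longrightarrow> b \<in> carrier B \<Longrightarrow> \<chi> n (pt a b) = c a [^]\<^bsub>B\<^esub> (q ^ n) \<otimes>\<^bsub>B\<^esub> b"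
    "\<And>n t. t \<in> carrier T \<Longrightarrow> \<chi> (Suc n) (\<sigma> t) = \<chi> n t [^]\<^bsub>B\<^esub> q"
proof -
  have pow_hom: "(\<lambda>b. b [^]\<^bsub>B\<^esub> (q ^ n)) \<in> ring_hom B B" for n
  proof (induction n)
    case 0
    show ?case by (rule ring_hom_memI) simp_all
  next
    case (Suc n)
    show ?case
    proof (rule ring_hom_memI)
      show "x [^]\<^bsub>B\<^esub> (q ^ Suc n) \<in> carrier B" if "x \<in> carrier B" for x using that by (rule B.nat_pow_closed)
      show "(x \<otimes>\<^bsub>B\<^esub> y) [^]\<^bsub>B\<^esub> (q ^ Suc n) = x [^]\<^bsub>B\<^esub> (q ^ Suc n) \<otimes>\<^bsub>B\<^esub> y [^]\<^bsub>B\<^esub> (q ^ Suc n)"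
        if "x \<in> carrier B" "y \<in> carrier B" for x y using that by (rule B.nat_pow_distrib)
      show "(x \<oplus>\<^bsub>B\<^esub> y) [^]\<^bsub>B\<^esub> (q ^ Suc n) = x [^]\<^bsub>B\<^esub> (q ^ Suc n) \<oplus>\<^bsub>B\<^esub> y [^]\<^bsub>B\<^esub> (q ^ Suc n)"
        if "x \<in> carrier B" "y \<in> carrier B" for x y by (rule B.frob_add[OF frob_exp_pow[OF frob_B] that])
      show "\<one>\<^bsub>B\<^esub> [^]\<^bsub>B\<^esub> (q ^ Suc n) = \<one>\<^bsub>B\<^esub>" by (rule B.nat_pow_one)
    qed
  qed
  have "\<exists>\<Phi>. \<Phi> \<in> ring_hom T B \<and>
    (\<forall>a\<in>carrier A. \<forall>b\<in>carrier B. \<Phi> (pt a b) = c a [^]\<^bsub>B\<^esub> (q ^ n) \<otimes>\<^bsub>B\<^esub> b)" for n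
  proof -
    have g: "(\<lambda>a. c a [^]\<^bsub>B\<^esub> (q ^ n)) \<in> ring_hom A B"
      using ring_hom_trans[OF c_hom pow_hom[of n]] by (simp add: comp_def)
    have i: "(\<lambda>b. b) \<in> ring_hom B B" by (rule ring_hom_memI) simp_all
    have e: "c (\<alpha> z) [^]\<^bsub>B\<^esub> (q ^ n) = \<beta> z" if z: "z \<in> carrier k" for z
      using \<beta>.hom_pow_nat[OF z, of "q ^ n"] k_pow_pow[OF z, of n] c_structure[OF z] by simp
    show ?thesis
    proof (rule tensor_lift_hom[OF B.is_cring g i e])
      fix \<Phi> assume "\<Phi> \<in> ring_hom T B" "\<And>a b. a \<in> carrier A \<Longrightarrow> b \<in> carrier B \<Longrightarrow> \<Phi> (pt a b) = c a [^]\<^bsub>B\<^esub> (q ^ n) \<otimes>\<^bsub>B\<^esub> b"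
      then show ?thesis by blast
    qed
  qed
  then obtain \<chi> where \<chi>: "\<And>n. \<chi> n \<in> ring_hom T B"
    "\<And>n a b. a \<in> carrier A \<Longrightarrow> b \<in> carrier B \<Longrightarrow> \<chi> n (pt a b) = c a [^]\<^bsub>B\<^esub> (q ^ n) \<otimes>\<^bsub>B\<^esub> b"
    by metis
  have s: "\<chi> (Suc n) (\<sigma> t) = \<chi> n t [^]\<^bsub>B\<^esub> q" if t: "t \<in> carrier T" for n t
  proof -
    interpret x: ring_hom_ring T B "\<chi> n" by (rule ring_hom_ringI2[OF T.ring_axioms B.ring_axioms \<chi>(1)])
    interpret y: ring_hom_ring T B "\<chi> (Suc n)" by (rule ring_hom_ringI2[OF T.ring_axioms B.ring_axioms \<chi>(1)])
    show ?thesis using t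
    proof (induction t rule: T_induct)
      case zero
      have "\<zero>\<^bsub>B\<^esub> [^]\<^bsub>B\<^esub> q = \<zero>\<^bsub>B\<^esub>" by (rule B.nat_pow_zero) (use q_gt_1 in simp)
      then show ?case by simp
    next
      case (pure a b)
      have "c a [^]\<^bsub>B\<^esub> (q ^ Suc n) = (c a [^]\<^bsub>B\<^esub> (q ^ n)) [^]\<^bsub>B\<^esub> q"
        using pure(1) by (simp add: B.nat_pow_pow mult.commute)
      then show ?case using pure by (simp only: sigma_pt \<chi>(2) B.nat_pow_closed) (simp add: B.nat_pow_distrib)
    next
      case (add x y)
      then show ?case by (simp add: B.frob_add[OF frob_B])
    qed
  qed
  show ?thesis by (rule that[OF \<chi> s])
qed

text \<open>Choose a \<open>B\<close>-linear functional that vanishes on \<open>N\<close> and not at \<open>v\<close>. Since it vanishes on \<open>J M\<close>, the element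
\<open>a \<otimes> 1\<close> acts on its values as \<open>1 \<otimes> c(a)\<close> does.\<close>

lemma initial_functional:
  fixes M :: "(('a \<times> 'b \<Rightarrow>\<^sub>0 int) set, 'm) module"
  assumes M: "module T M" and N: "submodule N T M" and JN: "\<And>j x. j \<in> J \<Longrightarrow> x \<in> carrier M \<Longrightarrow> j \<odot>\<^bsub>M\<^esub> x \<in> N"
    and v: "v \<in> carrier M" "v \<notin> N"
    and \<chi>: "\<chi> \<in> ring_hom T B" "\<And>a b. a \<in> carrier A \<Longrightarrow> b \<in> carrier B \<Longrightarrow> \<chi> (pt a b) = c a \<otimes>\<^bsub>B\<^esub> b"
  obtains l where "\<And>x. x \<in> carrier M \<Longrightarrow> l x \<in> carrier B"
    "\<And>x y. x \<in> carrier M \<Longrightarrow> y \<in> carrier M \<Longrightarrow> l (x \<oplus>\<^bsub>M\<^esub> y) = l x \<oplus>\<^bsub>B\<^esub> l y"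
    "\<And>t x. t \<in> carrier T \<Longrightarrow> x \<in> carrier M \<Longrightarrow> l (t \<odot>\<^bsub>M\<^esub> x) = \<chi> t \<otimes>\<^bsub>B\<^esub> l x"
    "l v \<noteq> \<zero>\<^bsub>B\<^esub>" "\<And>y. y \<in> N \<Longrightarrow> l y = \<zero>\<^bsub>B\<^esub>"
proof -
  interpret M: module T M by fact
  interpret x: ring_hom_ring T B \<chi> by (rule ring_hom_ringI2[OF T.ring_axioms B.ring_axioms \<chi>(1)])
  note NE = M.submoduleE[OF N]
  let ?V = "restrict_scalars (\<lambda>b. pt \<one>\<^bsub>A\<^esub> b) M"
  have V: "carrier ?V = carrier M" "x \<oplus>\<^bsub>?V\<^esub> y = x \<oplus>\<^bsub>M\<^esub> y" "b \<odot>\<^bsub>?V\<^esub> x = pt \<one>\<^bsub>A\<^esub> b \<odot>\<^bsub>M\<^esub> x" "\<zero>\<^bsub>?V\<^esub> = \<zero>\<^bsub>M\<^esub>" for x y b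
    by (simp_all add: restrict_scalars_def)
  have abV: "abelian_group ?V"
  proof (rule abelian_groupI)
    show "\<exists>y\<in>carrier ?V. y \<oplus>\<^bsub>?V\<^esub> x = \<zero>\<^bsub>?V\<^esub>" if "x \<in> carrier ?V" for x
      by (rule bexI[of _ "\<ominus>\<^bsub>M\<^esub> x"]) (use that in \<open>simp_all add: V M.l_neg\<close>)
  qed (simp_all add: V M.a_ac)
  have modV: "module B ?V"
  proof (rule moduleI[OF B.is_cring abV])
    show "a \<odot>\<^bsub>?V\<^esub> x \<in> carrier ?V" if "a \<in> carrier B" "x \<in> carrier ?V" for a x using that by (simp add: V)
    show "(a \<oplus>\<^bsub>B\<^esub> b) \<odot>\<^bsub>?V\<^esub> x = a \<odot>\<^bsub>?V\<^esub> x \<oplus>\<^bsub>?V\<^esub> b \<odot>\<^bsub>?V\<^esub> x" if "a \<in> carrier B" "b \<in> carrier B" "x \<in> carrier ?V" for a b x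
      using that by (simp add: V pt_add_right M.smult_l_distr)
    show "a \<odot>\<^bsub>?V\<^esub> (x \<oplus>\<^bsub>?V\<^esub> y) = a \<odot>\<^bsub>?V\<^esub> x \<oplus>\<^bsub>?V\<^esub> a \<odot>\<^bsub>?V\<^esub> y" if "a \<in> carrier B" "x \<in> carrier ?V" "y \<in> carrier ?V" for a x y
      using that by (simp add: V M.smult_r_distr)
    show "(a \<otimes>\<^bsub>B\<^esub> b) \<odot>\<^bsub>?V\<^esub> x = a \<odot>\<^bsub>?V\<^esub> (b \<odot>\<^bsub>?V\<^esub> x)" if "a \<in> carrier B" "b \<in> carrier B" "x \<in> carrier ?V" for a b x
      using that by (simp add: V M.smult_assoc1[symmetric])
    show "\<one>\<^bsub>B\<^esub> \<odot>\<^bsub>?V\<^esub> x = x" if "x \<in> carrier ?V" for x using that by (simp add: V pt_one)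
  qed
  have inv: "\<ominus>\<^bsub>?V\<^esub> x = \<ominus>\<^bsub>M\<^esub> x" if "x \<in> carrier M" for x
  proof -
    interpret V: abelian_group ?V by (rule abV)
    show ?thesis by (rule V.minus_equality) (use that in \<open>simp_all add: V M.l_neg\<close>)
  qed
  have subV: "submodule N B ?V"
  proof (rule module.submoduleI[OF modV])
    show "N \<subseteq> carrier ?V" unfolding V by (rule NE(1))
    show "\<zero>\<^bsub>?V\<^esub> \<in> N" unfolding V using subgroup.one_closed[OF submodule.axioms(1)[OF N]] by simp
    show "\<ominus>\<^bsub>?V\<^esub> a \<in> N" if "a \<in> N" for a using inv NE(1) NE(3)[OF that] that by (metis subsetD)
    show "a \<oplus>\<^bsub>?V\<^esub> b \<in> N" if "a \<in> N" "b \<in> N" for a b unfolding V by (rule NE(5)[OF that])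
    show "a \<odot>\<^bsub>?V\<^esub> x \<in> N" if "a \<in> carrier B" "x \<in> N" for a x unfolding V by (rule NE(4)) (use that in simp_all)
  qed
  have vV: "v \<in> carrier ?V" unfolding V by (rule v(1))
  obtain l where l: "l \<in> carrier ?V \<rightarrow> carrier B"
    "\<And>x y. x \<in> carrier ?V \<Longrightarrow> y \<in> carrier ?V \<Longrightarrow> l (x \<oplus>\<^bsub>?V\<^esub> y) = l x \<oplus>\<^bsub>B\<^esub> l y"
    "\<And>b x. b \<in> carrier B \<Longrightarrow> x \<in> carrier ?V \<Longrightarrow> l (b \<odot>\<^bsub>?V\<^esub> x) = b \<otimes>\<^bsub>B\<^esub> l x"
    "l v = \<one>\<^bsub>B\<^esub>" "\<And>w. w \<in> N \<Longrightarrow> l w = \<zero>\<^bsub>B\<^esub>"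
  proof (rule separating_functional[OF B.field_axioms modV subV vV v(2)])
    fix \<phi> assume "\<phi> \<in> carrier ?V \<rightarrow> carrier B"
    "\<And>x y. x \<in> carrier ?V \<Longrightarrow> y \<in> carrier ?V \<Longrightarrow> \<phi> (x \<oplus>\<^bsub>?V\<^esub> y) = \<phi> x \<oplus>\<^bsub>B\<^esub> \<phi> y"
    "\<And>b x. b \<in> carrier B \<Longrightarrow> x \<in> carrier ?V \<Longrightarrow> \<phi> (b \<odot>\<^bsub>?V\<^esub> x) = b \<otimes>\<^bsub>B\<^esub> \<phi> x"
    "\<phi> v = \<one>\<^bsub>B\<^esub>" "\<And>w. w \<in> N \<Longrightarrow> \<phi> w = \<zero>\<^bsub>B\<^esub>"
    then show thesis by (rule that)
  qed
  note l = l[unfolded V]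
  have lc: "l x \<in> carrier B" if "x \<in> carrier M" for x using l(1) that by (rule funcset_mem)
  have lin: "l (t \<odot>\<^bsub>M\<^esub> x) = \<chi> t \<otimes>\<^bsub>B\<^esub> l x" if t: "t \<in> carrier T" and x: "x \<in> carrier M" for t x
    using t
  proof (induction t rule: T_induct)
    case zero
    have "l \<zero>\<^bsub>M\<^esub> = \<zero>\<^bsub>B\<^esub>" by (rule l(5)) (use subgroup.one_closed[OF submodule.axioms(1)[OF N]] in simp)
    then show ?case using x lc by simp
  next
    case (pure a b)
    let ?g = "pt a \<one>\<^bsub>B\<^esub> \<ominus>\<^bsub>T\<^esub> pt \<one>\<^bsub>A\<^esub> (c a)"
    have gc: "?g \<in> carrier T" by (rule T.minus_closed) (simp_all add: pure)
    have "pt a \<one>\<^bsub>B\<^esub> = ?g \<oplus>\<^bsub>T\<^esub> pt \<one>\<^bsub>A\<^esub> (c a)"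
      using pure by (simp add: a_minus_def T.a_assoc T.l_neg)
    then have "pt a \<one>\<^bsub>B\<^esub> \<odot>\<^bsub>M\<^esub> x = ?g \<odot>\<^bsub>M\<^esub> x \<oplus>\<^bsub>M\<^esub> pt \<one>\<^bsub>A\<^esub> (c a) \<odot>\<^bsub>M\<^esub> x"
      using M.smult_l_distr[OF gc _ x, of "pt \<one>\<^bsub>A\<^esub> (c a)"] pure by simp
    moreover have "l (?g \<odot>\<^bsub>M\<^esub> x \<oplus>\<^bsub>M\<^esub> pt \<one>\<^bsub>A\<^esub> (c a) \<odot>\<^bsub>M\<^esub> x) = l (?g \<odot>\<^bsub>M\<^esub> x) \<oplus>\<^bsub>B\<^esub> l (pt \<one>\<^bsub>A\<^esub> (c a) \<odot>\<^bsub>M\<^esub> x)"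
      by (rule l(2)) (use gc x pure in simp_all)
    moreover have "l (?g \<odot>\<^bsub>M\<^esub> x) = \<zero>\<^bsub>B\<^esub>" by (rule l(5)[OF JN[OF J_gen[OF pure(1)] x]])
    moreover have "l (pt \<one>\<^bsub>A\<^esub> (c a) \<odot>\<^bsub>M\<^esub> x) = c a \<otimes>\<^bsub>B\<^esub> l x" by (rule l(3)) (use pure x in simp_all)
    ultimately have 1: "l (pt a \<one>\<^bsub>B\<^esub> \<odot>\<^bsub>M\<^esub> x) = c a \<otimes>\<^bsub>B\<^esub> l x" using pure lc[OF x] by simp
    have "pt a b \<odot>\<^bsub>M\<^esub> x = pt \<one>\<^bsub>A\<^esub> b \<odot>\<^bsub>M\<^esub> (pt a \<one>\<^bsub>B\<^esub> \<odot>\<^bsub>M\<^esub> x)"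
      using pure x by (simp add: M.smult_assoc1[symmetric])
    then have "l (pt a b \<odot>\<^bsub>M\<^esub> x) = b \<otimes>\<^bsub>B\<^esub> l (pt a \<one>\<^bsub>B\<^esub> \<odot>\<^bsub>M\<^esub> x)"
      using l(3)[OF pure(2), of "pt a \<one>\<^bsub>B\<^esub> \<odot>\<^bsub>M\<^esub> x"] pure x by simp
    then show ?case unfolding 1 \<chi>(2)[OF pure] using pure lc[OF x] by (simp add: B.m_ac)
  next
    case (add s t)
    have "l ((s \<oplus>\<^bsub>T\<^esub> t) \<odot>\<^bsub>M\<^esub> x) = l (s \<odot>\<^bsub>M\<^esub> x) \<oplus>\<^bsub>B\<^esub> l (t \<odot>\<^bsub>M\<^esub> x)"
      unfolding M.smult_l_distr[OF add(1,2) x] by (rule l(2)) (use add(1,2) x in simp_all)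
    then show ?case unfolding add(3,4) using add(1,2) lc[OF x] by (simp add: B.l_distr)
  qed
  have "l v \<noteq> \<zero>\<^bsub>B\<^esub>" unfolding l(4) by simp
  from that[OF lc l(2) lin this l(5)] show ?thesis .
qed

text \<open>The three cases are: \<open>c\<close> is not injective; \<open>c\<close> is injective with values in a finite field; \<open>c\<close> is injective
and every Frobenius power moves some value of \<open>c\<close>.\<close>

lemma coker_annihilated_by_rational:
  fixes M :: "(('a \<times> 'b \<Rightarrow>\<^sub>0 int) set, 'm) module" and M' :: "(('a \<times> 'b \<Rightarrow>\<^sub>0 int) set, 'n) module"
  assumes mor: "frobenius_module_morphism T \<sigma> J M \<tau> d M' \<tau>' d' f"
    and t: "t \<in> carrier T" "t \<noteq> \<zero>\<^bsub>T\<^esub>" "\<And>x. x \<in> carrier M' \<Longrightarrow> t \<odot>\<^bsub>M'\<^esub> x \<in> f ` carrier M"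
  obtains a where "a \<in> carrier A" "a \<noteq> \<zero>\<^bsub>A\<^esub>" "\<And>x. x \<in> carrier M' \<Longrightarrow> pt a \<one>\<^bsub>B\<^esub> \<odot>\<^bsub>M'\<^esub> x \<in> f ` carrier M"
proof -
  interpret X: frobenius_module_morphism T \<sigma> J M \<tau> d M' \<tau>' d' f by (rule mor)
  interpret ann: ideal X.ann T by (rule X.ann_ideal)
  have tI: "t \<in> X.ann" unfolding X.ann_def using t(1,3) by simp
  have annm: "x \<ominus>\<^bsub>T\<^esub> y \<in> X.ann" if "x \<in> X.ann" "y \<in> X.ann" for x y
    unfolding a_minus_def using ann.a_closed[OF that(1) ann.a_inv_closed[OF that(2)]] .
  have B1: "\<one>\<^bsub>B\<^esub> [^]\<^bsub>B\<^esub> q = \<one>\<^bsub>B\<^esub>" by simp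
  have "\<exists>a\<in>carrier A. a \<noteq> \<zero>\<^bsub>A\<^esub> \<and> pt a \<one>\<^bsub>B\<^esub> \<in> X.ann"
  proof (cases "\<exists>a0\<in>carrier A. a0 \<noteq> \<zero>\<^bsub>A\<^esub> \<and> c a0 = \<zero>\<^bsub>B\<^esub>")
    case True
    then obtain a0 where a0: "a0 \<in> carrier A" "a0 \<noteq> \<zero>\<^bsub>A\<^esub>" "c a0 = \<zero>\<^bsub>B\<^esub>" by blast
    define g where "g = pt a0 \<one>\<^bsub>B\<^esub>"
    have gc: "g \<in> carrier T" unfolding g_def using a0(1) by simp
    have gJ: "g \<in> J" using J_gen[OF a0(1)] gc unfolding a0(3) g_def by (simp add: a_minus_def)
    have sg: "\<sigma> g = g" unfolding g_def sigma_pt[OF a0(1) B.one_closed] B1 ..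
    define W where "W = {x \<in> carrier T. \<exists>n::nat. g [^]\<^bsub>T\<^esub> n \<otimes>\<^bsub>T\<^esub> x \<in> X.ann}"
    have WI: "x \<in> carrier T" "\<exists>n::nat. g [^]\<^bsub>T\<^esub> n \<otimes>\<^bsub>T\<^esub> x \<in> X.ann" if "x \<in> W" for x
      using that unfolding W_def by simp_all
    have IW: "x \<in> W" if "x \<in> carrier T" "g [^]\<^bsub>T\<^esub> (n::nat) \<otimes>\<^bsub>T\<^esub> x \<in> X.ann" for n x
      unfolding W_def using that(1) exI[of "\<lambda>n::nat. g [^]\<^bsub>T\<^esub> n \<otimes>\<^bsub>T\<^esub> x \<in> X.ann" n, OF that(2)] by simp
    have gn: "g [^]\<^bsub>T\<^esub> (n::nat) \<in> carrier T" for n by (rule T.nat_pow_closed[OF gc])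
    obtain a1 where a1: "a1 \<in> carrier A" "a1 \<noteq> \<zero>\<^bsub>A\<^esub>" "pt a1 \<one>\<^bsub>B\<^esub> \<in> W"
    proof (rule invariant_contains_rational[of W t])
      show "W \<subseteq> carrier T" using WI(1) by (rule subsetI)
      show "x \<ominus>\<^bsub>T\<^esub> y \<in> W" if x: "x \<in> W" and y: "y \<in> W" for x y
      proof -
        obtain m n :: nat where mn: "g [^]\<^bsub>T\<^esub> m \<otimes>\<^bsub>T\<^esub> x \<in> X.ann" "g [^]\<^bsub>T\<^esub> n \<otimes>\<^bsub>T\<^esub> y \<in> X.ann"
          using WI(2)[OF x] WI(2)[OF y] by (elim exE) (rule that)
        have "g [^]\<^bsub>T\<^esub> (m + n) \<otimes>\<^bsub>T\<^esub> (x \<ominus>\<^bsub>T\<^esub> y) =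
            g [^]\<^bsub>T\<^esub> n \<otimes>\<^bsub>T\<^esub> (g [^]\<^bsub>T\<^esub> m \<otimes>\<^bsub>T\<^esub> x) \<ominus>\<^bsub>T\<^esub> g [^]\<^bsub>T\<^esub> m \<otimes>\<^bsub>T\<^esub> (g [^]\<^bsub>T\<^esub> n \<otimes>\<^bsub>T\<^esub> y)"
          using WI(1)[OF x] WI(1)[OF y] gn
          by (simp add: T.nat_pow_mult[symmetric] gc a_minus_def T.r_distr T.r_minus T.l_minus T.m_ac)
        also have "\<dots> \<in> X.ann" by (rule annm[OF ann.I_l_closed[OF mn(1) gn] ann.I_l_closed[OF mn(2) gn]])
        finally show ?thesis by (rule IW[OF T.minus_closed[OF WI(1)[OF x] WI(1)[OF y]]])
      qed
      show "pt \<one>\<^bsub>A\<^esub> b \<otimes>\<^bsub>T\<^esub> x \<in> W" if b: "b \<in> carrier B" and x: "x \<in> W" for b x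
      proof -
        have bc: "pt \<one>\<^bsub>A\<^esub> b \<in> carrier T" using b by simp
        obtain n :: nat where n: "g [^]\<^bsub>T\<^esub> n \<otimes>\<^bsub>T\<^esub> x \<in> X.ann" using WI(2)[OF x] by (elim exE) (rule that)
        have "g [^]\<^bsub>T\<^esub> n \<otimes>\<^bsub>T\<^esub> (pt \<one>\<^bsub>A\<^esub> b \<otimes>\<^bsub>T\<^esub> x) = pt \<one>\<^bsub>A\<^esub> b \<otimes>\<^bsub>T\<^esub> (g [^]\<^bsub>T\<^esub> n \<otimes>\<^bsub>T\<^esub> x)"
          by (rule T.m_lcomm[OF gn bc WI(1)[OF x]])
        also have "\<dots> \<in> X.ann" by (rule ann.I_l_closed[OF n bc])
        finally show ?thesis by (rule IW[OF T.m_closed[OF bc WI(1)[OF x]]])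
      qed
      show "\<sigma> x \<in> W" if x: "x \<in> W" for x
      proof -
        obtain n :: nat where n: "g [^]\<^bsub>T\<^esub> n \<otimes>\<^bsub>T\<^esub> x \<in> X.ann" using WI(2)[OF x] by (elim exE) (rule that)
        have sx: "\<sigma> x \<in> carrier T" using WI(1)[OF x] by simp
        have "\<sigma> (g [^]\<^bsub>T\<^esub> n \<otimes>\<^bsub>T\<^esub> x) = g [^]\<^bsub>T\<^esub> n \<otimes>\<^bsub>T\<^esub> \<sigma> x"
          using \<sigma>.hom_mult[OF gn WI(1)[OF x]] \<sigma>.hom_pow_nat[OF gc] sg by simp
        then have "(g [^]\<^bsub>T\<^esub> n \<otimes>\<^bsub>T\<^esub> \<sigma> x) \<otimes>\<^bsub>T\<^esub> g [^]\<^bsub>T\<^esub> d' \<in> X.ann"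
          using X.sigma_ann[OF n T.pow_in_ideal_power[OF J_ideal gJ]] by simp
        moreover have "(g [^]\<^bsub>T\<^esub> n \<otimes>\<^bsub>T\<^esub> \<sigma> x) \<otimes>\<^bsub>T\<^esub> g [^]\<^bsub>T\<^esub> d' = g [^]\<^bsub>T\<^esub> (n + d') \<otimes>\<^bsub>T\<^esub> \<sigma> x"
          using sx gn by (simp add: T.nat_pow_mult[symmetric] gc T.m_ac)
        ultimately show ?thesis using IW[OF sx, of "n + d'"] by simp
      qed
      show "t \<in> W" by (rule IW[OF t(1), of 0]) (use tI t(1) in simp)
      show "t \<noteq> \<zero>\<^bsub>T\<^esub>" by (rule t(2))
    qed
    obtain n :: nat where n: "g [^]\<^bsub>T\<^esub> n \<otimes>\<^bsub>T\<^esub> pt a1 \<one>\<^bsub>B\<^esub> \<in> X.ann" using WI(2)[OF a1(3)] by (elim exE) (rule that)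
    have "g [^]\<^bsub>T\<^esub> n \<otimes>\<^bsub>T\<^esub> pt a1 \<one>\<^bsub>B\<^esub> = pt (a0 [^]\<^bsub>A\<^esub> n \<otimes>\<^bsub>A\<^esub> a1) \<one>\<^bsub>B\<^esub>"
      unfolding g_def using a0(1) a1(1) by (simp add: pt_pow)
    then have "pt (a0 [^]\<^bsub>A\<^esub> n \<otimes>\<^bsub>A\<^esub> a1) \<one>\<^bsub>B\<^esub> \<in> X.ann" using n by simp
    moreover have "a0 [^]\<^bsub>A\<^esub> n \<noteq> \<zero>\<^bsub>A\<^esub>" using A.pow_eq_zero[OF a0(1)] a0(2) by blast
    then have "a0 [^]\<^bsub>A\<^esub> n \<otimes>\<^bsub>A\<^esub> a1 \<noteq> \<zero>\<^bsub>A\<^esub>"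
      using A.integral[OF _ A.nat_pow_closed[OF a0(1)] a1(1)] a1(2) by blast
    ultimately show ?thesis using A.m_closed[OF A.nat_pow_closed[OF a0(1)] a1(1)] by (intro bexI conjI)
  next
    case False
    then have c_inj: "a = \<zero>\<^bsub>A\<^esub>" if "a \<in> carrier A" "c a = \<zero>\<^bsub>B\<^esub>" for a using that by blast
    show ?thesis
    proof (cases "\<exists>n. \<forall>a\<in>carrier A. c a [^]\<^bsub>B\<^esub> (q ^ Suc n) = c a")
      case True
      then obtain n where n: "\<And>a. a \<in> carrier A \<Longrightarrow> c a [^]\<^bsub>B\<^esub> (q ^ Suc n) = c a" by blast
      \<comment> \<open>As \<open>c\<close> is injective, every element of \<open>A\<close> is fixed by a Frobenius power and hence constant.\<close>
      have rat: "\<exists>z\<in>carrier k. a = \<alpha> z" if a: "a \<in> carrier A" for a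
      proof (rule fixed_rational[OF a, of n])
        let ?p = "a [^]\<^bsub>A\<^esub> (q ^ Suc n)"
        have pc: "?p \<in> carrier A" by (rule A.nat_pow_closed[OF a])
        have "c (?p \<ominus>\<^bsub>A\<^esub> a) = c ?p \<ominus>\<^bsub>B\<^esub> c a" using pc a by (simp add: a_minus_def)
        also have "c ?p = c a" using c.hom_pow_nat[OF a, of "q ^ Suc n"] n[OF a] by (rule trans)
        also have "c a \<ominus>\<^bsub>B\<^esub> c a = \<zero>\<^bsub>B\<^esub>" using a by (simp add: a_minus_def B.r_neg)
        finally have "?p \<ominus>\<^bsub>A\<^esub> a = \<zero>\<^bsub>A\<^esub>" by (rule c_inj[OF A.minus_closed[OF pc a]])
        then show "?p = a" by (simp only: A.r_right_minus_eq[OF pc a])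
      qed
      have "\<exists>b\<in>carrier B. x = pt \<one>\<^bsub>A\<^esub> b" if x: "x \<in> carrier T" for x
        using x
      proof (induction x rule: T_induct)
        case zero
        show ?case by (rule bexI[of _ "\<zero>\<^bsub>B\<^esub>"]) simp_all
      next
        case (pure a b)
        obtain z where z: "z \<in> carrier k" "a = \<alpha> z" using rat[OF pure(1)] by blast
        have "pt a b = pt (\<alpha> z \<otimes>\<^bsub>A\<^esub> \<one>\<^bsub>A\<^esub>) b" using z by simp
        also have "\<dots> = pt \<one>\<^bsub>A\<^esub> (\<beta> z \<otimes>\<^bsub>B\<^esub> b)" by (rule pt_balanced[OF z(1) A.one_closed pure(2)])
        finally show ?case by (rule bexI[of _ "\<beta> z \<otimes>\<^bsub>B\<^esub> b"]) (use z(1) pure(2) in simp)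
      next
        case (add x y)
        obtain u v where u: "u \<in> carrier B" "x = pt \<one>\<^bsub>A\<^esub> u" and v: "v \<in> carrier B" "y = pt \<one>\<^bsub>A\<^esub> v"
          using add(3,4) by (elim bexE) (rule that)
        have "x \<oplus>\<^bsub>T\<^esub> y = pt \<one>\<^bsub>A\<^esub> (u \<oplus>\<^bsub>B\<^esub> v)" unfolding u(2) v(2) by (rule pt_add_right[symmetric, OF A.one_closed u(1) v(1)])
        then show ?case by (rule bexI[of _ "u \<oplus>\<^bsub>B\<^esub> v"]) (use u(1) v(1) in simp)
      qed
      from this[OF t(1)] obtain b where b: "b \<in> carrier B" "t = pt \<one>\<^bsub>A\<^esub> b" by (elim bexE) (rule that)
      have "b \<noteq> \<zero>\<^bsub>B\<^esub>"
      proof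
        assume "b = \<zero>\<^bsub>B\<^esub>"
        then have "t = \<zero>\<^bsub>T\<^esub>" unfolding b(2) by simp
        then show False using t(2) by (rule notE[rotated])
      qed
      then have u: "inv\<^bsub>B\<^esub> b \<in> carrier B" "inv\<^bsub>B\<^esub> b \<otimes>\<^bsub>B\<^esub> b = \<one>\<^bsub>B\<^esub>" using b(1) B.field_Units by simp_all
      have "pt \<one>\<^bsub>A\<^esub> (inv\<^bsub>B\<^esub> b) \<otimes>\<^bsub>T\<^esub> t = pt \<one>\<^bsub>A\<^esub> \<one>\<^bsub>B\<^esub>" unfolding b(2) using u b(1) by simp
      moreover have "pt \<one>\<^bsub>A\<^esub> (inv\<^bsub>B\<^esub> b) \<otimes>\<^bsub>T\<^esub> t \<in> X.ann" by (rule ann.I_l_closed[OF tI]) (use u in simp)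
      ultimately have "pt \<one>\<^bsub>A\<^esub> \<one>\<^bsub>B\<^esub> \<in> X.ann" by simp
      then show ?thesis by (intro bexI[of _ "\<one>\<^bsub>A\<^esub>"] conjI) simp_all
    next
      case False
      have H: "N = carrier M'" if N: "submodule N T M'" "X.img \<subseteq> N"
        and JN: "\<And>j x. j \<in> J \<Longrightarrow> x \<in> carrier M' \<Longrightarrow> j \<odot>\<^bsub>M'\<^esub> x \<in> N" for N
      proof (rule ccontr)
        assume "N \<noteq> carrier M'"
        then obtain v where v: "v \<in> carrier M'" "v \<notin> N" using X.E'.M.submoduleE(1)[OF N(1)] by blast
        obtain \<chi> where \<chi>: "\<And>n. \<chi> n \<in> ring_hom T B"
          "\<And>n a b. a \<in> carrier A \<Longrightarrow> b \<in> carrier B \<Longrightarrow> \<chi> n (pt a b) = c a [^]\<^bsub>B\<^esub> (q ^ n) \<otimes>\<^bsub>B\<^esub> b"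
          "\<And>n t. t \<in> carrier T \<Longrightarrow> \<chi> (Suc n) (\<sigma> t) = \<chi> n t [^]\<^bsub>B\<^esub> q"
  proof (rule evaluations)
    fix \<psi> assume \<psi>: "\<And>n. \<psi> n \<in> ring_hom T B"
          "\<And>n a b. a \<in> carrier A \<Longrightarrow> b \<in> carrier B \<Longrightarrow> \<psi> n (pt a b) = c a [^]\<^bsub>B\<^esub> (q ^ n) \<otimes>\<^bsub>B\<^esub> b"
          "\<And>n t. t \<in> carrier T \<Longrightarrow> \<psi> (Suc n) (\<sigma> t) = \<psi> n t [^]\<^bsub>B\<^esub> q"
    then show thesis by (rule that)
  qed
        have ex: "\<exists>l. X.semifunctional B (\<chi> n) l" for n
        proof (induction n)
          case 0
          have e: "\<chi> 0 (pt a b) = c a \<otimes>\<^bsub>B\<^esub> b" if "a \<in> carrier A" "b \<in> carrier B" for a b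
            using \<chi>(2)[OF that, of 0] that by simp
          obtain l where l: "\<And>x. x \<in> carrier M' \<Longrightarrow> l x \<in> carrier B"
            "\<And>x y. x \<in> carrier M' \<Longrightarrow> y \<in> carrier M' \<Longrightarrow> l (x \<oplus>\<^bsub>M'\<^esub> y) = l x \<oplus>\<^bsub>B\<^esub> l y"
            "\<And>t x. t \<in> carrier T \<Longrightarrow> x \<in> carrier M' \<Longrightarrow> l (t \<odot>\<^bsub>M'\<^esub> x) = \<chi> 0 t \<otimes>\<^bsub>B\<^esub> l x"
            "l v \<noteq> \<zero>\<^bsub>B\<^esub>" "\<And>y. y \<in> N \<Longrightarrow> l y = \<zero>\<^bsub>B\<^esub>"
  proof (rule initial_functional[OF X.M' N(1) JN v \<chi>(1)[of 0] e])
    fix \<phi> assume "\<And>x. x \<in> carrier M' \<Longrightarrow> \<phi> x \<in> carrier B"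
            "\<And>x y. x \<in> carrier M' \<Longrightarrow> y \<in> carrier M' \<Longrightarrow> \<phi> (x \<oplus>\<^bsub>M'\<^esub> y) = \<phi> x \<oplus>\<^bsub>B\<^esub> \<phi> y"
            "\<And>t x. t \<in> carrier T \<Longrightarrow> x \<in> carrier M' \<Longrightarrow> \<phi> (t \<odot>\<^bsub>M'\<^esub> x) = \<chi> 0 t \<otimes>\<^bsub>B\<^esub> \<phi> x"
            "\<phi> v \<noteq> \<zero>\<^bsub>B\<^esub>" "\<And>y. y \<in> N \<Longrightarrow> \<phi> y = \<zero>\<^bsub>B\<^esub>"
    then show thesis by (rule that)
  qed
          then have "X.semifunctional B (\<chi> 0) l" unfolding X.semifunctional_def
            using v(1) l(5)[OF subsetD[OF N(2)]] by (intro conjI ballI bexI[of _ v])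
          then show ?case by (rule exI[of _ l])
        next
          case (Suc n)
          then obtain l where l: "X.semifunctional B (\<chi> n) l" by (elim exE) (rule that)
          obtain a where a: "a \<in> carrier A" "c a [^]\<^bsub>B\<^esub> (q ^ Suc n) \<noteq> c a" using False by blast
          interpret x: ring_hom_ring T B "\<chi> (Suc n)" by (rule ring_hom_ringI2[OF T.ring_axioms B.ring_axioms \<chi>(1)])
          let ?p = "c a [^]\<^bsub>B\<^esub> (q ^ Suc n)"
          have pc: "?p \<in> carrier B" by (rule B.nat_pow_closed) (use a(1) in simp)
          have p1: "\<chi> (Suc n) (pt a \<one>\<^bsub>B\<^esub>) = ?p" unfolding \<chi>(2)[OF a(1) B.one_closed] by (rule B.r_one[OF pc])
          have one: "c \<one>\<^bsub>A\<^esub> [^]\<^bsub>B\<^esub> (q ^ Suc n) = \<one>\<^bsub>B\<^esub>" unfolding c.hom_one by (rule B.nat_pow_one)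
          have p2: "\<chi> (Suc n) (pt \<one>\<^bsub>A\<^esub> (c a)) = c a"
            unfolding \<chi>(2)[OF A.one_closed c.hom_closed[OF a(1)]] one using a(1) by simp
          have "\<chi> (Suc n) (pt a \<one>\<^bsub>B\<^esub> \<ominus>\<^bsub>T\<^esub> pt \<one>\<^bsub>A\<^esub> (c a)) = \<chi> (Suc n) (pt a \<one>\<^bsub>B\<^esub>) \<ominus>\<^bsub>B\<^esub> \<chi> (Suc n) (pt \<one>\<^bsub>A\<^esub> (c a))"
            using a(1) by (simp add: a_minus_def)
          then have "\<chi> (Suc n) (pt a \<one>\<^bsub>B\<^esub> \<ominus>\<^bsub>T\<^esub> pt \<one>\<^bsub>A\<^esub> (c a)) = ?p \<ominus>\<^bsub>B\<^esub> c a" unfolding p1 p2 .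
          then have ne: "\<chi> (Suc n) (pt a \<one>\<^bsub>B\<^esub> \<ominus>\<^bsub>T\<^esub> pt \<one>\<^bsub>A\<^esub> (c a)) \<noteq> \<zero>\<^bsub>B\<^esub>"
            using a(2) B.r_right_minus_eq[OF pc c.hom_closed[OF a(1)]] by simp
          obtain l' where "X.semifunctional B (\<chi> (Suc n)) l'"
            using X.frobenius_twist_functional[OF B.field_axioms frob_B \<chi>(1) \<chi>(1) \<chi>(3) J_gen[OF a(1)] ne l] .
          then show ?case by (rule exI[of _ l'])
        qed
        \<comment> \<open>The cokernel has a nonzero fibre at every \<open>\<chi>\<^sub>n\<close>, so its annihilator vanishes there.\<close>
        have kill: "\<chi> n t = \<zero>\<^bsub>B\<^esub>" for n
        proof -
          obtain l where l: "X.semifunctional B (\<chi> n) l" using ex[of n] by (elim exE) (rule that)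
          show ?thesis by (rule X.functional_kills_ann[OF B.field_axioms \<chi>(1) l tI])
        qed
        \<comment> \<open>Finitely many \<open>n\<close> are exempted because \<open>\<chi>\<^sub>0(\<sigma> x)\<close> is not determined by the values \<open>\<chi>\<^sub>n(x)\<close>.\<close>
        define W where "W = {x \<in> carrier T. \<exists>n0. \<forall>n\<ge>n0. \<chi> n x = \<zero>\<^bsub>B\<^esub>}"
        have WI: "x \<in> carrier T" "\<exists>n0. \<forall>n\<ge>n0. \<chi> n x = \<zero>\<^bsub>B\<^esub>" if "x \<in> W" for x
          using that unfolding W_def by simp_all
        have IW: "x \<in> W" if "x \<in> carrier T" "\<And>n. n0 \<le> n \<Longrightarrow> \<chi> n x = \<zero>\<^bsub>B\<^esub>" for n0 x
          unfolding W_def using that by (intro CollectI conjI exI[of _ n0] allI impI)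
        obtain a where a: "a \<in> carrier A" "a \<noteq> \<zero>\<^bsub>A\<^esub>" "pt a \<one>\<^bsub>B\<^esub> \<in> W"
        proof (rule invariant_contains_rational[of W t])
          show "W \<subseteq> carrier T" using WI(1) by (rule subsetI)
          show "x \<ominus>\<^bsub>T\<^esub> y \<in> W" if x: "x \<in> W" and y: "y \<in> W" for x y
          proof -
            obtain m n where mn: "\<forall>i\<ge>m. \<chi> i x = \<zero>\<^bsub>B\<^esub>" "\<forall>i\<ge>n. \<chi> i y = \<zero>\<^bsub>B\<^esub>"
              using WI(2)[OF x] WI(2)[OF y] by (elim exE) (rule that)
            have "\<chi> i (x \<ominus>\<^bsub>T\<^esub> y) = \<zero>\<^bsub>B\<^esub>" if i: "max m n \<le> i" for i
            proof -
              interpret x: ring_hom_ring T B "\<chi> i" by (rule ring_hom_ringI2[OF T.ring_axioms B.ring_axioms \<chi>(1)])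
              show ?thesis using mn i WI(1)[OF x] WI(1)[OF y] by (simp add: a_minus_def)
            qed
            then show ?thesis by (rule IW[OF T.minus_closed[OF WI(1)[OF x] WI(1)[OF y]]])
          qed
          show "pt \<one>\<^bsub>A\<^esub> b \<otimes>\<^bsub>T\<^esub> x \<in> W" if b: "b \<in> carrier B" and x: "x \<in> W" for b x
          proof -
            obtain m where m: "\<forall>i\<ge>m. \<chi> i x = \<zero>\<^bsub>B\<^esub>" using WI(2)[OF x] by (elim exE) (rule that)
            have bc: "pt \<one>\<^bsub>A\<^esub> b \<in> carrier T" using b by simp
            have "\<chi> i (pt \<one>\<^bsub>A\<^esub> b \<otimes>\<^bsub>T\<^esub> x) = \<zero>\<^bsub>B\<^esub>" if i: "m \<le> i" for i
            proof -
              interpret x: ring_hom_ring T B "\<chi> i" by (rule ring_hom_ringI2[OF T.ring_axioms B.ring_axioms \<chi>(1)])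
              show ?thesis unfolding x.hom_mult[OF bc WI(1)[OF x]] using m i x.hom_closed[OF bc] by simp
            qed
            then show ?thesis by (rule IW[OF T.m_closed[OF bc WI(1)[OF x]]])
          qed
          show "\<sigma> x \<in> W" if x: "x \<in> W" for x
          proof -
            obtain m where m: "\<forall>i\<ge>m. \<chi> i x = \<zero>\<^bsub>B\<^esub>" using WI(2)[OF x] by (elim exE) (rule that)
            have "\<chi> i (\<sigma> x) = \<zero>\<^bsub>B\<^esub>" if i: "Suc m \<le> i" for i
            proof -
              obtain j where j: "i = Suc j" "m \<le> j" using i by (cases i) auto
              have "\<chi> j x = \<zero>\<^bsub>B\<^esub>" using m j(2) by blast
              then show ?thesis unfolding j(1) \<chi>(3)[OF WI(1)[OF x]]
                using B.nat_pow_zero[of q] q_gt_1 by simp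
            qed
            then show ?thesis by (rule IW[OF \<sigma>.hom_closed[OF WI(1)[OF x]]])
          qed
          show "t \<in> W" by (rule IW[OF t(1), of 0]) (rule kill)
          show "t \<noteq> \<zero>\<^bsub>T\<^esub>" by (rule t(2))
        qed
        obtain m where m: "\<forall>i\<ge>m. \<chi> i (pt a \<one>\<^bsub>B\<^esub>) = \<zero>\<^bsub>B\<^esub>" using WI(2)[OF a(3)] by (elim exE) (rule that)
        have "\<chi> m (pt a \<one>\<^bsub>B\<^esub>) = \<zero>\<^bsub>B\<^esub>" using m by blast
        then have "c a [^]\<^bsub>B\<^esub> (q ^ m) = \<zero>\<^bsub>B\<^esub>" using \<chi>(2)[OF a(1) B.one_closed, of m] a(1) by simp
        then have "c a = \<zero>\<^bsub>B\<^esub>" by (rule B.pow_eq_zero[OF c.hom_closed[OF a(1)]])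
        then show False using c_inj[OF a(1)] a(2) by blast
      qed
      obtain a where "a \<in> carrier A" "a \<noteq> \<zero>\<^bsub>A\<^esub>" "pt a \<one>\<^bsub>B\<^esub> \<in> X.ann"
      proof (rule invariant_contains_rational[of X.ann t])
        show "X.ann \<subseteq> carrier T" by (rule ann.a_subset)
        show "x \<ominus>\<^bsub>T\<^esub> y \<in> X.ann" if "x \<in> X.ann" "y \<in> X.ann" for x y by (rule annm[OF that])
        show "pt \<one>\<^bsub>A\<^esub> b \<otimes>\<^bsub>T\<^esub> x \<in> X.ann" if "b \<in> carrier B" "x \<in> X.ann" for b x
          by (rule ann.I_l_closed[OF that(2)]) (use that(1) in simp)
        show "\<sigma> x \<in> X.ann" if "x \<in> X.ann" for x by (rule X.ann_stable[OF H that])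
        show "t \<in> X.ann" "t \<noteq> \<zero>\<^bsub>T\<^esub>" by (rule tI, rule t(2))
      qed
      then show ?thesis by (intro bexI conjI)
    qed
  qed
  then obtain a where a: "a \<in> carrier A" "a \<noteq> \<zero>\<^bsub>A\<^esub>" "pt a \<one>\<^bsub>B\<^esub> \<in> X.ann" by (elim bexE conjE) (rule that)
  show ?thesis by (rule that[OF a(1,2) X.annD(2)[OF a(3)]])
qed

end

section \<open>The dual morphism\<close>

context frobenius_module_morphism
begin

text \<open>The equations for \<open>h = f\<^sup>-\<^sup>1 \<circ> g\<close> may be checked after applying the injective map \<open>f\<close>. For the compatibility
with \<open>\<tau>\<close>, the pullback of \<open>f \<circ> h\<close> is multiplication by \<open>\<sigma>(g) = g\<close>.\<close>

lemma dual_morphism: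
  assumes inj: "inj_on f (carrier M)" and g: "g \<in> ann" "\<sigma> g = g"
  obtains h where "h \<in> mod_hom T M' M" "\<And>x'. x' \<in> carrier M' \<Longrightarrow> f (h x') = g \<odot>\<^bsub>M'\<^esub> x'"
    "\<And>x. x \<in> carrier M \<Longrightarrow> h (f x) = g \<odot>\<^bsub>M\<^esub> x"
    "\<And>z. z \<in> carrier (base_change T \<sigma> T M') \<Longrightarrow> h (\<tau>' z) = \<tau> (base_change_map T \<sigma> T M h z)"
proof -
  define h where "h x' = inv_into (carrier M) f (g \<odot>\<^bsub>M'\<^esub> x')" for x'
  have gc: "g \<in> carrier T" by (rule annD(1)[OF g(1)])
  have hc: "h x' \<in> carrier M" and fh: "f (h x') = g \<odot>\<^bsub>M'\<^esub> x'" if "x' \<in> carrier M'" for x'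
    unfolding h_def by (rule inv_into_into[OF annD(2)[OF g(1) that]], rule f_inv_into_f[OF annD(2)[OF g(1) that]])
  have feq: "x = y" if "f x = f y" "x \<in> carrier M" "y \<in> carrier M" for x y by (rule inj_onD[OF inj that])
  have hf: "h (f x) = g \<odot>\<^bsub>M\<^esub> x" if "x \<in> carrier M" for x
    by (rule feq) (use that gc hc fD(1) in \<open>simp_all add: fh fD(3)\<close>)
  have hm: "h \<in> mod_hom T M' M" unfolding mod_hom_def
  proof (intro CollectI conjI ballI)
    show "h \<in> carrier M' \<rightarrow> carrier M" using hc by (rule funcsetI)
    show "h (x \<oplus>\<^bsub>M'\<^esub> y) = h x \<oplus>\<^bsub>M\<^esub> h y" if "x \<in> carrier M'" "y \<in> carrier M'" for x y
      by (rule feq) (use that gc hc in \<open>simp_all add: fh fD(2) E'.M.smult_r_distr\<close>)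
    show "h (a \<odot>\<^bsub>M'\<^esub> x) = a \<odot>\<^bsub>M\<^esub> h x" if "a \<in> carrier T" "x \<in> carrier M'" for a x
      by (rule feq) (use that gc hc in \<open>simp_all add: fh fD(3) E'.M.smult_assoc1[symmetric] T.m_comm\<close>)
  qed
  let ?F = "base_change_map T \<sigma> T M' f" and ?H = "base_change_map T \<sigma> T M h"
  note Fm = E.extension_map[OF M' f] and Hm = E'.extension_map[OF M hm]
  have FH: "?F (?H z) = g \<odot>\<^bsub>E'.BC\<^esub> z" if "z \<in> carrier E'.BC" for z
    using that
  proof (induction z rule: E'.BC_induct)
    case zero
    have h0: "h \<zero>\<^bsub>M'\<^esub> = \<zero>\<^bsub>M\<^esub>" by (rule mod_hom_zero[OF E'.M.abelian_group_axioms E.M.abelian_group_axioms hm])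
    have f0: "f \<zero>\<^bsub>M\<^esub> = \<zero>\<^bsub>M'\<^esub>" by (rule mod_hom_zero[OF E.M.abelian_group_axioms E'.M.abelian_group_axioms f])
    have "?F (?H (E'.pure \<zero>\<^bsub>M'\<^esub> \<one>\<^bsub>T\<^esub>)) = E'.pure \<zero>\<^bsub>M'\<^esub> \<one>\<^bsub>T\<^esub>"
      unfolding Hm(3)[OF E'.M.zero_closed T.one_closed] h0 Fm(3)[OF E.M.zero_closed T.one_closed] f0 ..
    moreover have "g \<odot>\<^bsub>E'.BC\<^esub> E'.pure \<zero>\<^bsub>M'\<^esub> \<one>\<^bsub>T\<^esub> = E'.pure \<zero>\<^bsub>M'\<^esub> \<one>\<^bsub>T\<^esub>"
      unfolding E'.smult_pure[OF gc E'.M.zero_closed T.one_closed] using E'.pure_zero gc by simp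
    ultimately show ?case using E'.pure_zero[OF T.one_closed] by simp
  next
    case (pure x s)
    have "?F (?H (E'.pure x s)) = E'.pure (g \<odot>\<^bsub>M'\<^esub> x) s"
      unfolding Hm(3)[OF pure] Fm(3)[OF hc[OF pure(1)] pure(2)] fh[OF pure(1)] ..
    also have "\<dots> = g \<odot>\<^bsub>E'.BC\<^esub> E'.pure x s"
      unfolding E'.pure_balanced[OF gc pure] E'.smult_pure[OF gc pure] g(2) ..
    finally show ?case .
  next
    case (add x y)
    show ?case unfolding Hm(2)[OF add(1,2)] Fm(2)[OF Hm(1)[OF add(1)] Hm(1)[OF add(2)]] add(3,4)
        E'.smult_add[OF gc add(1,2)] ..
  qed
  have comm: "h (\<tau>' z) = \<tau> (?H z)" if z: "z \<in> carrier E'.BC" for z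
  proof (rule feq)
    show "h (\<tau>' z) \<in> carrier M" by (rule hc[OF tD'(1)[OF z]])
    show "\<tau> (?H z) \<in> carrier M" by (rule tD(1)[OF Hm(1)[OF z]])
    show "f (h (\<tau>' z)) = f (\<tau> (?H z))"
      unfolding fh[OF tD'(1)[OF z]] commutes[OF Hm(1)[OF z]] FH[OF z] by (rule tD'(3)[symmetric, OF gc z])
  qed
  show ?thesis by (rule that[OF hm fh hf comm])
qed

end

section \<open>Isogenies of pure Anderson motives\<close>

lemma irreducible_chain_two_points:
  assumes "one_dimensional Y" shows "topspace Y - {x} \<noteq> {}"
proof
  assume e: "topspace Y - {x} = {}"
  obtain Z0 Z1 where Z: "irreducible_closed Y Z0" "irreducible_closed Y Z1" "Z0 \<subset> Z1"
    using assms unfolding one_dimensional_def by blast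
  have "Z0 \<noteq> {}" using Z(1)[unfolded irreducible_closed_def, THEN conjunct2, THEN conjunct1] .
  moreover have "closedin Y Z1" using Z(2)[unfolded irreducible_closed_def, THEN conjunct1] .
  then have "Z1 \<subseteq> {x}" using closedin_subset[of Y Z1] e by auto
  ultimately show False using Z(3) by auto
qed

text \<open>The complement of the closed point \<open>\<infinity>\<close> is open and nonempty, so \<open>A\<close> is a domain; the two arithmetic
properties are instances of \<open>section_ratio\<close>, the second one with \<open>e = 1\<close>.\<close>

lemma geometry_characteristic_tensor:
  assumes G: "anderson_geometry G" and c: "characteristic_hom G c"
  shows "characteristic_tensor (Fq G) (Fq_to_A G) (A_ring G) id (fld G) c"
proof -
  have L: "field (fld G)" and sub: "subfield (fq G) (fld G)" and fin: "finite (fq G)"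
    and curve: "smooth_projective_curve (Fq G) (curve G)" and rp: "rational_point (Fq G) (curve G) (infty G)"
    using G unfolding anderson_geometry_def by blast+
  interpret L: field "fld G" by (rule L)
  have K: "field (Fq G)" unfolding Fq_def by (rule L.subfield_iff(2)[OF sub])
  have cK: "carrier (Fq G) = fq G" by (simp add: Fq_def)
  have sch: "scheme_over (Fq G) (curve G)" "integral_scheme (curve G)" "geometrically_irreducible (Fq G) (curve G)"
    "one_dimensional (topo (curve G))"
    using curve unfolding smooth_projective_curve_def smooth_of_dim_1_def by blast+
  interpret C: integral_sch "Fq G" "curve G" by (rule integral_sch.intro[OF sch(1,2) K])
  have op: "openin (topo (curve G)) (affine_part G)"
    unfolding affine_part_def by (rule C.rational_point_closed[OF rp])
  have ne: "affine_part G \<noteq> {}"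
    unfolding affine_part_def by (rule irreducible_chain_two_points[OF sch(4)])
  have A: "domain (A_ring G)" unfolding A_ring_def by (rule C.domain_sec[OF op ne])
  interpret A: domain "A_ring G" by (rule A)
  have st: "Fq_to_A G \<in> ring_hom (Fq G) (A_ring G)" unfolding Fq_to_A_def A_ring_def by (rule C.str_on_hom[OF op])
  have id: "id \<in> ring_hom (Fq G) (fld G)"
    using subfieldE(3)[OF sub] by (intro ring_hom_memI) (auto simp: Fq_def)
  have finK: "finite (carrier (Fq G))" using fin cK by simp
  have ratio: "\<exists>z\<in>carrier (Fq G). u = Fq_to_A G z \<otimes>\<^bsub>A_ring G\<^esub> e"
    if "u \<in> carrier (A_ring G)" "e \<in> carrier (A_ring G)" "e \<noteq> \<zero>\<^bsub>A_ring G\<^esub>"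
      "u [^]\<^bsub>A_ring G\<^esub> (card (carrier (Fq G)) ^ Suc m) = e [^]\<^bsub>A_ring G\<^esub> (card (carrier (Fq G)) ^ Suc m - 1) \<otimes>\<^bsub>A_ring G\<^esub> u"
    for m u e
    using C.section_ratio[OF finK sch(3) op ne] that unfolding A_ring_def Fq_to_A_def by blast
  interpret T: frobenius_tensor "Fq G" "Fq_to_A G" "A_ring G" id "fld G"
    by (intro frobenius_tensor.intro tensor_product.intro frobenius_tensor_axioms.intro K A.is_cring L.is_cring st id finK L A)
  show ?thesis
  proof (intro characteristic_tensor.intro characteristic_tensor_axioms.intro)
    show "frobenius_tensor (Fq G) (Fq_to_A G) (A_ring G) id (fld G)" by (rule T.frobenius_tensor_axioms)
    show "domain (tensor_algebra (Fq G) (Fq_to_A G) (A_ring G) id (fld G))" by (rule T.tensor_domain[OF ratio])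
    show "\<exists>z\<in>carrier (Fq G). u = Fq_to_A G z"
      if u: "u \<in> carrier (A_ring G)" "u [^]\<^bsub>A_ring G\<^esub> (card (carrier (Fq G)) ^ Suc m) = u" for u m
    proof -
      have "u [^]\<^bsub>A_ring G\<^esub> (card (carrier (Fq G)) ^ Suc m) =
          \<one>\<^bsub>A_ring G\<^esub> [^]\<^bsub>A_ring G\<^esub> (card (carrier (Fq G)) ^ Suc m - 1) \<otimes>\<^bsub>A_ring G\<^esub> u"
        unfolding u(2) using u(1) by simp
      from ratio[OF u(1) A.one_closed A.one_not_zero this] obtain z where
        z: "z \<in> carrier (Fq G)" "u = Fq_to_A G z \<otimes>\<^bsub>A_ring G\<^esub> \<one>\<^bsub>A_ring G\<^esub>" by blast
      then show ?thesis using T.\<alpha>.hom_closed[OF z(1)] by auto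
    qed
    show "c \<in> ring_hom (A_ring G) (fld G)" using c unfolding characteristic_hom_def by blast
    show "c (Fq_to_A G z) = id z" if "z \<in> carrier (Fq G)" for z
      using c that cK unfolding characteristic_hom_def by simp
  qed
qed

theorem corollary1p32:
  fixes G :: "('l, 'p, 'a, 'y, 'b) geometry"
    and c :: "'a \<Rightarrow> 'l"
    and r d r' d' :: nat
    and M :: "('l, 'a, 'm) AL_module" and \<tau> :: "('l, 'a, 'm) pullback_elt \<Rightarrow> 'm"
    and M' :: "('l, 'a, 'n) AL_module" and \<tau>' :: "('l, 'a, 'n) pullback_elt \<Rightarrow> 'n"
    and f :: "'m \<Rightarrow> 'n"
  assumes "anderson_geometry G"
    and "characteristic_hom G c"
    and "pure_anderson_motive G c r d M \<tau>"
    and "pure_anderson_motive G c r' d' M' \<tau>'"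
    and "isogeny G M \<tau> M' \<tau>' f"
  shows "\<exists>a\<in>carrier (A_ring G). a \<noteq> \<zero>\<^bsub>A_ring G\<^esub> \<and>
           annihilates (coker M M' f) (A_in_AL G a) \<and>
           (\<exists>fdual. isogeny G M' \<tau>' M \<tau> fdual \<and>
              (\<forall>x'\<in>carrier M'. f (fdual x') = A_in_AL G a \<odot>\<^bsub>M'\<^esub> x') \<and>
              (\<forall>x\<in>carrier M. fdual (f x) = A_in_AL G a \<odot>\<^bsub>M\<^esub> x))"
proof -
  interpret X: characteristic_tensor "Fq G" "Fq_to_A G" "A_ring G" id "fld G" c
    by (rule geometry_characteristic_tensor[OF assms(1,2)])
  have T: "X.T = AL G" by (simp only: AL_def)
  have pt: "X.pt = AL_tensor G" by (simp only: AL_tensor_def)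
  have card_Fq: "card (carrier (Fq G)) = card (fq G)" by (simp add: Fq_def)
  have \<sigma>: "X.\<sigma> = sigma_star G"
    by (rule ext) (simp only: X.map_right_def sigma_star_def frob_def card_Fq)
  have J: "X.J = J_ideal G c" unfolding X.J_def J_ideal_def T pt ..
  interpret AL: domain "AL G" using X.T_domain unfolding T .
  note lf = assms(3)[unfolded pure_anderson_motive_def, THEN conjunct1]
    and lf' = assms(4)[unfolded pure_anderson_motive_def, THEN conjunct1]
  have M: "module (AL G) M" and M': "module (AL G) M'" using lf lf' unfolding locally_free_module_def by blast+
  interpret M: module "AL G" M by (rule M)
  interpret M': module "AL G" M' by (rule M')
  have \<tau>: "\<tau> \<in> mod_hom (AL G) (sigma_pullback G M) M" and \<tau>': "\<tau>' \<in> mod_hom (AL G) (sigma_pullback G M') M'"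
    and inj\<tau>': "inj_on \<tau>' (carrier (sigma_pullback G M'))"
    and ck: "\<forall>a\<in>ideal_power (AL G) (J_ideal G c) d. annihilates (coker (sigma_pullback G M) M \<tau>) a"
    and ck': "\<forall>a\<in>ideal_power (AL G) (J_ideal G c) d'. annihilates (coker (sigma_pullback G M') M' \<tau>') a"
    using assms(3,4) unfolding pure_anderson_motive_def by blast+
  have f: "f \<in> mod_hom (AL G) M M'" "\<And>z. z \<in> carrier (sigma_pullback G M) \<Longrightarrow> f (\<tau> z) = \<tau>' (sigma_pullback_map G M' f z)"
    and inj: "inj_on f (carrier M)" and tor: "torsion_module (AL G) (coker M M' f)"
    using assms(5) unfolding isogeny_def motive_morphism_def by blast+
  have sh: "sigma_star G \<in> ring_hom (AL G) (AL G)" using X.sigma_hom unfolding \<sigma> T .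
  have Ji: "ideal (J_ideal G c) (AL G)" using X.J_ideal unfolding J T .
  interpret E: scalar_extension "AL G" "sigma_star G" "AL G" M by (rule scalar_extension.intro[OF AL.is_cring sh M])
  interpret E': scalar_extension "AL G" "sigma_star G" "AL G" M' by (rule scalar_extension.intro[OF AL.is_cring sh M'])
  note sp = sigma_pullback_def and spm = sigma_pullback_map_def
  have subT: "submodule (\<tau> ` carrier (sigma_pullback G M)) (AL G) M"
    by (rule image_submodule[OF _ _ M \<tau>]) (simp_all only: sp E.group_BC E.smult_closed)
  have subT': "submodule (\<tau>' ` carrier (sigma_pullback G M')) (AL G) M'"
    by (rule image_submodule[OF _ _ M' \<tau>']) (simp_all only: sp E'.group_BC E'.smult_closed)
  have Jc: "g \<in> carrier (AL G)" if "g \<in> ideal_power (AL G) (J_ideal G c) n" for g n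
    by (rule ideal.Icarr[OF AL.ideal_power_ideal[OF Ji] that])
  have mor: "frobenius_module_morphism (AL G) (sigma_star G) (J_ideal G c) M \<tau> d M' \<tau>' d' f"
  proof (rule frobenius_module_morphism.intro)
    show "cring (AL G)" by (rule AL.is_cring)
    show "g \<odot>\<^bsub>M\<^esub> x \<in> \<tau> ` carrier (base_change (AL G) (sigma_star G) (AL G) M)"
      if g: "g \<in> ideal_power (AL G) (J_ideal G c) d" and x: "x \<in> carrier M" for g x
      using annihilates_coker_iff[OF M subT Jc[OF g], THEN iffD1, OF bspec[OF ck g]] x unfolding sp by (rule bspec)
    show "g \<odot>\<^bsub>M'\<^esub> x \<in> \<tau>' ` carrier (base_change (AL G) (sigma_star G) (AL G) M')"
      if g: "g \<in> ideal_power (AL G) (J_ideal G c) d'" and x: "x \<in> carrier M'" for g x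
      using annihilates_coker_iff[OF M' subT' Jc[OF g], THEN iffD1, OF bspec[OF ck' g]] x unfolding sp by (rule bspec)
  qed (rule sh Ji M M' f(1) \<tau>[unfolded sp] \<tau>'[unfolded sp] inj\<tau>'[unfolded sp] f(2)[unfolded sp spm]; assumption?)+
  interpret F: frobenius_module_morphism "AL G" "sigma_star G" "J_ideal G c" M \<tau> d M' \<tau>' d' f by (rule mor)
  have img: "submodule (f ` carrier M) (AL G) M'" by (rule F.img_sub)
  obtain t where t: "t \<in> carrier (AL G)" "t \<noteq> \<zero>\<^bsub>AL G\<^esub>" "\<And>x. x \<in> carrier M' \<Longrightarrow> t \<odot>\<^bsub>M'\<^esub> x \<in> f ` carrier M"
  proof (rule torsion_quotient_annihilated[OF AL.domain_axioms lf' img])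
    show "\<exists>a\<in>carrier (AL G). a \<noteq> \<zero>\<^bsub>AL G\<^esub> \<and> a \<odot>\<^bsub>M'\<^esub> x \<in> f ` carrier M" if "x \<in> carrier M'" for x
      by (rule bspec[OF torsion_coker_iff[OF M' img, THEN iffD1, OF tor] that])
    fix s assume "s \<in> carrier (AL G)" "s \<noteq> \<zero>\<^bsub>AL G\<^esub>" "\<And>x. x \<in> carrier M' \<Longrightarrow> s \<odot>\<^bsub>M'\<^esub> x \<in> f ` carrier M"
    then show thesis by (rule that)
  qed
  obtain a where a: "a \<in> carrier (A_ring G)" "a \<noteq> \<zero>\<^bsub>A_ring G\<^esub>"
    "\<And>x. x \<in> carrier M' \<Longrightarrow> X.pt a \<one>\<^bsub>fld G\<^esub> \<odot>\<^bsub>M'\<^esub> x \<in> f ` carrier M"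
  proof (rule X.coker_annihilated_by_rational[unfolded T \<sigma> J, OF mor t])
    fix b assume "b \<in> carrier (A_ring G)" "b \<noteq> \<zero>\<^bsub>A_ring G\<^esub>"
      "\<And>x. x \<in> carrier M' \<Longrightarrow> X.pt b \<one>\<^bsub>fld G\<^esub> \<odot>\<^bsub>M'\<^esub> x \<in> f ` carrier M"
    then show thesis by (rule that)
  qed
  define g where "g = A_in_AL G a"
  have g: "g = X.pt a \<one>\<^bsub>fld G\<^esub>" unfolding g_def A_in_AL_def pt ..
  have gc: "g \<in> carrier (AL G)" using X.pt_closed[OF a(1) X.B.one_closed] unfolding g T .
  have g0: "g \<noteq> \<zero>\<^bsub>AL G\<^esub>" using X.pt_one_nonzero[OF a(1,2) X.B.one_not_zero] unfolding g T .
  have gs: "sigma_star G g = g"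
    using X.sigma_pt[OF a(1) X.B.one_closed] unfolding g \<sigma> X.B.nat_pow_one .
  have gann: "g \<in> F.ann" unfolding F.ann_def using gc a(3) unfolding g by simp
  obtain h where h: "h \<in> mod_hom (AL G) M' M" "\<And>x'. x' \<in> carrier M' \<Longrightarrow> f (h x') = g \<odot>\<^bsub>M'\<^esub> x'"
    "\<And>x. x \<in> carrier M \<Longrightarrow> h (f x) = g \<odot>\<^bsub>M\<^esub> x"
    "\<And>z. z \<in> carrier E'.BC \<Longrightarrow> h (\<tau>' z) = \<tau> (base_change_map (AL G) (sigma_star G) (AL G) M h z)"
  proof (rule F.dual_morphism[OF inj gann gs])
    fix k assume "k \<in> mod_hom (AL G) M' M" "\<And>x'. x' \<in> carrier M' \<Longrightarrow> f (k x') = g \<odot>\<^bsub>M'\<^esub> x'"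
      "\<And>x. x \<in> carrier M \<Longrightarrow> k (f x) = g \<odot>\<^bsub>M\<^esub> x"
      "\<And>z. z \<in> carrier E'.BC \<Longrightarrow> k (\<tau>' z) = \<tau> (base_change_map (AL G) (sigma_star G) (AL G) M k z)"
    then show thesis by (rule that)
  qed
  have inj_h: "inj_on h (carrier M')"
  proof (rule inj_onI)
    fix x y assume xy: "x \<in> carrier M'" "y \<in> carrier M'" "h x = h y"
    have "g \<odot>\<^bsub>M'\<^esub> x = g \<odot>\<^bsub>M'\<^esub> y" using h(2)[OF xy(1)] h(2)[OF xy(2)] unfolding xy(3) by simp
    then have "g \<odot>\<^bsub>M'\<^esub> (x \<ominus>\<^bsub>M'\<^esub> y) = \<zero>\<^bsub>M'\<^esub>"
      using xy(1,2) gc by (simp add: a_minus_def M'.smult_r_distr M'.smult_r_minus M'.r_neg)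
    then have "x \<ominus>\<^bsub>M'\<^esub> y = \<zero>\<^bsub>M'\<^esub>"
      by (rule locally_free_torsion_free[OF AL.domain_axioms lf' gc g0 M'.minus_closed[OF xy(1,2)]])
    then have "\<ominus>\<^bsub>M'\<^esub> (\<ominus>\<^bsub>M'\<^esub> y) = x" unfolding a_minus_def by (rule M'.minus_equality) (use xy in simp_all)
    then show "x = y" using xy(2) by simp
  qed
  have tor_h: "torsion_module (AL G) (coker M' M h)"
  proof -
    have sub_h: "submodule (h ` carrier M') (AL G) M"
      by (rule image_submodule[OF M'.abelian_group_axioms M'.smult_closed M h(1)])
    have "\<forall>x\<in>carrier M. \<exists>s\<in>carrier (AL G). s \<noteq> \<zero>\<^bsub>AL G\<^esub> \<and> s \<odot>\<^bsub>M\<^esub> x \<in> h ` carrier M'"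
    proof
    fix x assume x: "x \<in> carrier M"
    have "g \<odot>\<^bsub>M\<^esub> x \<in> h ` carrier M'" unfolding h(3)[OF x, symmetric] by (rule imageI[OF F.fD(1)[OF x]])
    then show "\<exists>s\<in>carrier (AL G). s \<noteq> \<zero>\<^bsub>AL G\<^esub> \<and> s \<odot>\<^bsub>M\<^esub> x \<in> h ` carrier M'" using gc g0 by (intro bexI[of _ g] conjI)
    qed
    then show ?thesis using torsion_coker_iff[OF M sub_h] by (rule rev_iffD2)
  qed
  have iso: "isogeny G M' \<tau>' M \<tau> h"
    unfolding isogeny_def motive_morphism_def sp spm by (intro conjI ballI h(1) h(4) inj_h tor_h)
  have ann: "annihilates (coker M M' f) g"
    by (rule annihilates_coker_iff[OF M' img gc, THEN iffD2], rule ballI) (rule F.annD(2)[OF gann])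
  show ?thesis
    by (rule bexI[OF _ a(1)], intro conjI exI[of _ h] ballI) 
      (unfold g_def[symmetric], rule a(2), rule ann, rule iso, erule h(2), erule h(3))
qed

end
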